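(* Let $A=\Bbbk Q/I$, let $R=R_\varphi$ be a reduction system satisfying $(\diamond)$ for $I$, let $(B,\mathfrak m)$ be a complete local Noetherian $\Bbbk$-algebra and let $\widetilde\varphi\in\mathrm{Hom}(\Bbbk S,A)\widehat\otimes\mathfrak m$ be arbitrary. Let $a,b\in A$ and write $G_0^\bullet(a\otimes b):=ab$. For any $k\ge0$ we have $$\frac1{k!}\,G_k^\bullet(\widetilde\varphi^{\otimes k})(a\otimes b)=a\star^{\mathrm C,k}_{\varphi+\widetilde\varphi}b .$$ Thus $\star^{\mathrm C}_{\varphi+\widetilde\varphi}=\star^{\mathrm H}_{\varphi+\widetilde\varphi}$.
   Context: $\Bbbk$ is a field of characteristic $0$, $Q$ a finite quiver, $Q_n$ the paths of length $n$; $pq$ is concatenation if the target of $p$ is the source of $q$, else $0$. $\otimes=\otimes_{\Bbbk Q_0}$, $\mathrm{Hom}=\mathrm{Hom}_{\Bbbk Q_0^e}$ unless indicated; $I\subset\Bbbk Q$ a two-sided ideal, $\pi:\Bbbk Q\to A$ the projection; $\widehat\otimes$ is the $\mathfrak m$-adically completed tensor product. Reduction systems: $R=\{(s,\varphi_s)\mid s\in S\}$ with $S\subset Q_{\ge2}$, $s$ not a subpath of $s'$ for $s\ne s'\in S$, $\varphi_s$ a linear combination of irreducible paths parallel to $s$; a path is irreducible if it has no subpath in $S$; $\mathrm{Irr}_S$ is the set of irreducible paths. A basic reduction sends one path $qsr$ ($s\in S$) to $q\varphi_sr$ and fixes all other paths; a reduction is a finite composition. A path $p$ is reduction-finite if for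 any infinite sequence of reductions $\mathfrak r_n\cdots\mathfrak r_1(p)$ is eventually constant, reduction-unique if moreover all irreducible $\mathfrak r(p)$ coincide. $R$ satisfies $(\diamond)$ for $I$ if $I=\langle s-\varphi_s\rangle_{s\in S}$ and all paths are reduction-unique. Then $\pi|_{\Bbbk\mathrm{Irr}_S}$ is bijective onto $A$ with inverse $\sigma$; $\mathrm{Hom}(\Bbbk S,A)=\mathrm{Hom}(\Bbbk S,\Bbbk\mathrm{Irr}_S)$, $\varphi_s=\sigma\varphi(s)$, $\widetilde\varphi_s=\sigma\widetilde\varphi(s)$. Combinatorial star product: $\mathrm{red}_{\varphi+z\widetilde\varphi}$ ($z$ a formal central variable) fixes irreducible paths and sends a reducible path $qsr$, $s$ its rightmost subpath in $S$, to $q\varphi_sr+z\,q\widetilde\varphi_sr$; iterates stabilize modulo each power of $z$, giving $\mathrm{red}^{(\infty)}_{\varphi+z\widetilde\varphi}$ with values in power series in $z$. Then $a\star^{\mathrm C,k}_{\varphi+\widetilde\varphi}b$ is the coefficient of $z^k$ in $\pi(\mathrm{red}^{(\infty)}_{\varphi+z\widetilde\varphi}(\sigma(a)\sigma(b)))$ and $a\star^{\mathrm C}_{\varphi+\widetilde\varphi}b=\sum_{k\ge0}a\star^{\mathrm C,k}_{\varphi+\widetilde\varphi}b$. Homotopical star product: $a\star^{\mathrm H}_{\varphi+\widetilde\varphi}b=ab+\sum_{k\ge1}\frac1{k!}G_k^\bullet(\widetilde\varphi^{\otimes k})(a\otimes b)$, with $G_k^\bullet$ (extended $B$-linearly) defined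 as follows. (1) $S_0=Q_0$, $S_1=Q_1$, $S_2=S$, and for $n\ge1$, $S_{n+2}$ is the set of paths $u_0u_1\cdots u_{n+1}$ with $u_0\in Q_1$, $u_1,\dots,u_{n+1}$ irreducible, each $u_iu_{i+1}$ reducible and $u_id$ irreducible for every proper left subpath $d$ of $u_{i+1}$. For a path $p$, $\mathrm{split}_n(p)=\sum\pi(q)\otimes w\otimes\pi(r)$ over all $p=qwr$ with $w\in S_n$; $\mathrm{split}_n^{\mathrm R}(p)$, $\mathrm{split}^{\mathrm L}_n(p)$ are the single summands with $w$ rightmost, leftmost (zero if none). $P_n=A\otimes\Bbbk S_n\otimes A$, $P_{-1}=A$. $\delta_n$: bimodule maps with $\delta_1(1\otimes w\otimes1)=\pi(w)\otimes1-1\otimes\pi(w)$, $\delta_n(1\otimes w\otimes1)=\mathrm{split}^{\mathrm R}_{n-1}(w)-\mathrm{split}^{\mathrm L}_{n-1}(w)$ ($n>2$ odd), $=\mathrm{split}_{n-1}(w)$ ($n$ even). $\gamma_{n-1}$: left module maps with $\gamma_{n-1}(1\otimes w\otimes\pi(u))=(-1)^n\mathrm{split}_n(wu)$ for $u\in\mathrm{Irr}_S$. $\partial_0(a\otimes b)=ab$, $\rho_{-1}(a)=a\otimes1$, and for $n\ge1$: $\partial_n(a\otimes w\otimes b)=a((\mathrm{id}-\rho_{n-2}\partial_{n-1})\delta_n(1\otimes w\otimes1))b$, $\rho_{n-1}=\gamma_{n-1}+\sum_{i\ge1}\gamma_{n-1}(\delta_n\gamma_{n-1}-\partial_n\gamma_{n-1})^i$.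 (2) $\bar A=A/(\Bbbk Q_0\cdot1_A)$, $\varpi:A\to\bar A$, $\varpi_n=\mathrm{id}_{A\otimes\bar A^{\otimes n}}\otimes\varpi$, $\varpi_{-1}=\mathrm{id}_A$; $\mathrm{Bar}_n=A\otimes\bar A^{\otimes n}\otimes A$ the normalized bar resolution with differential $d_n$. $F_n:P_n\to\mathrm{Bar}_n$, $G_n:\mathrm{Bar}_n\to P_n$: $F_{-1}=G_{-1}=\mathrm{id}_A$, $F_n(a\otimes w\otimes b)=(-1)^n\varpi_{n-1}F_{n-1}\partial_n(a\otimes w\otimes1)\otimes b$, $G_n(a\otimes y\otimes b)=(\rho_{n-1}G_{n-1}d_n(a\otimes y\otimes1))b$ (so $F_0=G_0=\mathrm{id}$); $h_n(a_0\otimes\bar a_1\otimes\cdots\otimes\bar a_n\otimes a_{n+1})=\sum_{i=1}^n(-1)^{i+1}\varpi_iF_iG_i(a_0\otimes\bar a_1\otimes\cdots\otimes\bar a_i\otimes1)\otimes\bar a_{i+1}\otimes\cdots\otimes\bar a_n\otimes a_{n+1}$. (3) $\mathrm{Hom}(\Bbbk S_n,A)\cong\mathrm{Hom}_{A^e}(P_n,A)$, $f\leftrightarrow\check f$ with $f(w)=\check f(1\otimes w\otimes1)$ (similarly for Bar). For $f\in\mathrm{Hom}(\bar A^{\otimes m+2},A)$ and $g\in\mathrm{Hom}(\bar A^{\otimes n+2},A)$ put $[f,g]=(-1)^{m+1}[f,g]_{\mathrm G}$, with $[\,,]_{\mathrm G}$ the Gerstenhaber bracket: for $f$ of arity $m+1$,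 $g$ of arity $n+1$, $f\bullet g=\sum_{i=0}^m(-1)^{ni}f(\mathrm{id}^{\otimes i}\otimes g\otimes\mathrm{id}^{\otimes m-i})$, $[f,g]_{\mathrm G}=f\bullet g-(-1)^{mn}g\bullet f$. Let $G^n(f)=\check f\circ G_n$, $h^n(f)=(-1)^n\check f\circ h_n$ (for $f$ of arity $n+1$), under the identification $\mathrm{Hom}(M,A)\cong\mathrm{Hom}_{A^e}(A\otimes M\otimes A,A)$, $f\leftrightarrow\check f$, $f(m)=\check f(1\otimes m\otimes1)$, for $M=\Bbbk S_n$ and $M=\bar A^{\otimes n}$. Put $G_1^\bullet=G^\bullet$ and for $k>1$ $G_k^\bullet(f_1,\dots,f_k)=\sum h^\bullet([G_i^\bullet(f_{\sigma(1)},\dots,f_{\sigma(i)}),G_{k-i}^\bullet(f_{\sigma(i+1)},\dots,f_{\sigma(k)})])$, the sum over $1\le i\le k-1$ and $(i,k-i)$-shuffles $\sigma$ with $\sigma(1)<\sigma(i+1)$. Elements $G_k^\bullet(\widetilde\varphi^{\otimes k})\in\mathrm{Hom}(\bar A^{\otimes2},A)\widehat\otimes\mathfrak m$ are evaluated on $a\otimes b$ via $A\to\bar A$. *)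

theory Defs
  imports
    "Graph_Theory.Arc_Walk"
    "HOL-Library.Poly_Mapping"
    "HOL-Combinatorics.Permutations"
    "HOL-Algebra.QuotRing"
    "HOL-Algebra.Ideal_Product"
    "HOL-Algebra.Ring_Divisibility"
    "HOL-Algebra.Algebraic_Closure_Type"
begin

section \<open>Free vector spaces and path algebras\<close>

abbreviation bas :: "'x \<Rightarrow> ('x \<Rightarrow>\<^sub>0 'k::field_char_0)" where
  "bas x \<equiv> Poly_Mapping.single x 1"

definition scale :: "'k::field_char_0 \<Rightarrow> ('x \<Rightarrow>\<^sub>0 'k) \<Rightarrow> ('x \<Rightarrow>\<^sub>0 'k)" where
  "scale c x = Poly_Mapping.map (\<lambda>d. c * d) x"

definition lin :: "('x \<Rightarrow> ('y \<Rightarrow>\<^sub>0 'k::field_char_0)) \<Rightarrow> ('x \<Rightarrow>\<^sub>0 'k) \<Rightarrow> ('y \<Rightarrow>\<^sub>0 'k)" where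
  "lin g x = (\<Sum>t\<in>Poly_Mapping.keys x. scale (Poly_Mapping.lookup x t) (g t))"

text \<open>
  A quiver is a finite directed multigraph (loops allowed), \<^locale>\<open>fin_digraph\<close>; the source of an
  arrow is its \<^const>\<open>tail\<close>, the target its \<^const>\<open>head\<close>.  A path is the triple of its source, its
  list of arrows and its target, so that the trivial paths at distinct vertices are distinct.
\<close>

type_synonym ('v, 'e) qpath = "'v \<times> 'e list \<times> 'v"

definition src :: "('v, 'e) qpath \<Rightarrow> 'v" where "src p = fst p"
definition arrows :: "('v, 'e) qpath \<Rightarrow> 'e list" where "arrows p = fst (snd p)"
definition tgt :: "('v, 'e) qpath \<Rightarrow> 'v" where "tgt p = snd (snd p)"

abbreviation plen :: "('v, 'e) qpath \<Rightarrow> nat" where "plen p \<equiv> length (arrows p)"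

definition triv :: "'v \<Rightarrow> ('v, 'e) qpath" where "triv v = (v, [], v)"

definition pcomp :: "('v, 'e) qpath \<Rightarrow> ('v, 'e) qpath \<Rightarrow> ('v, 'e) qpath" where
  "pcomp p q = (src p, arrows p @ arrows q, tgt q)"

definition qpaths :: "('v, 'e) pre_digraph \<Rightarrow> ('v, 'e) qpath set" where
  "qpaths Q = {p. pre_digraph.awalk Q (src p) (arrows p) (tgt p)}"

definition pa_mult :: "(('v, 'e) qpath \<Rightarrow>\<^sub>0 'k::field_char_0) \<Rightarrow> (('v, 'e) qpath \<Rightarrow>\<^sub>0 'k) \<Rightarrow> (('v, 'e) qpath \<Rightarrow>\<^sub>0 'k)" where
  "pa_mult x y = lin (\<lambda>p. lin (\<lambda>q. if tgt p = src q then bas (pcomp p q) else 0) y) x"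

definition path_algebra :: "('v, 'e) pre_digraph \<Rightarrow> (('v, 'e) qpath \<Rightarrow>\<^sub>0 'k::field_char_0) ring" where
  "path_algebra Q =
    \<lparr>carrier = {x. Poly_Mapping.keys x \<subseteq> qpaths Q}, monoid.mult = pa_mult,
     one = (\<Sum>v\<in>verts Q. bas (triv v)), ring.zero = 0, add = (+)\<rparr>"

type_synonym ('v, 'e, 'k) pa = "('v, 'e) qpath \<Rightarrow>\<^sub>0 'k"

text \<open>Elements of the quotient algebra \<open>A\<close> are cosets of the ideal.\<close>
type_synonym ('v, 'e, 'k) alg = "('v, 'e, 'k) pa set"

text \<open>
  Tensor products over \<open>\<k>Q\<^sub>0\<close> are quotients of the vector space freely generated by elementary
  tensors.  Their elements are handled through representatives, i.e. formal linear combinations of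
  elementary tensors; all maps below are given on representatives by formulas that are compatible
  with the tensor relations.

  \<^item> \<open>Pten\<close>: the generator \<open>(a, w, b)\<close> stands for \<open>a \<otimes> w \<otimes> b\<close> in \<open>A \<otimes> \<k>S\<^sub>n \<otimes> A\<close>.
  \<^item> \<open>Barten\<close>: the generator \<open>[a\<^sub>0, \<dots>, a\<^sub>n\<^sub>+\<^sub>1]\<close> stands for the tensor of \<open>a\<^sub>0\<close>, the classes of
    \<open>a\<^sub>1, \<dots>, a\<^sub>n\<close> modulo \<open>\<k>Q\<^sub>0\<close>, and \<open>a\<^sub>n\<^sub>+\<^sub>1\<close>.  Elements of \<open>A/\<k>Q\<^sub>0\<close> are thus given by
    representatives in \<open>A\<close>, and the projections \<open>\<varpi>\<^sub>n\<close> are the identity on representatives.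
\<close>
type_synonym ('v, 'e, 'k) Pten = "(('v, 'e, 'k) alg \<times> ('v, 'e) qpath \<times> ('v, 'e, 'k) alg) \<Rightarrow>\<^sub>0 'k"
type_synonym ('v, 'e, 'k) Barten = "('v, 'e, 'k) alg list \<Rightarrow>\<^sub>0 'k"

text \<open>Multilinear maps from \<open>(A/\<k>Q\<^sub>0)\<^sup>n\<close> to \<open>A\<close>, evaluated on representatives in \<open>A\<close>.\<close>
type_synonym ('v, 'e, 'k) cochain = "('v, 'e, 'k) alg list \<Rightarrow> ('v, 'e, 'k) alg"


section \<open>Reduction systems\<close>

text \<open>The reduction system is \<open>{(s, \<phi> s) | s \<in> S}\<close>; the values of \<open>\<phi>\<close> outside \<open>S\<close> play no role.\<close>

locale reduction_datum =
  fixes Q :: "('v, 'e) pre_digraph"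
    and I :: "(('v, 'e) qpath \<Rightarrow>\<^sub>0 'k::field_char_0) set"
    and S :: "('v, 'e) qpath set"
    and \<phi> :: "('v, 'e) qpath \<Rightarrow> (('v, 'e) qpath \<Rightarrow>\<^sub>0 'k)"
begin

abbreviation KQ :: "('v, 'e, 'k) pa ring" where "KQ \<equiv> path_algebra Q"

definition A :: "('v, 'e, 'k) alg ring" where "A = KQ Quot I"

definition proj :: "('v, 'e, 'k) pa \<Rightarrow> ('v, 'e, 'k) alg" where
  "proj x = I +>\<^bsub>KQ\<^esub> x"

abbreviation pj :: "('v, 'e) qpath \<Rightarrow> ('v, 'e, 'k) alg" where "pj p \<equiv> proj (bas p)"

definition Ascale :: "'k \<Rightarrow> ('v, 'e, 'k) alg \<Rightarrow> ('v, 'e, 'k) alg" where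
  "Ascale c a = proj (scale c \<one>\<^bsub>KQ\<^esub>) \<otimes>\<^bsub>A\<^esub> a"

definition Alin :: "('x \<Rightarrow> ('v, 'e, 'k) alg) \<Rightarrow> ('x \<Rightarrow>\<^sub>0 'k) \<Rightarrow> ('v, 'e, 'k) alg" where
  "Alin g x = finsum A (\<lambda>t. Ascale (Poly_Mapping.lookup x t) (g t)) (Poly_Mapping.keys x)"

text \<open>The factorizations \<open>p = q w r\<close> with \<open>w \<in> W\<close>.\<close>
definition occs :: "('v, 'e) qpath set \<Rightarrow> ('v, 'e) qpath \<Rightarrow> (('v, 'e) qpath \<times> ('v, 'e) qpath \<times> ('v, 'e) qpath) set" where
  "occs W p = {(q, w, r). q \<in> qpaths Q \<and> w \<in> W \<and> r \<in> qpaths Q \<and> tgt q = src w \<and> tgt w = src r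
                 \<and> p = pcomp (pcomp q w) r}"

definition rightmost :: "('v, 'e) qpath set \<Rightarrow> ('v, 'e) qpath \<Rightarrow> (('v, 'e) qpath \<times> ('v, 'e) qpath \<times> ('v, 'e) qpath) set" where
  "rightmost W p = {(q, w, r) \<in> occs W p. \<forall>(q', w', r') \<in> occs W p. plen r \<le> plen r'}"

definition leftmost :: "('v, 'e) qpath set \<Rightarrow> ('v, 'e) qpath \<Rightarrow> (('v, 'e) qpath \<times> ('v, 'e) qpath \<times> ('v, 'e) qpath) set" where
  "leftmost W p = {(q, w, r) \<in> occs W p. \<forall>(q', w', r') \<in> occs W p. plen q \<le> plen q'}"

definition Irr :: "('v, 'e) qpath set" where
  "Irr = {p \<in> qpaths Q. occs S p = {}}"

definition kIrr :: "('v, 'e, 'k) pa set" where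
  "kIrr = {x. Poly_Mapping.keys x \<subseteq> Irr}"

definition reduction_system :: bool where
  "reduction_system \<longleftrightarrow>
     S \<subseteq> qpaths Q \<and> (\<forall>s\<in>S. 2 \<le> plen s) \<and>
     (\<forall>s\<in>S. \<forall>s'\<in>S. s \<noteq> s' \<longrightarrow> occs {s} s' = {}) \<and>
     (\<forall>s\<in>S. Poly_Mapping.keys (\<phi> s) \<subseteq> {u \<in> Irr. src u = src s \<and> tgt u = tgt s})"

definition basic_reduction :: "('v, 'e) qpath \<Rightarrow> ('v, 'e) qpath \<Rightarrow> ('v, 'e) qpath \<Rightarrow> ('v, 'e, 'k) pa \<Rightarrow> ('v, 'e, 'k) pa" where
  "basic_reduction q s r =
     lin (\<lambda>p. if p = pcomp (pcomp q s) r then pa_mult (pa_mult (bas q) (\<phi> s)) (bas r) else bas p)"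

inductive_set reductions :: "(('v, 'e, 'k) pa \<Rightarrow> ('v, 'e, 'k) pa) set" where
  "id \<in> reductions"
| "\<lbrakk>\<rho> \<in> reductions; (q, s, r) \<in> occs S p\<rbrakk> \<Longrightarrow> basic_reduction q s r \<circ> \<rho> \<in> reductions"

primrec iterate_reductions :: "(nat \<Rightarrow> ('v, 'e, 'k) pa \<Rightarrow> ('v, 'e, 'k) pa) \<Rightarrow> nat \<Rightarrow> ('v, 'e, 'k) pa \<Rightarrow> ('v, 'e, 'k) pa" where
  "iterate_reductions \<rho> 0 x = x"
| "iterate_reductions \<rho> (Suc n) x = \<rho> n (iterate_reductions \<rho> n x)"

definition reduction_finite :: "('v, 'e) qpath \<Rightarrow> bool" where
  "reduction_finite p \<longleftrightarrow>
     (\<forall>\<rho>. (\<forall>n. \<rho> n \<in> reductions) \<longrightarrow>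
        (\<exists>N. \<forall>n\<ge>N. iterate_reductions \<rho> n (bas p) = iterate_reductions \<rho> N (bas p)))"

definition reduction_unique :: "('v, 'e) qpath \<Rightarrow> bool" where
  "reduction_unique p \<longleftrightarrow> reduction_finite p \<and>
     (\<forall>\<rho>\<in>reductions. \<forall>\<rho>'\<in>reductions.
        \<rho> (bas p) \<in> kIrr \<longrightarrow> \<rho>' (bas p) \<in> kIrr \<longrightarrow> \<rho> (bas p) = \<rho>' (bas p))"

definition diamond :: bool where
  "diamond \<longleftrightarrow>
     I = genideal KQ {bas s - \<phi> s | s. s \<in> S} \<and> (\<forall>p\<in>qpaths Q. reduction_unique p)"

definition sigma :: "('v, 'e, 'k) alg \<Rightarrow> ('v, 'e, 'k) pa" where
  "sigma a = (THE x. x \<in> kIrr \<and> proj x = a)"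


section \<open>The resolution\<close>

definition pconcat :: "('v, 'e) qpath list \<Rightarrow> ('v, 'e) qpath" where
  "pconcat us = foldr pcomp (butlast us) (last us)"

definition amb :: "nat \<Rightarrow> ('v, 'e) qpath set" where
  "amb n =
    (if n = 0 then triv ` verts Q
     else if n = 1 then {(tail Q e, [e], head Q e) | e. e \<in> arcs Q}
     else if n = 2 then S
     else {pconcat us | us. length us = n
             \<and> (\<exists>e\<in>arcs Q. us ! 0 = (tail Q e, [e], head Q e))
             \<and> (\<forall>i. 1 \<le> i \<and> i < n \<longrightarrow> us ! i \<in> Irr)
             \<and> (\<forall>i. Suc i < n \<longrightarrow>
                   tgt (us ! i) = src (us ! Suc i)
                 \<and> pcomp (us ! i) (us ! Suc i) \<notin> Irr
                 \<and> (\<forall>d\<in>qpaths Q. \<forall>r\<in>qpaths Q.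
                       tgt d = src r \<and> pcomp d r = us ! Suc i \<and> d \<noteq> us ! Suc i
                         \<longrightarrow> pcomp (us ! i) d \<in> Irr))})"

definition split :: "nat \<Rightarrow> ('v, 'e) qpath \<Rightarrow> ('v, 'e, 'k) Pten" where
  "split n p = (\<Sum>(q, w, r)\<in>occs (amb n) p. bas (pj q, w, pj r))"

text \<open>Elements of \<open>S\<^sub>n\<close> do not properly contain each other, so for \<open>n \<ge> 1\<close> the next two sums have
  at most one summand.\<close>
definition splitR :: "nat \<Rightarrow> ('v, 'e) qpath \<Rightarrow> ('v, 'e, 'k) Pten" where
  "splitR n p = (\<Sum>(q, w, r)\<in>rightmost (amb n) p. bas (pj q, w, pj r))"

definition splitL :: "nat \<Rightarrow> ('v, 'e) qpath \<Rightarrow> ('v, 'e, 'k) Pten" where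
  "splitL n p = (\<Sum>(q, w, r)\<in>leftmost (amb n) p. bas (pj q, w, pj r))"

definition act :: "('v, 'e, 'k) alg \<Rightarrow> ('v, 'e, 'k) Pten \<Rightarrow> ('v, 'e, 'k) alg \<Rightarrow> ('v, 'e, 'k) Pten" where
  "act a x b = lin (\<lambda>(a', w, b'). bas (a \<otimes>\<^bsub>A\<^esub> a', w, b' \<otimes>\<^bsub>A\<^esub> b)) x"

definition bimod_ext :: "(('v, 'e) qpath \<Rightarrow> ('v, 'e, 'k) Pten) \<Rightarrow> ('v, 'e, 'k) Pten \<Rightarrow> ('v, 'e, 'k) Pten" where
  "bimod_ext g = lin (\<lambda>(a, w, b). act a (g w) b)"

text \<open>The kernel of the map from formal combinations of elementary tensors onto
  \<open>P\<^sub>n = A \<otimes> \<k>S\<^sub>n \<otimes> A\<close>.  The last two generators express \<open>a e\<^sub>v \<otimes> w = a \<otimes> e\<^sub>v w\<close> and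
  \<open>w e\<^sub>v \<otimes> b = w \<otimes> e\<^sub>v b\<close>.\<close>
inductive_set P_null :: "nat \<Rightarrow> ('v, 'e, 'k) Pten set" for n :: nat where
  "0 \<in> P_null n"
| "\<lbrakk>x \<in> P_null n; y \<in> P_null n\<rbrakk> \<Longrightarrow> x + y \<in> P_null n"
| "x \<in> P_null n \<Longrightarrow> scale c x \<in> P_null n"
| "\<lbrakk>a \<in> carrier A; a' \<in> carrier A; w \<in> amb n; b \<in> carrier A\<rbrakk> \<Longrightarrow>
     bas (a \<oplus>\<^bsub>A\<^esub> a', w, b) - bas (a, w, b) - bas (a', w, b) \<in> P_null n"
| "\<lbrakk>a \<in> carrier A; w \<in> amb n; b \<in> carrier A; b' \<in> carrier A\<rbrakk> \<Longrightarrow>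
     bas (a, w, b \<oplus>\<^bsub>A\<^esub> b') - bas (a, w, b) - bas (a, w, b') \<in> P_null n"
| "\<lbrakk>a \<in> carrier A; w \<in> amb n; b \<in> carrier A\<rbrakk> \<Longrightarrow>
     bas (Ascale c a, w, b) - scale c (bas (a, w, b)) \<in> P_null n"
| "\<lbrakk>a \<in> carrier A; w \<in> amb n; b \<in> carrier A\<rbrakk> \<Longrightarrow>
     bas (a, w, Ascale c b) - scale c (bas (a, w, b)) \<in> P_null n"
| "\<lbrakk>a \<in> carrier A; w \<in> amb n; b \<in> carrier A; v \<in> verts Q\<rbrakk> \<Longrightarrow>
     bas (a \<otimes>\<^bsub>A\<^esub> pj (triv v), w, b) - (if v = src w then bas (a, w, b) else 0) \<in> P_null n"
| "\<lbrakk>a \<in> carrier A; w \<in> amb n; b \<in> carrier A; v \<in> verts Q\<rbrakk> \<Longrightarrow>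
     bas (a, w, pj (triv v) \<otimes>\<^bsub>A\<^esub> b) - (if v = tgt w then bas (a, w, b) else 0) \<in> P_null n"

text \<open>\<open>delta1 n w\<close> is \<open>\<delta>\<^sub>n(1 \<otimes> w \<otimes> 1)\<close>, for \<open>n \<ge> 1\<close>.\<close>
definition delta1 :: "nat \<Rightarrow> ('v, 'e) qpath \<Rightarrow> ('v, 'e, 'k) Pten" where
  "delta1 n w =
    (if n = 1 then bas (pj w, triv (tgt w), \<one>\<^bsub>A\<^esub>) - bas (\<one>\<^bsub>A\<^esub>, triv (src w), pj w)
     else if odd n then splitR (n - 1) w - splitL (n - 1) w
     else split (n - 1) w)"

definition delta :: "nat \<Rightarrow> ('v, 'e, 'k) Pten \<Rightarrow> ('v, 'e, 'k) Pten" where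
  "delta n = bimod_ext (delta1 n)"

text \<open>\<open>gamma n\<close> maps \<open>P\<^sub>n\<close> to \<open>P\<^sub>n\<^sub>+\<^sub>1\<close>.  It is only left linear: the right tensor factor is expanded
  into irreducible paths \<open>u\<close>, and \<open>w \<otimes> u = 0\<close> unless \<open>u\<close> starts where \<open>w\<close> ends.\<close>
definition gamma :: "nat \<Rightarrow> ('v, 'e, 'k) Pten \<Rightarrow> ('v, 'e, 'k) Pten" where
  "gamma n = lin (\<lambda>(a, w, b).
     act a (lin (\<lambda>u. if tgt w = src u then scale ((-1) ^ Suc n) (split (Suc n) (pcomp w u)) else 0)
               (sigma b)) \<one>\<^bsub>A\<^esub>)"

text \<open>The augmentation \<open>\<partial>\<^sub>0\<close> and its section \<open>\<rho>\<^sub>-\<^sub>1\<close>, \<open>a \<mapsto> a \<otimes> 1 = \<Sum>\<^sub>v a \<otimes> e\<^sub>v \<otimes> 1\<close>.\<close>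
definition aug :: "('v, 'e, 'k) Pten \<Rightarrow> ('v, 'e, 'k) alg" where
  "aug = Alin (\<lambda>(a, w, b). a \<otimes>\<^bsub>A\<^esub> pj w \<otimes>\<^bsub>A\<^esub> b)"

definition coaug :: "('v, 'e, 'k) alg \<Rightarrow> ('v, 'e, 'k) Pten" where
  "coaug a = (\<Sum>v\<in>verts Q. bas (a, triv v, \<one>\<^bsub>A\<^esub>))"

text \<open>\<open>\<gamma>\<^sub>n + \<Sum>\<^sub>i\<^sub>\<ge>\<^sub>1 \<gamma>\<^sub>n (\<delta>\<^sub>n\<^sub>+\<^sub>1 \<gamma>\<^sub>n - \<partial> \<gamma>\<^sub>n)\<^sup>i\<close>, where the sum ranges over those \<open>i\<close> whose term is nonzero as
  an element of the tensor product \<open>P\<^sub>n\<^sub>+\<^sub>1\<close>.\<close>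
definition perturb :: "nat \<Rightarrow> (('v, 'e, 'k) Pten \<Rightarrow> ('v, 'e, 'k) Pten) \<Rightarrow> ('v, 'e, 'k) Pten \<Rightarrow> ('v, 'e, 'k) Pten" where
  "perturb n D x =
    (let T = (\<lambda>y. delta (Suc n) (gamma n y) - D (gamma n y))
     in gamma n x + (\<Sum>i | 1 \<le> i \<and> gamma n ((T ^^ i) x) \<notin> P_null (Suc n). gamma n ((T ^^ i) x)))"

text \<open>\<open>bdry n\<close> is \<open>\<partial>\<^sub>n : P\<^sub>n \<rightarrow> P\<^sub>n\<^sub>-\<^sub>1\<close> for \<open>n \<ge> 1\<close> (the value at \<open>0\<close> is a dummy, see \<^term>\<open>aug\<close>), and
  \<open>rho n\<close> is \<open>\<rho>\<^sub>n : P\<^sub>n \<rightarrow> P\<^sub>n\<^sub>+\<^sub>1\<close> for \<open>n \<ge> 0\<close>.\<close>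
function bdry :: "nat \<Rightarrow> ('v, 'e, 'k) Pten \<Rightarrow> ('v, 'e, 'k) Pten"
  and rho :: "nat \<Rightarrow> ('v, 'e, 'k) Pten \<Rightarrow> ('v, 'e, 'k) Pten" where
  "bdry 0 = (\<lambda>x. 0)"
| "bdry (Suc 0) = bimod_ext (\<lambda>w. delta1 1 w - coaug (aug (delta1 1 w)))"
| "bdry (Suc (Suc n)) =
     bimod_ext (\<lambda>w. delta1 (Suc (Suc n)) w - rho n (bdry (Suc n) (delta1 (Suc (Suc n)) w)))"
| "rho n = perturb n (bdry (Suc n))"
  by pat_completeness auto
termination
  by (relation "measure (case_sum (\<lambda>n. 2 * n) (\<lambda>n. 2 * n + 3))") auto


section \<open>Comparison with the normalized bar resolution\<close>

definition bar_diff :: "nat \<Rightarrow> ('v, 'e, 'k) Barten \<Rightarrow> ('v, 'e, 'k) Barten" where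
  "bar_diff n = lin (\<lambda>l. \<Sum>i\<le>n. scale ((-1) ^ i)
     (bas (take i l @ [l ! i \<otimes>\<^bsub>A\<^esub> l ! Suc i] @ drop (i + 2) l)))"

definition bar_append :: "('v, 'e, 'k) Barten \<Rightarrow> ('v, 'e, 'k) alg list \<Rightarrow> ('v, 'e, 'k) Barten" where
  "bar_append x bs = lin (\<lambda>l. bas (l @ bs)) x"

primrec F :: "nat \<Rightarrow> ('v, 'e, 'k) Pten \<Rightarrow> ('v, 'e, 'k) Barten" where
  "F 0 = lin (\<lambda>(a, w, b). bas [aug (bas (a, w, \<one>\<^bsub>A\<^esub>)), b])"
| "F (Suc n) = lin (\<lambda>(a, w, b).
     scale ((-1) ^ Suc n) (bar_append (F n (bdry (Suc n) (bas (a, w, \<one>\<^bsub>A\<^esub>)))) [b]))"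

primrec G :: "nat \<Rightarrow> ('v, 'e, 'k) Barten \<Rightarrow> ('v, 'e, 'k) Pten" where
  "G 0 = lin (\<lambda>l. act \<one>\<^bsub>A\<^esub> (coaug (l ! 0 \<otimes>\<^bsub>A\<^esub> \<one>\<^bsub>A\<^esub>)) (last l))"
| "G (Suc n) = lin (\<lambda>l.
     act \<one>\<^bsub>A\<^esub> (rho n (G n (bar_diff (Suc n) (bas (butlast l @ [\<one>\<^bsub>A\<^esub>]))))) (last l))"

definition h :: "nat \<Rightarrow> ('v, 'e, 'k) Barten \<Rightarrow> ('v, 'e, 'k) Barten" where
  "h n = lin (\<lambda>l. \<Sum>i=1..n. scale ((-1) ^ Suc i)
     (bar_append (F i (G i (bas (take (Suc i) l @ [\<one>\<^bsub>A\<^esub>])))) (drop (Suc i) l)))"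


section \<open>The higher maps\<close>

text \<open>\<open>Hom(\<k>S, A)\<close>, the \<open>\<k>Q\<^sub>0\<close>-bimodule maps, given by their values on \<open>S\<close>.\<close>
definition HomSA :: "(('v, 'e) qpath \<Rightarrow> ('v, 'e, 'k) alg) set" where
  "HomSA = {f. \<forall>s\<in>S. f s \<in> carrier A \<and> pj (triv (src s)) \<otimes>\<^bsub>A\<^esub> f s \<otimes>\<^bsub>A\<^esub> pj (triv (tgt s)) = f s}"

text \<open>The bimodule maps \<open>P\<^sub>n \<rightarrow> A\<close> and \<open>Bar\<^sub>n \<rightarrow> A\<close> corresponding to \<open>f\<close>.\<close>
definition check_P :: "(('v, 'e) qpath \<Rightarrow> ('v, 'e, 'k) alg) \<Rightarrow> ('v, 'e, 'k) Pten \<Rightarrow> ('v, 'e, 'k) alg" where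
  "check_P f = Alin (\<lambda>(a, w, b). a \<otimes>\<^bsub>A\<^esub> f w \<otimes>\<^bsub>A\<^esub> b)"

definition check_Bar :: "('v, 'e, 'k) cochain \<Rightarrow> ('v, 'e, 'k) Barten \<Rightarrow> ('v, 'e, 'k) alg" where
  "check_Bar f = Alin (\<lambda>l. hd l \<otimes>\<^bsub>A\<^esub> f (butlast (tl l)) \<otimes>\<^bsub>A\<^esub> last l)"

definition G_up :: "nat \<Rightarrow> (('v, 'e) qpath \<Rightarrow> ('v, 'e, 'k) alg) \<Rightarrow> ('v, 'e, 'k) cochain" where
  "G_up n f = (\<lambda>ys. check_P f (G n (bas ([\<one>\<^bsub>A\<^esub>] @ ys @ [\<one>\<^bsub>A\<^esub>]))))"

definition h_up :: "nat \<Rightarrow> ('v, 'e, 'k) cochain \<Rightarrow> ('v, 'e, 'k) cochain" where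
  "h_up n f = (\<lambda>ys. Ascale ((-1) ^ n) (check_Bar f (h n (bas ([\<one>\<^bsub>A\<^esub>] @ ys @ [\<one>\<^bsub>A\<^esub>])))))"

text \<open>\<open>f \<bullet> g\<close> for \<open>f\<close> of arity \<open>m + 1\<close> and \<open>g\<close> of arity \<open>n + 1\<close>, and the Gerstenhaber bracket.\<close>
definition bullet :: "nat \<Rightarrow> nat \<Rightarrow> ('v, 'e, 'k) cochain \<Rightarrow> ('v, 'e, 'k) cochain \<Rightarrow> ('v, 'e, 'k) cochain" where
  "bullet m n f g = (\<lambda>ys. finsum A
     (\<lambda>i. Ascale ((-1) ^ (n * i)) (f (take i ys @ [g (take (Suc n) (drop i ys))] @ drop (i + Suc n) ys)))
     {0..m})"

definition gerstenhaber :: "nat \<Rightarrow> nat \<Rightarrow> ('v, 'e, 'k) cochain \<Rightarrow> ('v, 'e, 'k) cochain \<Rightarrow> ('v, 'e, 'k) cochain" where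
  "gerstenhaber m n f g = (\<lambda>ys. bullet m n f g ys \<ominus>\<^bsub>A\<^esub> Ascale ((-1) ^ (m * n)) (bullet n m g f ys))"

text \<open>\<open>[f, g]\<close> for \<open>f\<close> of arity \<open>m + 2\<close> and \<open>g\<close> of arity \<open>n + 2\<close>.\<close>
definition bracket :: "nat \<Rightarrow> nat \<Rightarrow> ('v, 'e, 'k) cochain \<Rightarrow> ('v, 'e, 'k) cochain \<Rightarrow> ('v, 'e, 'k) cochain" where
  "bracket m n f g = (\<lambda>ys. Ascale ((-1) ^ Suc m) (gerstenhaber (Suc m) (Suc n) f g ys))"

end

text \<open>The pairs of \<open>1 \<le> i \<le> k - 1\<close> and an \<open>(i, k - i)\<close>-shuffle \<open>\<sigma>\<close> with \<open>\<sigma>(1) < \<sigma>(i + 1)\<close>; here the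
  shuffled indices are \<open>0, \<dots>, k - 1\<close>.\<close>
definition pointed_shuffles :: "nat \<Rightarrow> (nat \<times> (nat \<Rightarrow> nat)) set" where
  "pointed_shuffles k =
    {(i, \<tau>). 1 \<le> i \<and> i < k \<and> \<tau> permutes {..<k} \<and>
       strict_mono_on {..<i} \<tau> \<and> strict_mono_on {i..<k} \<tau> \<and> \<tau> 0 < \<tau> i}"

lemma foldSetD_cong:
  assumes "(A, x) \<in> foldSetD D F e" "\<And>a y. a \<in> A \<Longrightarrow> F a y = F' a y"
  shows "(A, x) \<in> foldSetD D F' e"
  using assms
proof (induct set: foldSetD)
  case emptyI
  show ?case using emptyI(1) by (rule foldSetD.emptyI)
next
  case (insertI x A y)
  have "(A, y) \<in> foldSetD D F' e" using insertI by blast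
  moreover have "F x y = F' x y" using insertI by simp
  ultimately show ?case using insertI foldSetD.insertI[of x A F' y D e] by metis
qed

lemma finsum_fundef_cong [fundef_cong]:
  assumes "A = B" "\<And>a. a \<in> B \<Longrightarrow> f a = g a"
  shows "finsum R f A = finsum R g B"
proof -
  let ?m = "\<lambda>h. monoid.mult (add_monoid R) \<circ> h"
  have "(B, x) \<in> foldSetD (carrier (add_monoid R)) (?m f) (one (add_monoid R))
      \<longleftrightarrow> (B, x) \<in> foldSetD (carrier (add_monoid R)) (?m g) (one (add_monoid R))" for x
    by (rule iffI; erule foldSetD_cong; simp add: assms(2))
  then show ?thesis
    unfolding finsum_def finprod_def foldD_def assms(1) by (simp only:)
qed

context reduction_datum
begin

text \<open>\<open>G_hi [f\<^sub>1, \<dots>, f\<^sub>k]\<close> is the cochain \<open>G\<^sub>k(f\<^sub>1, \<dots>, f\<^sub>k)\<close> of arity 2, for \<open>k \<ge> 1\<close> and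
  \<open>f\<^sub>1, \<dots>, f\<^sub>k\<close> in \<^term>\<open>HomSA\<close>.\<close>
function G_hi :: "(('v, 'e) qpath \<Rightarrow> ('v, 'e, 'k) alg) list \<Rightarrow> ('v, 'e, 'k) cochain" where
  "G_hi fs =
    (if length fs \<le> 1 then G_up 2 (hd fs)
     else (\<lambda>ys. finsum A
       (\<lambda>(i, \<tau>). h_up 2 (bracket 0 0 (G_hi (map (\<lambda>j. fs ! \<tau> j) [0..<i]))
                                     (G_hi (map (\<lambda>j. fs ! \<tau> j) [i..<length fs]))) ys)
       (pointed_shuffles (length fs))))"
  by pat_completeness auto
termination
  by (relation "measure length") (auto simp: pointed_shuffles_def)

end


section \<open>Complete local coefficients\<close>

abbreviation mpow :: "'b::comm_ring_1 set \<Rightarrow> nat \<Rightarrow> 'b set" where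
  "mpow \<mm> N \<equiv> \<mm> [^]\<^bsub>ideals_set ring_of_type_algebra\<^esub> N"

text \<open>Completeness says that \<open>B\<close> maps bijectively onto the inverse limit of the \<open>B/\<mm>\<^sup>N\<close>.\<close>
definition complete_local_noetherian :: "'b::comm_ring_1 set \<Rightarrow> bool" where
  "complete_local_noetherian \<mm> \<longleftrightarrow>
     noetherian_ring (ring_of_type_algebra :: 'b ring) \<and>
     maximalideal \<mm> ring_of_type_algebra \<and>
     (\<forall>J. maximalideal J ring_of_type_algebra \<longrightarrow> J = \<mm>) \<and>
     (\<forall>x. (\<forall>N. x (Suc N) - x N \<in> mpow \<mm> N) \<longrightarrow> (\<exists>!y. \<forall>N. y - x N \<in> mpow \<mm> N))"

definition adic_lim :: "'b::comm_ring_1 set \<Rightarrow> (nat \<Rightarrow> 'b) \<Rightarrow> 'b" where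
  "adic_lim \<mm> x = (THE y. \<forall>N. \<exists>n\<^sub>0. \<forall>n\<ge>n\<^sub>0. y - x n \<in> mpow \<mm> N)"

definition adic_infsum :: "'b::comm_ring_1 set \<Rightarrow> ('i \<Rightarrow> 'b) \<Rightarrow> 'i set \<Rightarrow> 'b" where
  "adic_infsum \<mm> x J =
    (THE y. \<forall>N. \<exists>E\<subseteq>J. finite E \<and> (\<forall>E'\<subseteq>J. finite E' \<and> E \<subseteq> E' \<longrightarrow> y - sum x E' \<in> mpow \<mm> N))"

locale deformation_datum = reduction_datum Q I S \<phi>
  for Q :: "('v, 'e) pre_digraph"
    and I :: "(('v, 'e) qpath \<Rightarrow>\<^sub>0 'k::field_char_0) set"
    and S :: "('v, 'e) qpath set"
    and \<phi> :: "('v, 'e) qpath \<Rightarrow> (('v, 'e) qpath \<Rightarrow>\<^sub>0 'k)" +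
  fixes \<iota> :: "'k \<Rightarrow> 'b::comm_ring_1"
    and \<mm> :: "'b set"
begin

text \<open>
  Every element of \<open>Hom(\<k>S, A)\<close> completed-tensor \<open>\<mm>\<close>, the inverse limit of the
  \<open>Hom(\<k>S, A) \<otimes>\<^sub>\<k> \<mm>/\<mm>\<^sup>N\<close>, is the sum of a series \<open>\<Sum>\<^sub>j f\<^sub>j \<otimes> t\<^sub>j\<close> with \<open>t\<^sub>j \<in> \<mm>\<close> converging
  \<open>\<mm>\<close>-adically to \<open>0\<close>, and every such series defines an element (the transition maps are onto, so lift
  successively).  The elements are given by such series \<open>(f, t)\<close>.
\<close>
definition completed_HomSA :: "((nat \<Rightarrow> ('v, 'e) qpath \<Rightarrow> ('v, 'e, 'k) alg) \<times> (nat \<Rightarrow> 'b)) set" where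
  "completed_HomSA = {(f, t). (\<forall>j. f j \<in> HomSA \<and> t j \<in> \<mm>) \<and> (\<forall>N. \<exists>j\<^sub>0. \<forall>j\<ge>j\<^sub>0. t j \<in> mpow \<mm> N)}"

definition emb :: "('v, 'e, 'k) pa \<Rightarrow> ('v, 'e) qpath \<Rightarrow> 'b" where
  "emb x = (\<lambda>p. \<iota> (Poly_Mapping.lookup x p))"

text \<open>The completed tensor product of \<open>\<k>Q\<close> and \<open>B\<close>: the inverse limit of the free
  \<open>B/\<mm>\<^sup>N\<close>-modules on the paths.\<close>
definition KQhat :: "(('v, 'e) qpath \<Rightarrow> 'b) set" where
  "KQhat = {x. (\<forall>p. p \<notin> qpaths Q \<longrightarrow> x p = 0) \<and> (\<forall>N. finite {p. x p \<notin> mpow \<mm> N})}"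

definition IB :: "(('v, 'e) qpath \<Rightarrow> 'b) set" where
  "IB = {y. \<exists>(n::nat) c x. (\<forall>i<n. x i \<in> I) \<and> y = (\<lambda>p. \<Sum>i<n. c i * emb (x i) p)}"

text \<open>The kernel of \<open>KQhat \<rightarrow> A \<otimes>\<^sub>\<k> B/\<mm>\<^sup>N\<close>.\<close>
definition nbhd :: "nat \<Rightarrow> (('v, 'e) qpath \<Rightarrow> 'b) set" where
  "nbhd N = {x \<in> KQhat. \<exists>y\<in>IB. \<forall>p. x p - y p \<in> mpow \<mm> N}"

text \<open>The completed tensor product \<open>Ahat\<close> of \<open>A\<close> and \<open>B\<close>, i.e. the inverse limit of the
  \<open>A \<otimes>\<^sub>\<k> B/\<mm>\<^sup>N\<close>, is the quotient of \<open>KQhat\<close> by the intersection of all \<open>nbhd N\<close>.\<close>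
definition projhat :: "(('v, 'e) qpath \<Rightarrow> 'b) \<Rightarrow> (('v, 'e) qpath \<Rightarrow> 'b) set" where
  "projhat x = {y \<in> KQhat. \<forall>N. (\<lambda>p. y p - x p) \<in> nbhd N}"

definition Ahat :: "(('v, 'e) qpath \<Rightarrow> 'b) set set" where
  "Ahat = projhat ` KQhat"

definition tens :: "('v, 'e, 'k) alg \<Rightarrow> 'b \<Rightarrow> (('v, 'e) qpath \<Rightarrow> 'b) set" where
  "tens a c = (\<Union>x\<in>a. projhat (\<lambda>p. c * emb x p))"

definition Ahat_add :: "(('v, 'e) qpath \<Rightarrow> 'b) set \<Rightarrow> (('v, 'e) qpath \<Rightarrow> 'b) set \<Rightarrow> (('v, 'e) qpath \<Rightarrow> 'b) set" where
  "Ahat_add Z Y = (\<Union>(x, y)\<in>Z \<times> Y. projhat (\<lambda>p. x p + y p))"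

definition Ahat_smult :: "'b \<Rightarrow> (('v, 'e) qpath \<Rightarrow> 'b) set \<Rightarrow> (('v, 'e) qpath \<Rightarrow> 'b) set" where
  "Ahat_smult c Z = (\<Union>x\<in>Z. projhat (\<lambda>p. c * x p))"

definition Ahat_infsum :: "('i \<Rightarrow> (('v, 'e) qpath \<Rightarrow> 'b) set) \<Rightarrow> 'i set \<Rightarrow> (('v, 'e) qpath \<Rightarrow> 'b) set" where
  "Ahat_infsum Z J =
    (THE Y. Y \<in> Ahat \<and>
      (\<forall>N. \<exists>E\<subseteq>J. finite E \<and> (\<forall>E'\<subseteq>J. finite E' \<and> E \<subseteq> E' \<longrightarrow>
         (\<forall>y\<in>Y. \<forall>x. (\<forall>j\<in>E'. x j \<in> Z j) \<longrightarrow> (\<lambda>p. y p - (\<Sum>j\<in>E'. x j p)) \<in> nbhd N))))"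


section \<open>The homotopical star product\<close>

text \<open>\<open>G_ext \<psi> k a b\<close> is the value on \<open>a \<otimes> b\<close> of the \<open>B\<close>-multilinear, \<open>\<mm>\<close>-adically continuous
  extension of \<open>G\<^sub>k\<close>, applied to \<open>k\<close> copies of \<open>\<psi> = \<Sum>\<^sub>j f\<^sub>j \<otimes> t\<^sub>j\<close>.\<close>
definition G_ext :: "(nat \<Rightarrow> ('v, 'e) qpath \<Rightarrow> ('v, 'e, 'k) alg) \<times> (nat \<Rightarrow> 'b) \<Rightarrow> nat
    \<Rightarrow> ('v, 'e, 'k) alg \<Rightarrow> ('v, 'e, 'k) alg \<Rightarrow> (('v, 'e) qpath \<Rightarrow> 'b) set" where
  "G_ext \<psi> k a b =
    (if k = 0 then tens (a \<otimes>\<^bsub>A\<^esub> b) 1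
     else Ahat_infsum (\<lambda>js. tens (G_hi (map (fst \<psi>) js) [a, b]) (prod_list (map (snd \<psi>) js)))
            {js. length js = k})"

definition star_H :: "(nat \<Rightarrow> ('v, 'e) qpath \<Rightarrow> ('v, 'e, 'k) alg) \<times> (nat \<Rightarrow> 'b)
    \<Rightarrow> ('v, 'e, 'k) alg \<Rightarrow> ('v, 'e, 'k) alg \<Rightarrow> (('v, 'e) qpath \<Rightarrow> 'b) set" where
  "star_H \<psi> a b =
    Ahat_add (tens (a \<otimes>\<^bsub>A\<^esub> b) 1)
      (Ahat_infsum (\<lambda>k. Ahat_smult (\<iota> (1 / fact k)) (G_ext \<psi> k a b)) {1..})"


section \<open>The combinatorial star product\<close>

text \<open>\<open>\<sigma>\<close> applied to the value of \<open>\<psi>\<close> at \<open>s\<close>.\<close>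
definition phi_tilde :: "(nat \<Rightarrow> ('v, 'e) qpath \<Rightarrow> ('v, 'e, 'k) alg) \<times> (nat \<Rightarrow> 'b)
    \<Rightarrow> ('v, 'e) qpath \<Rightarrow> ('v, 'e) qpath \<Rightarrow> 'b" where
  "phi_tilde \<psi> s = (\<lambda>u. adic_infsum \<mm> (\<lambda>j. snd \<psi> j * emb (sigma (fst \<psi> j s)) u) UNIV)"

text \<open>The product \<open>q y r\<close> in \<^const>\<open>KQhat\<close>; for each path the sum has at most one term.\<close>
definition sandwich :: "('v, 'e) qpath \<Rightarrow> (('v, 'e) qpath \<Rightarrow> 'b) \<Rightarrow> ('v, 'e) qpath \<Rightarrow> ('v, 'e) qpath \<Rightarrow> 'b" where
  "sandwich q y r = (\<lambda>p. \<Sum>u | u \<in> qpaths Q \<and> tgt q = src u \<and> tgt u = src r \<and> p = pcomp (pcomp q u) r. y u)"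

text \<open>Power series in \<open>z\<close> over \<^const>\<open>KQhat\<close> are functions of the exponent of \<open>z\<close>.  For a path \<open>p\<close>
  the image under the reduction is \<open>red0 p + z red1 p\<close>; no element of \<open>S\<close> contains another one, so
  the rightmost occurrence is unique.\<close>
definition red0 :: "('v, 'e) qpath \<Rightarrow> ('v, 'e) qpath \<Rightarrow> 'b" where
  "red0 p = (if p \<in> Irr then emb (bas p)
     else (case the_elem (rightmost S p) of (q, s, r) \<Rightarrow> sandwich q (emb (\<phi> s)) r))"

definition red1 :: "(nat \<Rightarrow> ('v, 'e) qpath \<Rightarrow> ('v, 'e, 'k) alg) \<times> (nat \<Rightarrow> 'b)
    \<Rightarrow> ('v, 'e) qpath \<Rightarrow> ('v, 'e) qpath \<Rightarrow> 'b" where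
  "red1 \<psi> p = (if p \<in> Irr then (\<lambda>p'. 0)
     else (case the_elem (rightmost S p) of (q, s, r) \<Rightarrow> sandwich q (phi_tilde \<psi> s) r))"

definition red :: "(nat \<Rightarrow> ('v, 'e) qpath \<Rightarrow> ('v, 'e, 'k) alg) \<times> (nat \<Rightarrow> 'b)
    \<Rightarrow> (nat \<Rightarrow> ('v, 'e) qpath \<Rightarrow> 'b) \<Rightarrow> (nat \<Rightarrow> ('v, 'e) qpath \<Rightarrow> 'b)" where
  "red \<psi> Z = (\<lambda>k p'. adic_infsum \<mm>
     (\<lambda>p. Z k p * red0 p p' + (if k = 0 then 0 else Z (k - 1) p * red1 \<psi> p p')) (qpaths Q))"

text \<open>If \<open>\<psi>\<close> takes values that are infinite sums of paths, the coefficients of the iterates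
  stabilize modulo every power of \<open>\<mm>\<close>, i.e. converge \<open>\<mm>\<close>-adically.\<close>
definition red_inf :: "(nat \<Rightarrow> ('v, 'e) qpath \<Rightarrow> ('v, 'e, 'k) alg) \<times> (nat \<Rightarrow> 'b)
    \<Rightarrow> (nat \<Rightarrow> ('v, 'e) qpath \<Rightarrow> 'b) \<Rightarrow> (nat \<Rightarrow> ('v, 'e) qpath \<Rightarrow> 'b)" where
  "red_inf \<psi> Z = (\<lambda>k p. adic_lim \<mm> (\<lambda>n. (red \<psi> ^^ n) Z k p))"

definition star_C_coeff :: "(nat \<Rightarrow> ('v, 'e) qpath \<Rightarrow> ('v, 'e, 'k) alg) \<times> (nat \<Rightarrow> 'b) \<Rightarrow> nat
    \<Rightarrow> ('v, 'e, 'k) alg \<Rightarrow> ('v, 'e, 'k) alg \<Rightarrow> (('v, 'e) qpath \<Rightarrow> 'b) set" where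
  "star_C_coeff \<psi> k a b =
    projhat (red_inf \<psi> (\<lambda>i. if i = 0 then emb (pa_mult (sigma a) (sigma b)) else (\<lambda>p. 0)) k)"

definition star_C :: "(nat \<Rightarrow> ('v, 'e) qpath \<Rightarrow> ('v, 'e, 'k) alg) \<times> (nat \<Rightarrow> 'b)
    \<Rightarrow> ('v, 'e, 'k) alg \<Rightarrow> ('v, 'e, 'k) alg \<Rightarrow> (('v, 'e) qpath \<Rightarrow> 'b) set" where
  "star_C \<psi> a b = Ahat_infsum (\<lambda>k. star_C_coeff \<psi> k a b) UNIV"

end

end

theory Submission
  imports Defs "HOL-Combinatorics.Multiset_Permutations"
begin

text \<open>
  Write \<open>R(f\<^sub>1, \<dots>, f\<^sub>k)\<close> for the part of the rightmost reduction of an element of \<open>\<k>Q\<close> in which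
  exactly \<open>k\<close> of the successive steps replace \<open>s\<close> by \<open>f\<^sub>1 s\<close>, \<dots>, \<open>f\<^sub>k s\<close>, in this order, and all other steps
  replace \<open>s\<close> by \<open>\<phi> s\<close> (\<open>polred\<close> below).  If \<open>\<psi> = \<Sum>\<^sub>j f\<^sub>j \<otimes> t\<^sub>j\<close>, the coefficient of \<open>z\<^sup>k\<close> in the
  combinatorial star product is the sum of \<open>t\<^sub>j\<^sub>1 \<cdots> t\<^sub>j\<^sub>k R(f\<^sub>j\<^sub>1, \<dots>, f\<^sub>j\<^sub>k)(\<sigma>(a)\<sigma>(b))\<close> over all index
  lists.  The theorem therefore follows from the polarized statement
  \<open>G\<^sub>k(f\<^sub>1, \<dots>, f\<^sub>k)(a, b) = \<Sum>\<^sub>\<tau> R(f\<^sub>\<tau>\<^sub>1, \<dots>, f\<^sub>\<tau>\<^sub>k)(\<sigma>(a)\<sigma>(b))\<close>, the sum being over all permutations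
  (\<open>G_hi_coch2\<close>): in a sum over all index lists each permutation contributes the same, and their
  number is cancelled by the factor \<open>1/k!\<close>.

  The polarized statement is proved by showing that both sides satisfy the same recursion.

  For the left-hand side the homotopy \<open>h\<close> has to be computed in arity 2.  Elements of
  \<open>P\<^sub>n = A \<otimes> \<k>S\<^sub>n \<otimes> A\<close> have normal forms, combinations of triples \<open>(q, w, r)\<close> with \<open>q, r\<close> irreducible
  (\<open>P_null_iff\<close>).  On normal forms \<open>\<rho>\<^sub>1\<close> becomes an operator \<open>Theta\<close> which, applied to the splitting of
  a path at its arrows, lists the triples \<open>(q, s, r)\<close> of all rightmost reductions performed while that
  path is reduced (\<open>Theta_step\<close>); in particular \<open>G\<^sub>2(1 \<otimes> a \<otimes> b \<otimes> 1)\<close> lists the reductions of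
  \<open>\<sigma>(a)\<sigma>(b)\<close> (\<open>G2\<close>).  The map \<open>F\<close> splits at arrows.  Hence for a 3-cochain \<open>c\<close>, with
  \<open>E(p, b) = \<Sum> q c(y, r, b)\<close> over the factorizations \<open>p = q y r\<close> at an arrow \<open>y\<close>,
  \<open>h(c)(a, b)\<close> is \<open>E(\<sigma>(a), b)\<close> minus the sum of \<open>q (E(s, r) - E(\<phi> s, r))\<close> over these reductions
  (\<open>h_up_eval\<close>).

  For the right-hand side take the associator \<open>c(x, y, z) = M\<^sub>1(x M\<^sub>2(y z)) - M\<^sub>1(M\<^sub>2(x y) z)\<close> of
  \<open>M\<^sub>1 = R(f\<^sub>i\<^sub>+\<^sub>1, \<dots>, f\<^sub>k)\<close> and \<open>M\<^sub>2 = R(f\<^sub>1, \<dots>, f\<^sub>i)\<close> and sum over \<open>0 < i < k\<close>.  Since the rightmost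
  reduction of \<open>y x\<close> first reduces \<open>x\<close> completely (\<open>polred_mult\<close>), the sums telescope along the
  arrows, and all that survives is \<open>R(f\<^sub>1, \<dots>, f\<^sub>k)(\<sigma>(a)\<sigma>(b))\<close> (\<open>polred_product_recursion\<close>).  The
  bracket of two such cochains is the sum of the two associators.  As the pointed shuffles
  correspond to the ways of dividing the arguments into two unordered nonempty parts,
  symmetrizing the recursion for \<open>R\<close> gives the defining recursion of \<open>G\<^sub>k\<close>.

  Everything rests on the termination of rightmost reduction as a relation on paths (\<open>wf_rrel\<close>).
  This is not immediate, since reduction-finiteness speaks of iterated reductions of an element, in
  which terms may cancel.
\<close>

section \<open>Linear maps on free vector spaces\<close>

type_synonym ('v, 'e, 'k) triples = "(('v, 'e) qpath \<times> ('v, 'e) qpath \<times> ('v, 'e) qpath) \<Rightarrow>\<^sub>0 'k"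

abbreviation supp :: "('x \<Rightarrow>\<^sub>0 'k::field_char_0) \<Rightarrow> 'x set" where "supp \<equiv> Poly_Mapping.keys"

notation pa_mult (infixl "\<odot>" 70)

lemma lookup_scale [simp]: "Poly_Mapping.lookup (scale c x) t = c * Poly_Mapping.lookup x t"
  unfolding scale_def by (simp add: Poly_Mapping.map.rep_eq when_def)

lemma scale_zero [simp]: "scale 0 x = 0" "scale c 0 = 0"
  by (auto intro!: poly_mapping_eqI)

lemma scale_one [simp]: "scale 1 x = x"
  by (auto intro!: poly_mapping_eqI)

lemma scale_scale [simp]: "scale c (scale d x) = scale (c * d) x"
  by (auto intro!: poly_mapping_eqI)

lemma scale_add: "scale c (x + y) = scale c x + scale c y"
  by (auto intro!: poly_mapping_eqI simp: lookup_add algebra_simps)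

lemma scale_add_left: "scale (c + d) x = scale c x + scale d x"
  by (auto intro!: poly_mapping_eqI simp: lookup_add algebra_simps)

lemma scale_diff: "scale c (x - y) = scale c x - scale c y"
  by (rule poly_mapping_eqI) (simp add: lookup_minus right_diff_distrib)

lemma scale_minus1 [simp]: "scale (- 1) x = - x"
  by (auto intro!: poly_mapping_eqI)

lemma scale_uminus: "scale c (- x) = - scale c x"
  by (auto intro!: poly_mapping_eqI)

lemma scale_sum: "scale c (sum f J) = (\<Sum>j\<in>J. scale c (f j))"
  by (induction J rule: infinite_finite_induct) (auto simp: scale_add)

lemma keys_scale: "supp (scale c x) \<subseteq> supp x"
  by (auto simp: in_keys_iff)

lemma lin_superset:
  assumes "finite T" "supp x \<subseteq> T"
  shows "lin g x = (\<Sum>t\<in>T. scale (Poly_Mapping.lookup x t) (g t))"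
  unfolding lin_def by (rule sum.mono_neutral_left) (use assms in \<open>auto simp: in_keys_iff\<close>)

lemma lin_zero [simp]: "lin g 0 = 0"
  by (simp add: lin_def)

lemma lin_bas [simp]: "lin g (bas t) = g t"
  by (simp add: lin_def)

lemma lin_add: "lin g (x + y) = lin g x + lin g y"
proof -
  let ?T = "supp x \<union> supp y"
  have "lin g z = (\<Sum>t\<in>?T. scale (Poly_Mapping.lookup z t) (g t))" if "z \<in> {x, y, x + y}" for z
    by (rule lin_superset) (use that Poly_Mapping.keys_add[of x y] in auto)
  then show ?thesis by (simp add: lookup_add scale_add_left sum.distrib)
qed

lemma lin_scale: "lin g (scale c x) = scale c (lin g x)"
  using lin_superset[of "supp x" "scale c x" g] keys_scale[of c x]
  by (simp add: lin_def scale_sum)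

definition islin :: "(('x \<Rightarrow>\<^sub>0 'k::field_char_0) \<Rightarrow> ('y \<Rightarrow>\<^sub>0 'k)) \<Rightarrow> bool" where
  "islin f \<longleftrightarrow> (\<forall>x y. f (x + y) = f x + f y) \<and> (\<forall>c x. f (scale c x) = scale c (f x))"

lemma islin_add: "islin f \<Longrightarrow> f (x + y) = f x + f y"
  and islin_scale: "islin f \<Longrightarrow> f (scale c x) = scale c (f x)"
  by (auto simp: islin_def)

lemma islin_zero: "islin f \<Longrightarrow> f 0 = 0"
  using islin_scale[of f 0 0] by simp

lemma islin_uminus: "islin f \<Longrightarrow> f (- x) = - f x"
  using islin_scale[of f "- 1" x] by simp

lemma islin_diff: "islin f \<Longrightarrow> f (x - y) = f x - f y"
  using islin_add[of f x "- y"] islin_uminus[of f y] by simp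

lemma islin_sum: "islin f \<Longrightarrow> f (sum g J) = (\<Sum>j\<in>J. f (g j))"
  by (induction J rule: infinite_finite_induct) (auto simp: islin_zero islin_add)

lemma islin_lin [simp]: "islin (lin g)"
  by (simp add: islin_def lin_add lin_scale)

lemmas lin_diff = islin_diff[OF islin_lin]
  and lin_uminus = islin_uminus[OF islin_lin]
  and lin_sum = islin_sum[OF islin_lin]

lemma lin_bas_id [simp]: "lin bas x = x"
proof (rule poly_mapping_eqI)
  fix t
  have "Poly_Mapping.lookup (lin bas x) t
      = (\<Sum>s\<in>supp x. Poly_Mapping.lookup x s * Poly_Mapping.lookup (bas s :: _ \<Rightarrow>\<^sub>0 'b) t)"
    by (simp add: lin_def lookup_sum)
  also have "\<dots> = (\<Sum>s\<in>supp x. if s = t then Poly_Mapping.lookup x s else 0)"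
    by (rule sum.cong) (auto simp: lookup_single)
  also have "\<dots> = Poly_Mapping.lookup x t"
    by (simp add: in_keys_iff)
  finally show "Poly_Mapping.lookup (lin bas x) t = Poly_Mapping.lookup x t" .
qed

lemma lin_cong: "(\<And>t. t \<in> supp x \<Longrightarrow> g t = g' t) \<Longrightarrow> lin g x = lin g' x"
  unfolding lin_def by (rule sum.cong) auto

lemma islin_comp_lin: "islin f \<Longrightarrow> f (lin g x) = lin (\<lambda>t. f (g t)) x"
  by (simp add: lin_def islin_sum islin_scale)

lemma islin_expand: "islin f \<Longrightarrow> f x = lin (\<lambda>t. f (bas t)) x"
  using islin_comp_lin[of f bas x] by simp

lemma islin_eqI:
  assumes "islin f" "islin g" "\<And>t. t \<in> supp x \<Longrightarrow> f (bas t) = g (bas t)"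
  shows "f x = g x"
  using islin_expand[OF assms(1), of x] islin_expand[OF assms(2), of x]
    lin_cong[OF assms(3), of x] by simp

lemma lin_lin: "lin f (lin g x) = lin (\<lambda>t. lin f (g t)) x"
  by (rule islin_comp_lin) simp

lemma lin_add_fun: "lin (\<lambda>t. f t + g t) x = lin f x + lin g x"
  by (simp add: lin_def scale_add sum.distrib)

lemma lin_scale_fun: "lin (\<lambda>t. scale c (f t)) x = scale c (lin f x)"
  by (simp add: lin_def scale_sum mult.commute)

lemma lin_diff_fun: "lin (\<lambda>t. f t - g t) x = lin f x - lin g x"
  by (simp add: lin_def scale_diff sum_subtractf)

lemma lin_sum_fun: "lin (\<lambda>t. \<Sum>j\<in>J. f j t) x = (\<Sum>j\<in>J. lin (f j) x)"
  by (simp add: lin_def scale_sum sum.swap[of _ J])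

lemma lin_zero_fun [simp]: "lin (\<lambda>t. 0) x = 0"
  by (simp add: lin_def)

lemma lin_swap: "lin (\<lambda>s. lin (\<lambda>t. f s t) y) x = lin (\<lambda>t. lin (\<lambda>s. f s t) x) y"
  unfolding lin_def by (simp add: scale_sum mult.commute) (rule sum.swap)

lemma islin_id [simp]: "islin (\<lambda>x. x)" and islin_0 [simp]: "islin (\<lambda>x. 0)"
  by (auto simp: islin_def)

lemma islin_compose: "islin f \<Longrightarrow> islin g \<Longrightarrow> islin (\<lambda>x. f (g x))"
  by (simp add: islin_def)

lemma islin_plus: "islin f \<Longrightarrow> islin g \<Longrightarrow> islin (\<lambda>x. f x + g x)"
  by (simp add: islin_def scale_add)

lemma islin_minus: "islin f \<Longrightarrow> islin g \<Longrightarrow> islin (\<lambda>x. f x - g x)"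
  by (simp add: islin_def scale_diff)

lemma islin_neg: "islin f \<Longrightarrow> islin (\<lambda>x. - f x)"
  by (simp add: islin_def scale_uminus)

lemma islin_sum_fun: "(\<And>j. j \<in> J \<Longrightarrow> islin (f j)) \<Longrightarrow> islin (\<lambda>x. \<Sum>j\<in>J. f j x)"
  by (induction J rule: infinite_finite_induct) (auto intro: islin_plus)

lemma islin_lin_arg: "islin (\<lambda>y. lin (\<lambda>t. f t y) x)" if "\<And>t. islin (f t)"
  unfolding islin_def
  using that by (simp add: islin_add islin_scale lin_add_fun lin_scale_fun)

lemma keys_sum_subset: "supp (sum f J) \<subseteq> (\<Union>j\<in>J. supp (f j))"
proof (induction J rule: infinite_finite_induct)
  case (insert j J)
  then show ?case using Poly_Mapping.keys_add[of "f j" "sum f J"] by auto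
qed auto

lemma keys_lin: "supp (lin g x) \<subseteq> (\<Union>t\<in>supp x. supp (g t))"
  unfolding lin_def
  by (rule order_trans[OF keys_sum_subset]) (intro UN_mono subset_refl keys_scale)

lemma keys_lin_subset:
  "(\<And>t. t \<in> supp x \<Longrightarrow> supp (g t) \<subseteq> W) \<Longrightarrow> supp (lin g x) \<subseteq> W"
  using keys_lin[of g x] by blast

lemma keys_bas [simp]: "supp (bas t :: _ \<Rightarrow>\<^sub>0 'k::field_char_0) = {t}"
  by simp

lemma keys_diff_subset: "supp (x - y) \<subseteq> supp x \<union> supp y"
  by (rule Poly_Mapping.keys_diff)

lemma lookup_lin: "Poly_Mapping.lookup (lin g x) y
    = (\<Sum>t\<in>supp x. Poly_Mapping.lookup x t * Poly_Mapping.lookup (g t) y)"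
  by (simp add: lin_def lookup_sum)

section \<open>The path algebra\<close>

lemma pa_mult_islin1 [simp]: "islin (\<lambda>x. x \<odot> y)"
  unfolding pa_mult_def by simp

lemma pa_mult_islin2 [simp]: "islin (\<lambda>y. x \<odot> y)"
  unfolding pa_mult_def by (rule islin_lin_arg) simp

lemma pa_mult_add_left: "(x + x') \<odot> y = x \<odot> y + x' \<odot> y"
  and pa_mult_add_right: "x \<odot> (y + y') = x \<odot> y + x \<odot> y'"
  and pa_mult_diff_left: "(x - x') \<odot> y = x \<odot> y - x' \<odot> y"
  and pa_mult_diff_right: "x \<odot> (y - y') = x \<odot> y - x \<odot> y'"
  and pa_mult_scale_left: "scale c x \<odot> y = scale c (x \<odot> y)"
  and pa_mult_scale_right: "x \<odot> scale c y = scale c (x \<odot> y)"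
  and pa_mult_sum_left: "sum f J \<odot> y = (\<Sum>j\<in>J. f j \<odot> y)"
  and pa_mult_sum_right: "x \<odot> sum f J = (\<Sum>j\<in>J. x \<odot> f j)"
  and pa_mult_zero [simp]: "0 \<odot> y = 0" "x \<odot> 0 = 0"
  by (rule islin_add[OF pa_mult_islin1] islin_add[OF pa_mult_islin2]
    islin_diff[OF pa_mult_islin1] islin_diff[OF pa_mult_islin2]
    islin_scale[OF pa_mult_islin1] islin_scale[OF pa_mult_islin2]
    islin_sum[OF pa_mult_islin1] islin_sum[OF pa_mult_islin2]
    islin_zero[OF pa_mult_islin1] islin_zero[OF pa_mult_islin2])+

lemma pa_mult_bas: "bas p \<odot> bas q = (if tgt p = src q then bas (pcomp p q) else 0)"
  by (simp add: pa_mult_def)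

lemma src_pcomp [simp]: "src (pcomp p q) = src p"
  and tgt_pcomp [simp]: "tgt (pcomp p q) = tgt q"
  and arrows_pcomp [simp]: "arrows (pcomp p q) = arrows p @ arrows q"
  by (auto simp: pcomp_def src_def tgt_def arrows_def)

lemma src_triv [simp]: "src (triv v) = v" and tgt_triv [simp]: "tgt (triv v) = v"
  and arrows_triv [simp]: "arrows (triv v) = []"
  by (auto simp: triv_def src_def tgt_def arrows_def)

lemma path_eqI: "src p = src q \<Longrightarrow> arrows p = arrows q \<Longrightarrow> tgt p = tgt q \<Longrightarrow> p = q"
  by (simp add: src_def tgt_def arrows_def prod_eq_iff)

lemma pcomp_assoc: "pcomp (pcomp p q) r = pcomp p (pcomp q r)"
  by (rule path_eqI) auto

lemma pa_mult_assoc: "(x \<odot> y) \<odot> z = x \<odot> (y \<odot> z)"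
proof -
  have 1: "(bas p \<odot> bas q) \<odot> bas r = bas p \<odot> (bas q \<odot> (bas r :: ('a, 'b, 'c) pa))" for p q r
    by (auto simp: pa_mult_bas pcomp_assoc)
  have 2: "(bas p \<odot> bas q) \<odot> z = bas p \<odot> (bas q \<odot> z)" for p q
    by (rule islin_eqI[of _ _ z]) (auto intro: islin_compose 1)
  have 3: "(bas p \<odot> y) \<odot> z = bas p \<odot> (y \<odot> z)" for p
    by (rule islin_eqI[of "\<lambda>y. (bas p \<odot> y) \<odot> z" "\<lambda>y. bas p \<odot> (y \<odot> z)" y])
      (auto intro: islin_compose[of "\<lambda>x. x \<odot> z"] islin_compose[of "\<lambda>x. bas p \<odot> x"] 2)
  show ?thesis
    by (rule islin_eqI[of "\<lambda>x. (x \<odot> y) \<odot> z" "\<lambda>x. x \<odot> (y \<odot> z)" x])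
      (auto intro: islin_compose[of "\<lambda>x. x \<odot> z"] 3)
qed

lemma keys_pa_mult: "supp (x \<odot> y) \<subseteq>
    {pcomp p q | p q. p \<in> supp x \<and> q \<in> supp y \<and> tgt p = src q}"
  unfolding pa_mult_def
proof (intro keys_lin_subset)
  fix p q assume "p \<in> supp x" "q \<in> supp y"
  then have "tgt p = src q \<Longrightarrow> pcomp p q \<in> {pcomp p q | p q. p \<in> supp x \<and> q \<in> supp y \<and> tgt p = src q}"
    by blast
  then show "supp (if tgt p = src q then bas (pcomp p q) else (0 :: ('a, 'b, 'c) pa))
      \<subseteq> {pcomp p q | p q. p \<in> supp x \<and> q \<in> supp y \<and> tgt p = src q}"
    by simp
qed

section \<open>Paths and rightmost occurrences\<close>

locale confluent_system = reduction_datum Q I S \<phi>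
  for Q :: "('v, 'e) pre_digraph"
    and I :: "(('v, 'e) qpath \<Rightarrow>\<^sub>0 'k::field_char_0) set"
    and S :: "('v, 'e) qpath set"
    and \<phi> :: "('v, 'e) qpath \<Rightarrow> (('v, 'e) qpath \<Rightarrow>\<^sub>0 'k)" +
  assumes fin: "fin_digraph Q"
    and idl: "ideal I (path_algebra Q)"
    and RS: "reduction_system"
    and dia: "diamond"
begin

sublocale QD: fin_digraph Q by (rule fin)

abbreviation irr_par :: "('v, 'e) qpath \<Rightarrow> ('v, 'e) qpath set" where
  "irr_par p \<equiv> {u \<in> Irr. src u = src p \<and> tgt u = tgt p}"
abbreviation QP :: "('v, 'e) qpath set" where "QP \<equiv> qpaths Q"
definition CQ :: "('v, 'e, 'k) pa set" where "CQ = {x. supp x \<subseteq> QP}"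
definition arw :: "('v, 'e) qpath set" where "arw = amb 1"

lemma CQ_iff: "x \<in> CQ \<longleftrightarrow> supp x \<subseteq> QP"
  by (simp add: CQ_def)

lemma QP_awalk: "p \<in> QP \<longleftrightarrow> QD.awalk (src p) (arrows p) (tgt p)"
  by (simp add: qpaths_def)

lemma QP_verts: "p \<in> QP \<Longrightarrow> src p \<in> verts Q" "p \<in> QP \<Longrightarrow> tgt p \<in> verts Q"
  by (auto simp: QP_awalk)

lemma triv_QP: "v \<in> verts Q \<Longrightarrow> triv v \<in> QP"
  by (simp add: QP_awalk QD.awalk_Nil_iff)

lemma pcomp_QP: "\<lbrakk>p \<in> QP; q \<in> QP; tgt p = src q\<rbrakk> \<Longrightarrow> pcomp p q \<in> QP"
  by (auto simp: QP_awalk intro: QD.awalk_appendI)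

lemma path_eq_src: "\<lbrakk>p \<in> QP; q \<in> QP; src p = src q; arrows p = arrows q\<rbrakk> \<Longrightarrow> p = q"
  by (rule path_eqI) (auto simp: QP_awalk dest: QD.awalk_ends)

lemma path_eq_tgt: "\<lbrakk>p \<in> QP; q \<in> QP; tgt p = tgt q; arrows p = arrows q\<rbrakk> \<Longrightarrow> p = q"
  by (rule path_eqI) (auto simp: QP_awalk dest: QD.awalk_ends)

lemma plen0: "\<lbrakk>p \<in> QP; arrows p = []\<rbrakk> \<Longrightarrow> p = triv (src p) \<and> tgt p = src p \<and> src p \<in> verts Q"
  by (auto simp: QP_awalk QD.awalk_Nil_iff intro!: path_eqI)

lemma triv_pcomp [simp]: "src p = v \<Longrightarrow> pcomp (triv v) p = p"
  and pcomp_triv [simp]: "tgt p = v \<Longrightarrow> pcomp p (triv v) = p"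
  by (auto intro: path_eqI)

lemma QP_split:
  assumes "p \<in> QP" "arrows p = xs @ ys"
  obtains q r where "q \<in> QP" "r \<in> QP" "tgt q = src r" "p = pcomp q r" "arrows q = xs" "arrows r = ys"
proof -
  let ?m = "QD.awlast (src p) xs"
  have a: "QD.awalk (src p) xs ?m" "QD.awalk ?m ys (tgt p)"
    using assms by (auto simp: QP_awalk)
  show ?thesis
    by (rule that[of "(src p, xs, ?m)" "(?m, ys, tgt p)"])
      (use a assms(2) in \<open>auto simp: QP_awalk src_def tgt_def arrows_def pcomp_def prod_eq_iff\<close>)
qed

lemma pcomp_cancel:
  assumes "pcomp q r = pcomp q' r'" "q \<in> QP" "r \<in> QP" "q' \<in> QP" "r' \<in> QP"
    "tgt q = src r" "tgt q' = src r'" "plen q = plen q'"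
  shows "q = q' \<and> r = r'"
proof -
  have "src q = src q'" "tgt r = tgt r'" "arrows q @ arrows r = arrows q' @ arrows r'"
    using assms(1) by (metis src_pcomp tgt_pcomp arrows_pcomp)+
  then show ?thesis using assms path_eq_src[of q q'] path_eq_tgt[of r r'] by auto
qed

text \<open>Levi's lemma for paths: of two factorizations of a path, the one with the longer left factor refines the other.\<close>
lemma pcomp_levi:
  assumes "pcomp q r = pcomp q' r'" "q \<in> QP" "r \<in> QP" "q' \<in> QP" "r' \<in> QP"
    "tgt q = src r" "tgt q' = src r'" "plen q \<le> plen q'"
  obtains m where "m \<in> QP" "q' = pcomp q m" "r = pcomp m r'" "tgt q = src m" "tgt m = src r'"
proof -
  have "arrows q @ arrows r = arrows q' @ arrows r'"
    using assms(1) by (metis arrows_pcomp)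
  then have "\<exists>ys. arrows q' = arrows q @ ys \<and> arrows r = ys @ arrows r'"
    using assms(8) by (auto simp: append_eq_append_conv2)
  then obtain ys where ys: "arrows q' = arrows q @ ys" "arrows r = ys @ arrows r'" by blast
  obtain q1 m where m: "q1 \<in> QP" "m \<in> QP" "tgt q1 = src m" "q' = pcomp q1 m" "arrows q1 = arrows q" "arrows m = ys"
    using QP_split[OF assms(4) ys(1)] by metis
  have "src q1 = src q" using m(4) assms(1) by (metis src_pcomp)
  then have q1: "q1 = q" using m assms path_eq_src by metis
  have tm: "tgt m = src r'" using m assms by (metis tgt_pcomp)
  have "r = pcomp m r'"
    by (rule path_eq_tgt) (use m ys assms tm in \<open>auto intro: pcomp_QP\<close>, metis tgt_pcomp)
  then show ?thesis using that[of m] m q1 tm by auto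
qed

lemma arw_iff: "p \<in> arw \<longleftrightarrow> p \<in> QP \<and> plen p = 1"
proof
  assume "p \<in> arw"
  then show "p \<in> QP \<and> plen p = 1"
    by (auto simp: arw_def amb_def QP_awalk src_def tgt_def arrows_def QD.awalk_simps)
next
  assume "p \<in> QP \<and> plen p = 1"
  then show "p \<in> arw"
    by (cases p) (auto simp: arw_def amb_def QP_awalk src_def tgt_def arrows_def QD.awalk_simps length_Suc_conv)
qed

lemma path_cases:
  assumes "p \<in> QP"
  obtains v where "v \<in> verts Q" "p = triv v"
  | y p' where "y \<in> arw" "p' \<in> QP" "tgt y = src p'" "p = pcomp y p'"
proof (cases "arrows p")
  case Nil
  then show ?thesis using plen0[OF assms] that(1) by metis
next
  case (Cons e es)
  obtain q r where "q \<in> QP" "r \<in> QP" "tgt q = src r" "p = pcomp q r" "arrows q = [e]" "arrows r = es"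
    by (rule QP_split[OF assms, of "[e]" es]) (use Cons in simp_all)
  then show ?thesis by (intro that(2)[of q r]) (auto simp: arw_iff)
qed

lemma path_induct [consumes 1, case_names triv arrow]:
  assumes "p \<in> QP" "\<And>v. v \<in> verts Q \<Longrightarrow> P (triv v)"
    "\<And>y p'. \<lbrakk>y \<in> arw; p' \<in> QP; tgt y = src p'; P p'\<rbrakk> \<Longrightarrow> P (pcomp y p')"
  shows "P p"
  using assms(1)
proof (induction "plen p" arbitrary: p)
  case 0
  then show ?case using plen0[of p] assms(2) by (metis length_0_conv)
next
  case (Suc n)
  from \<open>p \<in> QP\<close> show ?case
  proof (cases rule: path_cases)
    case (1 v) then show ?thesis using assms(2) by simp
  next
    case (2 y p')
    then have "n = plen p'" using Suc(2) by (simp add: arw_iff)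
    then have "P p'" using Suc(1) 2 by blast
    then show ?thesis using assms(3) 2 by blast
  qed
qed

lemma arw_QP: "y \<in> arw \<Longrightarrow> y \<in> QP" by (simp add: arw_iff)

lemma arw_plen: "y \<in> arw \<Longrightarrow> plen y = 1" by (simp add: arw_iff)

lemma occsI: "\<lbrakk>q \<in> QP; w \<in> W; r \<in> QP; tgt q = src w; tgt w = src r\<rbrakk> \<Longrightarrow> (q, w, r) \<in> occs W (pcomp (pcomp q w) r)"
  by (simp add: occs_def)

lemma S_QP: "s \<in> S \<Longrightarrow> s \<in> QP" and S_len: "s \<in> S \<Longrightarrow> 2 \<le> plen s"
  and S_indep: "s \<in> S \<Longrightarrow> s' \<in> S \<Longrightarrow> s \<noteq> s' \<Longrightarrow> occs {s} s' = {}"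
  and phi_keys: "s \<in> S \<Longrightarrow> supp (\<phi> s) \<subseteq> irr_par s"
  using RS unfolding reduction_system_def by blast+

lemma occs_determined:
  assumes "(q, w, r) \<in> occs W p" "(q', w', r') \<in> occs W p" "W \<subseteq> QP" "plen q = plen q'" "plen w = plen w'"
  shows "(q, w, r) = (q', w', r')"
proof -
  have 1: "q = q' \<and> pcomp w r = pcomp w' r'"
    by (rule pcomp_cancel) (use assms in \<open>auto simp: occs_def pcomp_assoc intro: pcomp_QP\<close>)
  have "w = w' \<and> r = r'"
    by (rule pcomp_cancel) (use assms 1 in \<open>auto simp: occs_def\<close>)
  with 1 show ?thesis by simp
qed

lemma finite_occs: assumes "W \<subseteq> QP" shows "finite (occs W p)"
proof -
  have "inj_on (\<lambda>(q, w, r). (plen q, plen w)) (occs W p)"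
  proof (rule inj_onI)
    fix t t' assume "t \<in> occs W p" "t' \<in> occs W p"
      "(\<lambda>(q, w, r). (plen q, plen w)) t = (\<lambda>(q, w, r). (plen q, plen w)) t'"
    then show "t = t'"
      using occs_determined[of _ _ _ W p] assms by (cases t, cases t') auto
  qed
  moreover have "(\<lambda>(q, w, r). (plen q, plen w)) ` occs W p \<subseteq> {..plen p} \<times> {..plen p}"
    by (auto simp: occs_def)
  ultimately show ?thesis
    by (meson finite_SigmaI finite_atMost finite_imageD finite_subset)
qed

lemma Irr_QP: "p \<in> Irr \<Longrightarrow> p \<in> QP" by (simp add: Irr_def)

lemma IrrI: "p \<in> QP \<Longrightarrow> (\<And>q s r. (q, s, r) \<in> occs S p \<Longrightarrow> False) \<Longrightarrow> p \<in> Irr"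
  unfolding Irr_def by auto

lemma IrrD: "p \<in> Irr \<Longrightarrow> t \<notin> occs S p"
  unfolding Irr_def by auto

lemma occs_extend_right:
  "\<lbrakk>(a, w, b) \<in> occs W p; r \<in> QP; tgt p = src r\<rbrakk> \<Longrightarrow> (a, w, pcomp b r) \<in> occs W (pcomp p r)"
  unfolding occs_def by (auto simp: pcomp_assoc intro: pcomp_QP)

lemma occs_extend_left:
  "\<lbrakk>(a, w, b) \<in> occs W p; q \<in> QP; tgt q = src p\<rbrakk> \<Longrightarrow> (pcomp q a, w, b) \<in> occs W (pcomp q p)"
  unfolding occs_def by (auto simp: pcomp_assoc intro: pcomp_QP)

lemma Irr_subpath:
  assumes "pcomp q r \<in> Irr" "q \<in> QP" "r \<in> QP" "tgt q = src r"
  shows "q \<in> Irr" "r \<in> Irr"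
  using assms by (blast intro: IrrI dest: IrrD occs_extend_right occs_extend_left)+

lemma Irr_short: assumes "p \<in> QP" "plen p \<le> 1" shows "p \<in> Irr"
proof (rule IrrI[OF assms(1)])
  fix q s r assume "(q, s, r) \<in> occs S p"
  then have "s \<in> S" "plen s \<le> plen p" by (auto simp: occs_def)
  then show False using S_len[of s] assms(2) by simp
qed

lemma triv_Irr: "v \<in> verts Q \<Longrightarrow> triv v \<in> Irr" by (simp add: Irr_short triv_QP)
lemma arw_Irr: "y \<in> arw \<Longrightarrow> y \<in> Irr" by (simp add: Irr_short arw_iff)

lemma rightmost_occs: "t \<in> rightmost S p \<Longrightarrow> t \<in> occs S p"
  by (auto simp: rightmost_def)

lemma rightmost_iff: "(q, s, r) \<in> rightmost W p \<longleftrightarrow>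
    (q, s, r) \<in> occs W p \<and> (\<forall>q' s' r'. (q', s', r') \<in> occs W p \<longrightarrow> plen r \<le> plen r')"
  unfolding rightmost_def by auto

lemma rightmostD:
  assumes "(q, s, r) \<in> rightmost S p"
  shows "q \<in> QP" "s \<in> S" "r \<in> QP" "tgt q = src s" "tgt s = src r" "p = pcomp (pcomp q s) r" "p \<in> QP" "p \<notin> Irr"
proof -
  have o: "(q, s, r) \<in> occs S p" using assms by (rule rightmost_occs)
  then show d: "q \<in> QP" "s \<in> S" "r \<in> QP" "tgt q = src s" "tgt s = src r" "p = pcomp (pcomp q s) r"
    by (simp_all add: occs_def)
  show "p \<in> QP" unfolding d(6) by (intro pcomp_QP) (use d S_QP in simp_all)
  show "p \<notin> Irr" using o IrrD by blast
qed

lemma rightmost_ex: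
  assumes "p \<in> QP" "p \<notin> Irr" obtains q s r where "(q, s, r) \<in> rightmost S p"
proof -
  have "occs S p \<noteq> {}" using assms by (simp add: Irr_def)
  then obtain t where "t \<in> occs S p" by blast
  then obtain t where t: "t \<in> occs S p" "\<forall>u. u \<in> occs S p \<longrightarrow> plen (snd (snd t)) \<le> plen (snd (snd u))"
    using ex_has_least_nat[of "\<lambda>t. t \<in> occs S p" t "\<lambda>t. plen (snd (snd t))"] by blast
  obtain q s r where qsr: "t = (q, s, r)" by (cases t)
  have "plen r \<le> plen r'" if "(q', s', r') \<in> occs S p" for q' s' r'
    using t(2)[rule_format, OF that] qsr by simp
  then have "(q, s, r) \<in> rightmost S p" using t qsr unfolding rightmost_iff by blast
  then show ?thesis using that by blast
qed

text \<open>Independence of \<open>S\<close>: two occurrences ending at the same place coincide.\<close>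
lemma occs_same_end:
  assumes "(q, s, r) \<in> occs S p" "(q', s', r') \<in> occs S p" "plen r = plen r'" "plen s \<le> plen s'"
  shows "(q, s, r) = (q', s', r')"
proof -
  note d = assms(1,2)[unfolded occs_def, simplified]
  have s: "s \<in> QP" "s' \<in> QP" using d S_QP by auto
  have e: "pcomp (pcomp q s) r = pcomp (pcomp q' s') r'" using d by simp
  have "plen q + plen s + plen r = plen q' + plen s' + plen r'"
    using arg_cong[OF e, of "\<lambda>p. plen p"] by simp
  then have l: "plen q + plen s = plen q' + plen s'" using assms(3) by simp
  have 1: "pcomp q s = pcomp q' s' \<and> r = r'"
    by (rule pcomp_cancel[OF e]) (use d s l in \<open>auto intro: pcomp_QP\<close>)
  obtain m where m: "m \<in> QP" "s' = pcomp m s" "tgt m = src s"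
  proof (rule pcomp_levi[of q' s' q s])
    show "pcomp q' s' = pcomp q s" using 1 by simp
    show "plen q' \<le> plen q" using l assms(4) by linarith
  qed (use d s in auto)
  have "(m, s, triv (tgt s)) \<in> occs {s} s'"
    using m s QP_verts(2)[OF s(1)] by (auto simp: occs_def triv_QP)
  then have "s = s'" using S_indep[of s s'] d by auto
  then show ?thesis using occs_determined[OF assms(1,2)] l S_QP by (auto simp: subset_iff)
qed

lemma rightmost_unique:
  assumes "t \<in> rightmost S p" "t' \<in> rightmost S p" shows "t = t'"
proof -
  obtain q s r q' s' r' where t: "t = (q, s, r)" "t' = (q', s', r')" by (metis prod_cases3)
  then have a: "(q, s, r) \<in> rightmost S p" "(q', s', r') \<in> rightmost S p" using assms by simp_all
  have "plen r \<le> plen r'" "plen r' \<le> plen r"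
    using a[unfolded rightmost_iff] by blast+
  then have "plen r = plen r'" by simp
  then show ?thesis
    using occs_same_end[of q s r p q' s' r'] occs_same_end[of q' s' r' p q s r] assms t rightmost_occs
    by (metis linorder_le_cases)
qed

text \<open>The rightmost occurrence; arbitrary for irreducible paths.\<close>
definition rm :: "('v, 'e) qpath \<Rightarrow> ('v, 'e) qpath \<times> ('v, 'e) qpath \<times> ('v, 'e) qpath" where
  "rm p = the_elem (rightmost S p)"

lemma rm_eq: "t \<in> rightmost S p \<Longrightarrow> rm p = t"
  unfolding rm_def using rightmost_unique by (metis is_singletonI' is_singleton_the_elem empty_iff singleton_iff)

text \<open>An occurrence in a proper right part of \<open>s r\<close> would have to lie inside \<open>s\<close>.\<close>
lemma rightmost_tail:
  assumes "(q, s, r) \<in> rightmost S p" "s = pcomp y s'" "y \<in> QP" "plen y > 0" "s' \<in> QP" "tgt y = src s'"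
  shows "pcomp s' r \<in> Irr"
proof (rule ccontr)
  note d = rightmostD[OF assms(1)]
  have ts: "tgt s' = src r" using assms d by auto
  then have sr: "pcomp s' r \<in> QP" using assms d by (auto intro: pcomp_QP)
  assume "pcomp s' r \<notin> Irr"
  then obtain q1 s1 r1 where o: "(q1, s1, r1) \<in> occs S (pcomp s' r)"
    using sr by (auto simp: Irr_def)
  then have o': "q1 \<in> QP" "s1 \<in> S" "r1 \<in> QP" "tgt q1 = src s1" "tgt s1 = src r1" "pcomp s' r = pcomp (pcomp q1 s1) r1"
    by (auto simp: occs_def)
  have "(pcomp (pcomp q y) q1, s1, r1) \<in> occs S (pcomp (pcomp q y) (pcomp s' r))"
    by (rule occs_extend_left[OF o]) (use d assms in \<open>auto intro: pcomp_QP\<close>)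
  then have "(pcomp (pcomp q y) q1, s1, r1) \<in> occs S p"
    using d(6) assms(2) by (simp add: pcomp_assoc)
  then have le: "plen r \<le> plen r1" using assms(1) unfolding rightmost_iff by blast
  have s1: "s1 \<in> QP" using o' S_QP by blast
  have l: "plen s' + plen r = plen q1 + plen s1 + plen r1"
    using arg_cong[OF o'(6), of plen] by simp
  obtain m where m: "m \<in> QP" "s' = pcomp (pcomp q1 s1) m" "tgt (pcomp q1 s1) = src m"
  proof (rule pcomp_levi[of "pcomp q1 s1" r1 s' r])
    show "plen (pcomp q1 s1) \<le> plen s'" using l le by simp
    show "pcomp q1 s1 \<in> QP" by (rule pcomp_QP) (use o' s1 in auto)
  qed (use o' assms d ts in auto)
  have "(pcomp y q1, s1, m) \<in> occs {s1} s"
    using m o' s1 assms by (auto simp: occs_def pcomp_assoc intro!: pcomp_QP)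
  moreover have "plen s1 < plen s" using m assms by auto
  ultimately show False using S_indep[of s1 s] o' d by auto
qed

lemma rightmost_Irr: assumes "(q, s, r) \<in> rightmost S p" shows "r \<in> Irr"
proof -
  note d = rightmostD[OF assms]
  have s: "s \<in> QP" "plen s > 0" using S_QP[OF d(2)] S_len[OF d(2)] by auto
  have "pcomp (triv (tgt s)) r \<in> Irr"
    by (rule rightmost_tail[OF assms, of s]) (use s QP_verts(2)[OF s(1)] in \<open>auto intro: triv_QP\<close>)
  then show ?thesis using d by simp
qed

text \<open>An occurrence in \<open>q' p\<close> further right than \<open>s\<close> would either lie in \<open>p\<close>, against the choice of \<open>s\<close>, or
  start in \<open>q'\<close> and contain \<open>s\<close>, against independence.  So rightmost reductions commute with
  multiplication by a path from the left.\<close>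
lemma rightmost_prefix:
  assumes "(q, s, r) \<in> rightmost S p" "q' \<in> QP" "tgt q' = src p"
  shows "(pcomp q' q, s, r) \<in> rightmost S (pcomp q' p)"
proof -
  note d = rightmostD[OF assms(1)]
  have o: "(pcomp q' q, s, r) \<in> occs S (pcomp q' p)"
    by (rule occs_extend_left[OF rightmost_occs[OF assms(1)] assms(2,3)])
  have "plen r \<le> plen r1" if "(q1, s1, r1) \<in> occs S (pcomp q' p)" for q1 s1 r1
  proof (rule ccontr)
    assume a: "\<not> plen r \<le> plen r1"
    have o1: "q1 \<in> QP" "s1 \<in> S" "r1 \<in> QP" "tgt q1 = src s1" "tgt s1 = src r1" "pcomp q' p = pcomp (pcomp q1 s1) r1"
      using that by (auto simp: occs_def)
    have s1: "s1 \<in> QP" using o1 S_QP by blast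
    have s: "s \<in> QP" using d S_QP by blast
    show False
    proof (cases "plen q' \<le> plen q1")
      case True
      obtain m where m: "m \<in> QP" "q1 = pcomp q' m" "p = pcomp m (pcomp s1 r1)" "tgt q' = src m" "tgt m = src (pcomp s1 r1)"
      proof (rule pcomp_levi[of q' p q1 "pcomp s1 r1"])
        show "pcomp s1 r1 \<in> QP" by (rule pcomp_QP) (use o1 s1 in simp_all)
      qed (use o1 d(7) assms True in \<open>simp_all add: pcomp_assoc\<close>)
      then have "(m, s1, r1) \<in> occs S p" using o1 by (auto simp: occs_def pcomp_assoc)
      then show False using assms(1) a unfolding rightmost_iff by blast
    next
      case False
      have l: "plen q' + plen p = plen q1 + plen s1 + plen r1"
        using arg_cong[OF o1(6), of plen] by simp
      have lp: "plen p = plen q + plen s + plen r" using d by simp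
      \<comment> \<open>then \<open>s\<close> is a subpath of \<open>s1\<close>\<close>
      obtain m where m: "m \<in> QP" "pcomp s1 r1 = pcomp m p" "q' = pcomp q1 m" "tgt q1 = src m" "tgt m = src p"
      proof (rule pcomp_levi[of q1 "pcomp s1 r1" q' p])
        show "pcomp s1 r1 \<in> QP" by (rule pcomp_QP) (use o1 s1 in simp_all)
      qed (use o1 d(7) assms False in \<open>simp_all add: pcomp_assoc\<close>)
      have e: "pcomp (pcomp (pcomp m q) s) r = pcomp s1 r1" using m d by (simp add: pcomp_assoc)
      obtain n where n: "n \<in> QP" "s1 = pcomp (pcomp (pcomp m q) s) n" "tgt s = src n"
      proof (rule pcomp_levi[OF e])
        show "plen (pcomp (pcomp m q) s) \<le> plen s1"
          using arg_cong[OF e, of "\<lambda>x. plen x"] a by simp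
        show "pcomp (pcomp m q) s \<in> QP" by (intro pcomp_QP) (use m d s in simp_all)
      qed (use m d s s1 o1 in simp_all)
      have "(pcomp m q, s, n) \<in> occs {s} s1"
        using n m d s by (auto simp: occs_def intro: pcomp_QP)
      then have "s = s1" using S_indep[of s s1] o1 d by auto
      then have "plen n = 0" "plen m = 0" using arg_cong[OF n(2), of "\<lambda>x. plen x"] by auto
      moreover have "plen q' = plen q1 + plen m" using m by auto
      ultimately show False using False by simp
    qed
  qed
  with o show ?thesis unfolding rightmost_iff by blast
qed

text \<open>As \<open>u\<close> is irreducible, an occurrence in \<open>y u\<close> has to use the arrow \<open>y\<close>.\<close>
lemma rightmost_arrow:
  assumes "y \<in> arw" "u \<in> Irr" "tgt y = src u" "pcomp y u \<notin> Irr"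
  obtains s r where "(triv (src y), s, r) \<in> rightmost S (pcomp y u)" "pcomp s r = pcomp y u"
proof -
  have y: "y \<in> QP" "plen y = 1" "u \<in> QP" using assms by (auto simp: arw_iff Irr_QP)
  obtain q s r where t: "(q, s, r) \<in> rightmost S (pcomp y u)"
    using rightmost_ex[OF pcomp_QP[OF y(1,3) assms(3)] assms(4)] by metis
  note d = rightmostD[OF t]
  have s: "s \<in> QP" using d S_QP by blast
  have "plen q = 0"
  proof (rule ccontr)
    assume q0: "plen q \<noteq> 0"
    obtain m where "m \<in> QP" "q = pcomp y m" "u = pcomp m (pcomp s r)" "tgt m = src (pcomp s r)"
    proof (rule pcomp_levi[of y u q "pcomp s r"])
      show "pcomp s r \<in> QP" by (rule pcomp_QP) (use d s in simp_all)
      show "plen y \<le> plen q" using q0 y by linarith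
    qed (use d y assms(3) in \<open>simp_all add: pcomp_assoc\<close>)
    then have "(m, s, r) \<in> occs S u" using d by (auto simp: occs_def pcomp_assoc)
    then show False using assms by (auto simp: Irr_def)
  qed
  then have "q = triv (src q)" "tgt q = src q" using plen0[OF d(1)] by auto
  moreover have "src q = src y" using d(6) by (metis src_pcomp)
  ultimately have "q = triv (src y)" "tgt q = src y" by auto
  with t d(4,6) show ?thesis by (intro that[of s r]) (auto simp: pcomp_assoc)
qed

section \<open>Normal forms\<close>

sublocale ID: ideal I KQ by (rule idl)

lemma KQ_sel [simp]: "carrier KQ = CQ" "monoid.mult KQ = (\<odot>)" "ring.add KQ = (+)" "ring.zero KQ = 0"
  "one KQ = (\<Sum>v\<in>verts Q. bas (triv v))"
  by (simp_all add: path_algebra_def CQ_def)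

definition eQ :: "('v, 'e, 'k) pa" where "eQ = (\<Sum>v\<in>verts Q. bas (triv v))"

lemma CQ_add: "x \<in> CQ \<Longrightarrow> y \<in> CQ \<Longrightarrow> x + y \<in> CQ"
  using Poly_Mapping.keys_add[of x y] unfolding CQ_iff by blast
lemma CQ_scale: "x \<in> CQ \<Longrightarrow> scale c x \<in> CQ"
  using keys_scale[of c x] unfolding CQ_iff by blast
lemma CQ_diff: "x \<in> CQ \<Longrightarrow> y \<in> CQ \<Longrightarrow> x - y \<in> CQ"
  using keys_diff_subset[of x y] unfolding CQ_iff by blast
lemma CQ_mult: "x \<in> CQ \<Longrightarrow> y \<in> CQ \<Longrightarrow> x \<odot> y \<in> CQ"
  using ID.m_closed[of x y] by simp
lemma CQ_sum: "(\<And>j. j \<in> J \<Longrightarrow> f j \<in> CQ) \<Longrightarrow> sum f J \<in> CQ"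
  using keys_sum_subset[of f J] unfolding CQ_iff by blast
lemma CQ_lin: "(\<And>t. t \<in> supp x \<Longrightarrow> g t \<in> CQ) \<Longrightarrow> lin g x \<in> CQ"
  using keys_lin[of g x] unfolding CQ_iff by blast
lemma CQ_bas: "p \<in> QP \<Longrightarrow> bas p \<in> CQ" by (simp add: CQ_iff)
lemma CQ_zero: "0 \<in> CQ" by (simp add: CQ_iff)
lemma eQ_CQ: "eQ \<in> CQ" unfolding eQ_def by (rule CQ_sum) (simp add: triv_QP CQ_bas)

lemma eQ_left: "x \<in> CQ \<Longrightarrow> eQ \<odot> x = x" and eQ_right: "x \<in> CQ \<Longrightarrow> x \<odot> eQ = x"
  using ID.l_one[of x] ID.r_one[of x] by (simp_all add: eQ_def)

lemma I_CQ: "x \<in> I \<Longrightarrow> x \<in> CQ" using ID.Icarr[of x] by simp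
lemma I_add: "x \<in> I \<Longrightarrow> y \<in> I \<Longrightarrow> x + y \<in> I" using additive_subgroup.a_closed[OF ID.additive_subgroup_axioms, of x y] by simp
lemma I_zero: "0 \<in> I" using additive_subgroup.zero_closed[OF ID.additive_subgroup_axioms] by simp
lemma I_multl: "x \<in> I \<Longrightarrow> y \<in> CQ \<Longrightarrow> y \<odot> x \<in> I" using ID.I_l_closed[of x y] by simp
lemma I_multr: "x \<in> I \<Longrightarrow> y \<in> CQ \<Longrightarrow> x \<odot> y \<in> I" using ID.I_r_closed[of x y] by simp
lemma I_scale: assumes "x \<in> I" shows "scale c x \<in> I"
proof -
  have "scale c eQ \<odot> x \<in> I" by (rule I_multl[OF assms]) (simp only: CQ_scale eQ_CQ)
  then show ?thesis using eQ_left[OF I_CQ[OF assms]] by (simp add: pa_mult_scale_left)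
qed
lemma I_sum: "(\<And>j. j \<in> J \<Longrightarrow> f j \<in> I) \<Longrightarrow> sum f J \<in> I"
  by (induction J rule: infinite_finite_induct) (auto simp: I_zero I_add)
lemma I_lin: "(\<And>t. t \<in> supp x \<Longrightarrow> g t \<in> I) \<Longrightarrow> lin g x \<in> I"
  unfolding lin_def by (rule I_sum) (simp add: I_scale)

lemma kIrr_iff: "x \<in> kIrr \<longleftrightarrow> supp x \<subseteq> Irr"
  by (simp add: kIrr_def)
lemma kIrr_CQ: "x \<in> kIrr \<Longrightarrow> x \<in> CQ" using Irr_QP unfolding kIrr_iff CQ_iff by blast
lemma kIrr_add: "x \<in> kIrr \<Longrightarrow> y \<in> kIrr \<Longrightarrow> x + y \<in> kIrr"
  using Poly_Mapping.keys_add[of x y] unfolding kIrr_iff by blast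
lemma kIrr_diff: "x \<in> kIrr \<Longrightarrow> y \<in> kIrr \<Longrightarrow> x - y \<in> kIrr"
  using keys_diff_subset[of x y] unfolding kIrr_iff by blast
lemma kIrr_lin: "(\<And>t. t \<in> supp x \<Longrightarrow> g t \<in> kIrr) \<Longrightarrow> lin g x \<in> kIrr"
  using keys_lin[of g x] unfolding kIrr_iff by blast
lemma kIrr_sum: "(\<And>j. j \<in> J \<Longrightarrow> f j \<in> kIrr) \<Longrightarrow> sum f J \<in> kIrr"
  using keys_sum_subset[of f J] unfolding kIrr_iff by blast
lemma kIrr_bas: "p \<in> Irr \<Longrightarrow> bas p \<in> kIrr" by (simp add: kIrr_def)

subsection \<open>Rightmost reduction of a path\<close>

text \<open>One step of \<open>red\<^bsub>\<phi>\<^esub>\<close>: the rightmost reduction of all reducible terms simultaneously.\<close>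
definition r0 :: "('v, 'e, 'k) pa \<Rightarrow> ('v, 'e, 'k) pa" where
  "r0 = lin (\<lambda>p. if p \<in> Irr then bas p else case rm p of (q, s, r) \<Rightarrow> bas q \<odot> \<phi> s \<odot> bas r)"

lemma islin_r0 [simp]: "islin r0" by (simp add: r0_def)

lemma r0_Irr: "p \<in> Irr \<Longrightarrow> r0 (bas p) = bas p" by (simp add: r0_def)

lemma r0_rightmost: "(q, s, r) \<in> rightmost S p \<Longrightarrow> r0 (bas p) = bas q \<odot> \<phi> s \<odot> bas r"
  using rightmostD(8)[of q s r p] rm_eq[of "(q, s, r)" p] by (simp add: r0_def)

lemma phi_kIrr: "s \<in> S \<Longrightarrow> \<phi> s \<in> kIrr" using phi_keys unfolding kIrr_iff by blast
lemma phi_CQ: "s \<in> S \<Longrightarrow> \<phi> s \<in> CQ" by (rule kIrr_CQ[OF phi_kIrr])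

lemma sandwich_keys:
  assumes "t \<in> supp (bas q \<odot> x \<odot> (bas r :: ('v, 'e, 'k) pa))"
  shows "\<exists>u\<in>supp x. tgt q = src u \<and> tgt u = src r \<and> t = pcomp (pcomp q u) r"
proof -
  obtain w where "w \<in> supp (bas q \<odot> x)" "tgt w = src r" "t = pcomp w r"
    using keys_pa_mult[of "bas q \<odot> x" "bas r :: ('v, 'e, 'k) pa"] assms by auto
  moreover then obtain u where "u \<in> supp x" "tgt q = src u" "w = pcomp q u"
    using keys_pa_mult[of "bas q :: ('v, 'e, 'k) pa" x] by auto
  ultimately show ?thesis by auto
qed

text \<open>The reduced path does not reappear, as \<open>\<phi> s\<close> is irreducible and \<open>s\<close> is not.\<close>
lemma lookup_r0_self:
  assumes "p \<in> QP" "p \<notin> Irr" shows "Poly_Mapping.lookup (r0 (bas p)) p = 0"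
proof (rule ccontr)
  obtain q s r where t: "(q, s, r) \<in> rightmost S p" using rightmost_ex[OF assms] by metis
  note d = rightmostD[OF t]
  assume "Poly_Mapping.lookup (r0 (bas p)) p \<noteq> 0"
  then have "p \<in> supp (bas q \<odot> \<phi> s \<odot> bas r)"
    using r0_rightmost[OF t] by (simp add: in_keys_iff)
  then obtain u where u: "u \<in> supp (\<phi> s)" "p = pcomp (pcomp q u) r"
    using sandwich_keys by blast
  have u': "u \<in> Irr" "src u = src s" "tgt u = tgt s" using u phi_keys[OF d(2)] by auto
  have e: "pcomp (pcomp q s) r = pcomp (pcomp q u) r" using u d by simp
  have "arrows u = arrows s" using arg_cong[OF e, of arrows] by simp
  then have "u = s" using u' path_eqI by blast
  moreover have "s \<notin> Irr"
    using IrrD[of s "(triv (src s), s, triv (tgt s))"] occsI[of "triv (src s)" s S "triv (tgt s)"]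
      QP_verts[OF S_QP[OF d(2)]] d(2) by (auto simp: triv_QP)
  ultimately show False using u' by simp
qed

lemma r0_CQ: assumes "x \<in> CQ" shows "r0 x \<in> CQ"
  unfolding r0_def
proof (rule CQ_lin)
  fix p assume "p \<in> supp x"
  then have p: "p \<in> QP" using assms unfolding CQ_iff by blast
  show "(if p \<in> Irr then bas p else case rm p of (q, s, r) \<Rightarrow> bas q \<odot> \<phi> s \<odot> bas r) \<in> CQ"
  proof (cases "p \<in> Irr")
    case False
    obtain q s r where t: "(q, s, r) \<in> rightmost S p" using rightmost_ex[OF p False] by metis
    show ?thesis
      using rm_eq[OF t] False CQ_mult[OF CQ_mult[OF CQ_bas phi_CQ] CQ_bas, of q s r] rightmostD[OF t] by simp
  qed (use p in \<open>simp add: CQ_bas\<close>)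
qed

text \<open>A path is above the paths that occur in its rightmost reduction.\<close>
definition rrel :: "(('v, 'e) qpath \<times> ('v, 'e) qpath) set" where
  "rrel = {(p', p). p \<in> QP \<and> p \<notin> Irr \<and> p' \<in> supp (r0 (bas p))}"

subsection \<open>Well-foundedness\<close>

text \<open>Unlike \<open>r0\<close> this reduces the single path \<open>p\<close> and fixes all others, as a basic reduction must.\<close>
definition rightmost_red :: "('v, 'e) qpath \<Rightarrow> ('v, 'e, 'k) pa \<Rightarrow> ('v, 'e, 'k) pa" where
  "rightmost_red p = (case rm p of (q, s, r) \<Rightarrow> basic_reduction q s r)"

lemma rightmost_red_reduction: assumes "p \<in> QP" "p \<notin> Irr" shows "rightmost_red p \<in> reductions"
proof -
  obtain q s r where t: "(q, s, r) \<in> rightmost S p" using rightmost_ex[OF assms] by metis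
  have "basic_reduction q s r \<circ> id \<in> reductions"
    by (rule reductions.intros) (auto intro: reductions.intros rightmost_occs[OF t])
  then show ?thesis by (simp add: rightmost_red_def rm_eq[OF t])
qed

lemma islin_basic: "islin (basic_reduction q s r)" by (simp add: basic_reduction_def)

lemma rightmost_red_bas:
  assumes "p \<in> QP" "p \<notin> Irr"
  shows "rightmost_red p (bas t) = (if t = p then r0 (bas p) else bas t)"
proof -
  obtain q s r where t: "(q, s, r) \<in> rightmost S p" using rightmost_ex[OF assms] by metis
  show ?thesis
    unfolding rightmost_red_def rm_eq[OF t] basic_reduction_def prod.case rightmostD(6)[OF t, symmetric]
    by (simp add: r0_rightmost[OF t])
qed

lemma islin_rightmost_red: "islin (rightmost_red p)"
  by (simp add: rightmost_red_def islin_basic split: prod.split)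

lemma rightmost_red_eq:
  assumes "p \<in> QP" "p \<notin> Irr"
  shows "rightmost_red p x = x + scale (Poly_Mapping.lookup x p) (r0 (bas p) - bas p)"
proof (rule islin_eqI[of "rightmost_red p" "\<lambda>x. x + scale (Poly_Mapping.lookup x p) (r0 (bas p) - bas p)"])
  show "islin (\<lambda>x. x + scale (Poly_Mapping.lookup x p) (r0 (bas p) - bas p))"
    by (simp add: islin_def lookup_add scale_add scale_add_left)
qed (auto simp: islin_rightmost_red rightmost_red_bas[OF assms] lookup_single)

lemma lookup_rightmost_red:
  assumes "p \<in> QP" "p \<notin> Irr"
  shows "t \<noteq> p \<Longrightarrow> Poly_Mapping.lookup (rightmost_red p x) t
      = Poly_Mapping.lookup x t + Poly_Mapping.lookup x p * Poly_Mapping.lookup (r0 (bas p)) t"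
    and "Poly_Mapping.lookup (rightmost_red p x) p = 0"
  using lookup_r0_self[OF assms]
  by (auto simp: rightmost_red_eq[OF assms] lookup_add lookup_minus lookup_single)

lemma reductions_comp: "\<rho>' \<in> reductions \<Longrightarrow> \<rho> \<in> reductions \<Longrightarrow> \<rho>' \<circ> \<rho> \<in> reductions"
  by (induction rule: reductions.induct) (auto simp: o_assoc[symmetric] intro: reductions.intros)

lemma islin_reduction: "\<rho> \<in> reductions \<Longrightarrow> islin \<rho>"
  by (induction rule: reductions.induct) (auto simp: islin_def islin_add[OF islin_basic] islin_scale[OF islin_basic])

lemma occs_S_D:
  assumes "(q, s, r) \<in> occs S p"
  shows "q \<in> QP" "s \<in> S" "r \<in> QP" "tgt q = src s" "tgt s = src r" "p = pcomp (pcomp q s) r"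
  using assms by (simp_all add: occs_def)

lemma basic_diff_I:
  assumes "(q, s, r) \<in> occs S p" "x \<in> CQ" shows "x - basic_reduction q s r x \<in> I"
proof -
  note d = occs_S_D[OF assms(1)]
  have "bas s - \<phi> s \<in> I"
  proof -
    have "{bas s - \<phi> s | s. s \<in> S} \<subseteq> carrier KQ"
      using CQ_diff[OF CQ_bas[OF S_QP] phi_CQ] by auto
    from subsetD[OF ID.genideal_self[OF this]] show ?thesis
      using dia d(2) unfolding diamond_def by blast
  qed
  then have "bas q \<odot> (bas s - \<phi> s) \<odot> bas r \<in> I"
    using d by (intro I_multr I_multl CQ_bas) auto
  then have 1: "bas p - bas q \<odot> \<phi> s \<odot> bas r \<in> I"
    using d by (simp add: pa_mult_diff_left pa_mult_diff_right pa_mult_bas)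
  have "x - basic_reduction q s r x
    = lin (\<lambda>t. bas t - (if t = pcomp (pcomp q s) r then bas q \<odot> \<phi> s \<odot> bas r else bas t)) x"
    by (simp add: lin_diff_fun basic_reduction_def)
  also have "\<dots> \<in> I" by (rule I_lin) (use 1 d I_zero in auto)
  finally show ?thesis .
qed

lemma reduction_diff_I: "\<rho> \<in> reductions \<Longrightarrow> x \<in> CQ \<Longrightarrow> x - \<rho> x \<in> I"
proof (induction rule: reductions.induct)
  case (2 \<rho> q s r p)
  have "\<rho> x = x - (x - \<rho> x)" by simp
  then have "\<rho> x \<in> CQ" using CQ_diff 2 I_CQ by metis
  then show ?case using I_add[OF 2(3)[OF 2(4)] basic_diff_I[OF 2(2)], of "\<rho> x"] by simp
qed (simp add: I_zero)

lemma reduction_CQ: assumes "\<rho> \<in> reductions" "x \<in> CQ" shows "\<rho> x \<in> CQ"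
proof -
  have "\<rho> x = x - (x - \<rho> x)" by simp
  then show ?thesis using CQ_diff assms(2) I_CQ reduction_diff_I[OF assms] by metis
qed

lemma basic_kIrr: assumes "(q, s, r) \<in> occs S p" "x \<in> kIrr" shows "basic_reduction q s r x = x"
proof -
  have "p \<notin> Irr" using IrrD assms by blast
  then have "basic_reduction q s r x = lin bas x"
    unfolding basic_reduction_def using assms occs_S_D(6)[OF assms(1)]
    by (intro lin_cong) (auto simp: kIrr_def)
  then show ?thesis by simp
qed

lemma reduction_kIrr: "\<rho> \<in> reductions \<Longrightarrow> x \<in> kIrr \<Longrightarrow> \<rho> x = x"
  by (induction rule: reductions.induct) (auto simp: basic_kIrr)

text \<open>Reduction-finiteness excludes strategies that change the current element forever.\<close>
lemma no_infinite_strategy: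
  assumes step: "\<And>x. P x \<Longrightarrow> \<exists>\<rho>\<in>reductions. \<rho> x \<noteq> x \<and> P (\<rho> x)"
    and start: "p \<in> QP" "\<rho>0 \<in> reductions" "P (\<rho>0 (bas p))"
  shows False
proof -
  obtain st where st: "\<And>x. P x \<Longrightarrow> st x \<in> reductions \<and> st x x \<noteq> x \<and> P (st x x)"
    using step by metis
  define y where "y = rec_nat (\<rho>0 (bas p)) (\<lambda>_ x. st x x)"
  have y: "y 0 = \<rho>0 (bas p)" "y (Suc n) = st (y n) (y n)" for n by (simp_all add: y_def)
  have Py: "P (y n)" for n by (induction n) (use st start in \<open>auto simp: y\<close>)
  define \<rho> where "\<rho> = case_nat \<rho>0 (\<lambda>n. st (y n))"
  have "\<rho> n \<in> reductions" for n using start st[OF Py] by (auto simp: \<rho>_def split: nat.split)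
  moreover have it: "iterate_reductions \<rho> (Suc n) (bas p) = y n" for n
    by (induction n) (auto simp: \<rho>_def y)
  moreover have "reduction_finite p" using dia start unfolding diamond_def reduction_unique_def by blast
  ultimately obtain N where N: "\<forall>n\<ge>N. iterate_reductions \<rho> n (bas p) = iterate_reductions \<rho> N (bas p)"
    unfolding reduction_finite_def by blast
  have "iterate_reductions \<rho> (Suc N) (bas p) = iterate_reductions \<rho> (Suc (Suc N)) (bas p)"
    using N by (metis le_SucI order_refl)
  then have "y N = y (Suc N)" unfolding it .
  then show False using st[OF Py[of N]] by (simp add: y)
qed

text \<open>Along a shortest chain from the support of \<open>x\<close> to a path outside of it nothing cancels; the
  path reduced last has disappeared afterwards.\<close>
lemma reach_reduction:
  assumes R: "\<And>b c. (b, c) \<in> R \<Longrightarrow> b \<in> QP \<and> b \<notin> Irr \<and> c \<in> K \<and> (c, b) \<in> rrel"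
    and Rmax: "\<And>b c. b \<in> K \<Longrightarrow> c \<in> K \<Longrightarrow> (c, b) \<in> rrel \<Longrightarrow> (b, c) \<in> R"
  shows "b \<in> K \<Longrightarrow> b \<in> supp x \<Longrightarrow> (b, t) \<in> R ^^ n \<Longrightarrow> t \<notin> supp x
    \<Longrightarrow> \<exists>\<rho>\<in>reductions. \<exists>u\<in>K. t \<in> supp (\<rho> x) \<and> u \<notin> supp (\<rho> x) \<and> (u, t) \<in> R"
proof (induction n arbitrary: b x rule: less_induct)
  case (less n)
  show ?case
  proof (cases "\<exists>m<n. \<exists>b'\<in>K. b' \<in> supp x \<and> (b', t) \<in> R ^^ m")
    case True
    then show ?thesis using less by blast
  next
    case False
    have "n \<noteq> 0" using less(3,4,5) by (cases n) simp_all
    then obtain m where m: "n = Suc m" by (cases n) auto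
    then obtain c where c: "(b, c) \<in> R" "(c, t) \<in> R ^^ m" using less(4) by (metis relpow_Suc_D2)
    have b: "b \<in> QP" "b \<notin> Irr" and cF: "c \<in> K" using R[OF c(1)] by auto
    have bt: "t \<noteq> b" using less by auto
    have c0: "c \<in> supp (r0 (bas b))" using R[OF c(1)] by (simp add: rrel_def)
    then have cb: "c \<noteq> b" using lookup_r0_self[OF b] by (auto simp: in_keys_iff)
    have xb: "Poly_Mapping.lookup x b \<noteq> 0" using less by (simp add: in_keys_iff)
    show ?thesis
    proof (cases "m = 0")
      case True
      then have "c = t" using c by simp
      then have "t \<in> supp (rightmost_red b x)" using lookup_rightmost_red(1)[OF b bt, of x] c0 xb less(5)
        by (simp add: in_keys_iff)
      moreover have "b \<notin> supp (rightmost_red b x)" using lookup_rightmost_red(2)[OF b] by (simp add: in_keys_iff)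
      ultimately show ?thesis using rightmost_red_reduction[OF b] c(1) \<open>c = t\<close> less(2) by blast
    next
      case False
      have cx: "c \<notin> supp x"
        using \<open>\<not> (\<exists>m<n. _ m)\<close> m c cF by blast
      have 1: "c \<in> supp (rightmost_red b x)"
        using lookup_rightmost_red(1)[OF b cb, of x] c0 xb cx by (simp add: in_keys_iff)
      have "t \<notin> supp (rightmost_red b x)"
      proof
        assume "t \<in> supp (rightmost_red b x)"
        then have "t \<in> supp (r0 (bas b))"
          using lookup_rightmost_red(1)[OF b bt, of x] less(5) by (auto simp: in_keys_iff)
        then have "(t, b) \<in> rrel" using b by (simp add: rrel_def)
        moreover have "t \<in> K" using less(2,4) m R by (metis relpow_Suc_E)
        ultimately have "(b, t) \<in> R ^^ 1" using Rmax less(2) by simp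
        moreover have "1 < n" using m False by simp
        ultimately show False using \<open>\<not> (\<exists>m<n. _ m)\<close> less(2,3) by blast
      qed
      then obtain \<rho> u where "\<rho> \<in> reductions" "u \<in> K" "t \<in> supp (\<rho> (rightmost_red b x))"
          "u \<notin> supp (\<rho> (rightmost_red b x))" "(u, t) \<in> R"
        using less(1)[of m c "rightmost_red b x"] m cF 1 c by blast
      then show ?thesis
        using reductions_comp[OF _ rightmost_red_reduction[OF b], of \<rho>]
        by (intro bexI[of _ "\<rho> \<circ> rightmost_red b"] bexI[of _ u]) auto
    qed
  qed
qed

lemma rrel_QP: "(p', p) \<in> rrel \<Longrightarrow> p' \<in> QP"
  using r0_CQ[OF CQ_bas, of p] unfolding rrel_def CQ_iff by blast

text \<open>Let \<open>K\<close> be the set of inaccessible paths; each of them has a successor in \<open>K\<close>.  A strategy of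
  reductions that never comes to rest contradicts reduction-finiteness.

  If every path in \<open>K\<close> reaches infinitely many paths of \<open>K\<close>, then some path reachable from the support
  of the current element is missing in this support, which is finite, and a reduction can make it
  appear.  This can be repeated forever.

  Otherwise a smallest finite set \<open>H\<close> of the form "all paths reachable from \<open>b\<close>" is strongly connected,
  and it has at least two elements since no path occurs in its own reduction.  Start with one path
  of \<open>H\<close>.  After each reduction that makes a missing path of \<open>H\<close> appear, the path of \<open>H\<close> that was reduced
  last is missing, so that again the process never stops.\<close>
theorem wf_rrel: "wf rrel"
proof (rule acc_wfI, rule allI, rule ccontr)
  fix p0 assume p0: "p0 \<notin> Wellfounded.acc rrel"
  define K where "K = - Wellfounded.acc rrel"
  define R where "R = {(b, c). b \<in> K \<and> c \<in> K \<and> (c, b) \<in> rrel}"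
  have K: "\<exists>c. (b, c) \<in> R" if "b \<in> K" for b
  proof -
    from that have "b \<notin> Wellfounded.acc rrel" by (simp add: K_def)
    then obtain c where "(c, b) \<in> rrel" "c \<notin> Wellfounded.acc rrel" by (rule not_acc_down)
    then have "(b, c) \<in> R" using that by (simp add: K_def R_def)
    then show ?thesis by blast
  qed
  have R: "b \<in> QP \<and> b \<notin> Irr \<and> c \<in> K \<and> (c, b) \<in> rrel" if "(b, c) \<in> R" for b c
    using that by (auto simp: R_def rrel_def)
  define Re where "Re b = {t. (b, t) \<in> R\<^sup>+}" for b
  have ReK: "Re b \<subseteq> K" for b
    unfolding Re_def using R by (blast elim: tranclE)
  show False
  proof (cases "\<forall>b\<in>K. infinite (Re b)")
    case True
    show False
    \<comment> \<open>invariant: the support meets \<open>K\<close>\<close>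
    proof (rule no_infinite_strategy[of "\<lambda>x. \<exists>b\<in>K. b \<in> supp x" p0 id])
      fix x :: "('v, 'e, 'k) pa" assume "\<exists>b\<in>K. b \<in> supp x"
      then obtain b where b: "b \<in> K" "b \<in> supp x" by blast
      obtain t where t: "t \<in> Re b" "t \<notin> supp x"
        using True b finite_subset[of "Re b" "supp x", OF _ finite_keys] by blast
      obtain n where n: "(b, t) \<in> R ^^ n" using t unfolding Re_def by (auto simp: trancl_power)
      have "\<exists>\<rho>\<in>reductions. \<exists>u\<in>K. t \<in> supp (\<rho> x) \<and> u \<notin> supp (\<rho> x) \<and> (u, t) \<in> R"
        by (rule reach_reduction[of R K, OF R _ b n t(2)]) (auto simp: R_def)
      then obtain \<rho> where "\<rho> \<in> reductions" "t \<in> supp (\<rho> x)" by blast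
      moreover then have "\<rho> x \<noteq> x" using t by metis
      moreover have "t \<in> K" using t ReK by blast
      ultimately show "\<exists>\<rho>\<in>reductions. \<rho> x \<noteq> x \<and> (\<exists>b\<in>K. b \<in> supp (\<rho> x))"
        by blast
    next
      show "p0 \<in> QP" using K[of p0] p0 R unfolding K_def by blast
    next
      have "p0 \<in> K \<and> p0 \<in> supp (id (bas p0 :: ('v, 'e, 'k) pa))"
        using p0 by (simp add: K_def)
      then show "\<exists>b\<in>K. b \<in> supp (id (bas p0 :: ('v, 'e, 'k) pa))" by blast
    qed (rule reductions.intros(1))
  next
    case False
    then obtain b0 where b0: "b0 \<in> K \<and> finite (Re b0)" by blast
    obtain b where b: "b \<in> K" "finite (Re b)" and bmin: "\<And>c. c \<in> K \<Longrightarrow> finite (Re c) \<Longrightarrow> card (Re b) \<le> card (Re c)"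
      using ex_has_least_nat[of "\<lambda>b. b \<in> K \<and> finite (Re b)" b0 "\<lambda>b. card (Re b)"] b0 by blast
    define H where "H = Re b"
    have HK: "H \<subseteq> K" using ReK unfolding H_def .
    have HRe: "Re c = H" if "c \<in> H" for c
    proof -
      have "Re c \<subseteq> H"
        using that unfolding H_def Re_def by (blast intro: trancl_trans)
      moreover have "card H \<le> card (Re c)"
        using bmin[of c] that ReK[of b] finite_subset[OF \<open>Re c \<subseteq> H\<close>] b(2) unfolding H_def by blast
      ultimately show ?thesis using b(2) unfolding H_def by (metis card_seteq)
    qed
    obtain c where c: "(b, c) \<in> R" using K[OF b(1)] by blast
    then have cH: "c \<in> H" by (simp add: H_def Re_def)
    then obtain d where d: "(c, d) \<in> R" using K HK by blast
    then have dH: "d \<in> H" using HRe[OF cH] unfolding Re_def by blast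
    have dc: "d \<noteq> c" using lookup_r0_self[of c] R[OF d] by (auto simp: rrel_def in_keys_iff)
    define R' where "R' = R \<inter> H \<times> H"
    have path: "(u, t) \<in> R\<^sup>+ \<Longrightarrow> u \<in> H \<Longrightarrow> (u, t) \<in> R'\<^sup>+" for u t
    proof (induction rule: trancl_induct)
      case (base t)
      then have "t \<in> H" using HRe[of u] unfolding Re_def by blast
      then show ?case using base by (auto simp: R'_def)
    next
      case (step t t')
      then have "t \<in> H" "t' \<in> H" using HRe[of u] unfolding Re_def by (blast intro: trancl_into_trancl)+
      then have "(t, t') \<in> R'" using step by (auto simp: R'_def)
      then show ?case using step by (meson trancl_into_trancl)
    qed
    show False
    \<comment> \<open>invariant: the support meets \<open>H\<close> and does not contain it\<close>
    proof (rule no_infinite_strategy[of "\<lambda>x. (\<exists>b\<in>H. b \<in> supp x) \<and> (\<exists>t\<in>H. t \<notin> supp x)" c id])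
      fix x :: "('v, 'e, 'k) pa"
      assume "(\<exists>b\<in>H. b \<in> supp x) \<and> (\<exists>t\<in>H. t \<notin> supp x)"
      then obtain b' t where b': "b' \<in> H" "b' \<in> supp x" and t: "t \<in> H" "t \<notin> supp x" by blast
      have "(b', t) \<in> R'\<^sup>+" using path[of b' t] HRe[OF b'(1)] t b' unfolding Re_def by blast
      then obtain n where n: "(b', t) \<in> R' ^^ n" by (auto simp: trancl_power)
      have "\<exists>\<rho>\<in>reductions. \<exists>u\<in>H. t \<in> supp (\<rho> x) \<and> u \<notin> supp (\<rho> x) \<and> (u, t) \<in> R'"
        by (rule reach_reduction[of R' H, OF _ _ b' n t(2)])
          (use R HK in \<open>unfold R'_def R_def, blast+\<close>)
      then obtain \<rho> u where r: "\<rho> \<in> reductions" "u \<in> H" "t \<in> supp (\<rho> x)" "u \<notin> supp (\<rho> x)"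
        by blast
      moreover have "\<rho> x \<noteq> x" using t r(3) by metis
      ultimately show "\<exists>\<rho>\<in>reductions. \<rho> x \<noteq> x \<and> (\<exists>b\<in>H. b \<in> supp (\<rho> x)) \<and> (\<exists>t\<in>H. t \<notin> supp (\<rho> x))"
        using t(1) by blast
    next
      show "c \<in> QP" using R[OF d] by blast
    next
      show "(\<exists>b\<in>H. b \<in> supp (id (bas c :: ('v, 'e, 'k) pa))) \<and> (\<exists>t\<in>H. t \<notin> supp (id (bas c :: ('v, 'e, 'k) pa)))"
        using cH dH dc by (intro conjI bexI[of _ c] bexI[of _ d]) simp_all
    qed (rule reductions.intros(1))
  qed
qed

subsection \<open>Uniqueness of normal forms\<close>

text \<open>As long as the element has a reducible term, reducing this term changes the element.\<close>
lemma eventually_irreducible: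
  assumes "p \<in> QP" "\<rho>0 \<in> reductions"
  shows "\<exists>\<rho>\<in>reductions. \<rho> (\<rho>0 (bas p)) \<in> kIrr"
proof (rule ccontr)
  assume n: "\<not> (\<exists>\<rho>\<in>reductions. \<rho> (\<rho>0 (bas p)) \<in> kIrr)"
  show False
  proof (rule no_infinite_strategy[of "\<lambda>x. x \<in> CQ \<and> (\<forall>\<rho>\<in>reductions. \<rho> x \<notin> kIrr)" p \<rho>0])
    fix x :: "('v, 'e, 'k) pa" assume x: "x \<in> CQ \<and> (\<forall>\<rho>\<in>reductions. \<rho> x \<notin> kIrr)"
    then have "id x \<notin> kIrr" using reductions.intros(1) by blast
    then obtain b where b: "b \<in> supp x" "b \<notin> Irr" unfolding kIrr_iff by auto
    then have bQ: "b \<in> QP" using x unfolding CQ_iff by blast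
    have 1: "rightmost_red b \<in> reductions" by (rule rightmost_red_reduction[OF bQ b(2)])
    have "rightmost_red b x \<noteq> x" using lookup_rightmost_red(2)[OF bQ b(2), of x] b(1) by (auto simp: in_keys_iff)
    moreover have "rightmost_red b x \<in> CQ" using reduction_CQ[OF 1] x by blast
    moreover have "\<rho> (rightmost_red b x) \<notin> kIrr" if "\<rho> \<in> reductions" for \<rho>
      using x reductions_comp[OF that 1] by fastforce
    ultimately show "\<exists>\<rho>\<in>reductions. \<rho> x \<noteq> x \<and> \<rho> x \<in> CQ \<and> (\<forall>\<rho>'\<in>reductions. \<rho>' (\<rho> x) \<notin> kIrr)"
      using 1 by blast
  qed (use assms n reduction_CQ[OF assms(2) CQ_bas[OF assms(1)]] in auto)
qed

text \<open>Reductions fix irreducible elements, so the paths can be treated one after the other.\<close>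
lemma simultaneous_reduction:
  assumes "finite K" "K \<subseteq> QP" shows "\<exists>\<rho>\<in>reductions. \<forall>p\<in>K. \<rho> (bas p) \<in> kIrr"
  using assms
proof (induction K)
  case empty
  then show ?case using reductions.intros(1) by blast
next
  case (insert p K)
  then obtain \<rho> where \<rho>: "\<rho> \<in> reductions" "\<forall>p\<in>K. \<rho> (bas p) \<in> kIrr" by auto
  obtain \<rho>' where \<rho>': "\<rho>' \<in> reductions" "\<rho>' (\<rho> (bas p)) \<in> kIrr"
    using eventually_irreducible[of p \<rho>] insert \<rho> by blast
  have "\<forall>t\<in>insert p K. (\<rho>' \<circ> \<rho>) (bas t) \<in> kIrr"
    using \<rho> \<rho>' reduction_kIrr[OF \<rho>'(1)] by simp
  then show ?case using reductions_comp[OF \<rho>'(1) \<rho>(1)] by blast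
qed

text \<open>Independent of the choice, by reduction-uniqueness (\<open>path_nf_eq\<close>).\<close>
definition path_nf :: "('v, 'e) qpath \<Rightarrow> ('v, 'e, 'k) pa" where
  "path_nf p = (SOME y. y \<in> kIrr \<and> (\<exists>\<rho>\<in>reductions. \<rho> (bas p) = y))"

text \<open>The composition \<open>\<sigma>\<pi>\<close> on \<open>\<k>Q\<close>, see \<open>sigma_proj\<close>.\<close>
definition nf :: "('v, 'e, 'k) pa \<Rightarrow> ('v, 'e, 'k) pa" where "nf = lin path_nf"

lemma islin_nf [simp]: "islin nf" by (simp add: nf_def)

lemma path_nf_ex:
  assumes "p \<in> QP" shows "path_nf p \<in> kIrr \<and> (\<exists>\<rho>\<in>reductions. \<rho> (bas p) = path_nf p)"
proof -
  have "\<exists>y. y \<in> kIrr \<and> (\<exists>\<rho>\<in>reductions. \<rho> (bas p) = y)"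
    using eventually_irreducible[OF assms reductions.intros(1)] by auto
  then show ?thesis unfolding path_nf_def by (rule someI_ex)
qed

lemma path_nf_eq: assumes "p \<in> QP" "\<rho> \<in> reductions" "\<rho> (bas p) \<in> kIrr" shows "path_nf p = \<rho> (bas p)"
proof -
  have u: "reduction_unique p" using dia assms(1) unfolding diamond_def by blast
  obtain \<rho>' where "\<rho>' \<in> reductions" "\<rho>' (bas p) = path_nf p" "path_nf p \<in> kIrr" using path_nf_ex[OF assms(1)] by blast
  then show ?thesis using u assms unfolding reduction_unique_def by metis
qed

lemma nf_kIrr: assumes "x \<in> CQ" shows "nf x \<in> kIrr"
  unfolding nf_def by (rule kIrr_lin) (use assms path_nf_ex in \<open>auto simp: CQ_iff\<close>)

lemma nf_id: assumes "x \<in> kIrr" shows "nf x = x"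
proof -
  have "path_nf p = bas p" if "p \<in> Irr" for p
    using path_nf_eq[of p id] that kIrr_bas[OF that] Irr_QP[OF that] reductions.intros(1) by simp
  then have "nf x = lin bas x"
    unfolding nf_def using assms by (intro lin_cong) (auto simp: kIrr_iff)
  then show ?thesis by simp
qed

lemma nf_diff_I: assumes "x \<in> CQ" shows "x - nf x \<in> I"
proof -
  have "bas p - path_nf p \<in> I" if p: "p \<in> QP" for p
  proof -
    obtain \<rho> where \<rho>: "\<rho> \<in> reductions" "\<rho> (bas p) = path_nf p" using path_nf_ex[OF p] by blast
    show ?thesis using reduction_diff_I[OF \<rho>(1) CQ_bas[OF p]] \<rho>(2) by simp
  qed
  then have "lin (\<lambda>t. bas t - path_nf t) x \<in> I" by (intro I_lin) (use assms in \<open>auto simp: CQ_iff\<close>)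
  then show ?thesis by (simp add: lin_diff_fun nf_def)
qed

text \<open>Follow the basic reduction at \<open>(q, s, r)\<close> by one that makes all terms of the result irreducible;
  both sides are then values of the same reduction at \<open>p\<close>.\<close>
lemma nf_basic:
  assumes "(q, s, r) \<in> occs S p" "p \<in> QP"
  shows "nf (bas p) = nf (bas q \<odot> \<phi> s \<odot> bas r)"
proof -
  let ?y = "bas q \<odot> \<phi> s \<odot> bas r"
  note d = occs_S_D[OF assms(1)]
  have y: "?y \<in> CQ" by (intro CQ_mult CQ_bas phi_CQ d)
  have b: "basic_reduction q s r \<circ> id \<in> reductions"
    by (rule reductions.intros(2)[OF reductions.intros(1) assms(1)])
  have bp: "(basic_reduction q s r \<circ> id) (bas p) = ?y"
    using d by (simp add: basic_reduction_def)
  obtain \<rho> where \<rho>: "\<rho> \<in> reductions" "\<forall>p\<in>supp ?y. \<rho> (bas p) \<in> kIrr"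
    using simultaneous_reduction[of "supp ?y"] y unfolding CQ_iff by auto
  have 1: "\<rho> ?y = nf ?y"
  proof (rule islin_eqI[OF islin_reduction[OF \<rho>(1)] islin_nf])
    fix t assume "t \<in> supp ?y"
    then show "\<rho> (bas t) = nf (bas t)"
      using path_nf_eq[of t \<rho>] \<rho> y unfolding CQ_iff nf_def by auto
  qed
  have "(\<rho> \<circ> (basic_reduction q s r \<circ> id)) (bas p) = nf ?y" using bp 1 by simp
  moreover have "\<rho> \<circ> (basic_reduction q s r \<circ> id) \<in> reductions" by (rule reductions_comp[OF \<rho>(1) b])
  ultimately have "path_nf p = nf ?y" using path_nf_eq[OF assms(2)] nf_kIrr[OF y] by metis
  then show ?thesis by (simp add: nf_def)
qed

text \<open>The elements that \<open>nf\<close> kills inside every product \<open>q x r\<close> form a two-sided ideal, which contains the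
  generators \<open>s - \<phi> s\<close> of \<open>I\<close>.  The factors \<open>q\<close> and \<open>r\<close> are there to make it an ideal.\<close>
lemma nf_sandwich_I:
  assumes "x \<in> I" "q \<in> QP" "r \<in> QP" shows "nf (bas q \<odot> x \<odot> bas r) = 0"
proof -
  define J where "J = {x \<in> CQ. \<forall>q\<in>QP. \<forall>r\<in>QP. nf (bas q \<odot> x \<odot> bas r) = 0}"
  have Jl: "nf (y \<odot> x \<odot> z) = 0" if "x \<in> J" "y \<in> CQ" "z \<in> CQ" for x y z
  proof -
    have 1: "nf (bas q \<odot> x \<odot> z) = 0" if "q \<in> QP" for q
      by (rule islin_eqI[of "\<lambda>z. nf (bas q \<odot> x \<odot> z)" "\<lambda>z. 0" z])
        (use that \<open>x \<in> J\<close> \<open>z \<in> CQ\<close> in \<open>auto simp: J_def CQ_iff intro!: islin_compose[OF islin_nf pa_mult_islin2]\<close>)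
    show ?thesis
      by (rule islin_eqI[of "\<lambda>y. nf (y \<odot> x \<odot> z)" "\<lambda>z. 0" y])
        (use 1 \<open>y \<in> CQ\<close> in \<open>auto simp: CQ_iff intro!: islin_compose[OF islin_nf] islin_compose[OF pa_mult_islin1 pa_mult_islin1]\<close>)
  qed
  have JI: "y \<odot> x \<odot> z \<in> J" if "x \<in> J" "y \<in> CQ" "z \<in> CQ" for x y z
  proof -
    have "x \<in> CQ" using that by (simp add: J_def)
    then have "y \<odot> x \<odot> z \<in> CQ" using that by (intro CQ_mult)
    moreover have "nf (bas q \<odot> (y \<odot> x \<odot> z) \<odot> bas r) = 0" if "q \<in> QP" "r \<in> QP" for q r
      using Jl[OF \<open>x \<in> J\<close> CQ_mult[OF CQ_bas[OF that(1)] \<open>y \<in> CQ\<close>] CQ_mult[OF \<open>z \<in> CQ\<close> CQ_bas[OF that(2)]]]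
      by (simp add: pa_mult_assoc)
    ultimately show ?thesis by (simp add: J_def)
  qed
  have J0: "0 \<in> J" by (simp add: J_def CQ_zero islin_zero[OF islin_nf])
  have Jadd: "x + y \<in> J" if "x \<in> J" "y \<in> J" for x y
    using that by (auto simp: J_def CQ_add pa_mult_add_left pa_mult_add_right islin_add[OF islin_nf])
  have Jneg: "- x \<in> J" if "x \<in> J" for x
    using JI[OF that CQ_scale[OF eQ_CQ, of "- 1"] eQ_CQ] that
    by (simp add: J_def pa_mult_scale_left[of "- 1", simplified] eQ_left eQ_right CQ_iff keys_minus)
  have "ideal J KQ"
  proof (rule idealI)
    show "ring KQ" by (rule ID.ring_axioms)
    have inv: "a_inv KQ x = - x" if "x \<in> CQ" for x
      by (rule ID.minus_equality) (use that in \<open>simp_all add: CQ_iff keys_minus\<close>)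
    have sub: "J \<subseteq> CQ" by (auto simp: J_def)
    show "subgroup J (add_monoid KQ)"
    proof (rule subgroup.intro)
      show "J \<subseteq> carrier (add_monoid KQ)" using sub by simp
      show "x \<otimes>\<^bsub>add_monoid KQ\<^esub> y \<in> J" if "x \<in> J" "y \<in> J" for x y using Jadd[OF that] by simp
      show "\<one>\<^bsub>add_monoid KQ\<^esub> \<in> J" using J0 by simp
      show "inv\<^bsub>add_monoid KQ\<^esub> x \<in> J" if "x \<in> J" for x
        using inv[of x] Jneg[OF that] sub that by (simp only: a_inv_def[symmetric] subset_iff)
    qed
  next
    fix a x assume a: "a \<in> J" "x \<in> carrier KQ"
    then have "a \<in> CQ" "x \<in> CQ" by (auto simp: J_def)
    then show "x \<otimes>\<^bsub>KQ\<^esub> a \<in> J" "a \<otimes>\<^bsub>KQ\<^esub> x \<in> J"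
      using JI[OF a(1) _ eQ_CQ, of x] JI[OF a(1) eQ_CQ, of x]
      by (simp_all add: eQ_left eQ_right CQ_mult)
  qed
  moreover
  have "bas s - \<phi> s \<in> J" if s: "s \<in> S" for s
  proof -
    have "nf (bas q \<odot> (bas s - \<phi> s) \<odot> bas r) = 0" if qr: "q \<in> QP" "r \<in> QP" for q r
    proof (cases "tgt q = src s \<and> tgt s = src r")
      case True
      then have "(q, s, r) \<in> occs S (pcomp (pcomp q s) r)" using qr s occsI by blast
      moreover have "pcomp (pcomp q s) r \<in> QP" using True qr S_QP[OF s] by (intro pcomp_QP) auto
      ultimately have "nf (bas (pcomp (pcomp q s) r)) = nf (bas q \<odot> \<phi> s \<odot> bas r)" by (rule nf_basic)
      then show ?thesis using True
        by (simp add: pa_mult_diff_left pa_mult_diff_right pa_mult_bas islin_diff[OF islin_nf])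
    next
      case False
      have "bas q \<odot> \<phi> s \<odot> bas r = 0"
      proof -
        have "t \<notin> supp (bas q \<odot> \<phi> s \<odot> (bas r :: ('v, 'e, 'k) pa))" for t
        proof
          assume "t \<in> supp (bas q \<odot> \<phi> s \<odot> (bas r :: ('v, 'e, 'k) pa))"
          then obtain u where "u \<in> supp (\<phi> s)" "tgt q = src u" "tgt u = src r"
            using sandwich_keys by blast
          then show False using phi_keys[OF s] False by auto
        qed
        then have "supp (bas q \<odot> \<phi> s \<odot> (bas r :: ('v, 'e, 'k) pa)) = {}" by blast
        then show ?thesis by simp
      qed
      moreover have "bas q \<odot> bas s \<odot> (bas r :: ('v, 'e, 'k) pa) = 0" using False by (auto simp: pa_mult_bas)
      ultimately show ?thesis by (simp add: pa_mult_diff_left pa_mult_diff_right islin_zero[OF islin_nf])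
    qed
    then show ?thesis using CQ_diff[OF CQ_bas[OF S_QP[OF s]] phi_CQ[OF s]] by (simp add: J_def)
  qed
  then have "{bas s - \<phi> s | s. s \<in> S} \<subseteq> J" by blast
  ultimately have "genideal KQ {bas s - \<phi> s | s. s \<in> S} \<subseteq> J"
    by (rule ID.genideal_minimal)
  then have "x \<in> J" using assms(1) dia unfolding diamond_def by blast
  then show ?thesis using assms by (simp add: J_def)
qed

text \<open>So \<open>\<k>Irr\<close> is a complement of \<open>I\<close>.\<close>
lemma nf_I: assumes "x \<in> I" shows "nf x = 0"
proof -
  have e: "eQ \<odot> x \<odot> eQ = (\<Sum>w\<in>verts Q. \<Sum>v\<in>verts Q. bas (triv v) \<odot> x \<odot> bas (triv w))"
    by (simp add: eQ_def pa_mult_sum_left pa_mult_sum_right)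
  have "nf x = nf (eQ \<odot> x \<odot> eQ)" using I_CQ[OF assms] by (simp add: eQ_left eQ_right)
  also have "\<dots> = (\<Sum>w\<in>verts Q. \<Sum>v\<in>verts Q. nf (bas (triv v) \<odot> x \<odot> bas (triv w)))"
    unfolding e by (simp add: islin_sum[OF islin_nf])
  also have "\<dots> = 0" by (simp add: nf_sandwich_I[OF assms triv_QP triv_QP])
  finally show ?thesis .
qed

lemma nf_cong: "x - y \<in> I \<Longrightarrow> nf x = nf y"
  using nf_I[of "x - y"] by (simp add: islin_diff[OF islin_nf])

lemma nf_unique: "\<lbrakk>y \<in> kIrr; x - y \<in> I\<rbrakk> \<Longrightarrow> nf x = y"
  using nf_cong nf_id by metis

lemma nf_mult_left: assumes "x \<in> CQ" "y \<in> CQ" shows "nf (nf x \<odot> y) = nf (x \<odot> y)"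
  using nf_cong[of "x \<odot> y" "nf x \<odot> y"] I_multr[OF nf_diff_I[OF assms(1)] assms(2)]
  by (simp add: pa_mult_diff_left)

lemma nf_mult_right: assumes "x \<in> CQ" "y \<in> CQ" shows "nf (x \<odot> nf y) = nf (x \<odot> y)"
  using nf_cong[of "x \<odot> y" "x \<odot> nf y"] I_multl[OF nf_diff_I[OF assms(2)] assms(1)]
  by (simp add: pa_mult_diff_right)

lemma nf_nf: "x \<in> CQ \<Longrightarrow> nf (nf x) = nf x"
  by (rule nf_id[OF nf_kIrr])

lemma nf_CQ: "x \<in> CQ \<Longrightarrow> nf x \<in> CQ" by (rule kIrr_CQ[OF nf_kIrr])

lemma nf_r0: assumes "x \<in> CQ" shows "nf (r0 x) = nf x"
proof (rule islin_eqI[of "\<lambda>x. nf (r0 x)" nf x])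
  fix p assume "p \<in> supp x"
  then have p: "p \<in> QP" using assms by (auto simp: CQ_iff)
  show "nf (r0 (bas p)) = nf (bas p)"
  proof (cases "p \<in> Irr")
    case False
    obtain q s r where t: "(q, s, r) \<in> rightmost S p" using rightmost_ex[OF p False] by metis
    show ?thesis using nf_basic[OF rightmost_occs[OF t] p] r0_rightmost[OF t] by simp
  qed (simp add: r0_Irr)
qed (auto intro: islin_compose)

subsection \<open>The quotient algebra\<close>

lemma A_carrier: "a \<in> carrier A \<longleftrightarrow> (\<exists>x\<in>CQ. a = proj x)"
  unfolding A_def FactRing_def A_RCOSETS_def' proj_def by auto

lemma proj_carrier [simp]: "x \<in> CQ \<Longrightarrow> proj x \<in> carrier A"
  by (auto simp: A_carrier)

lemma proj_mult: "x \<in> CQ \<Longrightarrow> y \<in> CQ \<Longrightarrow> proj x \<otimes>\<^bsub>A\<^esub> proj y = proj (x \<odot> y)"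
  using ID.rcoset_mult_add[of x y] by (simp add: A_def FactRing_def proj_def)

lemma proj_add: "x \<in> CQ \<Longrightarrow> y \<in> CQ \<Longrightarrow> proj x \<oplus>\<^bsub>A\<^esub> proj y = proj (x + y)"
  using ID.a_rcos_sum[of x y] by (simp add: A_def FactRing_def proj_def)

lemma ring_A: "ring A"
  unfolding A_def by (rule ID.quotient_is_ring)

lemma A_one: "\<one>\<^bsub>A\<^esub> = proj eQ"
  by (simp add: A_def FactRing_def proj_def eQ_def)

lemma minus_KQ: assumes "x \<in> CQ" "y \<in> CQ" shows "x \<ominus>\<^bsub>KQ\<^esub> y = x - y"
proof -
  have "a_inv KQ y = - y"
    by (rule ID.minus_equality) (use assms in \<open>simp_all add: CQ_iff keys_minus\<close>)
  then show ?thesis by (simp add: a_minus_def)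
qed

lemma proj_eq: assumes "x \<in> CQ" "y \<in> CQ" shows "proj x = proj y \<longleftrightarrow> x - y \<in> I"
  using ID.quotient_eq_iff_same_a_r_cos[OF idl, of x y] assms by (simp add: proj_def minus_KQ)

lemma A_zero: "\<zero>\<^bsub>A\<^esub> = proj 0"
proof -
  have "proj 0 \<oplus>\<^bsub>A\<^esub> proj 0 = proj 0" by (simp add: proj_add CQ_zero)
  then show ?thesis
    using ring.ring_simprules(15)[OF ring_A] ring_A proj_carrier[OF CQ_zero]
    by (metis abelian_group.r_neg1 abelian_group.l_neg ring.is_abelian_group)
qed

lemma proj_nf: "x \<in> CQ \<Longrightarrow> proj (nf x) = proj x"
  using proj_eq[of x "nf x"] nf_diff_I nf_CQ by auto

lemma sigma_proj: assumes "x \<in> CQ" shows "sigma (proj x) = nf x"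
  unfolding sigma_def
proof (rule the_equality)
  show "nf x \<in> kIrr \<and> proj (nf x) = proj x" using assms by (simp add: nf_kIrr proj_nf)
  fix y assume "y \<in> kIrr \<and> proj y = proj x"
  then show "y = nf x" using proj_eq[of x y] assms nf_unique[of y x] kIrr_CQ by metis
qed

lemma sigma_kIrr: "a \<in> carrier A \<Longrightarrow> sigma a \<in> kIrr"
  by (auto simp: A_carrier sigma_proj nf_kIrr)

lemma sigma_CQ: "a \<in> carrier A \<Longrightarrow> sigma a \<in> CQ"
  by (rule kIrr_CQ[OF sigma_kIrr])

lemma proj_sigma [simp]: "a \<in> carrier A \<Longrightarrow> proj (sigma a) = a"
  by (auto simp: A_carrier sigma_proj proj_nf)

lemma sigma_inj: "\<lbrakk>a \<in> carrier A; b \<in> carrier A; sigma a = sigma b\<rbrakk> \<Longrightarrow> a = b"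
  by (metis proj_sigma)

lemma sigma_mult: "\<lbrakk>a \<in> carrier A; b \<in> carrier A\<rbrakk> \<Longrightarrow> sigma (a \<otimes>\<^bsub>A\<^esub> b) = nf (sigma a \<odot> sigma b)"
  by (metis CQ_mult proj_mult proj_sigma sigma_CQ sigma_proj)

lemma sigma_add: "\<lbrakk>a \<in> carrier A; b \<in> carrier A\<rbrakk> \<Longrightarrow> sigma (a \<oplus>\<^bsub>A\<^esub> b) = sigma a + sigma b"
  by (metis CQ_add kIrr_add nf_id proj_add proj_sigma sigma_CQ sigma_kIrr sigma_proj)

lemma sigma_zero [simp]: "sigma \<zero>\<^bsub>A\<^esub> = 0"
  by (simp add: A_zero sigma_proj CQ_zero islin_zero[OF islin_nf])

lemma eQ_kIrr: "eQ \<in> kIrr" unfolding eQ_def by (rule kIrr_sum) (simp add: triv_Irr kIrr_bas)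

lemma sigma_one [simp]: "sigma \<one>\<^bsub>A\<^esub> = eQ"
  by (simp add: A_one sigma_proj eQ_CQ nf_id eQ_kIrr)

lemma Ascale_proj: "x \<in> CQ \<Longrightarrow> Ascale c (proj x) = proj (scale c x)"
  using proj_mult[OF CQ_scale[OF eQ_CQ] , of x c]
  by (simp add: Ascale_def eQ_def[symmetric] pa_mult_scale_left eQ_left)

lemma Ascale_carrier [simp]: "a \<in> carrier A \<Longrightarrow> Ascale c a \<in> carrier A"
  by (auto simp: A_carrier Ascale_proj intro: CQ_scale)

lemma sigma_Ascale: "a \<in> carrier A \<Longrightarrow> sigma (Ascale c a) = scale c (sigma a)"
  by (auto simp: A_carrier Ascale_proj sigma_proj CQ_scale islin_scale[OF islin_nf])

lemma finsum_A:
  assumes "\<And>j. j \<in> J \<Longrightarrow> f j \<in> carrier A"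
  shows "finsum A f J \<in> carrier A \<and> sigma (finsum A f J) = (\<Sum>j\<in>J. sigma (f j))"
  using assms
proof (induction J rule: infinite_finite_induct)
  case (infinite J)
  interpret RA: ring A by (rule ring_A)
  show ?case using infinite by (simp add: RA.finsum_infinite)
next
  case empty
  interpret RA: ring A by (rule ring_A)
  show ?case by simp
next
  case (insert j J)
  interpret RA: ring A by (rule ring_A)
  show ?case using insert by (simp add: RA.finsum_insert Pi_def sigma_add)
qed

lemma Alin_A:
  assumes "\<And>t. t \<in> supp x \<Longrightarrow> g t \<in> carrier A"
  shows "Alin g x \<in> carrier A" "sigma (Alin g x) = lin (\<lambda>t. sigma (g t)) x"
proof -
  have "Ascale (Poly_Mapping.lookup x t) (g t) \<in> carrier A" if "t \<in> supp x" for t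
    using assms that by simp
  note f = finsum_A[where J = "supp x" and f = "\<lambda>t. Ascale (Poly_Mapping.lookup x t) (g t)", OF this]
  show "Alin g x \<in> carrier A" unfolding Alin_def using f by blast
  have "sigma (Alin g x) = (\<Sum>t\<in>supp x. sigma (Ascale (Poly_Mapping.lookup x t) (g t)))"
    unfolding Alin_def using f by blast
  also have "\<dots> = lin (\<lambda>t. sigma (g t)) x"
    unfolding lin_def by (rule sum.cong) (simp_all add: sigma_Ascale assms)
  finally show "sigma (Alin g x) = lin (\<lambda>t. sigma (g t)) x" .
qed

lemma A_mult_closed [simp]: "\<lbrakk>a \<in> carrier A; b \<in> carrier A\<rbrakk> \<Longrightarrow> a \<otimes>\<^bsub>A\<^esub> b \<in> carrier A"
  and A_add_closed [simp]: "\<lbrakk>a \<in> carrier A; b \<in> carrier A\<rbrakk> \<Longrightarrow> a \<oplus>\<^bsub>A\<^esub> b \<in> carrier A"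
  and A_one_closed [simp]: "\<one>\<^bsub>A\<^esub> \<in> carrier A"
  and A_zero_closed [simp]: "\<zero>\<^bsub>A\<^esub> \<in> carrier A"
proof -
  interpret RA: ring A by (rule ring_A)
  show "\<lbrakk>a \<in> carrier A; b \<in> carrier A\<rbrakk> \<Longrightarrow> a \<otimes>\<^bsub>A\<^esub> b \<in> carrier A"
    "\<lbrakk>a \<in> carrier A; b \<in> carrier A\<rbrakk> \<Longrightarrow> a \<oplus>\<^bsub>A\<^esub> b \<in> carrier A"
    "\<one>\<^bsub>A\<^esub> \<in> carrier A" "\<zero>\<^bsub>A\<^esub> \<in> carrier A" by auto
qed

end

section \<open>The polarized reduction\<close>

definition evlim :: "(nat \<Rightarrow> 'a) \<Rightarrow> 'a" where
  "evlim a = (THE y. \<exists>n0. \<forall>n\<ge>n0. a n = y)"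

lemma evlimI: assumes "\<And>n. n \<ge> n0 \<Longrightarrow> a n = y" shows "evlim a = y"
  unfolding evlim_def
proof (rule the_equality)
  show "\<exists>n0. \<forall>n\<ge>n0. a n = y" using assms by blast
  fix z assume "\<exists>n0. \<forall>n\<ge>n0. a n = z"
  then obtain n1 where "\<forall>n\<ge>n1. a n = z" by blast
  then show "z = y" using assms[of "max n0 n1"] by simp
qed

lemma pa_mult_eq_0:
  assumes "\<And>u. u \<in> supp x \<Longrightarrow> src u \<noteq> tgt y" shows "bas y \<odot> x = 0"
proof -
  have "bas y \<odot> x = lin (\<lambda>u. bas y \<odot> bas u) x" by (rule islin_expand) simp
  also have "\<dots> = lin (\<lambda>u. 0) x"
    by (rule lin_cong) (use assms in \<open>simp add: pa_mult_bas, metis\<close>)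
  finally show ?thesis by simp
qed

lemma pa_mult_eq_0':
  assumes "\<And>u. u \<in> supp x \<Longrightarrow> tgt u \<noteq> src y" shows "x \<odot> bas y = 0"
proof -
  have "x \<odot> bas y = lin (\<lambda>u. bas u \<odot> bas y) x" by (rule islin_expand[of "\<lambda>x. x \<odot> bas y"]) simp
  also have "\<dots> = lin (\<lambda>u. 0) x" by (rule lin_cong) (use assms in \<open>simp add: pa_mult_bas\<close>)
  finally show ?thesis by simp
qed

context confluent_system begin

text \<open>The lifts to \<open>\<k>Irr\<close> of the elements of \<open>Hom(\<k>S, A)\<close>, see \<open>HomSA_adm\<close>.\<close>
definition adm :: "(('v, 'e) qpath \<Rightarrow> ('v, 'e, 'k) pa) \<Rightarrow> bool" where
  "adm f \<longleftrightarrow> (\<forall>s\<in>S. supp (f s) \<subseteq> irr_par s)"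

text \<open>The coefficient of \<open>z\<close> in one step of \<open>red\<close>, for the deformation \<open>f\<close>.\<close>
definition r1 :: "(('v, 'e) qpath \<Rightarrow> ('v, 'e, 'k) pa) \<Rightarrow> ('v, 'e, 'k) pa \<Rightarrow> ('v, 'e, 'k) pa" where
  "r1 f = lin (\<lambda>p. if p \<in> Irr then 0 else case rm p of (q, s, r) \<Rightarrow> bas q \<odot> f s \<odot> bas r)"

text \<open>The part of the \<open>n\<close>-fold iterate of \<open>r0 + z r1\<close> in which the entries of \<open>fs\<close> are used in this order,
  each once.\<close>
primrec polred_iter :: "nat \<Rightarrow> (('v, 'e) qpath \<Rightarrow> ('v, 'e, 'k) pa) list \<Rightarrow> ('v, 'e, 'k) pa \<Rightarrow> ('v, 'e, 'k) pa" where
  "polred_iter 0 fs x = (if fs = [] then x else 0)"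
| "polred_iter (Suc n) fs x = polred_iter n fs (r0 x) + (case fs of [] \<Rightarrow> 0 | f # fs' \<Rightarrow> polred_iter n fs' (r1 f x))"

text \<open>The operator \<open>R(f\<^sub>1, \<dots>, f\<^sub>k)\<close>: rightmost reduction until no reducible path is left, using the entries of
  \<open>fs\<close> in this order, each once, and \<open>\<phi>\<close> otherwise.\<close>
definition polred :: "(('v, 'e) qpath \<Rightarrow> ('v, 'e, 'k) pa) list \<Rightarrow> ('v, 'e, 'k) pa \<Rightarrow> ('v, 'e, 'k) pa" where
  "polred fs = lin (\<lambda>p. evlim (\<lambda>n. polred_iter n fs (bas p)))"

lemma islin_r1 [simp]: "islin (r1 f)" by (simp add: r1_def)
lemma islin_polred [simp]: "islin (polred fs)" by (simp add: polred_def)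

lemma r1_Irr: "p \<in> Irr \<Longrightarrow> r1 f (bas p) = 0" by (simp add: r1_def)

lemma r1_rightmost: "(q, s, r) \<in> rightmost S p \<Longrightarrow> r1 f (bas p) = bas q \<odot> f s \<odot> bas r"
  using rightmostD(8)[of q s r p] rm_eq[of "(q, s, r)" p] by (simp add: r1_def)

lemma adm_CQ: "adm f \<Longrightarrow> s \<in> S \<Longrightarrow> f s \<in> CQ"
  unfolding adm_def CQ_iff using Irr_QP by blast
lemma adm_kIrr: "adm f \<Longrightarrow> s \<in> S \<Longrightarrow> f s \<in> kIrr"
  unfolding adm_def kIrr_iff by blast

definition par :: "('v, 'e) qpath \<Rightarrow> ('v, 'e) qpath set" where
  "par p = {u \<in> QP. src u = src p \<and> tgt u = tgt p}"

lemma sandwich_par: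
  assumes "(q, s, r) \<in> rightmost S p" "supp x \<subseteq> irr_par s"
  shows "supp (bas q \<odot> x \<odot> (bas r :: ('v, 'e, 'k) pa)) \<subseteq> par p"
proof
  note d = rightmostD[OF assms(1)]
  fix t assume "t \<in> supp (bas q \<odot> x \<odot> (bas r :: ('v, 'e, 'k) pa))"
  then obtain u where u: "u \<in> supp x" "tgt q = src u" "tgt u = src r" "t = pcomp (pcomp q u) r"
    using sandwich_keys by blast
  then have "u \<in> QP" using assms(2) Irr_QP by blast
  then have "t \<in> QP" unfolding u(4) using u(2,3) d by (intro pcomp_QP) auto
  then show "t \<in> par p" using u d by (simp add: par_def)
qed

lemma r0_par: assumes "p \<in> QP" shows "supp (r0 (bas p)) \<subseteq> par p"
proof (cases "p \<in> Irr")
  case False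
  obtain q s r where t: "(q, s, r) \<in> rightmost S p" using rightmost_ex[OF assms False] by metis
  show ?thesis using sandwich_par[OF t phi_keys[OF rightmostD(2)[OF t]]] r0_rightmost[OF t] by simp
qed (use assms in \<open>simp add: r0_Irr par_def\<close>)

lemma r1_par: assumes "p \<in> QP" "adm f" shows "supp (r1 f (bas p)) \<subseteq> par p"
proof (cases "p \<in> Irr")
  case False
  obtain q s r where t: "(q, s, r) \<in> rightmost S p" using rightmost_ex[OF assms(1) False] by metis
  show ?thesis
    using sandwich_par[OF t, of "f s"] rightmostD(2)[OF t] assms(2) r1_rightmost[OF t] by (simp add: adm_def)
qed (simp add: r1_Irr)

lemma r1_CQ: assumes "x \<in> CQ" "adm f" shows "r1 f x \<in> CQ"
proof -
  have "r1 f x = lin (\<lambda>p. r1 f (bas p)) x" by (rule islin_expand) simp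
  moreover have "\<dots> \<in> CQ"
    by (rule CQ_lin) (use r1_par[OF _ assms(2)] assms(1) in \<open>unfold CQ_iff par_def, blast\<close>)
  ultimately show ?thesis by simp
qed

lemma islin_polred_iter [simp]: "islin (polred_iter n fs)"
proof (induction n arbitrary: fs)
  case 0
  then show ?case by (cases "fs = []") simp_all
next
  case (Suc n)
  show ?case
  proof (cases fs)
    case (Cons f fs')
    show ?thesis
      using islin_plus[OF islin_compose[OF Suc[of fs] islin_r0] islin_compose[OF Suc[of fs'] islin_r1[of f]]]
      by (simp add: Cons)
  qed (use islin_compose[OF Suc[of fs] islin_r0] in simp)
qed

text \<open>The definition splits off the first step; here the last step is split off.\<close>
lemma polred_iter_snoc: "polred_iter (Suc n) (gs @ [g]) x = r0 (polred_iter n (gs @ [g]) x) + r1 g (polred_iter n gs x)"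
  and polred_iter_nil: "polred_iter (Suc n) [] x = r0 (polred_iter n [] x)"
proof (induction n arbitrary: gs x)
  case 0
  { case 1 show ?case by (cases gs) (auto simp: islin_zero) next case 2 show ?case by simp }
next
  case (Suc n)
  { case 1
    show ?case
    proof (cases gs)
      case Nil
      then show ?thesis using Suc(1)[of "[]" "r0 x"] Suc(2)[of "r1 g x"]
        by (simp add: islin_add algebra_simps del: polred_iter.simps(2)) (simp add: islin_add)
    next
      case (Cons f gs')
      then show ?thesis using Suc(1)[of gs "r0 x"] Suc(1)[of gs' "r1 f x"]
        by (simp add: islin_add)
    qed
  next
    case 2
    show ?case using Suc(2) by simp
  }
qed

definition polred_ok :: "(('v, 'e) qpath \<Rightarrow> ('v, 'e, 'k) pa) list \<Rightarrow> ('v, 'e) qpath \<Rightarrow> bool" where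
  "polred_ok fs p \<longleftrightarrow> (\<exists>n0. \<forall>n\<ge>n0. polred_iter n fs (bas p) = polred fs (bas p))
     \<and> supp (polred fs (bas p)) \<subseteq> irr_par p"

lemma polred_iter_limit:
  assumes "\<And>t. t \<in> supp x \<Longrightarrow> polred_ok fs t"
  shows "\<exists>n0. \<forall>n\<ge>n0. polred_iter n fs x = polred fs x"
proof -
  have "\<forall>t\<in>supp x. \<exists>n0. \<forall>n\<ge>n0. polred_iter n fs (bas t) = polred fs (bas t)"
    using assms unfolding polred_ok_def by blast
  then obtain N where N: "\<And>t n. t \<in> supp x \<Longrightarrow> n \<ge> N t \<Longrightarrow> polred_iter n fs (bas t) = polred fs (bas t)"
    by metis
  have "polred_iter n fs x = polred fs x" if n: "n \<ge> Max (insert 0 (N ` supp x))" for n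
  proof (rule islin_eqI[OF islin_polred_iter islin_polred])
    fix t assume "t \<in> supp x"
    then have "N t \<le> n" using n by simp
    then show "polred_iter n fs (bas t) = polred fs (bas t)" using N \<open>t \<in> _\<close> by blast
  qed
  then show ?thesis by blast
qed

lemma polred_keys:
  assumes "\<And>t. t \<in> supp x \<Longrightarrow> polred_ok fs t" "supp x \<subseteq> par p"
  shows "supp (polred fs x) \<subseteq> irr_par p"
proof -
  have "polred fs x = lin (\<lambda>t. polred fs (bas t)) x" by (rule islin_expand) simp
  moreover have "supp (lin (\<lambda>t. polred fs (bas t)) x) \<subseteq> irr_par p"
  proof (rule keys_lin_subset)
    fix t assume t: "t \<in> supp x"
    then have "src t = src p" "tgt t = tgt p" using assms(2) unfolding par_def by blast+
    then show "supp (polred fs (bas t)) \<subseteq> irr_par p"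
      using assms(1)[OF t] unfolding polred_ok_def by simp
  qed
  ultimately show ?thesis by simp
qed

lemma polred_okI:
  assumes "\<And>n. n \<ge> n0 \<Longrightarrow> polred_iter n fs (bas p) = y"
    "supp y \<subseteq> irr_par p"
  shows "polred_ok fs p \<and> polred fs (bas p) = y"
proof -
  have "polred fs (bas p) = y" using evlimI[of n0 "\<lambda>n. polred_iter n fs (bas p)" y] assms(1) by (simp add: polred_def)
  then show ?thesis using assms unfolding polred_ok_def by blast
qed

lemma polred_Irr_aux:
  assumes "p \<in> Irr" shows "polred_ok fs p \<and> polred fs (bas p) = (if fs = [] then bas p else 0)"
proof (rule polred_okI[of 0])
  fix n
  show "polred_iter n fs (bas p) = (if fs = [] then bas p else 0)"
  proof (induction n)
    case (Suc n)
    then show ?case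
      by (cases fs) (auto simp: r0_Irr[OF assms] r1_Irr[OF assms] islin_zero[OF islin_polred_iter])
  qed simp
qed (use assms in simp)

text \<open>Induction on the number of entries still to be used, and for a fixed list along the rightmost reduction.\<close>
lemma polred_all:
  assumes "\<forall>f\<in>set fs. adm f" "p \<in> QP"
  shows "polred_ok fs p \<and> polred fs (bas p) = polred fs (r0 (bas p)) + (case fs of [] \<Rightarrow> 0 | f # fs' \<Rightarrow> polred fs' (r1 f (bas p)))"
  using assms
proof (induction fs arbitrary: p rule: length_induct)
  case (1 fs)
  show ?case using 1(3)
  proof (induction p rule: wf_induct_rule[OF wf_rrel])
    case (1 p)
    show ?case
    proof (cases "p \<in> Irr")
      case True
      then show ?thesis using polred_Irr_aux[of p fs]
        by (auto simp: r0_Irr r1_Irr islin_zero[OF islin_polred] split: list.split)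
    next
      case False
      have ok0: "polred_ok fs t" if "t \<in> supp (r0 (bas p))" for t
        using 1(1)[of t] that False 1(2) r0_par[OF 1(2)] unfolding rrel_def par_def by blast
      then obtain n0 where n0: "\<And>n. n \<ge> n0 \<Longrightarrow> polred_iter n fs (r0 (bas p)) = polred fs (r0 (bas p))"
        using polred_iter_limit[of "r0 (bas p)" fs] by blast
      note k0 = polred_keys[OF ok0 r0_par[OF 1(2)]]
      define z where "z = (case fs of [] \<Rightarrow> 0 | f # fs' \<Rightarrow> polred fs' (r1 f (bas p)))"
      have z: "(\<exists>n1. \<forall>n\<ge>n1. (case fs of [] \<Rightarrow> 0 | f # fs' \<Rightarrow> polred_iter n fs' (r1 f (bas p))) = z)
          \<and> supp z \<subseteq> irr_par p"
      proof (cases fs)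
        case (Cons f fs')
        have f: "adm f" "\<forall>f\<in>set fs'. adm f" using \<open>\<forall>f\<in>set fs. adm f\<close> Cons by auto
        have ok1: "polred_ok fs' t" if "t \<in> supp (r1 f (bas p))" for t
          using \<open>\<forall>ys. length ys < length fs \<longrightarrow> _ ys\<close>[rule_format, of fs' t] Cons f that
            r1_par[OF 1(2) f(1)] unfolding par_def by auto
        show ?thesis using polred_iter_limit[OF ok1] polred_keys[OF ok1 r1_par[OF 1(2) f(1)]] by (simp add: z_def Cons)
      qed (simp add: z_def)
      then obtain n1 where n1: "\<And>n. n \<ge> n1 \<Longrightarrow> (case fs of [] \<Rightarrow> 0 | f # fs' \<Rightarrow> polred_iter n fs' (r1 f (bas p))) = z"
        by blast
      show ?thesis
        unfolding z_def[symmetric]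
      proof (rule polred_okI[of "Suc (max n0 n1)"])
        fix n assume "Suc (max n0 n1) \<le> n"
        then obtain m where "n = Suc m" "n0 \<le> m" "n1 \<le> m" by (cases n) auto
        then show "polred_iter n fs (bas p) = polred fs (r0 (bas p)) + z" using n0[of m] n1[of m] by simp
      qed (use k0 z Poly_Mapping.keys_add[of "polred fs (r0 (bas p))" z] in blast)
    qed
  qed
qed

abbreviation adms :: "(('v, 'e) qpath \<Rightarrow> ('v, 'e, 'k) pa) list \<Rightarrow> bool" where
  "adms fs \<equiv> \<forall>f\<in>set fs. adm f"

lemma polred_iter_eventually_polred: "\<lbrakk>adms fs; x \<in> CQ\<rbrakk> \<Longrightarrow> \<exists>n0. \<forall>n\<ge>n0. polred_iter n fs x = polred fs x"
  using polred_iter_limit[of x fs] polred_all[of fs] unfolding CQ_iff by blast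

lemma polred_parallel: "\<lbrakk>adms fs; p \<in> QP\<rbrakk> \<Longrightarrow>
    supp (polred fs (bas p)) \<subseteq> irr_par p"
  using polred_all[of fs p] unfolding polred_ok_def by blast

lemma polred_kIrr: assumes "adms fs" "x \<in> CQ" shows "polred fs x \<in> kIrr"
proof -
  have "polred fs x = lin (\<lambda>t. polred fs (bas t)) x" by (rule islin_expand) simp
  moreover have "\<dots> \<in> kIrr"
    by (rule kIrr_lin) (use polred_parallel[OF assms(1)] assms(2) in \<open>unfold CQ_iff kIrr_iff, blast\<close>)
  ultimately show ?thesis by simp
qed

lemma polred_CQ: "\<lbrakk>adms fs; x \<in> CQ\<rbrakk> \<Longrightarrow> polred fs x \<in> CQ"
  by (rule kIrr_CQ[OF polred_kIrr])

lemma polred_on_kIrr: assumes "x \<in> kIrr" shows "polred fs x = (if fs = [] then x else 0)"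
proof (rule islin_eqI[of "polred fs" "\<lambda>x. if fs = [] then x else 0"])
  show "islin (\<lambda>x. if fs = [] then x else 0)" by (cases "fs = []") simp_all
qed (use assms polred_Irr_aux in \<open>auto simp: kIrr_iff\<close>)

lemma polred_unfold: assumes "adms (f # fs)" "x \<in> CQ"
  shows "polred (f # fs) x = polred (f # fs) (r0 x) + polred fs (r1 f x)"
proof (rule islin_eqI[of "polred (f # fs)" "\<lambda>x. polred (f # fs) (r0 x) + polred fs (r1 f x)"])
  show "islin (\<lambda>x. polred (f # fs) (r0 x) + polred fs (r1 f x))"
    by (intro islin_plus islin_compose[OF islin_polred islin_r0] islin_compose[OF islin_polred islin_r1])
  fix p assume "p \<in> supp x"
  then have "p \<in> QP" using assms(2) unfolding CQ_iff by blast
  from conjunct2[OF polred_all[OF assms(1) this]]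
  show "polred (f # fs) (bas p) = polred (f # fs) (r0 (bas p)) + polred fs (r1 f (bas p))" by simp
qed simp

lemma polred_step:
  assumes "adms (f # fs)" "(q, s, r) \<in> rightmost S p"
  shows "polred (f # fs) (bas p) = polred (f # fs) (bas q \<odot> \<phi> s \<odot> bas r) + polred fs (bas q \<odot> f s \<odot> bas r)"
  using polred_unfold[OF assms(1) CQ_bas[OF rightmostD(7)[OF assms(2)]]]
  by (simp add: r0_rightmost[OF assms(2)] r1_rightmost[OF assms(2)])

lemma polred_nil: assumes "x \<in> CQ" shows "polred [] x = nf x"
proof -
  have polred_iter: "polred_iter n [] x \<in> CQ \<and> nf (polred_iter n [] x) = nf x" for n
  proof (induction n)
    case (Suc n)
    then show ?case unfolding polred_iter_nil by (simp add: r0_CQ nf_r0)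
  qed (use assms in simp)
  obtain n where "polred_iter n [] x = polred [] x" using polred_iter_eventually_polred[of "[]" x] assms by auto
  then have "nf (polred [] x) = nf x" using polred_iter[of n] by simp
  then show ?thesis using nf_id[OF polred_kIrr[of "[]" x]] assms by simp
qed

text \<open>Reducing \<open>y x\<close> means reducing \<open>x\<close> completely, consuming an initial segment of the list, and
  then reducing \<open>y\<close> times the result.\<close>
lemma polred_mult:
  assumes "adms fs" "y \<in> QP" "x \<in> CQ"
  shows "polred fs (bas y \<odot> x) = (\<Sum>i\<le>length fs. polred (drop i fs) (bas y \<odot> polred (take i fs) x))"
  using assms(1,3)
proof (induction fs arbitrary: x)
  case Nil
  then show ?case
    using polred_nil[OF CQ_mult[OF CQ_bas[OF assms(2)]]] nf_mult_right[OF CQ_bas[OF assms(2)]]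
    by (simp add: polred_nil nf_CQ)
next
  case (Cons f fs)
  let ?g = "f # fs"
  let ?rhs = "\<lambda>x. \<Sum>i\<le>length ?g. polred (drop i ?g) (bas y \<odot> polred (take i ?g) x)"
  have linr: "islin ?rhs"
    by (intro islin_sum_fun islin_compose[OF islin_polred] islin_compose[OF pa_mult_islin2] islin_polred)
  have linl: "islin (\<lambda>x. polred ?g (bas y \<odot> x))"
    by (rule islin_compose[OF islin_polred pa_mult_islin2])
  have "polred ?g (bas y \<odot> bas p) = ?rhs (bas p)" if "p \<in> QP" for p
    using that
  proof (induction p rule: wf_induct_rule[OF wf_rrel])
    case (1 p)
    show ?case
    proof (cases "tgt y = src p")
      case False
      have 0: "bas y \<odot> polred (take i ?g) (bas p) = 0" for i
      proof -
        have "adms (take i ?g)" using Cons(2) set_take_subset by fastforce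
        then have "supp (polred (take i ?g) (bas p)) \<subseteq> {u. src u = src p}"
          using polred_parallel 1(2) by blast
        then have "src u \<noteq> tgt y" if "u \<in> supp (polred (take i ?g) (bas p))" for u
          using that False by auto
        then show ?thesis by (rule pa_mult_eq_0)
      qed
      show ?thesis using False by (simp only: 0 pa_mult_bas islin_zero[OF islin_polred] if_False sum.neutral_const)
    next
      case True
      show ?thesis
      proof (cases "p \<in> Irr")
        case True
        have "?rhs (bas p) = (\<Sum>i\<le>length ?g. if i = 0 then polred ?g (bas y \<odot> bas p) else 0)"
          by (rule sum.cong) (auto simp: polred_on_kIrr[OF kIrr_bas[OF True]] islin_zero[OF islin_polred])
        then show ?thesis by simp
      next
        case False
        obtain q s r where t: "(q, s, r) \<in> rightmost S p" using rightmost_ex[OF 1(2) False] by metis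
        note d = rightmostD[OF t]
        have t': "(pcomp y q, s, r) \<in> rightmost S (pcomp y p)"
          by (rule rightmost_prefix[OF t assms(2) True])
        define x0 where "x0 = bas q \<odot> \<phi> s \<odot> bas r"
        define x1 where "x1 = bas q \<odot> f s \<odot> bas r"
        have af: "adm f" "adms fs" using Cons(2) by auto
        have xCQ: "x0 \<in> CQ" "x1 \<in> CQ" unfolding x0_def x1_def
          by (intro CQ_mult CQ_bas d phi_CQ adm_CQ[OF af(1)])+
        have yq: "bas (pcomp y q) = bas y \<odot> (bas q :: ('v, 'e, 'k) pa)"
          using True d by (simp add: pa_mult_bas)
        have yp: "bas (pcomp y p) = bas y \<odot> (bas p :: ('v, 'e, 'k) pa)"
          using True by (simp add: pa_mult_bas)
        have "polred ?g (bas y \<odot> bas p) = polred ?g (bas y \<odot> x0) + polred fs (bas y \<odot> x1)"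
          using polred_step[OF Cons(2) t', unfolded yq yp] unfolding x0_def x1_def by (simp only: pa_mult_assoc)
        also have "polred ?g (bas y \<odot> x0) = ?rhs x0"
        proof (rule islin_eqI[OF linl linr])
          fix u assume "u \<in> supp x0"
          then have "(u, p) \<in> rrel" using False 1(2) r0_rightmost[OF t] by (simp add: rrel_def x0_def)
          then show "polred ?g (bas y \<odot> bas u) = ?rhs (bas u)" using 1(1) rrel_QP by blast
        qed
        also have "polred fs (bas y \<odot> x1) = (\<Sum>i\<le>length fs. polred (drop i fs) (bas y \<odot> polred (take i fs) x1))"
          using Cons af xCQ by blast
        also have "?rhs x0 + \<dots> = ?rhs (bas p)"
        proof -
          have "polred [] x0 = polred [] (bas p)"
            using nf_basic[OF rightmost_occs[OF t] 1(2)] xCQ CQ_bas[OF 1(2)]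
            by (simp add: polred_nil x0_def)
          moreover have "polred (f # take i fs) x0 + polred (take i fs) x1 = polred (f # take i fs) (bas p)" for i
          proof -
            have "adms (f # take i fs)" using af set_take_subset[of i fs] by auto
            then show ?thesis using polred_step[OF _ t] by (simp add: x0_def x1_def)
          qed
          ultimately show ?thesis
            by (simp add: sum.atMost_Suc_shift sum.distrib[symmetric] islin_add[OF islin_polred, symmetric]
                pa_mult_add_right[symmetric] add.assoc del: sum.atMost_Suc)
        qed
        finally show ?thesis .
      qed
    qed
  qed
  then show ?case using islin_eqI[OF linl linr, of x] Cons(3) unfolding CQ_iff by blast
qed

section \<open>Arrow splittings and the homotopy\<close>

definition asum :: "(('v, 'e) qpath \<Rightarrow> ('v, 'e) qpath \<Rightarrow> ('v, 'e) qpath \<Rightarrow> 'm::comm_monoid_add) \<Rightarrow> ('v, 'e) qpath \<Rightarrow> 'm" where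
  "asum g p = (\<Sum>(q, y, r)\<in>occs arw p. g q y r)"

lemma occs_iff: "(q, w, r) \<in> occs W p \<longleftrightarrow> q \<in> QP \<and> w \<in> W \<and> r \<in> QP \<and> tgt q = src w \<and> tgt w = src r
    \<and> p = pcomp (pcomp q w) r"
  by (simp add: occs_def)

lemma arw_sub: "arw \<subseteq> QP" using arw_QP by blast

lemma asum_cong:
  assumes "\<And>q y r. \<lbrakk>q \<in> QP; y \<in> arw; r \<in> QP; tgt q = src y; tgt y = src r; p = pcomp (pcomp q y) r\<rbrakk> \<Longrightarrow> g q y r = g' q y r"
  shows "asum g p = asum g' p"
  unfolding asum_def by (rule sum.cong[OF refl]) (clarsimp simp only: occs_iff assms prod.case split: prod.splits)

lemma asum_triv [simp]: "asum g (triv v) = 0"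
proof -
  have "t \<notin> occs arw (triv v)" for t
  proof
    assume "t \<in> occs arw (triv v)"
    then obtain q y r where y: "y \<in> arw" and e: "triv v = pcomp (pcomp q y) r" by (cases t) (auto simp: occs_iff)
    show False using arg_cong[OF e, of "\<lambda>x. plen x"] arw_plen[OF y] by simp
  qed
  then have "occs arw (triv v) = {}" by blast
  then show ?thesis by (simp add: asum_def)
qed

lemma asum_arw: assumes "y \<in> arw" shows "asum g y = g (triv (src y)) y (triv (tgt y))"
proof -
  have y: "y \<in> QP" "plen y = 1" using assms by (auto simp: arw_iff)
  have "t \<in> occs arw y \<longleftrightarrow> t = (triv (src y), y, triv (tgt y))" for t
  proof
    assume "t \<in> occs arw y"
    then obtain q z r where t: "t = (q, z, r)" "(q, z, r) \<in> occs arw y" by (cases t) simp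
    then have o: "q \<in> QP" "z \<in> arw" "r \<in> QP" "tgt q = src z" "tgt z = src r" "y = pcomp (pcomp q z) r"
      by (simp_all add: occs_iff)
    have "plen q + plen z + plen r = 1" using arg_cong[OF o(6), of "\<lambda>x. plen x"] y by simp
    then have "plen q = 0" "plen r = 0" using arw_plen[OF o(2)] by auto
    then have q: "q = triv (src q)" "tgt q = src q" and r: "r = triv (src r)" "tgt r = src r"
      using plen0[OF o(1)] plen0[OF o(3)] by auto
    have "q = triv (src z)" "r = triv (tgt z)" using q r o by metis+
    then show "t = (triv (src y), y, triv (tgt y))" using o(6) t by simp
  next
    assume "t = (triv (src y), y, triv (tgt y))"
    then show "t \<in> occs arw y" using assms QP_verts[OF y(1)] by (simp add: occs_iff triv_QP)
  qed
  then have "occs arw y = {(triv (src y), y, triv (tgt y))}" by blast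
  then show ?thesis by (simp add: asum_def)
qed

lemma asum_pcomp:
  assumes "p \<in> QP" "p' \<in> QP" "tgt p = src p'"
  shows "asum g (pcomp p p') = asum (\<lambda>q y r. g q y (pcomp r p')) p + asum (\<lambda>q. g (pcomp p q)) p'"
proof -
  let ?f1 = "\<lambda>(q, y, r). (q, y, pcomp r p')" and ?f2 = "\<lambda>(q, y, r). (pcomp p q, y, r)"
  have U: "occs arw (pcomp p p') = ?f1 ` occs arw p \<union> ?f2 ` occs arw p'"
  proof (intro equalityI subsetI)
    fix t assume t: "t \<in> occs arw (pcomp p p')"
    obtain q y r where tq: "t = (q, y, r)" by (cases t)
    then have o: "q \<in> QP" "y \<in> arw" "r \<in> QP" "tgt q = src y" "tgt y = src r" "pcomp p p' = pcomp (pcomp q y) r"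
      using t by (simp_all add: occs_iff)
    have yQ: "y \<in> QP" "plen y = 1" using o(2) by (auto simp: arw_iff)
    show "t \<in> ?f1 ` occs arw p \<union> ?f2 ` occs arw p'"
    proof (cases "plen q < plen p")
      case True
      obtain m where m: "m \<in> QP" "p = pcomp (pcomp q y) m" "r = pcomp m p'" "tgt (pcomp q y) = src m" "tgt m = src p'"
      proof (rule pcomp_levi[of "pcomp q y" r p p'])
        show "pcomp q y \<in> QP" by (rule pcomp_QP) (use o yQ in simp_all)
        show "plen (pcomp q y) \<le> plen p" using True yQ by simp
      qed (use o assms in simp_all)
      then have "(q, y, m) \<in> occs arw p" using o by (simp add: occs_iff)
      then have "?f1 (q, y, m) \<in> ?f1 ` occs arw p" by (rule imageI)
      then show ?thesis using m(3) tq by simp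
    next
      case False
      obtain m where m: "m \<in> QP" "q = pcomp p m" "p' = pcomp m (pcomp y r)" "tgt p = src m" "tgt m = src (pcomp y r)"
      proof (rule pcomp_levi[of p p' q "pcomp y r"])
        show "pcomp y r \<in> QP" by (rule pcomp_QP) (use o yQ in simp_all)
      qed (use o assms False in \<open>simp_all add: pcomp_assoc\<close>)
      then have "(m, y, r) \<in> occs arw p'" using o by (simp add: occs_iff pcomp_assoc)
      then have "?f2 (m, y, r) \<in> ?f2 ` occs arw p'" by (rule imageI)
      then show ?thesis using m(2) tq by simp
    qed
  next
    fix t assume "t \<in> ?f1 ` occs arw p \<union> ?f2 ` occs arw p'"
    then consider q y r where "(q, y, r) \<in> occs arw p" "t = (q, y, pcomp r p')"
      | q y r where "(q, y, r) \<in> occs arw p'" "t = (pcomp p q, y, r)" by auto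
    then show "t \<in> occs arw (pcomp p p')"
      by cases (use occs_extend_right[OF _ assms(2,3)] occs_extend_left[OF _ assms(1,3)] in blast)+
  qed
  have D: "?f1 ` occs arw p \<inter> ?f2 ` occs arw p' = {}"
  proof -
    have "plen (fst t) < plen p" if t: "t \<in> ?f1 ` occs arw p" for t
    proof -
      obtain q y r where qyr: "(q, y, r) \<in> occs arw p" "t = (q, y, pcomp r p')" using t by auto
      then have "y \<in> arw" "p = pcomp (pcomp q y) r" by (simp_all add: occs_iff)
      then show ?thesis using arw_plen[of y] qyr(2) by simp
    qed
    moreover have "\<not> plen (fst t) < plen p" if t: "t \<in> ?f2 ` occs arw p'" for t
      using t by auto
    ultimately show ?thesis by blast
  qed
  have i1: "inj_on ?f1 (occs arw p)"
  proof (rule inj_onI)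
    fix t t' assume a: "t \<in> occs arw p" "t' \<in> occs arw p" "?f1 t = ?f1 t'"
    obtain q y r q' y' r' where t: "t = (q, y, r)" "t' = (q', y', r')" by (metis prod_cases3)
    then have "q = q'" "y = y'" using a by auto
    then show "t = t'" using occs_determined[of q y r arw p q' y' r'] a t arw_sub by simp
  qed
  have i2: "inj_on ?f2 (occs arw p')"
  proof (rule inj_onI)
    fix t t' assume a: "t \<in> occs arw p'" "t' \<in> occs arw p'" "?f2 t = ?f2 t'"
    obtain q y r q' y' r' where t: "t = (q, y, r)" "t' = (q', y', r')" by (metis prod_cases3)
    then have e: "pcomp p q = pcomp p q'" and "y = y'" using a by auto
    moreover have "plen q = plen q'" using arg_cong[OF e, of "\<lambda>x. plen x"] by simp
    ultimately show "t = t'" using occs_determined[of q y r arw p' q' y' r'] a t arw_sub by simp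
  qed
  have "asum g (pcomp p p') = sum (\<lambda>(q, y, r). g q y r) (?f1 ` occs arw p) + sum (\<lambda>(q, y, r). g q y r) (?f2 ` occs arw p')"
    unfolding asum_def U by (rule sum.union_disjoint) (use D finite_occs[OF arw_sub] in auto)
  also have "\<dots> = asum (\<lambda>q y r. g q y (pcomp r p')) p + asum (\<lambda>q. g (pcomp p q)) p'"
    unfolding sum.reindex[OF i1] sum.reindex[OF i2] asum_def by (simp add: case_prod_unfold o_def)
  finally show ?thesis .
qed

lemma asum_arw_pcomp:
  assumes "y \<in> arw" "p' \<in> QP" "tgt y = src p'"
  shows "asum g (pcomp y p') = g (triv (src y)) y p' + asum (\<lambda>q. g (pcomp y q)) p'"
  using asum_pcomp[OF arw_QP[OF assms(1)] assms(2,3), of g] assms(3) by (simp add: asum_arw[OF assms(1)])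

lemma asum_islin: "islin f \<Longrightarrow> f (asum g p) = asum (\<lambda>q y r. f (g q y r)) p"
  by (simp add: asum_def islin_sum case_prod_unfold)

lemma asum_zero: "asum (\<lambda>q y r. 0) p = 0" by (simp add: asum_def case_prod_unfold)

lemma asum_add: "asum (\<lambda>q y r. g q y r + g' q y r) p = asum g p + asum g' p"
  by (simp add: asum_def case_prod_unfold sum.distrib)

lemma asum_sum: "asum (\<lambda>q y r. \<Sum>j\<in>J. g j q y r) p = (\<Sum>j\<in>J. asum (g j) p)"
  by (simp add: asum_def case_prod_unfold sum.swap[of _ J])

subsection \<open>Normal forms of tensors\<close>

text \<open>The normal form of \<open>\<pi>(x) \<otimes> w \<otimes> \<pi>(y)\<close> for \<open>x\<close> and \<open>y\<close> in \<open>\<k>Irr\<close>: over \<open>\<k>Q\<^sub>0\<close> only composable paths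
  survive.\<close>
definition tri :: "('v, 'e, 'k) pa \<Rightarrow> ('v, 'e) qpath \<Rightarrow> ('v, 'e, 'k) pa \<Rightarrow>
    ('v, 'e, 'k) triples" where
  "tri x w y = lin (\<lambda>q. lin (\<lambda>r. if tgt q = src w \<and> tgt w = src r then bas (q, w, r) else 0) y) x"

lemma tri_bas: "tri (bas q) w (bas r) = (if tgt q = src w \<and> tgt w = src r then bas (q, w, r) else 0)"
  by (simp add: tri_def)

lemma islin_tri1 [simp]: "islin (\<lambda>x. tri x w y)" by (simp add: tri_def)
lemma islin_tri2 [simp]: "islin (\<lambda>y. tri x w y)" unfolding tri_def by (rule islin_lin_arg) simp

lemma tri_expand1: "tri x w y = lin (\<lambda>q. tri (bas q) w y) x" by (rule islin_expand[of "\<lambda>x. tri x w y"]) simp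

definition irr_triples :: "('v, 'e) qpath set \<Rightarrow> (('v, 'e) qpath \<times> ('v, 'e) qpath \<times> ('v, 'e) qpath) set" where
  "irr_triples W = {(q, w, r). q \<in> Irr \<and> w \<in> W \<and> r \<in> Irr \<and> tgt q = src w \<and> tgt w = src r}"

lemma tri_irr_triples: assumes "x \<in> kIrr" "y \<in> kIrr" "w \<in> W" shows "supp (tri x w y) \<subseteq> irr_triples W"
  unfolding tri_def
proof (intro keys_lin_subset)
  fix q r assume "q \<in> supp x" "r \<in> supp y"
  then have "q \<in> Irr" "r \<in> Irr" using assms by (auto simp: kIrr_iff)
  then show "supp (if tgt q = src w \<and> tgt w = src r then bas (q, w, r) else (0 :: _ \<Rightarrow>\<^sub>0 'k)) \<subseteq> irr_triples W"
    using assms(3) by (simp add: irr_triples_def)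
qed

text \<open>The normal form of \<open>split\<^sub>1(p)\<close>.\<close>
definition asplit :: "('v, 'e) qpath \<Rightarrow> ('v, 'e, 'k) triples" where
  "asplit p = asum (\<lambda>q y r. tri (nf (bas q)) y (nf (bas r))) p"

text \<open>On normal forms \<open>\<gamma>\<^sub>1\<close> and \<open>\<delta>\<^sub>2\<gamma>\<^sub>1 - \<partial>\<^sub>2\<gamma>\<^sub>1\<close> become the following operators.\<close>
definition gamma1 :: "('v, 'e, 'k) triples \<Rightarrow> ('v, 'e, 'k) triples" where
  "gamma1 = lin (\<lambda>(q, x, u). if pcomp x u \<in> Irr then 0 else case rm (pcomp x u) of (_, s, r) \<Rightarrow> bas (q, s, r))"

definition tau :: "('v, 'e, 'k) triples \<Rightarrow> ('v, 'e, 'k) triples" where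
  "tau = lin (\<lambda>(q, x, u). if pcomp x u \<in> Irr then 0 else case rm (pcomp x u) of (_, s, r) \<Rightarrow>
      lin (asum (\<lambda>q' y t. tri (nf (bas q \<odot> bas q')) y (nf (bas t \<odot> bas r)))) (\<phi> s))"

lemma islin_gamma1 [simp]: "islin gamma1" by (simp add: gamma1_def)
lemma islin_tau [simp]: "islin tau" by (simp add: tau_def)
lemma islin_tau_pow [simp]: "islin (tau ^^ n)"
proof (induction n)
  case 0 then show ?case by (simp add: islin_def)
next
  case (Suc n)
  show ?case using islin_compose[OF islin_tau Suc] by (simp add: o_def)
qed

text \<open>Distinct paths \<open>u\<close> give distinct paths \<open>q u r\<close>, so nothing cancels in a product \<open>q x r\<close>.\<close>
lemma lookup_sandwich:
  assumes "q \<in> QP" "r \<in> QP" "x \<in> CQ" "u \<in> supp x" "tgt q = src u" "tgt u = src r"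
  shows "pcomp (pcomp q u) r \<in> supp (bas q \<odot> x \<odot> (bas r :: ('v, 'e, 'k) pa))"
proof -
  have uQ: "u \<in> QP" using assms by (auto simp: CQ_iff)
  have "bas q \<odot> x \<odot> bas r = lin (\<lambda>t. bas q \<odot> bas t \<odot> bas r) x"
    by (rule islin_expand[of "\<lambda>x. bas q \<odot> x \<odot> bas r"]) (rule islin_compose[OF pa_mult_islin1 pa_mult_islin2])
  then have "Poly_Mapping.lookup (bas q \<odot> x \<odot> bas r) (pcomp (pcomp q u) r)
    = (\<Sum>t\<in>supp x. Poly_Mapping.lookup x t * Poly_Mapping.lookup (bas q \<odot> bas t \<odot> (bas r :: ('v, 'e, 'k) pa)) (pcomp (pcomp q u) r))"
    by (simp add: lookup_lin)
  also have "\<dots> = (\<Sum>t\<in>supp x. if t = u then Poly_Mapping.lookup x t else 0)"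
  proof (rule sum.cong[OF refl])
    fix t assume "t \<in> supp x"
    then have tQ: "t \<in> QP" using assms(3) by (auto simp: CQ_iff)
    have "t = u" if e: "tgt q = src t" "tgt t = src r" "pcomp (pcomp q t) r = pcomp (pcomp q u) r"
    proof (rule path_eqI)
      show "arrows t = arrows u" using arg_cong[OF e(3), of "\<lambda>x. arrows x"] by simp
    qed (use e assms in simp_all)
    then show "Poly_Mapping.lookup x t * Poly_Mapping.lookup (bas q \<odot> bas t \<odot> (bas r :: ('v, 'e, 'k) pa)) (pcomp (pcomp q u) r)
        = (if t = u then Poly_Mapping.lookup x t else 0)"
      using assms(5,6) by (auto simp: pa_mult_bas lookup_single when_def)
  qed
  also have "\<dots> = Poly_Mapping.lookup x u" using assms(4) by simp
  finally show ?thesis using assms(4) by (simp add: in_keys_iff)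
qed

lemma r0_prefix:
  assumes "c \<in> QP" "w \<in> QP" "tgt c = src w" "w \<notin> Irr"
  shows "r0 (bas (pcomp c w)) = bas c \<odot> r0 (bas w)" "pcomp c w \<notin> Irr"
proof -
  obtain q s r where t: "(q, s, r) \<in> rightmost S w" using rightmost_ex[OF assms(2,4)] by metis
  note t' = rightmost_prefix[OF t assms(1,3)]
  show "pcomp c w \<notin> Irr" by (rule rightmostD(8)[OF t'])
  have "src q = src w" using rightmostD(6)[OF t] by simp
  then show "r0 (bas (pcomp c w)) = bas c \<odot> r0 (bas w)"
    using assms(3) unfolding r0_rightmost[OF t] r0_rightmost[OF t'] by (simp add: pa_mult_bas pa_mult_assoc[symmetric])
qed

text \<open>The normal form is reached by rightmost reductions, and these stay possible after multiplication
  by a path from the left.\<close>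
lemma nf_reachable:
  assumes "w \<in> QP" "c \<in> QP" "tgt c = src w" "v \<in> supp (nf (bas w))"
  shows "(pcomp c v, pcomp c w) \<in> rrel\<^sup>* \<and> v \<in> Irr \<and> src v = src w \<and> tgt v = tgt w"
  using assms(1,3,4)
proof (induction w arbitrary: v rule: wf_induct_rule[OF wf_rrel])
  case (1 w)
  show ?case
  proof (cases "w \<in> Irr")
    case True
    then show ?thesis using 1 nf_id[OF kIrr_bas[OF True]] by simp
  next
    case False
    have "nf (bas w) = nf (r0 (bas w))" using nf_r0[OF CQ_bas[OF 1(2)]] by simp
    also have "\<dots> = lin (\<lambda>t. nf (bas t)) (r0 (bas w))" by (rule islin_expand) simp
    finally obtain w' where w': "w' \<in> supp (r0 (bas w))" "v \<in> supp (nf (bas w'))"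
      using 1(4) keys_lin[of "\<lambda>t. nf (bas t)" "r0 (bas w)"] by auto
    have r: "(w', w) \<in> rrel" using w' False 1(2) by (simp add: rrel_def)
    have p': "w' \<in> QP" "src w' = src w" "tgt w' = tgt w" using r0_par[OF 1(2)] w' unfolding par_def by auto
    note IH = 1(1)[OF r p'(1) _ w'(2)]
    have "bas c \<odot> r0 (bas w) = bas c \<odot> r0 (bas w) \<odot> bas (triv (tgt w))"
    proof -
      have "r0 (bas w) \<odot> bas (triv (tgt w)) = lin bas (r0 (bas w))"
      proof -
        have "r0 (bas w) \<odot> bas (triv (tgt w)) = lin (\<lambda>t. bas t \<odot> bas (triv (tgt w))) (r0 (bas w))"
          by (rule islin_expand[of "\<lambda>x. x \<odot> bas (triv (tgt w))"]) simp
        also have "\<dots> = lin bas (r0 (bas w))"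
        proof (rule lin_cong)
          fix t assume "t \<in> supp (r0 (bas w))"
          then have "tgt t = tgt w" using r0_par[OF 1(2)] unfolding par_def by blast
          then show "bas t \<odot> bas (triv (tgt w)) = bas t" by (simp add: pa_mult_bas)
        qed
        finally show ?thesis .
      qed
      then show ?thesis by (simp add: pa_mult_assoc)
    qed
    moreover have "pcomp (pcomp c w') (triv (tgt w)) \<in> supp (bas c \<odot> r0 (bas w) \<odot> bas (triv (tgt w)))"
      by (rule lookup_sandwich) (use assms(2) 1 p' w' QP_verts[OF 1(2)] in \<open>simp_all add: triv_QP r0_CQ CQ_bas\<close>)
    ultimately have "pcomp c w' \<in> supp (r0 (bas (pcomp c w)))"
      using r0_prefix(1)[OF assms(2) 1(2,3) False] p' by simp
    then have "(pcomp c w', pcomp c w) \<in> rrel"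
      using r0_prefix(2)[OF assms(2) 1(2,3) False] pcomp_QP[OF assms(2) 1(2,3)] by (simp add: rrel_def)
    then show ?thesis using IH 1(3) p' by (auto intro: rtrancl_into_rtrancl)
  qed
qed

lemma tau_killed:
  assumes "\<And>q y u. (q, y, u) \<in> supp z \<Longrightarrow> pcomp y u \<in> Irr" shows "tau z = 0" "gamma1 z = 0"
proof -
  have "tau z = lin (\<lambda>t. 0) z" unfolding tau_def
  proof (rule lin_cong, goal_cases)
    case (1 t)
    then show ?case using assms by (cases t) simp
  qed
  then show "tau z = 0" by simp
  have "gamma1 z = lin (\<lambda>t. 0) z" unfolding gamma1_def
  proof (rule lin_cong, goal_cases)
    case (1 t)
    then show ?case using assms by (cases t) simp
  qed
  then show "gamma1 z = 0" by simp
qed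

text \<open>Nilpotency of \<open>\<tau>\<close> at \<open>z\<close>, i.e. finiteness of the perturbation series for \<open>\<rho>\<^sub>1\<close> at \<open>z\<close>.\<close>
definition nilp :: "('v, 'e, 'k) triples \<Rightarrow> bool" where
  "nilp z \<longleftrightarrow> (\<exists>n. (tau ^^ n) z = 0)"

lemma tau_pow_mono: "(tau ^^ n) z = 0 \<Longrightarrow> n \<le> m \<Longrightarrow> (tau ^^ m) z = 0"
proof (induction m)
  case (Suc m)
  then show ?case by (cases "n = Suc m") (auto simp: islin_zero[OF islin_tau])
qed simp

lemma nilp_keys:
  assumes "\<And>t. t \<in> supp z \<Longrightarrow> nilp (bas t)" shows "nilp z"
proof -
  obtain N where N: "\<And>t. t \<in> supp z \<Longrightarrow> (tau ^^ N t) (bas t) = 0"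
    using assms unfolding nilp_def by metis
  define M where "M = Max (insert 0 (N ` supp z))"
  have "(tau ^^ M) z = lin (\<lambda>t. (tau ^^ M) (bas t)) z" by (rule islin_expand) simp
  also have "\<dots> = lin (\<lambda>t. 0) z"
  proof (rule lin_cong)
    fix t assume "t \<in> supp z"
    then show "(tau ^^ M) (bas t) = 0" using tau_pow_mono[OF N] by (auto simp: M_def)
  qed
  finally show ?thesis unfolding nilp_def by auto
qed

lemma nilp_tau: "nilp (tau z) \<Longrightarrow> nilp z"
  unfolding nilp_def by (metis funpow_simps_right(2) o_apply)

lemma tau_bas:
  assumes "(q0, s, r) \<in> rightmost S (pcomp x u)"
  shows "tau (bas (q, x, u)) = lin (asum (\<lambda>q' y t. tri (nf (bas q \<odot> bas q')) y (nf (bas t \<odot> bas r)))) (\<phi> s)"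
    "gamma1 (bas (q, x, u)) = bas (q, s, r)"
  using rightmostD(8)[OF assms] rm_eq[OF assms] by (simp_all add: tau_def gamma1_def)

lemma keys_tri: "(q, y, v) \<in> supp (tri x w z) \<Longrightarrow>
    q \<in> supp x \<and> y = w \<and> v \<in> supp z \<and> tgt q = src w \<and> tgt w = src v"
proof -
  assume a: "(q, y, v) \<in> supp (tri x w z)"
  have "supp (tri x w z) \<subseteq>
      {(q, y, v). q \<in> supp x \<and> y = w \<and> v \<in> supp z \<and> tgt q = src w \<and> tgt w = src v}"
    unfolding tri_def by (intro keys_lin_subset) simp
  then show ?thesis using a by blast
qed

lemma keys_asum: "supp (asum g p) \<subseteq> (\<Union>(q, y, r)\<in>occs arw p. supp (g q y r))"
  unfolding asum_def by (rule order_trans[OF keys_sum_subset]) auto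

text \<open>A term of the image of \<open>\<tau>\<close> is, up to its left factor, a path reachable by rightmost reduction.\<close>
lemma nilp_bas:
  assumes "p \<in> QP"
  shows "\<lbrakk>p = pcomp q (pcomp x u); q \<in> QP; x \<in> arw; u \<in> Irr; tgt q = src x; tgt x = src u; q0 \<in> QP; tgt q0 = src x\<rbrakk>
    \<Longrightarrow> nilp (bas (q0, x, u))"
  using assms
proof (induction p arbitrary: q x u q0 rule: wf_induct_rule[OF wf_trancl[OF wf_rrel]])
  case (1 p)
  show ?case
  proof (cases "pcomp x u \<in> Irr")
    case True
    then have "tau (bas (q0, x, u)) = 0" by (intro tau_killed) simp
    then have "(tau ^^ 1) (bas (q0, x, u)) = 0" by simp
    then show ?thesis unfolding nilp_def by blast
  next
    case False
    obtain s r where t: "(triv (src x), s, r) \<in> rightmost S (pcomp x u)" "pcomp s r = pcomp x u"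
      using rightmost_arrow[OF 1(4,5,7) False] by metis
    note d = rightmostD[OF t(1)]
    have sx: "src s = src x" using d(4) by simp
    show ?thesis
    proof (rule nilp_tau, rule nilp_keys)
      fix T assume "T \<in> supp (tau (bas (q0, x, u)))"
      then obtain w where w: "w \<in> supp (\<phi> s)"
          "T \<in> supp (asum (\<lambda>q' y t. tri (nf (bas q0 \<odot> bas q')) y (nf (bas t \<odot> bas r))) w)"
        using keys_lin[of "asum (\<lambda>q' y t. tri (nf (bas q0 \<odot> bas q')) y (nf (bas t \<odot> bas r)))" "\<phi> s"]
        unfolding tau_bas[OF t(1)] by blast
      obtain oc where oc: "oc \<in> occs arw w" "T \<in> supp (case oc of (q', y, t) \<Rightarrow> tri (nf (bas q0 \<odot> bas q')) y (nf (bas t \<odot> bas r)))"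
        using subsetD[OF keys_asum w(2)] by (auto simp only: UN_iff case_prod_unfold)
      then obtain q' y t' where O: "(q', y, t') \<in> occs arw w" "T \<in> supp (tri (nf (bas q0 \<odot> bas q')) y (nf (bas t' \<odot> bas r)))"
        by (cases oc) auto
      obtain q1 v where T: "T = (q1, y, v)" "q1 \<in> supp (nf (bas q0 \<odot> bas q'))"
          "v \<in> supp (nf (bas t' \<odot> bas r))" "tgt q1 = src y" "tgt y = src v"
        using keys_tri O(2) by (cases T) metis
      have o: "q' \<in> QP" "y \<in> arw" "t' \<in> QP" "tgt q' = src y" "tgt y = src t'" "w = pcomp (pcomp q' y) t'"
        using O(1) by (simp_all add: occs_iff)
      have ww: "w \<in> Irr" "src w = src s" "tgt w = tgt s" using phi_keys[OF d(2)] w(1) by auto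
      have q's: "src q' = src x" "tgt t' = src r" using ww o d sx by auto
      have wQ: "w \<in> QP" using ww Irr_QP by blast
      have tr: "pcomp t' r \<in> QP" by (rule pcomp_QP) (use o d q's in simp_all)
      have yQ: "y \<in> QP" using o arw_QP by blast
      have v: "v \<in> supp (nf (bas (pcomp t' r)))" using T(3) q's by (simp add: pa_mult_bas)
      \<comment> \<open>the path represented by the new triple is \<open>?c v\<close>; it is reached from \<open>p\<close> by first reducing \<open>s\<close>\<close>
      let ?c = "pcomp (pcomp q q') y"
      have cQ: "?c \<in> QP" by (intro pcomp_QP) (use 1 o q's yQ in simp_all)
      have R1: "(pcomp ?c v, pcomp ?c (pcomp t' r)) \<in> rrel\<^sup>*" and vI: "v \<in> Irr"
        using nf_reachable[OF tr cQ _ v] o by auto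
      have pr: "(pcomp q (triv (src x)), s, r) \<in> rightmost S p"
        using rightmost_prefix[OF t(1) 1(3)] 1(2,6) by simp
      have "pcomp (pcomp q w) r \<in> supp (bas q \<odot> \<phi> s \<odot> (bas r :: ('v, 'e, 'k) pa))"
        by (rule lookup_sandwich) (use 1 d phi_CQ w ww sx in simp_all)
      then have "(pcomp (pcomp q w) r, p) \<in> rrel"
        using r0_rightmost[OF pr] rightmostD(8)[OF pr] 1 by (simp add: rrel_def)
      moreover have "pcomp (pcomp q w) r = pcomp ?c (pcomp t' r)" using o by (simp add: pcomp_assoc)
      ultimately have R: "(pcomp ?c v, p) \<in> rrel\<^sup>+" using R1 by (metis rtrancl_into_trancl1)
      have q1Q: "q1 \<in> QP"
      proof -
        have "nf (bas q0 \<odot> bas q') \<in> CQ" using 1 o by (intro nf_CQ CQ_mult CQ_bas)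
        then show ?thesis using T(2) unfolding CQ_iff by blast
      qed
      have "pcomp ?c v \<in> QP" by (rule pcomp_QP[OF cQ]) (use vI Irr_QP T in simp_all)
      then show "nilp (bas T)" unfolding T(1)
        using 1(1)[OF R, of "pcomp q q'" y v q1] o 1 q's vI T q1Q by (simp add: pcomp_assoc pcomp_QP)
    qed
  qed
qed

lemma nilp_irr_triples: assumes "supp z \<subseteq> irr_triples arw" shows "nilp z"
proof (rule nilp_keys)
  fix t assume "t \<in> supp z"
  then obtain q x u where t: "t = (q, x, u)" "q \<in> Irr" "x \<in> arw" "u \<in> Irr" "tgt q = src x" "tgt x = src u"
    using assms unfolding irr_triples_def by blast
  show "nilp (bas t)" unfolding t(1)
    by (rule nilp_bas[of "pcomp q (pcomp x u)" q x u q]) (use t Irr_QP arw_QP in \<open>simp_all add: pcomp_QP\<close>)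
qed

text \<open>\<open>\<rho>\<^sub>1\<close> on normal forms, see \<open>rho1\<close>: the sum of all \<open>\<gamma>\<^sub>1\<tau>\<^sup>i\<close>.\<close>
definition Theta :: "('v, 'e, 'k) triples \<Rightarrow> ('v, 'e, 'k) triples" where
  "Theta = lin (\<lambda>t. evlim (\<lambda>n. \<Sum>i<n. gamma1 ((tau ^^ i) (bas t))))"

lemma islin_Theta [simp]: "islin Theta" by (simp add: Theta_def)

lemma Theta_eventually:
  assumes "supp z \<subseteq> irr_triples arw"
  shows "\<exists>n0. \<forall>n\<ge>n0. (\<Sum>i<n. gamma1 ((tau ^^ i) z)) = Theta z"
proof -
  have 1: "\<exists>n0. \<forall>n\<ge>n0. (\<Sum>i<n. gamma1 ((tau ^^ i) (bas t))) = Theta (bas t)" if t: "t \<in> supp z" for t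
  proof -
    have "nilp (bas t)" by (rule nilp_irr_triples) (use t assms in auto)
    then obtain n0 where n0: "(tau ^^ n0) (bas t) = 0" unfolding nilp_def by blast
    have e: "(\<Sum>i<n. gamma1 ((tau ^^ i) (bas t))) = (\<Sum>i<n0. gamma1 ((tau ^^ i) (bas t)))" if "n \<ge> n0" for n
      by (rule sum.mono_neutral_right) (use that tau_pow_mono[OF n0] in \<open>auto simp: islin_zero[OF islin_gamma1]\<close>)
    have th: "Theta (bas t) = (\<Sum>i<n0. gamma1 ((tau ^^ i) (bas t)))"
      unfolding Theta_def lin_bas by (rule evlimI[OF e])
    show ?thesis unfolding th using e by blast
  qed
  define P where "P t n0 \<longleftrightarrow> (\<forall>n\<ge>n0. (\<Sum>i<n. gamma1 ((tau ^^ i) (bas t))) = Theta (bas t))" for t n0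
  have "\<forall>t\<in>supp z. \<exists>n0. P t n0" using 1 unfolding P_def by blast
  from bchoice[OF this] obtain N where "\<forall>t\<in>supp z. P t (N t)" by blast
  then have N: "\<And>t n. t \<in> supp z \<Longrightarrow> n \<ge> N t \<Longrightarrow> (\<Sum>i<n. gamma1 ((tau ^^ i) (bas t))) = Theta (bas t)"
    unfolding P_def by blast
  have "(\<Sum>i<n. gamma1 ((tau ^^ i) z)) = Theta z" if n: "n \<ge> Max (insert 0 (N ` supp z))" for n
  proof (rule islin_eqI[of "\<lambda>z. \<Sum>i<n. gamma1 ((tau ^^ i) z)" Theta])
    show "islin (\<lambda>z. \<Sum>i<n. gamma1 ((tau ^^ i) z))"
      by (intro islin_sum_fun islin_compose[OF islin_gamma1 islin_tau_pow])
    fix t assume t: "t \<in> supp z"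
    then have "N t \<le> n" using n by simp
    then show "(\<Sum>i<n. gamma1 ((tau ^^ i) (bas t))) = Theta (bas t)" using N t by blast
  qed simp
  then show ?thesis by blast
qed

lemma asum_irr_triples: "(\<And>q y r. (q, y, r) \<in> occs arw p \<Longrightarrow> supp (g q y r) \<subseteq> W) \<Longrightarrow> supp (asum g p) \<subseteq> W"
  using keys_asum[of g p] by fastforce

lemma tau_irr_triples: assumes "supp z \<subseteq> irr_triples arw" shows "supp (tau z) \<subseteq> irr_triples arw"
  unfolding tau_def
proof (rule keys_lin_subset)
  fix t assume "t \<in> supp z"
  then obtain q x u where t: "t = (q, x, u)" "q \<in> Irr" "x \<in> arw" "u \<in> Irr" "tgt q = src x" "tgt x = src u"
    using assms unfolding irr_triples_def by blast
  show "supp (case t of (q, x, u) \<Rightarrow> if pcomp x u \<in> Irr then 0 else case rm (pcomp x u) of (_, s, r) \<Rightarrow>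
      lin (asum (\<lambda>q' y t. tri (nf (bas q \<odot> bas q')) y (nf (bas t \<odot> bas r)))) (\<phi> s)) \<subseteq> irr_triples arw"
  proof (cases "pcomp x u \<in> Irr")
    case False
    obtain s r where tt: "(triv (src x), s, r) \<in> rightmost S (pcomp x u)"
      using rightmost_arrow[OF t(3,4,6) False] by metis
    have "supp (lin (asum (\<lambda>q' y t. tri (nf (bas q \<odot> bas q')) y (nf (bas t \<odot> bas r)))) (\<phi> s)) \<subseteq> irr_triples arw"
      by (intro keys_lin_subset asum_irr_triples tri_irr_triples nf_kIrr CQ_mult CQ_bas)
        (use t Irr_QP rightmostD[OF tt] in \<open>simp_all add: occs_iff\<close>)
    then show ?thesis using False rm_eq[OF tt] t(1) by simp
  qed (simp add: t(1))
qed

lemma Theta_unfold: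
  assumes "supp z \<subseteq> irr_triples arw" shows "Theta z = gamma1 z + Theta (tau z)"
proof -
  obtain n0 where n0: "\<And>n. n \<ge> n0 \<Longrightarrow> (\<Sum>i<n. gamma1 ((tau ^^ i) z)) = Theta z"
    using Theta_eventually[OF assms] by blast
  obtain n1 where n1: "\<And>n. n \<ge> n1 \<Longrightarrow> (\<Sum>i<n. gamma1 ((tau ^^ i) (tau z))) = Theta (tau z)"
    using Theta_eventually[OF tau_irr_triples[OF assms]] by blast
  let ?n = "max n0 n1"
  have "Theta z = (\<Sum>i<Suc ?n. gamma1 ((tau ^^ i) z))" using n0[of "Suc ?n"] by simp
  also have "\<dots> = gamma1 z + (\<Sum>i<?n. gamma1 ((tau ^^ i) (tau z)))"
    by (simp add: sum.lessThan_Suc_shift funpow_swap1 del: sum.lessThan_Suc)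
  finally show ?thesis using n1[of ?n] by simp
qed

lemma Theta_killed:
  assumes "supp z \<subseteq> irr_triples arw" "\<And>q y u. (q, y, u) \<in> supp z \<Longrightarrow> pcomp y u \<in> Irr"
  shows "Theta z = 0"
  using Theta_unfold[OF assms(1)] tau_killed[OF assms(2)] by (simp add: islin_zero[OF islin_Theta])

lemma rel_I: assumes "s \<in> S" shows "bas s - \<phi> s \<in> I"
proof -
  have "{bas s - \<phi> s | s. s \<in> S} \<subseteq> carrier KQ"
    using CQ_diff[OF CQ_bas[OF S_QP] phi_CQ] by auto
  from subsetD[OF ID.genideal_self[OF this]] show ?thesis
    using dia assms unfolding diamond_def by blast
qed

lemma phi_path:
  assumes "s \<in> S" "u \<in> supp (\<phi> s)"
  shows "u \<in> QP" "src u = src s" "tgt u = tgt s" "u \<in> Irr"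
proof -
  have "u \<in> irr_par s" using phi_keys[OF assms(1)] assms(2) by blast
  then show "u \<in> QP" "src u = src s" "tgt u = tgt s" "u \<in> Irr" using Irr_QP by blast+
qed

lemma nf_parallel: assumes "p \<in> QP" "u \<in> supp (nf (bas p))"
  shows "u \<in> Irr" "src u = src p" "tgt u = tgt p"
  using polred_parallel[of "[]" p] assms polred_nil[OF CQ_bas[OF assms(1)]] by auto

lemma nf_Irr: "p \<in> Irr \<Longrightarrow> nf (bas p) = bas p"
  by (rule nf_id[OF kIrr_bas])

lemma rightmost_drop:
  assumes "(q, s, r) \<in> rightmost S p" shows "(triv (src s), s, r) \<in> rightmost S (pcomp s r)"
proof -
  note d = rightmostD[OF assms]
  have s: "s \<in> QP" using d S_QP by blast
  have "(triv (src s), s, r) \<in> occs S (pcomp s r)"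
    using d s QP_verts[OF s] by (simp add: occs_iff triv_QP)
  moreover have "plen r \<le> plen r'" if o: "(q', s', r') \<in> occs S (pcomp s r)" for q' s' r'
  proof -
    have "(pcomp q q', s', r') \<in> occs S (pcomp q (pcomp s r))"
      by (rule occs_extend_left[OF o d(1)]) (use d in simp)
    then have "(pcomp q q', s', r') \<in> occs S p" using d(6) by (simp add: pcomp_assoc)
    then show ?thesis using assms unfolding rightmost_iff by blast
  qed
  ultimately show ?thesis unfolding rightmost_iff by blast
qed

lemma S_cases:
  assumes "s \<in> S" obtains x s' where "x \<in> arw" "s' \<in> QP" "tgt x = src s'" "s = pcomp x s'"
  using path_cases[OF S_QP[OF assms]] S_len[OF assms] by (metis arrows_triv list.size(3) not_numeral_le_zero)

text \<open>The change of the arrow splitting under a rightmost reduction, up to irreducible terms.\<close>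
lemma asplit_step:
  fixes \<Lambda> :: "_ \<Rightarrow> ('x \<Rightarrow>\<^sub>0 'k)"
  assumes lin: "islin \<Lambda>"
    and kill: "\<And>x y u. \<lbrakk>x \<in> kIrr; y \<in> arw; u \<in> Irr; tgt y = src u; pcomp y u \<in> Irr\<rbrakk> \<Longrightarrow> \<Lambda> (tri x y (bas u)) = 0"
    and t: "(q, s, r) \<in> rightmost S p" and s: "s = pcomp x s'" "x \<in> arw" "s' \<in> QP" "tgt x = src s'"
  shows "\<Lambda> (asplit p) = \<Lambda> (lin asplit (bas q \<odot> \<phi> s \<odot> bas r)) + \<Lambda> (tri (nf (bas q)) x (bas (pcomp s' r)))
    - \<Lambda> (lin (asum (\<lambda>q' y t. tri (nf (bas q \<odot> bas q')) y (nf (bas t \<odot> bas r)))) (\<phi> s))"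
proof -
  note d = rightmostD[OF t]
  have sQ: "s \<in> QP" using d S_QP by blast
  have xQ: "x \<in> QP" "plen x > 0" using s arw_QP arw_plen by auto
  have s'r: "pcomp s' r \<in> Irr" by (rule rightmost_tail[OF t s(1) xQ s(3,4)])
  have rI: "r \<in> Irr" by (rule rightmost_Irr[OF t])
  have ts: "tgt s' = src r" using s d by simp
  have s'rQ: "pcomp s' r \<in> QP" by (rule Irr_QP[OF s'r])
  define L1 where "L1 z = asum (\<lambda>q1 y1 r1. tri (nf (bas q1)) y1 (nf (bas r1 \<odot> z))) q" for z :: "('v, 'e, 'k) pa"
  have L1: "islin L1" unfolding L1_def asum_def case_prod_unfold
    by (intro islin_sum_fun islin_compose[OF islin_tri2] islin_compose[OF islin_nf pa_mult_islin2])
  let ?g = "\<lambda>q y r. tri (nf (bas q)) y (nf (bas r))"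
  have KIL: "\<Lambda> (asum (\<lambda>q1. ?g (pcomp c q1)) w) = 0" if "w \<in> Irr" "c \<in> QP" "tgt c = src w" for c w
  proof -
    have "\<Lambda> (asum (\<lambda>q1. ?g (pcomp c q1)) w) = asum (\<lambda>q1 y r. 0) w"
      unfolding asum_islin[OF lin]
    proof (rule asum_cong)
      fix q1 y r1 assume o: "q1 \<in> QP" "y \<in> arw" "r1 \<in> QP" "tgt q1 = src y" "tgt y = src r1" "w = pcomp (pcomp q1 y) r1"
      have yQ: "y \<in> QP" using o arw_QP by blast
      have "pcomp q1 (pcomp y r1) \<in> Irr" using that o by (simp add: pcomp_assoc)
      then have yr: "pcomp y r1 \<in> Irr" by (rule Irr_subpath) (use o yQ in \<open>simp_all add: pcomp_QP\<close>)
      then have "r1 \<in> Irr" using Irr_subpath(2)[OF _ yQ o(3,5)] by blast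
      moreover have "nf (bas (pcomp c q1)) \<in> kIrr" using that o by (intro nf_kIrr CQ_bas pcomp_QP) auto
      ultimately show "\<Lambda> (?g (pcomp c q1) y r1) = 0" using kill yr o by (simp add: nf_Irr)
    qed
    then show ?thesis by (simp add: asum_zero)
  qed
  have first: "asum (\<lambda>q1 y r1. ?g q1 y (pcomp r1 w)) q = L1 (bas w)" if "tgt q = src w" for w
    unfolding L1_def by (rule asum_cong) (use that in \<open>simp add: pa_mult_bas\<close>)
  have p: "p = pcomp q (pcomp s r)" using d by (simp add: pcomp_assoc)
  have srQ: "pcomp s r \<in> QP" by (rule pcomp_QP) (use sQ d in simp_all)
  have "asplit p = L1 (bas (pcomp s r)) + asum (\<lambda>q1. ?g (pcomp q q1)) (pcomp s r)"
    unfolding asplit_def p using first[of "pcomp s r"] asum_pcomp[OF d(1) srQ, of ?g] d by simp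
  also have "asum (\<lambda>q1. ?g (pcomp q q1)) (pcomp s r)
     = tri (nf (bas q)) x (bas (pcomp s' r)) + asum (\<lambda>q1. ?g (pcomp (pcomp q x) q1)) (pcomp s' r)"
    using asum_arw_pcomp[OF s(2) s'rQ, of "\<lambda>q1. ?g (pcomp q q1)"] s d by (simp add: pcomp_assoc nf_Irr[OF s'r])
  finally have A: "\<Lambda> (asplit p) = \<Lambda> (L1 (bas (pcomp s r))) + \<Lambda> (tri (nf (bas q)) x (bas (pcomp s' r)))"
    using KIL[OF s'r, of "pcomp q x"] s d xQ by (simp add: islin_add[OF lin] pcomp_QP)
  have B: "\<Lambda> (asplit (pcomp (pcomp q u) r)) = \<Lambda> (L1 (bas u \<odot> bas r))
      + \<Lambda> (asum (\<lambda>q' y t. tri (nf (bas q \<odot> bas q')) y (nf (bas t \<odot> bas r))) u)"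
    if u: "u \<in> supp (\<phi> s)" for u
  proof -
    have u': "u \<in> QP" "src u = src s" "tgt u = tgt s" using phi_path[OF d(2) u] by simp_all
    have urQ: "pcomp u r \<in> QP" "pcomp q u \<in> QP" by (intro pcomp_QP; use u' d in simp)+
    have "asplit (pcomp (pcomp q u) r) = L1 (bas (pcomp u r)) + asum (\<lambda>q1. ?g (pcomp q q1)) (pcomp u r)"
      unfolding asplit_def pcomp_assoc using first[of "pcomp u r"] asum_pcomp[OF d(1) urQ(1), of ?g] u' d by simp
    also have "asum (\<lambda>q1. ?g (pcomp q q1)) (pcomp u r)
       = asum (\<lambda>q1 y r1. ?g (pcomp q q1) y (pcomp r1 r)) u + asum (\<lambda>q1. ?g (pcomp (pcomp q u) q1)) r"
      using asum_pcomp[OF u'(1) d(3), of "\<lambda>q1. ?g (pcomp q q1)"] u' d by (simp add: pcomp_assoc)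
    also have "asum (\<lambda>q1 y r1. ?g (pcomp q q1) y (pcomp r1 r)) u
      = asum (\<lambda>q' y t. tri (nf (bas q \<odot> bas q')) y (nf (bas t \<odot> bas r))) u"
      by (rule asum_cong) (use u' d in \<open>simp add: pa_mult_bas\<close>)
    finally show ?thesis
      using KIL[OF rI urQ(2)] u' d by (simp add: islin_add[OF lin] pa_mult_bas)
  qed
  have "bas q \<odot> \<phi> s \<odot> bas r = lin (\<lambda>u. bas q \<odot> bas u \<odot> bas r) (\<phi> s)"
    by (rule islin_expand[of "\<lambda>z. bas q \<odot> z \<odot> bas r"]) (rule islin_compose[OF pa_mult_islin1 pa_mult_islin2])
  also have "\<dots> = lin (\<lambda>u. bas (pcomp (pcomp q u) r)) (\<phi> s)"
    by (rule lin_cong) (use phi_keys[OF d(2)] d in \<open>fastforce simp: pa_mult_bas\<close>)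
  finally have "\<Lambda> (lin asplit (bas q \<odot> \<phi> s \<odot> bas r)) = lin (\<lambda>u. \<Lambda> (asplit (pcomp (pcomp q u) r))) (\<phi> s)"
    by (simp add: lin_lin islin_comp_lin[OF lin])
  also have "\<dots> = lin (\<lambda>u. \<Lambda> (L1 (bas u \<odot> bas r)) + \<Lambda> (asum (\<lambda>q' y t. tri (nf (bas q \<odot> bas q')) y (nf (bas t \<odot> bas r))) u)) (\<phi> s)"
    by (rule lin_cong) (rule B)
  also have "\<dots> = \<Lambda> (L1 (\<phi> s \<odot> bas r)) + \<Lambda> (lin (asum (\<lambda>q' y t. tri (nf (bas q \<odot> bas q')) y (nf (bas t \<odot> bas r)))) (\<phi> s))"
  proof -
    have "islin (\<lambda>z. \<Lambda> (L1 (z \<odot> bas r)))" by (intro islin_compose[OF lin] islin_compose[OF L1] pa_mult_islin1)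
    from islin_expand[OF this, of "\<phi> s"] show ?thesis by (simp add: lin_add_fun islin_comp_lin[OF lin])
  qed
  also have "L1 (\<phi> s \<odot> bas r) = L1 (bas (pcomp s r))"
    unfolding L1_def
  proof (rule asum_cong)
    fix q1 y r1 assume o: "r1 \<in> QP"
    have "bas r1 \<odot> ((bas s - \<phi> s) \<odot> bas r) \<in> I"
      by (rule I_multl[OF I_multr[OF rel_I[OF d(2)]]]) (use o d in \<open>simp_all add: CQ_bas\<close>)
    then have "nf (bas r1 \<odot> (bas s \<odot> bas r)) = nf (bas r1 \<odot> (\<phi> s \<odot> bas r))"
      by (intro nf_cong) (simp add: pa_mult_diff_left pa_mult_diff_right)
    then show "tri (nf (bas q1)) y (nf (bas r1 \<odot> (\<phi> s \<odot> bas r))) = tri (nf (bas q1)) y (nf (bas r1 \<odot> bas (pcomp s r)))"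
      using d by (simp add: pa_mult_bas)
  qed
  finally show ?thesis using A by simp
qed

lemma Theta_tri_killed:
  assumes "x \<in> kIrr" "y \<in> arw" "u \<in> Irr" "pcomp y u \<in> Irr"
  shows "Theta (tri x y (bas u)) = 0"
proof (rule Theta_killed[OF tri_irr_triples])
  fix q z v assume "(q, z, v) \<in> supp (tri x y (bas u))"
  then have "z = y \<and> v \<in> supp (bas u :: ('v, 'e, 'k) pa)" using keys_tri by blast
  then show "pcomp z v \<in> Irr" using assms by simp
qed (use assms kIrr_bas in simp_all)

lemma asplit_killed:
  assumes "islin \<Lambda>" "\<And>x y u. \<lbrakk>x \<in> kIrr; y \<in> arw; u \<in> Irr; tgt y = src u; pcomp y u \<in> Irr\<rbrakk> \<Longrightarrow> \<Lambda> (tri x y (bas u)) = 0" "p \<in> Irr"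
  shows "\<Lambda> (asplit p) = 0"
proof -
  have "\<Lambda> (asplit p) = asum (\<lambda>q y r. 0) p"
    unfolding asplit_def asum_islin[OF assms(1)]
  proof (rule asum_cong)
    fix q1 y r1 assume o: "q1 \<in> QP" "y \<in> arw" "r1 \<in> QP" "tgt q1 = src y" "tgt y = src r1" "p = pcomp (pcomp q1 y) r1"
    have yQ: "y \<in> QP" using o arw_QP by blast
    have "pcomp q1 (pcomp y r1) \<in> Irr" using assms o by (simp add: pcomp_assoc)
    then have yr: "pcomp y r1 \<in> Irr" by (rule Irr_subpath) (use o yQ in \<open>simp_all add: pcomp_QP\<close>)
    then have "r1 \<in> Irr" using Irr_subpath(2)[OF _ yQ o(3,5)] by blast
    then show "\<Lambda> (tri (nf (bas q1)) y (nf (bas r1))) = 0"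
      using assms(2) yr o nf_kIrr[OF CQ_bas[OF o(1)]] by (simp add: nf_Irr)
  qed
  then show ?thesis by (simp add: asum_zero)
qed

lemma Theta_Irr: "p \<in> Irr \<Longrightarrow> Theta (asplit p) = 0"
  by (rule asplit_killed[of Theta]) (simp_all add: Theta_tri_killed)

lemma tri_left:
  assumes "q \<in> QP" "tgt q = src w" "tgt w = src r"
  shows "tri (nf (bas q)) w (bas r) = lin (\<lambda>q1. bas (q1, w, r)) (nf (bas q))"
proof -
  have "tri (nf (bas q)) w (bas r) = lin (\<lambda>q1. tri (bas q1) w (bas r)) (nf (bas q))" by (rule tri_expand1)
  also have "\<dots> = lin (\<lambda>q1. bas (q1, w, r)) (nf (bas q))"
    by (rule lin_cong) (use nf_parallel(3)[OF assms(1)] assms in \<open>simp add: tri_bas\<close>)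
  finally show ?thesis .
qed

text \<open>The splittings of \<open>p = q s r\<close> and of \<open>q \<phi>\<^sub>s r\<close> agree at the arrows of \<open>q\<close>, where the right factors have the
  same normal form.  At the other arrows of \<open>p\<close> all terms are killed by \<open>\<gamma>\<^sub>1\<close> and \<open>\<tau>\<close>, except the one at
  the first arrow of \<open>s\<close>: from it \<open>\<gamma>\<^sub>1\<close> makes the triple \<open>(q, s, r)\<close>, and \<open>\<tau>\<close> the terms of the
  splitting of \<open>q \<phi>\<^sub>s r\<close> at the arrows of \<open>\<phi>\<^sub>s\<close>.  Iterating this, \<open>Theta\<close> lists the triples of all
  rightmost reductions of \<open>p\<close>.\<close>
theorem Theta_step:
  assumes t: "(q, s, r) \<in> rightmost S p"
  shows "Theta (asplit p) = tri (nf (bas q)) s (bas r) + Theta (lin asplit (bas q \<odot> \<phi> s \<odot> bas r))"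
proof -
  note d = rightmostD[OF t]
  obtain x s' where s: "x \<in> arw" "s' \<in> QP" "tgt x = src s'" "s = pcomp x s'" using S_cases[OF d(2)] by metis
  have xQ: "x \<in> QP" "plen x > 0" using s arw_QP arw_plen by auto
  have s'r: "pcomp s' r \<in> Irr" by (rule rightmost_tail[OF t s(4) xQ s(2,3)])
  have tt: "(triv (src s), s, r) \<in> rightmost S (pcomp x (pcomp s' r))"
    using rightmost_drop[OF t] s by (simp add: pcomp_assoc)
  let ?B = "tri (nf (bas q)) x (bas (pcomp s' r))"
  have tB: "?B = lin (\<lambda>q1. bas (q1, x, pcomp s' r)) (nf (bas q))"
    by (rule tri_left) (use d s in simp_all)
  have TB: "Theta ?B = gamma1 ?B + Theta (tau ?B)"
    by (rule Theta_unfold[OF tri_irr_triples]) (use s s'r d in \<open>simp_all add: nf_kIrr CQ_bas kIrr_bas\<close>)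
  have gB: "gamma1 ?B = tri (nf (bas q)) s (bas r)"
    unfolding tB islin_comp_lin[OF islin_gamma1] tau_bas(2)[OF tt]
    by (rule tri_left[symmetric]) (use d in simp_all)
  have "tau ?B = lin (\<lambda>q1. lin (asum (\<lambda>q' y t. tri (nf (bas q1 \<odot> bas q')) y (nf (bas t \<odot> bas r)))) (\<phi> s)) (nf (bas q))"
    unfolding tB islin_comp_lin[OF islin_tau] tau_bas(1)[OF tt] ..
  also have "\<dots> = lin (\<lambda>u. lin (\<lambda>q1. asum (\<lambda>q' y t. tri (nf (bas q1 \<odot> bas q')) y (nf (bas t \<odot> bas r))) u) (nf (bas q))) (\<phi> s)"
    by (rule lin_swap)
  also have "\<dots> = lin (asum (\<lambda>q' y t. tri (nf (bas q \<odot> bas q')) y (nf (bas t \<odot> bas r)))) (\<phi> s)"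
  proof (rule lin_cong)
    fix u
    have "lin (\<lambda>q1. asum (\<lambda>q' y t. tri (nf (bas q1 \<odot> bas q')) y (nf (bas t \<odot> bas r))) u) (nf (bas q))
      = asum (\<lambda>q' y t. lin (\<lambda>q1. tri (nf (bas q1 \<odot> bas q')) y (nf (bas t \<odot> bas r))) (nf (bas q))) u"
      by (simp add: asum_def lin_sum_fun case_prod_unfold)
    also have "\<dots> = asum (\<lambda>q' y t. tri (nf (bas q \<odot> bas q')) y (nf (bas t \<odot> bas r))) u"
    proof (rule asum_cong)
      fix q' y t assume "q' \<in> QP"
      have "islin (\<lambda>z. tri (nf (z \<odot> bas q')) y (nf (bas t \<odot> bas r)))"
        by (intro islin_compose[OF islin_tri1] islin_compose[OF islin_nf] pa_mult_islin1)
      from islin_expand[OF this, of "nf (bas q)"]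
      show "lin (\<lambda>q1. tri (nf (bas q1 \<odot> bas q')) y (nf (bas t \<odot> bas r))) (nf (bas q)) = tri (nf (bas q \<odot> bas q')) y (nf (bas t \<odot> bas r))"
        using nf_mult_left[OF CQ_bas[OF d(1)] CQ_bas[OF \<open>q' \<in> QP\<close>]] by simp
    qed
    finally show "lin (\<lambda>q1. asum (\<lambda>q' y t. tri (nf (bas q1 \<odot> bas q')) y (nf (bas t \<odot> bas r))) u) (nf (bas q))
      = asum (\<lambda>q' y t. tri (nf (bas q \<odot> bas q')) y (nf (bas t \<odot> bas r))) u" .
  qed
  finally have tauB: "tau ?B = lin (asum (\<lambda>q' y t. tri (nf (bas q \<odot> bas q')) y (nf (bas t \<odot> bas r)))) (\<phi> s)" .
  have "Theta (asplit p) = Theta (lin asplit (bas q \<odot> \<phi> s \<odot> bas r)) + Theta ?B - Theta (tau ?B)"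
    unfolding tauB by (rule asplit_step[OF islin_Theta Theta_tri_killed t s(4,1,2,3)])
  then show ?thesis using TB gB by (simp add: algebra_simps)
qed

section \<open>The recursion for the polarized reduction\<close>

text \<open>The bimodule map \<open>P\<^sub>n \<rightarrow> A\<close> with \<open>q \<otimes> w \<otimes> r \<mapsto> q e(w, r)\<close>, on normal forms.  The right factor is an
  argument of \<open>e\<close>, because \<open>F\<close> turns it into an argument of the cochain that is evaluated.\<close>
definition eval_gen :: "(('v, 'e) qpath \<Rightarrow> ('v, 'e, 'k) pa \<Rightarrow> ('v, 'e, 'k) pa) \<Rightarrow>
    ('v, 'e, 'k) triples \<Rightarrow> ('v, 'e, 'k) pa" where
  "eval_gen e = lin (\<lambda>(q, w, r). nf (bas q \<odot> e w (bas r)))"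

lemma islin_eval_gen [simp]: "islin (eval_gen e)" by (simp add: eval_gen_def)

lemma eval_gen_tri:
  assumes "islin (e w)" "\<And>q. q \<in> supp x \<Longrightarrow> tgt q = src w"
    "\<And>r. r \<in> supp z \<Longrightarrow> src r = tgt w"
  shows "eval_gen e (tri x w z) = nf (x \<odot> e w z)"
proof -
  have "eval_gen e (tri x w z) = lin (\<lambda>q. lin (\<lambda>r. eval_gen e (if tgt q = src w \<and> tgt w = src r then bas (q, w, r) else 0)) z) x"
    by (simp add: tri_def islin_comp_lin[OF islin_eval_gen])
  also have "\<dots> = lin (\<lambda>q. lin (\<lambda>r. nf (bas q \<odot> e w (bas r))) z) x"
    by (intro lin_cong) (simp add: assms eval_gen_def)
  also have "\<dots> = lin (\<lambda>q. nf (bas q \<odot> e w z)) x"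
  proof (rule lin_cong)
    fix q
    have "islin (\<lambda>z. nf (bas q \<odot> e w z))"
      by (intro islin_compose[OF islin_nf] islin_compose[OF pa_mult_islin2] assms(1))
    from islin_expand[OF this, of z] show "lin (\<lambda>r. nf (bas q \<odot> e w (bas r))) z = nf (bas q \<odot> e w z)" by simp
  qed
  also have "\<dots> = nf (x \<odot> e w z)"
  proof -
    have "islin (\<lambda>x. nf (x \<odot> e w z))" by (rule islin_compose[OF islin_nf pa_mult_islin1])
    from islin_expand[OF this, of x] show ?thesis by simp
  qed
  finally show ?thesis .
qed

text \<open>One half of the Gerstenhaber bracket of the cochains \<open>(a, b) \<mapsto> M\<^sub>i(a b)\<close>, see \<open>bracket_coch3\<close>.\<close>
definition assoc_op :: "(('v, 'e, 'k) pa \<Rightarrow> ('v, 'e, 'k) pa) \<Rightarrow> (('v, 'e, 'k) pa \<Rightarrow> ('v, 'e, 'k) pa) \<Rightarrow>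
    ('v, 'e, 'k) pa \<Rightarrow> ('v, 'e, 'k) pa \<Rightarrow> ('v, 'e, 'k) pa \<Rightarrow> ('v, 'e, 'k) pa" where
  "assoc_op M1 M2 x y z = M1 (x \<odot> M2 (y \<odot> z)) - M1 (M2 (x \<odot> y) \<odot> z)"

text \<open>The cochain \<open>assoc_op M1 M2\<close> composed with \<open>F\<^sub>1\<close> and with the splitting of \<open>p\<close> at its arrows.\<close>
definition arrow_assoc :: "(('v, 'e, 'k) pa \<Rightarrow> ('v, 'e, 'k) pa) \<Rightarrow> (('v, 'e, 'k) pa \<Rightarrow> ('v, 'e, 'k) pa) \<Rightarrow>
    ('v, 'e) qpath \<Rightarrow> ('v, 'e, 'k) pa \<Rightarrow> ('v, 'e, 'k) pa" where
  "arrow_assoc M1 M2 p b = asum (\<lambda>q y r. nf (bas q \<odot> assoc_op M1 M2 (bas y) (nf (bas r)) b)) p"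

text \<open>The cochain \<open>assoc_op M1 M2\<close> composed with \<open>F\<^sub>2\<close>; the difference comes from \<open>\<partial>\<^sub>2\<close>, which sends
  \<open>s\<close> to the splitting of \<open>s\<close> minus that of \<open>\<phi> s\<close>.\<close>
definition rel_assoc :: "(('v, 'e, 'k) pa \<Rightarrow> ('v, 'e, 'k) pa) \<Rightarrow> (('v, 'e, 'k) pa \<Rightarrow> ('v, 'e, 'k) pa) \<Rightarrow>
    ('v, 'e) qpath \<Rightarrow> ('v, 'e, 'k) pa \<Rightarrow> ('v, 'e, 'k) pa" where
  "rel_assoc M1 M2 s b = arrow_assoc M1 M2 s b - lin (\<lambda>p. arrow_assoc M1 M2 p b) (\<phi> s)"

text \<open>The homotopy \<open>h\<close> applied to the associator; the two terms come from \<open>F\<^sub>1G\<^sub>1\<close> and \<open>F\<^sub>2G\<^sub>2\<close>.\<close>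
definition homotopy_assoc :: "(('v, 'e, 'k) pa \<Rightarrow> ('v, 'e, 'k) pa) \<Rightarrow> (('v, 'e, 'k) pa \<Rightarrow> ('v, 'e, 'k) pa) \<Rightarrow>
    ('v, 'e, 'k) pa \<Rightarrow> ('v, 'e, 'k) pa \<Rightarrow> ('v, 'e, 'k) pa" where
  "homotopy_assoc M1 M2 a b = lin (\<lambda>p. arrow_assoc M1 M2 p b) a - eval_gen (rel_assoc M1 M2) (Theta (lin asplit (a \<odot> b)))"

lemma islin_Aop3: assumes "islin M1" "islin M2" shows "islin (\<lambda>z. assoc_op M1 M2 x y z)"
  unfolding assoc_op_def
  by (rule islin_minus[OF
        islin_compose[OF assms(1) islin_compose[OF pa_mult_islin2[of x] islin_compose[OF assms(2) pa_mult_islin2[of y]]]]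
        islin_compose[OF assms(1) pa_mult_islin2[of "M2 (x \<odot> y)"]]])

lemma islin_arrow_assoc: "islin M1 \<Longrightarrow> islin M2 \<Longrightarrow> islin (\<lambda>b. arrow_assoc M1 M2 p b)"
  unfolding arrow_assoc_def asum_def case_prod_unfold
  by (intro islin_sum_fun islin_compose[OF islin_nf] islin_compose[OF pa_mult_islin2] islin_Aop3)

lemma islin_rel_assoc: "islin M1 \<Longrightarrow> islin M2 \<Longrightarrow> islin (rel_assoc M1 M2 s)"
  unfolding rel_assoc_def[abs_def] by (intro islin_minus islin_lin_arg islin_arrow_assoc)

lemma mult_parallel_src:
  assumes "\<And>u. u \<in> supp x \<Longrightarrow> src u = v" shows "bas (triv v) \<odot> x = x"
proof -
  have "bas (triv v) \<odot> x = lin (\<lambda>u. bas (triv v) \<odot> bas u) x" by (rule islin_expand) simp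
  also have "\<dots> = lin bas x" by (rule lin_cong) (use assms in \<open>simp add: pa_mult_bas\<close>)
  finally show ?thesis by simp
qed

lemma mult_parallel_tgt:
  assumes "\<And>u. u \<in> supp x \<Longrightarrow> tgt u = v" shows "x \<odot> bas (triv v) = x"
proof -
  have "x \<odot> bas (triv v) = lin (\<lambda>u. bas u \<odot> bas (triv v)) x" by (rule islin_expand[of "\<lambda>x. x \<odot> bas (triv v)"]) simp
  also have "\<dots> = lin bas x" by (rule lin_cong) (use assms in \<open>simp add: pa_mult_bas\<close>)
  finally show ?thesis by simp
qed

lemma polred_triv_left:
  assumes "adms fs" "x \<in> CQ" shows "polred fs (bas (triv v) \<odot> x) = bas (triv v) \<odot> polred fs x"
proof (rule islin_eqI[of "\<lambda>x. polred fs (bas (triv v) \<odot> x)" "\<lambda>x. bas (triv v) \<odot> polred fs x"])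
  fix p assume "p \<in> supp x"
  then have p: "p \<in> QP" using assms by (auto simp: CQ_iff)
  have k: "src u = src p" if "u \<in> supp (polred fs (bas p))" for u
    using polred_parallel[OF assms(1) p] that by auto
  show "polred fs (bas (triv v) \<odot> bas p) = bas (triv v) \<odot> polred fs (bas p)"
  proof (cases "v = src p")
    case True
    then show ?thesis using mult_parallel_src[of "polred fs (bas p)" v] k by (simp add: pa_mult_bas)
  next
    case False
    then show ?thesis using pa_mult_eq_0[of "polred fs (bas p)" "triv v"] k
      by (simp add: pa_mult_bas islin_zero[OF islin_polred])
  qed
qed (intro islin_compose[OF islin_polred] islin_compose[OF pa_mult_islin2] pa_mult_islin2 islin_polred)+

lemma polred_triv_right:
  assumes "adms fs" "x \<in> CQ" shows "polred fs (x \<odot> bas (triv v)) = polred fs x \<odot> bas (triv v)"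
proof (rule islin_eqI[of "\<lambda>x. polred fs (x \<odot> bas (triv v))" "\<lambda>x. polred fs x \<odot> bas (triv v)"])
  fix p assume "p \<in> supp x"
  then have p: "p \<in> QP" using assms by (auto simp: CQ_iff)
  have k: "tgt u = tgt p" if "u \<in> supp (polred fs (bas p))" for u
    using polred_parallel[OF assms(1) p] that by auto
  show "polred fs (bas p \<odot> bas (triv v)) = polred fs (bas p) \<odot> bas (triv v)"
  proof (cases "tgt p = v")
    case True
    then show ?thesis using mult_parallel_tgt[of "polred fs (bas p)" v] k by (simp add: pa_mult_bas)
  next
    case False
    then show ?thesis using pa_mult_eq_0'[of "polred fs (bas p)" "triv v"] k
      by (simp add: pa_mult_bas islin_zero[OF islin_polred])
  qed
qed (intro islin_compose[OF islin_polred] islin_compose[OF pa_mult_islin1] pa_mult_islin1 islin_polred)+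

lemma triv_mult_kIrr: "b \<in> kIrr \<Longrightarrow> bas (triv v) \<odot> b \<in> kIrr"
proof -
  assume b: "b \<in> kIrr"
  have "bas (triv v) \<odot> b = lin (\<lambda>u. bas (triv v) \<odot> bas u) b" by (rule islin_expand) simp
  also have "\<dots> \<in> kIrr" by (rule kIrr_lin) (use b in \<open>auto simp: kIrr_iff pa_mult_bas\<close>)
  finally show ?thesis .
qed

text \<open>The properties of \<open>polred fs\<close> used below: it is a \<open>\<k>Q\<^sub>0\<close>-bimodule map into \<open>\<k>Irr\<close>.\<close>
definition goodM :: "(('v, 'e, 'k) pa \<Rightarrow> ('v, 'e, 'k) pa) \<Rightarrow> bool" where
  "goodM M \<longleftrightarrow> islin M \<and> (\<forall>x\<in>CQ. M x \<in> kIrr \<and>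
     (\<forall>v. M (bas (triv v) \<odot> x) = bas (triv v) \<odot> M x \<and> M (x \<odot> bas (triv v)) = M x \<odot> bas (triv v)))"

lemma goodM_polred: "adms fs \<Longrightarrow> goodM (polred fs)"
  by (simp add: goodM_def polred_kIrr polred_triv_left polred_triv_right)

lemma goodM_D:
  assumes "goodM M"
  shows "islin M" "x \<in> CQ \<Longrightarrow> M x \<in> kIrr" "x \<in> CQ \<Longrightarrow> M x \<in> CQ"
    "x \<in> CQ \<Longrightarrow> M (bas (triv v) \<odot> x) = bas (triv v) \<odot> M x"
    "x \<in> CQ \<Longrightarrow> M (x \<odot> bas (triv v)) = M x \<odot> bas (triv v)"
  using assms kIrr_CQ unfolding goodM_def by auto

lemma bas_triv_src: "bas (triv (src p)) \<odot> bas p = bas p" and bas_triv_tgt: "bas p \<odot> bas (triv (tgt p)) = bas p"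
  by (simp_all add: pa_mult_bas)

lemma assoc_op_props:
  assumes "goodM M1" "goodM M2" "x \<in> CQ" "y \<in> CQ" "z \<in> CQ"
  shows "assoc_op M1 M2 x y z \<in> kIrr" "assoc_op M1 M2 (bas (triv v) \<odot> x) y z = bas (triv v) \<odot> assoc_op M1 M2 x y z"
    "assoc_op M1 M2 x y (z \<odot> bas (triv v)) = assoc_op M1 M2 x y z \<odot> bas (triv v)"
proof -
  note a = goodM_D[OF assms(1)] and b = goodM_D[OF assms(2)]
  have 1: "x \<odot> M2 (y \<odot> z) \<in> CQ" "M2 (x \<odot> y) \<odot> z \<in> CQ" "x \<odot> y \<in> CQ" "y \<odot> z \<in> CQ"
    using assms by (auto intro!: CQ_mult b(3))
  show "assoc_op M1 M2 x y z \<in> kIrr" unfolding assoc_op_def by (intro kIrr_diff a(2) 1)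
  show "assoc_op M1 M2 (bas (triv v) \<odot> x) y z = bas (triv v) \<odot> assoc_op M1 M2 x y z"
    unfolding assoc_op_def by (simp add: pa_mult_assoc a(4) b(4) 1 pa_mult_diff_right)
  show "assoc_op M1 M2 x y (z \<odot> bas (triv v)) = assoc_op M1 M2 x y z \<odot> bas (triv v)"
    unfolding assoc_op_def using 1 by (simp add: pa_mult_assoc[symmetric] a(5) b(5) pa_mult_diff_left)
qed

lemma nf_mult_asum:
  assumes "y \<in> arw" "p \<in> QP" "tgt y = src p"
    "\<And>q x r. \<lbrakk>q \<in> QP; x \<in> arw; r \<in> QP\<rbrakk> \<Longrightarrow> g x r \<in> CQ"
  shows "asum (\<lambda>q x r. nf (bas (pcomp y q) \<odot> g x r)) p = nf (bas y \<odot> asum (\<lambda>q x r. nf (bas q \<odot> g x r)) p)"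
proof -
  have "islin (\<lambda>z. nf (bas y \<odot> z))" by (rule islin_compose[OF islin_nf pa_mult_islin2])
  from asum_islin[OF this] have "nf (bas y \<odot> asum (\<lambda>q x r. nf (bas q \<odot> g x r)) p) = asum (\<lambda>q x r. nf (bas y \<odot> nf (bas q \<odot> g x r))) p" .
  also have "\<dots> = asum (\<lambda>q x r. nf (bas (pcomp y q) \<odot> g x r)) p"
  proof (rule asum_cong)
    fix q x r assume o: "q \<in> QP" "x \<in> arw" "r \<in> QP" "p = pcomp (pcomp q x) r"
    have "nf (bas y \<odot> nf (bas q \<odot> g x r)) = nf (bas y \<odot> (bas q \<odot> g x r))"
      by (rule nf_mult_right[OF CQ_bas[OF arw_QP[OF assms(1)]] CQ_mult[OF CQ_bas[OF o(1)] assms(4)[OF o(1-3)]]])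
    then show "nf (bas y \<odot> nf (bas q \<odot> g x r)) = nf (bas (pcomp y q) \<odot> g x r)"
      using assms(3) o by (simp add: pa_mult_assoc[symmetric] pa_mult_bas)
  qed
  finally show ?thesis by simp
qed

lemma arrow_assoc_arrow:
  assumes "goodM M1" "goodM M2" "y \<in> arw" "p \<in> QP" "tgt y = src p" "b \<in> CQ"
  shows "arrow_assoc M1 M2 (pcomp y p) b = assoc_op M1 M2 (bas y) (nf (bas p)) b + nf (bas y \<odot> arrow_assoc M1 M2 p b)"
proof -
  have yC: "bas y \<in> CQ" using assms by (simp add: CQ_bas arw_QP)
  have "bas (triv (src y)) \<odot> assoc_op M1 M2 (bas y) (nf (bas p)) b = assoc_op M1 M2 (bas y) (nf (bas p)) b"
    using assoc_op_props(2)[OF assms(1,2) yC nf_CQ[OF CQ_bas[OF assms(4)]] assms(6), of "src y"] by (simp add: bas_triv_src)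
  then have "nf (bas (triv (src y)) \<odot> assoc_op M1 M2 (bas y) (nf (bas p)) b) = assoc_op M1 M2 (bas y) (nf (bas p)) b"
    using assoc_op_props(1)[OF assms(1,2) yC nf_CQ[OF CQ_bas[OF assms(4)]] assms(6)] by (simp add: nf_id)
  moreover have "asum (\<lambda>q x r. nf (bas (pcomp y q) \<odot> assoc_op M1 M2 (bas x) (nf (bas r)) b)) p = nf (bas y \<odot> arrow_assoc M1 M2 p b)"
    unfolding arrow_assoc_def
    by (rule nf_mult_asum[OF assms(3-5)])
      (rule kIrr_CQ, rule assoc_op_props(1)[OF assms(1,2)], simp_all add: CQ_bas arw_QP nf_CQ assms(6))
  ultimately show ?thesis unfolding arrow_assoc_def asum_arw_pcomp[OF assms(3-5)] by simp
qed

text \<open>What the telescoping sum \<open>sum_arrow_assoc\<close> leaves behind: at each arrow \<open>y\<close> the summand of \<open>polred_mult\<close> in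
  which no entry of \<open>fs\<close> is used for the factor to the right of \<open>y\<close>.\<close>
definition arrow_polred :: "(('v, 'e) qpath \<Rightarrow> ('v, 'e, 'k) pa) list \<Rightarrow> ('v, 'e) qpath \<Rightarrow> ('v, 'e, 'k) pa \<Rightarrow> ('v, 'e, 'k) pa" where
  "arrow_polred fs p b = asum (\<lambda>q y r. nf (bas q \<odot> polred fs (bas y \<odot> nf (bas r \<odot> b)))) p"

lemma islin_arrow_polred: "islin (arrow_polred fs p)"
  unfolding arrow_polred_def[abs_def] asum_def case_prod_unfold
  by (intro islin_sum_fun islin_compose[OF islin_nf] islin_compose[OF pa_mult_islin2] islin_compose[OF islin_polred]
      islin_compose[OF islin_nf] pa_mult_islin2)

lemma adms_take: "adms fs \<Longrightarrow> adms (take i fs)" and adms_drop: "adms fs \<Longrightarrow> adms (drop i fs)"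
  using set_take_subset[of i fs] set_drop_subset[of i fs] by blast+

lemma arrow_polred_arrow:
  assumes "adms fs" "y \<in> arw" "p \<in> QP" "tgt y = src p" "b \<in> CQ"
  shows "arrow_polred fs (pcomp y p) b = polred fs (bas y \<odot> nf (bas p \<odot> b)) + nf (bas y \<odot> arrow_polred fs p b)"
proof -
  have yC: "bas y \<in> CQ" using assms by (simp add: CQ_bas arw_QP)
  have c: "bas y \<odot> nf (bas r \<odot> b) \<in> CQ" if "y \<in> arw" "r \<in> QP" for y r
    by (rule CQ_mult[OF CQ_bas[OF arw_QP[OF that(1)]] nf_CQ[OF CQ_mult[OF CQ_bas[OF that(2)] assms(5)]]])
  let ?z = "polred fs (bas y \<odot> nf (bas p \<odot> b))"
  have "bas (triv (src y)) \<odot> ?z = ?z"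
    using polred_triv_left[OF assms(1) c[OF assms(2,3)], of "src y"] by (simp add: pa_mult_assoc[symmetric] bas_triv_src)
  then have "nf (bas (triv (src y)) \<odot> ?z) = ?z"
    using polred_kIrr[OF assms(1) c[OF assms(2,3)]] by (simp add: nf_id)
  moreover have "asum (\<lambda>q x r. nf (bas (pcomp y q) \<odot> polred fs (bas x \<odot> nf (bas r \<odot> b)))) p = nf (bas y \<odot> arrow_polred fs p b)"
    unfolding arrow_polred_def by (rule nf_mult_asum[OF assms(2-4)]) (intro polred_CQ[OF assms(1)] c)
  ultimately show ?thesis unfolding arrow_polred_def asum_arw_pcomp[OF assms(2-4)] by simp
qed

lemma arrow_polred_killed:
  assumes "fs \<noteq> []" "p \<in> QP" "r \<in> QP" "tgt p = src r" "pcomp p r \<in> Irr"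
  shows "arrow_polred fs p (bas r) = 0"
proof -
  have "arrow_polred fs p (bas r) = asum (\<lambda>q y r. 0) p"
    unfolding arrow_polred_def
  proof (rule asum_cong)
    fix q y r1 assume o: "q \<in> QP" "y \<in> arw" "r1 \<in> QP" "tgt q = src y" "tgt y = src r1" "p = pcomp (pcomp q y) r1"
    have yQ: "y \<in> QP" using o arw_QP by blast
    have r1r: "pcomp r1 r \<in> QP" by (rule pcomp_QP) (use o assms in simp_all)
    have "pcomp q (pcomp y (pcomp r1 r)) \<in> Irr" using assms o by (simp add: pcomp_assoc)
    then have yr: "pcomp y (pcomp r1 r) \<in> Irr"
      by (rule Irr_subpath) (use o yQ r1r in \<open>simp_all add: pcomp_QP\<close>)
    have "pcomp r1 r \<in> Irr" by (rule Irr_subpath(2)[OF yr yQ r1r]) (use o in simp)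
    then have "nf (bas r1 \<odot> bas r) = bas (pcomp r1 r)" using o assms by (simp add: pa_mult_bas nf_Irr)
    then have "polred fs (bas y \<odot> nf (bas r1 \<odot> bas r)) = 0"
      using polred_on_kIrr[OF kIrr_bas[OF yr], of fs] assms o by (simp add: pa_mult_bas)
    then show "nf (bas q \<odot> polred fs (bas y \<odot> nf (bas r1 \<odot> bas r))) = 0" by (simp add: islin_zero[OF islin_nf])
  qed
  then show ?thesis by (simp add: asum_zero)
qed

lemma triv_rightmost_S: "s \<in> S \<Longrightarrow> (triv (src s), s, triv (tgt s)) \<in> rightmost S s"
  unfolding rightmost_iff using QP_verts[OF S_QP] by (simp add: occs_iff triv_QP)

lemma triv_sandwich:
  assumes "supp x \<subseteq> {u \<in> Irr. src u = v \<and> tgt u = w}"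
  shows "bas (triv v) \<odot> x = x" "x \<odot> bas (triv w) = x"
  using assms by (auto intro!: mult_parallel_src mult_parallel_tgt)

lemma polred_S:
  assumes "adms (f # gs)" "s \<in> S" shows "polred (f # gs) (bas s) = (if gs = [] then f s else 0)"
proof -
  have f: "adm f" using assms by simp
  have k: "supp (f s) \<subseteq> irr_par s"
    using f assms(2) by (simp add: adm_def)
  show ?thesis
    using polred_step[OF assms(1) triv_rightmost_S[OF assms(2)]]
    by (simp add: triv_sandwich[OF k] triv_sandwich[OF phi_keys[OF assms(2)]] polred_on_kIrr phi_kIrr assms adm_kIrr[OF f])
qed

text \<open>Induction along the arrows of \<open>p = y p'\<close>.  By \<open>polred_mult\<close> the first halves of the associators at \<open>y\<close>
  add up to \<open>polred fs (y p' b)\<close> up to the two extreme summands.  One of these is the summand of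
  \<open>arrow_polred\<close> at \<open>y\<close>, the other cancels against the induction hypothesis.  The second halves contain
  \<open>polred (take i fs) p\<close>.  This vanishes for irreducible \<open>p\<close>, while for \<open>p \<in> S\<close> exactly the one with
  \<open>i = 1\<close> survives, because \<open>f1 p\<close> is irreducible.\<close>
lemma sum_arrow_assoc:
  assumes fs: "fs = f1 # fs'" "fs' \<noteq> []" "adms fs" and b: "b \<in> kIrr"
  shows "p \<in> Irr \<Longrightarrow> (\<Sum>i\<in>{1..<length fs}. arrow_assoc (polred (drop i fs)) (polred (take i fs)) p b) = polred fs (bas p \<odot> b) - arrow_polred fs p b" (is "_ \<Longrightarrow> ?P p")
    and "p \<in> S \<Longrightarrow> (\<Sum>i\<in>{1..<length fs}. arrow_assoc (polred (drop i fs)) (polred (take i fs)) p b)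
      = polred fs (bas p \<odot> b) - arrow_polred fs p b - polred fs' (f1 p \<odot> b)"
proof -
  let ?k = "length fs"
  let ?D = "\<lambda>i. polred (drop i fs)" and ?T = "\<lambda>i. polred (take i fs)"
  have bC: "b \<in> CQ" by (rule kIrr_CQ[OF b])
  have g: "goodM (?D i)" "goodM (?T i)" for i using goodM_polred[OF adms_drop[OF fs(3)]] goodM_polred[OF adms_take[OF fs(3)]] by auto
  have arr: "(\<Sum>i\<in>{1..<?k}. arrow_assoc (?D i) (?T i) (pcomp y p) b)
      = polred fs (bas (pcomp y p) \<odot> b) - arrow_polred fs (pcomp y p) b - (\<Sum>i\<in>{1..<?k}. ?D i (?T i (bas (pcomp y p)) \<odot> b))"
    if y: "y \<in> arw" "p \<in> Irr" "tgt y = src p" "?P p" for y p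
  proof -
    have pQ: "p \<in> QP" by (rule Irr_QP[OF y(2)])
    have pb: "bas p \<odot> b \<in> CQ" using pQ bC by (intro CQ_mult CQ_bas)
    have "(\<Sum>i\<in>{1..<?k}. arrow_assoc (?D i) (?T i) (pcomp y p) b)
       = (\<Sum>i\<in>{1..<?k}. assoc_op (?D i) (?T i) (bas y) (bas p) b) + nf (bas y \<odot> (\<Sum>i\<in>{1..<?k}. arrow_assoc (?D i) (?T i) p b))"
      using arrow_assoc_arrow[OF g y(1) pQ y(3) bC] by (simp add: sum.distrib nf_Irr[OF y(2)] pa_mult_sum_right islin_sum[OF islin_nf])
    also have "(\<Sum>i\<in>{1..<?k}. assoc_op (?D i) (?T i) (bas y) (bas p) b)
       = (\<Sum>i\<in>{1..<?k}. ?D i (bas y \<odot> ?T i (bas p \<odot> b))) - (\<Sum>i\<in>{1..<?k}. ?D i (?T i (bas (pcomp y p)) \<odot> b))"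
      using y by (simp add: assoc_op_def sum_subtractf pa_mult_bas)
    also have "(\<Sum>i\<in>{1..<?k}. ?D i (bas y \<odot> ?T i (bas p \<odot> b)))
       = polred fs (bas (pcomp y p) \<odot> b) - polred fs (bas y \<odot> nf (bas p \<odot> b)) - nf (bas y \<odot> polred fs (bas p \<odot> b))"
    proof -
      have yp: "bas (pcomp y p) \<odot> b = bas y \<odot> (bas p \<odot> b)" using y by (simp add: pa_mult_assoc[symmetric] pa_mult_bas)
      \<comment> \<open>the summands \<open>i = 0\<close> and \<open>i = length fs\<close> of \<open>polred_mult\<close> have no counterpart among the associators\<close>
      have "{..?k} = insert 0 (insert ?k {1..<?k})" using fs(1) by auto
      then have "polred fs (bas y \<odot> (bas p \<odot> b)) = ?D 0 (bas y \<odot> ?T 0 (bas p \<odot> b)) + (?D ?k (bas y \<odot> ?T ?k (bas p \<odot> b))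
          + (\<Sum>i\<in>{1..<?k}. ?D i (bas y \<odot> ?T i (bas p \<odot> b))))"
        unfolding polred_mult[OF fs(3) arw_QP[OF y(1)] pb] using fs(1) by simp
      moreover have "bas y \<odot> polred fs (bas p \<odot> b) \<in> CQ" by (intro CQ_mult CQ_bas arw_QP y polred_CQ fs pb)
      ultimately show ?thesis unfolding yp by (simp add: polred_nil[OF pb] polred_nil)
    qed
    also have "(\<Sum>i\<in>{1..<?k}. arrow_assoc (?D i) (?T i) p b) = polred fs (bas p \<odot> b) - arrow_polred fs p b" by (rule y(4))
    finally show ?thesis
      using arrow_polred_arrow[OF fs(3) y(1) pQ y(3) bC] by (simp add: pa_mult_diff_right islin_diff[OF islin_nf] algebra_simps)
  qed
  have irr: "?P p" if "p \<in> Irr" for p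
    using Irr_QP[OF that] that
  proof (induction p rule: path_induct)
    case (triv v)
    then show ?case using triv_mult_kIrr[OF b, of v] fs by (simp add: arrow_assoc_def arrow_polred_def polred_on_kIrr)
  next
    case (arrow y p)
    then have p: "p \<in> Irr" using Irr_subpath(2)[OF arrow(5) arw_QP[OF arrow(1)]] by simp
    have "?D i (?T i (bas (pcomp y p)) \<odot> b) = 0" if "i \<in> {1..<?k}" for i
    proof -
      have "take i fs \<noteq> []" using that fs by auto
      then show ?thesis using polred_on_kIrr[OF kIrr_bas[OF arrow(5)], of "take i fs"] by (simp add: islin_zero[OF islin_polred])
    qed
    then show ?case using arr[OF arrow(1) p arrow(3)] arrow(4)[OF p] by simp
  qed
  then show "p \<in> Irr \<Longrightarrow> ?P p" by simp
  assume p: "p \<in> S"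
  obtain y p' where y: "y \<in> arw" "p' \<in> QP" "tgt y = src p'" "p = pcomp y p'" using S_cases[OF p] by metis
  have "pcomp p' (triv (tgt p)) \<in> Irr"
    by (rule rightmost_tail[OF triv_rightmost_S[OF p] y(4)]) (use y arw_QP arw_plen in simp_all)
  then have p': "p' \<in> Irr" using y by simp
  have "?D i (?T i (bas p) \<odot> b) = (if i = 1 then polred fs' (f1 p \<odot> b) else 0)" if i: "i \<in> {1..<?k}" for i
  proof -
    obtain j where j: "i = Suc j" "j < length fs'" using i fs by (cases i) auto
    have a: "adms (f1 # take j fs')" using adms_take[OF fs(3), of i] j fs(1) by simp
    have "take j fs' = [] \<longleftrightarrow> j = 0" using j by auto
    then show ?thesis using polred_S[OF a p] j fs(1) by (auto simp: islin_zero[OF islin_polred])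
  qed
  then have "(\<Sum>i\<in>{1..<?k}. ?D i (?T i (bas p) \<odot> b)) = (\<Sum>i\<in>{1..<?k}. if i = 1 then polred fs' (f1 p \<odot> b) else 0)"
    by (rule sum.cong[OF refl])
  also have "\<dots> = polred fs' (f1 p \<odot> b)"
  proof -
    have "1 \<in> {1..<?k}" using fs by (cases fs') auto
    then show ?thesis by simp
  qed
  finally show "(\<Sum>i\<in>{1..<?k}. arrow_assoc (?D i) (?T i) p b) = polred fs (bas p \<odot> b) - arrow_polred fs p b - polred fs' (f1 p \<odot> b)"
    using arr[OF y(1) p' y(3) irr[OF p']] y(4) by simp
qed

text \<open>Evaluating the arrow splitting with this map gives \<open>arrow_polred\<close>.\<close>
definition left_polred :: "(('v, 'e) qpath \<Rightarrow> ('v, 'e, 'k) pa) list \<Rightarrow> ('v, 'e) qpath \<Rightarrow> ('v, 'e, 'k) pa \<Rightarrow> ('v, 'e, 'k) pa" where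
  "left_polred fs y z = polred fs (bas y \<odot> z)"

lemma islin_left_polred: "islin (left_polred fs y)"
  unfolding left_polred_def[abs_def] by (rule islin_compose[OF islin_polred pa_mult_islin2])

lemma left_polred_killed:
  assumes "fs \<noteq> []" "tgt y = src u" "pcomp y u \<in> Irr" shows "eval_gen (left_polred fs) (tri x y (bas u)) = 0"
proof -
  have "eval_gen (left_polred fs) (tri x y (bas u)) = lin (\<lambda>q. eval_gen (left_polred fs) (tri (bas q) y (bas u))) x"
    using tri_expand1[of x y "bas u"] by (simp add: islin_comp_lin[OF islin_eval_gen])
  also have "\<dots> = lin (\<lambda>q. 0) x"
    by (rule lin_cong) (use assms polred_on_kIrr[OF kIrr_bas[OF assms(3)], of fs] in
        \<open>simp add: tri_bas eval_gen_def left_polred_def pa_mult_bas islin_zero[OF islin_nf]\<close>)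
  finally show ?thesis by simp
qed

lemma eval_gen_left_polred_step:
  assumes fs: "fs \<noteq> []" "adms fs" and t: "(q, s, r) \<in> rightmost S p"
  shows "eval_gen (left_polred fs) (asplit p) = eval_gen (left_polred fs) (lin asplit (bas q \<odot> \<phi> s \<odot> bas r))
    + nf (bas q \<odot> (arrow_polred fs s (bas r) - lin (\<lambda>u. arrow_polred fs u (bas r)) (\<phi> s)))"
proof -
  note d = rightmostD[OF t]
  obtain x s' where s: "x \<in> arw" "s' \<in> QP" "tgt x = src s'" "s = pcomp x s'" using S_cases[OF d(2)] by metis
  have xQ: "x \<in> QP" "plen x > 0" using s arw_QP arw_plen by auto
  have s'r: "pcomp s' r \<in> Irr" by (rule rightmost_tail[OF t s(4) xQ s(2,3)])
  have ts: "tgt s' = src r" using s d by simp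
  have qC: "bas q \<in> CQ" using d by (simp add: CQ_bas)
  have us: "arrow_polred fs s (bas r) = polred fs (bas x \<odot> bas (pcomp s' r))"
    using arrow_polred_arrow[OF fs(2) s(1,2,3) CQ_bas[OF d(3)]] arrow_polred_killed[OF fs(1) s(2) d(3) ts s'r] s(4) ts
    by (simp add: pa_mult_bas nf_Irr[OF s'r] islin_zero[OF islin_nf])
  have "polred fs (bas x \<odot> bas (pcomp s' r)) \<in> CQ"
    by (intro polred_CQ fs CQ_mult CQ_bas xQ Irr_QP[OF s'r])
  then have B: "eval_gen (left_polred fs) (tri (nf (bas q)) x (bas (pcomp s' r))) = nf (bas q \<odot> arrow_polred fs s (bas r))"
    unfolding us using nf_parallel(3)[OF d(1)] d(4) s(3,4)
    by (subst eval_gen_tri) (simp_all add: islin_left_polred left_polred_def nf_mult_left[OF qC])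
  have U: "eval_gen (left_polred fs) (asum (\<lambda>q' y t. tri (nf (bas q \<odot> bas q')) y (nf (bas t \<odot> bas r))) u) = nf (bas q \<odot> arrow_polred fs u (bas r))"
    if u: "u \<in> supp (\<phi> s)" for u
  proof -
    have u': "u \<in> QP" "src u = src s" "tgt u = tgt s" using phi_path[OF d(2) u] by simp_all
    have lin: "islin (\<lambda>z. nf (bas q \<odot> z))" by (rule islin_compose[OF islin_nf pa_mult_islin2])
    show ?thesis
      unfolding arrow_polred_def asum_islin[OF islin_eval_gen] asum_islin[OF lin]
    proof (rule asum_cong)
      fix q' y t assume o: "q' \<in> QP" "y \<in> arw" "t \<in> QP" "tgt q' = src y" "tgt y = src t" "u = pcomp (pcomp q' y) t"
      have qq: "pcomp q q' \<in> QP" "pcomp t r \<in> QP" "tgt q = src q'" "tgt t = src r" using o u' d by (auto intro!: pcomp_QP)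
      have C: "polred fs (bas y \<odot> nf (bas t \<odot> bas r)) \<in> CQ"
        by (intro polred_CQ fs CQ_mult nf_CQ CQ_bas arw_QP o d)
      have "eval_gen (left_polred fs) (tri (nf (bas q \<odot> bas q')) y (nf (bas t \<odot> bas r)))
        = nf (nf (bas q \<odot> bas q') \<odot> polred fs (bas y \<odot> nf (bas t \<odot> bas r)))"
        by (subst eval_gen_tri) (use qq o nf_parallel(3)[OF qq(1)] nf_parallel(2)[OF qq(2)] in \<open>simp_all add: islin_left_polred left_polred_def pa_mult_bas\<close>)
      also have "\<dots> = nf (bas q \<odot> bas q' \<odot> polred fs (bas y \<odot> nf (bas t \<odot> bas r)))"
        by (rule nf_mult_left[OF CQ_mult[OF qC CQ_bas[OF o(1)]] C])
      also have "\<dots> = nf (bas q \<odot> nf (bas q' \<odot> polred fs (bas y \<odot> nf (bas t \<odot> bas r))))"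
        using nf_mult_right[OF qC CQ_mult[OF CQ_bas[OF o(1)] C]] by (simp add: pa_mult_assoc)
      finally show "eval_gen (left_polred fs) (tri (nf (bas q \<odot> bas q')) y (nf (bas t \<odot> bas r))) = \<dots>" .
    qed
  qed
  have "eval_gen (left_polred fs) (lin (asum (\<lambda>q' y t. tri (nf (bas q \<odot> bas q')) y (nf (bas t \<odot> bas r)))) (\<phi> s))
    = lin (\<lambda>u. nf (bas q \<odot> arrow_polred fs u (bas r))) (\<phi> s)"
    unfolding islin_comp_lin[OF islin_eval_gen] by (rule lin_cong) (rule U)
  also have "\<dots> = nf (bas q \<odot> lin (\<lambda>u. arrow_polred fs u (bas r)) (\<phi> s))"
    by (rule islin_comp_lin[OF islin_compose[OF islin_nf pa_mult_islin2], symmetric])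
  finally show ?thesis
    using asplit_step[OF islin_eval_gen left_polred_killed[OF fs(1)] t s(4,1,2,3)] B
    by (simp add: pa_mult_diff_right islin_diff[OF islin_nf])
qed

lemma asum_CQ:
  assumes "\<And>q y r. \<lbrakk>q \<in> QP; y \<in> arw; r \<in> QP\<rbrakk> \<Longrightarrow> g q y r \<in> CQ" shows "asum g p \<in> CQ"
  unfolding asum_def
proof (rule CQ_sum)
  fix t assume t: "t \<in> occs arw p"
  obtain q y r where "t = (q, y, r)" by (cases t)
  then show "(case t of (q, y, r) \<Rightarrow> g q y r) \<in> CQ" using t assms by (simp add: occs_iff)
qed

lemma arrow_assoc_CQ: assumes "goodM M1" "goodM M2" "b \<in> CQ" shows "arrow_assoc M1 M2 p b \<in> CQ"
  unfolding arrow_assoc_def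
  by (rule asum_CQ, rule nf_CQ, rule CQ_mult, simp add: CQ_bas, rule kIrr_CQ, rule assoc_op_props(1)[OF assms(1,2)])
    (simp_all add: CQ_bas arw_QP nf_CQ assms(3))

lemma rel_assoc_CQ: assumes "goodM M1" "goodM M2" "b \<in> CQ" shows "rel_assoc M1 M2 s b \<in> CQ"
  unfolding rel_assoc_def by (intro CQ_diff CQ_lin arrow_assoc_CQ assms)

lemma eval_gen_sum: "eval_gen (\<lambda>s z. \<Sum>j\<in>J. e j s z) x = (\<Sum>j\<in>J. eval_gen (e j) x)"
  unfolding eval_gen_def lin_sum_fun[symmetric]
  by (rule lin_cong) (simp add: pa_mult_sum_right islin_sum[OF islin_nf] split: prod.split)

text \<open>Induction along the rightmost reduction: by \<open>Theta_step\<close> and \<open>eval_gen_left_polred_step\<close> both sides change by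
  the same amount in each step.  At a step \<open>(q, s, r)\<close> the terms \<open>polred fs (s r)\<close> and
  \<open>polred fs (\<phi> s r)\<close> differ by the term \<open>polred fs' (f1 s r)\<close> that \<open>sum_arrow_assoc\<close> leaves for \<open>s\<close>.\<close>
lemma rel_assoc_Theta:
  assumes fs: "fs = f1 # fs'" "fs' \<noteq> []" "adms fs" and p: "p \<in> QP"
  shows "eval_gen (\<lambda>s z. \<Sum>i\<in>{1..<length fs}. rel_assoc (polred (drop i fs)) (polred (take i fs)) s z) (Theta (asplit p)) = - eval_gen (left_polred fs) (asplit p)"
proof -
  let ?k = "\<lambda>s z. \<Sum>i\<in>{1..<length fs}. rel_assoc (polred (drop i fs)) (polred (take i fs)) s z"
  have ne: "fs \<noteq> []" using fs by simp
  have linS: "islin (\<lambda>x. Theta (lin asplit x))" by (rule islin_compose[OF islin_Theta islin_lin])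
  show ?thesis using p
  proof (induction p rule: wf_induct_rule[OF wf_rrel])
    case (1 p)
    show ?case
    proof (cases "p \<in> Irr")
      case True
      then show ?thesis
        using asplit_killed[OF islin_eval_gen left_polred_killed[OF ne] True] by (simp add: Theta_Irr islin_zero[OF islin_eval_gen])
    next
      case False
      obtain q s r where t: "(q, s, r) \<in> rightmost S p" using rightmost_ex[OF 1(2) False] by metis
      note d = rightmostD[OF t]
      let ?x0 = "bas q \<odot> \<phi> s \<odot> bas r"
      have rI: "r \<in> Irr" by (rule rightmost_Irr[OF t])
      have k: "?k s (bas r) = - (arrow_polred fs s (bas r) - lin (\<lambda>u. arrow_polred fs u (bas r)) (\<phi> s))"
      proof -
        have "?k s (bas r) = (\<Sum>i\<in>{1..<length fs}. arrow_assoc (polred (drop i fs)) (polred (take i fs)) s (bas r))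
            - lin (\<lambda>u. \<Sum>i\<in>{1..<length fs}. arrow_assoc (polred (drop i fs)) (polred (take i fs)) u (bas r)) (\<phi> s)"
          by (simp add: rel_assoc_def sum_subtractf lin_sum_fun)
        also have "lin (\<lambda>u. \<Sum>i\<in>{1..<length fs}. arrow_assoc (polred (drop i fs)) (polred (take i fs)) u (bas r)) (\<phi> s)
            = lin (\<lambda>u. polred fs (bas u \<odot> bas r) - arrow_polred fs u (bas r)) (\<phi> s)"
        proof (rule lin_cong)
          fix u assume "u \<in> supp (\<phi> s)"
          then have "u \<in> Irr" using phi_keys[OF d(2)] by blast
          then show "(\<Sum>i\<in>{1..<length fs}. arrow_assoc (polred (drop i fs)) (polred (take i fs)) u (bas r)) = polred fs (bas u \<odot> bas r) - arrow_polred fs u (bas r)"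
            by (rule sum_arrow_assoc(1)[OF fs kIrr_bas[OF rI]])
        qed
        also have "\<dots> = polred fs (\<phi> s \<odot> bas r) - lin (\<lambda>u. arrow_polred fs u (bas r)) (\<phi> s)"
          unfolding lin_diff_fun
          using islin_expand[of "\<lambda>z. polred fs (z \<odot> bas r)" "\<phi> s"] islin_compose[OF islin_polred pa_mult_islin1] by simp
        also have "(\<Sum>i\<in>{1..<length fs}. arrow_assoc (polred (drop i fs)) (polred (take i fs)) s (bas r))
            = polred fs (bas s \<odot> bas r) - arrow_polred fs s (bas r) - polred fs' (f1 s \<odot> bas r)"
          by (rule sum_arrow_assoc(2)[OF fs kIrr_bas[OF rI] d(2)])
        also have "polred fs (bas s \<odot> bas r) = polred fs (\<phi> s \<odot> bas r) + polred fs' (f1 s \<odot> bas r)"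
        proof -
          have "adm f1" using fs by simp
          then have "supp (f1 s) \<subseteq> irr_par s" using d(2) by (simp add: adm_def)
          then show ?thesis
            using polred_step[OF _ rightmost_drop[OF t], of f1 fs'] fs d(5)
              triv_sandwich(1)[OF phi_keys[OF d(2)]] triv_sandwich(1)[of "f1 s" "src s" "tgt s"]
            by (simp add: pa_mult_bas)
        qed
        finally show ?thesis by simp
      qed
      have ik: "islin (?k s)"
        by (intro islin_sum_fun islin_rel_assoc islin_polred)
      have E: "eval_gen ?k (tri (nf (bas q)) s (bas r)) = nf (bas q \<odot> ?k s (bas r))"
      proof -
        have kC: "?k s (bas r) \<in> CQ"
          by (intro CQ_sum rel_assoc_CQ goodM_polred adms_take adms_drop fs CQ_bas d)
        show ?thesis
          using eval_gen_tri[of ?k s "nf (bas q)" "bas r", OF ik] nf_parallel(3)[OF d(1)] d nf_mult_left[OF CQ_bas[OF d(1)] kC] by simp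
      qed
      have x0: "?x0 \<in> CQ" by (intro CQ_mult CQ_bas phi_CQ d)
      have IH: "eval_gen ?k (Theta (lin asplit ?x0)) = - eval_gen (left_polred fs) (lin asplit ?x0)"
      proof (rule islin_eqI[of "\<lambda>x. eval_gen ?k (Theta (lin asplit x))" "\<lambda>x. - eval_gen (left_polred fs) (lin asplit x)"])
        show "islin (\<lambda>x. eval_gen ?k (Theta (lin asplit x)))" by (rule islin_compose[OF islin_eval_gen linS])
        show "islin (\<lambda>x. - eval_gen (left_polred fs) (lin asplit x))" by (rule islin_neg[OF islin_compose[OF islin_eval_gen islin_lin]])
        fix u assume u: "u \<in> supp ?x0"
        then have "(u, p) \<in> rrel" using False 1(2) r0_rightmost[OF t] by (simp add: rrel_def)
        then show "eval_gen ?k (Theta (lin asplit (bas u))) = - eval_gen (left_polred fs) (lin asplit (bas u))" using 1(1) rrel_QP by simp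
      qed
      have "eval_gen ?k (Theta (asplit p)) = eval_gen ?k (tri (nf (bas q)) s (bas r)) + eval_gen ?k (Theta (lin asplit ?x0))"
        unfolding Theta_step[OF t] by (rule islin_add[OF islin_eval_gen])
      then show ?thesis
        unfolding E IH k eval_gen_left_polred_step[OF ne fs(3) t] by (simp add: pa_mult_diff_right islin_diff[OF islin_nf])
    qed
  qed
qed

text \<open>By \<open>sum_arrow_assoc\<close> the first term of the homotopy gives \<open>polred fs (a b)\<close> minus the \<open>arrow_polred\<close> of \<open>a\<close>,
  and by \<open>rel_assoc_Theta\<close> its second term gives this \<open>arrow_polred\<close> back: of the splitting of \<open>a b\<close> only
  the arrows in \<open>a\<close> matter, since paths in \<open>b\<close> are irreducible.\<close>
theorem polred_product_recursion:
  assumes fs: "fs = f1 # fs'" "fs' \<noteq> []" "adms fs" and a: "a \<in> kIrr" and b: "b \<in> kIrr"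
  shows "polred fs (a \<odot> b) = (\<Sum>i\<in>{1..<length fs}. homotopy_assoc (polred (drop i fs)) (polred (take i fs)) a b)"
proof -
  let ?J = "{1..<length fs}"
  let ?k = "\<lambda>s z. \<Sum>i\<in>?J. rel_assoc (polred (drop i fs)) (polred (take i fs)) s z"
  have ne: "fs \<noteq> []" using fs by simp
  have ab: "a \<odot> b \<in> CQ" by (intro CQ_mult kIrr_CQ a b)
  have linS: "islin (\<lambda>x. Theta (lin asplit x))" by (rule islin_compose[OF islin_Theta islin_lin])
  have "(\<Sum>i\<in>?J. homotopy_assoc (polred (drop i fs)) (polred (take i fs)) a b)
    = lin (\<lambda>p. \<Sum>i\<in>?J. arrow_assoc (polred (drop i fs)) (polred (take i fs)) p b) a - eval_gen ?k (Theta (lin asplit (a \<odot> b)))"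
    by (simp add: homotopy_assoc_def sum_subtractf lin_sum_fun eval_gen_sum)
  also have "lin (\<lambda>p. \<Sum>i\<in>?J. arrow_assoc (polred (drop i fs)) (polred (take i fs)) p b) a = lin (\<lambda>p. polred fs (bas p \<odot> b) - arrow_polred fs p b) a"
    by (rule lin_cong) (use a sum_arrow_assoc(1)[OF fs b] in \<open>auto simp: kIrr_iff\<close>)
  also have "\<dots> = polred fs (a \<odot> b) - lin (\<lambda>p. arrow_polred fs p b) a"
    unfolding lin_diff_fun using islin_expand[of "\<lambda>z. polred fs (z \<odot> b)" a] islin_compose[OF islin_polred pa_mult_islin1] by simp
  also have "eval_gen ?k (Theta (lin asplit (a \<odot> b))) = - eval_gen (left_polred fs) (lin asplit (a \<odot> b))"
  proof (rule islin_eqI[of "\<lambda>x. eval_gen ?k (Theta (lin asplit x))" "\<lambda>x. - eval_gen (left_polred fs) (lin asplit x)"])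
    show "islin (\<lambda>x. eval_gen ?k (Theta (lin asplit x)))" by (rule islin_compose[OF islin_eval_gen linS])
    show "islin (\<lambda>x. - eval_gen (left_polred fs) (lin asplit x))" by (rule islin_neg[OF islin_compose[OF islin_eval_gen islin_lin]])
  qed (use ab rel_assoc_Theta[OF fs] in \<open>auto simp: CQ_iff\<close>)
  also have "eval_gen (left_polred fs) (lin asplit (a \<odot> b)) = lin (\<lambda>p. arrow_polred fs p b) a"
  proof -
    have P: "eval_gen (left_polred fs) (lin asplit (bas p \<odot> bas r)) = arrow_polred fs p (bas r)" if p: "p \<in> Irr" and r: "r \<in> Irr" for p r
    proof (cases "tgt p = src r")
      case False
      have "arrow_polred fs p (bas r) = asum (\<lambda>q y r. 0) p" unfolding arrow_polred_def
        by (rule asum_cong) (use False in \<open>simp add: pa_mult_bas islin_zero[OF islin_nf] islin_zero[OF islin_polred]\<close>)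
      then show ?thesis using False by (simp add: pa_mult_bas islin_zero[OF islin_eval_gen] asum_zero)
    next
      case True
      have pQ: "p \<in> QP" and rQ: "r \<in> QP" using p r Irr_QP by auto
      let ?g = "\<lambda>q y t. tri (nf (bas q)) y (nf (bas t))"
      have "asplit (pcomp p r) = asum (\<lambda>q y t. ?g q y (pcomp t r)) p + asum (\<lambda>q. ?g (pcomp p q)) r"
        unfolding asplit_def by (rule asum_pcomp[OF pQ rQ True])
      moreover have "eval_gen (left_polred fs) (asum (\<lambda>q. ?g (pcomp p q)) r) = 0"
      proof -
        have "eval_gen (left_polred fs) (asum (\<lambda>q. ?g (pcomp p q)) r) = asum (\<lambda>q y t. 0) r"
          unfolding asum_islin[OF islin_eval_gen]
        proof (rule asum_cong)
          fix q y t assume o: "q \<in> QP" "y \<in> arw" "t \<in> QP" "tgt q = src y" "tgt y = src t" "r = pcomp (pcomp q y) t"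
          have yQ: "y \<in> QP" using o arw_QP by blast
          have "pcomp q (pcomp y t) \<in> Irr" using r o by (simp add: pcomp_assoc)
          then have yt: "pcomp y t \<in> Irr" by (rule Irr_subpath) (use o yQ in \<open>simp_all add: pcomp_QP\<close>)
          then have "t \<in> Irr" using Irr_subpath(2)[OF _ yQ o(3,5)] by blast
          then show "eval_gen (left_polred fs) (?g (pcomp p q) y t) = 0" using left_polred_killed[OF ne o(5) yt] by (simp add: nf_Irr)
        qed
        then show ?thesis by (simp add: asum_zero)
      qed
      moreover have "eval_gen (left_polred fs) (asum (\<lambda>q y t. ?g q y (pcomp t r)) p) = arrow_polred fs p (bas r)"
        unfolding asum_islin[OF islin_eval_gen] arrow_polred_def
      proof (rule asum_cong)
        fix q y t assume o: "q \<in> QP" "y \<in> arw" "t \<in> QP" "tgt q = src y" "tgt y = src t" "p = pcomp (pcomp q y) t"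
        have tr: "pcomp t r \<in> QP" "tgt t = src r" using o rQ True by (auto intro!: pcomp_QP)
        have C: "polred fs (bas y \<odot> nf (bas t \<odot> bas r)) \<in> CQ"
          by (intro polred_CQ fs CQ_mult nf_CQ CQ_bas arw_QP o rQ)
        show "eval_gen (left_polred fs) (?g q y (pcomp t r)) = nf (bas q \<odot> polred fs (bas y \<odot> nf (bas t \<odot> bas r)))"
          using nf_mult_left[OF CQ_bas[OF o(1)] C]
          by (subst eval_gen_tri) (use o tr nf_parallel(3)[OF o(1)] nf_parallel(2)[OF tr(1)] in \<open>simp_all add: islin_left_polred left_polred_def pa_mult_bas\<close>)
      qed
      ultimately show ?thesis using True by (simp add: pa_mult_bas islin_add[OF islin_eval_gen])
    qed
    have "eval_gen (left_polred fs) (lin asplit (bas p \<odot> b)) = arrow_polred fs p b" if p: "p \<in> Irr" for p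
      by (rule islin_eqI[of "\<lambda>b. eval_gen (left_polred fs) (lin asplit (bas p \<odot> b))" "arrow_polred fs p" b])
        (use b P[OF p] in \<open>auto simp: kIrr_iff islin_arrow_polred intro!: islin_compose[OF islin_eval_gen] islin_compose[OF islin_lin] pa_mult_islin2\<close>)
    then show ?thesis
      using a by (intro islin_eqI[of "\<lambda>a. eval_gen (left_polred fs) (lin asplit (a \<odot> b))" "lin (\<lambda>p. arrow_polred fs p b)" a])
        (auto simp: kIrr_iff intro!: islin_compose[OF islin_eval_gen] islin_compose[OF islin_lin] pa_mult_islin1)
  qed
  finally show ?thesis by simp
qed

section \<open>Normal forms of elements of the resolution\<close>

text \<open>The normal form of a tensor in \<open>A \<otimes> \<k>S\<^sub>n \<otimes> A\<close>.\<close>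
definition tnf :: "('v, 'e, 'k) Pten \<Rightarrow> ('v, 'e, 'k) triples" where
  "tnf = lin (\<lambda>(a, w, b). tri (sigma a) w (sigma b))"

text \<open>The formal combinations that represent elements of \<open>P\<^sub>n\<close>; the operators are only controlled on these.\<close>
definition valid :: "nat \<Rightarrow> ('v, 'e, 'k) Pten \<Rightarrow> bool" where
  "valid n x \<longleftrightarrow> supp x \<subseteq> carrier A \<times> amb n \<times> carrier A"

lemma islin_tnf [simp]: "islin tnf" by (simp add: tnf_def)
lemma tnf_bas [simp]: "tnf (bas (a, w, b)) = tri (sigma a) w (sigma b)" by (simp add: tnf_def)

lemma valid_bas: "valid n (bas (a, w, b)) \<longleftrightarrow> a \<in> carrier A \<and> w \<in> amb n \<and> b \<in> carrier A"
  by (simp add: valid_def)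
lemma valid_0 [simp]: "valid n 0" by (simp add: valid_def)
lemma valid_add: "valid n x \<Longrightarrow> valid n y \<Longrightarrow> valid n (x + y)"
  unfolding valid_def using Poly_Mapping.keys_add[of x y] by blast
lemma valid_diff: "valid n x \<Longrightarrow> valid n y \<Longrightarrow> valid n (x - y)"
  unfolding valid_def using keys_diff_subset[of x y] by blast
lemma valid_scale: "valid n x \<Longrightarrow> valid n (scale c x)"
  unfolding valid_def using keys_scale[of c x] by blast
lemma valid_sum: "(\<And>j. j \<in> J \<Longrightarrow> valid n (f j)) \<Longrightarrow> valid n (sum f J)"
  unfolding valid_def using keys_sum_subset[of f J] by blast
lemma valid_lin: "(\<And>t. t \<in> supp x \<Longrightarrow> valid n (g t)) \<Longrightarrow> valid n (lin g x)"
  unfolding valid_def using keys_lin[of g x] by blast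
lemma valid_keys: "valid n x \<Longrightarrow> (a, w, b) \<in> supp x \<Longrightarrow> a \<in> carrier A \<and> w \<in> amb n \<and> b \<in> carrier A"
  unfolding valid_def by blast

lemma tnf_valid_eqI:
  assumes "islin f" "islin g" "valid n x"
    "\<And>a w b. \<lbrakk>a \<in> carrier A; w \<in> amb n; b \<in> carrier A\<rbrakk> \<Longrightarrow> f (bas (a, w, b)) = g (bas (a, w, b))"
  shows "f x = g x"
proof (rule islin_eqI[OF assms(1,2)])
  fix t assume t: "t \<in> supp x"
  obtain a w b where "t = (a, w, b)" by (cases t)
  then show "f (bas t) = g (bas t)" using assms(4) valid_keys[OF assms(3)] t by blast
qed

lemma amb_simps: "amb 0 = triv ` verts Q" "amb (Suc 0) = arw" "amb 2 = S" "amb (Suc (Suc 0)) = S"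
  by (simp_all add: amb_def arw_def)

lemma sigma_pj: "p \<in> QP \<Longrightarrow> sigma (pj p) = nf (bas p)"
  by (rule sigma_proj[OF CQ_bas])

lemma pj_carrier [simp]: "p \<in> QP \<Longrightarrow> pj p \<in> carrier A"
  by (rule proj_carrier[OF CQ_bas])

lemma lin_eq_0: "(\<And>t. t \<in> supp x \<Longrightarrow> g t = 0) \<Longrightarrow> lin g x = 0"
  using lin_cong[of x g "\<lambda>t. 0"] by simp

lemma tri_zero_left: assumes "\<And>q. q \<in> supp x \<Longrightarrow> tgt q \<noteq> src w" shows "tri x w y = 0"
  unfolding tri_def by (intro lin_eq_0) (simp add: assms)

lemma tri_zero_right: assumes "\<And>r. r \<in> supp y \<Longrightarrow> src r \<noteq> tgt w" shows "tri x w y = 0"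
  unfolding tri_def by (intro lin_eq_0) (simp add: assms[symmetric])

lemma tri_triv_left: "tri (x \<odot> bas (triv v)) w y = (if v = src w then tri x w y else 0)"
proof (rule islin_eqI[of "\<lambda>x. tri (x \<odot> bas (triv v)) w y" "\<lambda>x. if v = src w then tri x w y else 0" x])
  show "islin (\<lambda>x. tri (x \<odot> bas (triv v)) w y)" by (rule islin_compose[OF islin_tri1 pa_mult_islin1])
  show "islin (\<lambda>x. if v = src w then tri x w y else 0)" by (cases "v = src w") simp_all
  fix t
  show "tri (bas t \<odot> bas (triv v)) w y = (if v = src w then tri (bas t) w y else 0)"
    by (cases "tgt t = v") (auto simp: pa_mult_bas islin_zero[OF islin_tri1] intro!: tri_zero_left tri_zero_left[symmetric])
qed

lemma tri_triv_right: "tri x w (bas (triv v) \<odot> y) = (if v = tgt w then tri x w y else 0)"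
proof (rule islin_eqI[of "\<lambda>y. tri x w (bas (triv v) \<odot> y)" "\<lambda>y. if v = tgt w then tri x w y else 0" y])
  show "islin (\<lambda>y. tri x w (bas (triv v) \<odot> y))" by (rule islin_compose[OF islin_tri2 pa_mult_islin2])
  show "islin (\<lambda>y. if v = tgt w then tri x w y else 0)" by (cases "v = tgt w") simp_all
  fix t
  show "tri x w (bas (triv v) \<odot> bas t) = (if v = tgt w then tri x w (bas t) else 0)"
    by (cases "src t = v") (auto simp: pa_mult_bas islin_zero[OF islin_tri2] intro!: tri_zero_right tri_zero_right[symmetric])
qed

lemma mult_triv_kIrr: "b \<in> kIrr \<Longrightarrow> b \<odot> bas (triv v) \<in> kIrr"
proof -
  assume b: "b \<in> kIrr"
  have "b \<odot> bas (triv v) = lin (\<lambda>u. bas u \<odot> bas (triv v)) b" by (rule islin_expand[of "\<lambda>b. b \<odot> bas (triv v)"]) simp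
  also have "\<dots> \<in> kIrr" by (rule kIrr_lin) (use b in \<open>auto simp: kIrr_iff pa_mult_bas\<close>)
  finally show ?thesis .
qed

lemma sigma_mult_triv:
  assumes "a \<in> carrier A" "v \<in> verts Q"
  shows "sigma (a \<otimes>\<^bsub>A\<^esub> pj (triv v)) = sigma a \<odot> bas (triv v)" "sigma (pj (triv v) \<otimes>\<^bsub>A\<^esub> a) = bas (triv v) \<odot> sigma a"
  using assms by (simp_all add: sigma_mult triv_QP sigma_pj nf_Irr triv_Irr nf_id mult_triv_kIrr triv_mult_kIrr sigma_kIrr)

lemma P_null_tnf: "x \<in> P_null n \<Longrightarrow> tnf x = 0"
proof (induction rule: P_null.induct)
  case (2 x y) then show ?case by (simp add: islin_add[OF islin_tnf])
next
  case (3 x c) then show ?case by (simp add: islin_scale[OF islin_tnf])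
next
  case (4 a a' w b) then show ?case by (simp add: islin_diff[OF islin_tnf] sigma_add islin_add[OF islin_tri1])
next
  case (5 a w b b') then show ?case by (simp add: islin_diff[OF islin_tnf] sigma_add islin_add[OF islin_tri2])
next
  case (6 a w b c) then show ?case by (simp add: islin_diff[OF islin_tnf] islin_scale[OF islin_tnf] sigma_Ascale islin_scale[OF islin_tri1])
next
  case (7 a w b c) then show ?case by (simp add: islin_diff[OF islin_tnf] islin_scale[OF islin_tnf] sigma_Ascale islin_scale[OF islin_tri2])
next
  case (8 a w b v) then show ?case by (simp add: islin_diff[OF islin_tnf] islin_zero[OF islin_tnf] sigma_mult_triv tri_triv_left)
next
  case (9 a w b v) then show ?case by (simp add: islin_diff[OF islin_tnf] islin_zero[OF islin_tnf] sigma_mult_triv tri_triv_right)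
qed (simp add: islin_zero[OF islin_tnf])

lemma P_null_sum: "(\<And>j. j \<in> J \<Longrightarrow> f j \<in> P_null n) \<Longrightarrow> sum f J \<in> P_null n"
  by (induction J rule: infinite_finite_induct) (auto intro: P_null.intros)

lemma P_null_lin: "(\<And>t. t \<in> supp x \<Longrightarrow> g t \<in> P_null n) \<Longrightarrow> lin g x \<in> P_null n"
  unfolding lin_def by (intro P_null_sum P_null.intros(3))

lemma P_null_trans: "x - y \<in> P_null n \<Longrightarrow> y - z \<in> P_null n \<Longrightarrow> x - z \<in> P_null n"
  using P_null.intros(2)[of "x - y" n "y - z"] by simp

lemma P_null_expand_left:
  assumes "w \<in> amb n" "b \<in> carrier A" "x \<in> CQ"
  shows "bas (proj x, w, b) - lin (\<lambda>q. bas (pj q, w, b)) x \<in> P_null n"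
proof -
  have "bas (proj (\<Sum>t\<in>T. scale (c t) (bas t)), w, b) - (\<Sum>t\<in>T. scale (c t) (bas (pj t, w, b))) \<in> P_null n"
    if "finite T" "T \<subseteq> QP" for T and c :: "_ \<Rightarrow> 'k"
    using that
  proof (induction T)
    case empty
    have "proj 0 = Ascale 0 \<one>\<^bsub>A\<^esub>" by (simp add: A_one Ascale_proj eQ_CQ)
    then show ?case using P_null.intros(6)[of "\<one>\<^bsub>A\<^esub>" w n b 0] assms by simp
  next
    case (insert p T)
    let ?y = "\<Sum>t\<in>T. scale (c t) (bas t) :: ('v, 'e, 'k) pa"
    have y: "?y \<in> CQ" by (intro CQ_sum CQ_scale CQ_bas) (use insert in auto)
    have p: "p \<in> QP" using insert by simp
    have e: "proj (scale (c p) (bas p) + ?y) = Ascale (c p) (pj p) \<oplus>\<^bsub>A\<^esub> proj ?y"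
      by (simp add: Ascale_proj CQ_bas p proj_add CQ_scale y)
    have 1: "bas (Ascale (c p) (pj p) \<oplus>\<^bsub>A\<^esub> proj ?y, w, b) - bas (Ascale (c p) (pj p), w, b) - bas (proj ?y, w, b) \<in> P_null n"
      by (rule P_null.intros(4)) (use p y assms in simp_all)
    have 2: "bas (Ascale (c p) (pj p), w, b) - scale (c p) (bas (pj p, w, b)) \<in> P_null n"
      by (rule P_null.intros(6)) (use p y assms in simp_all)
    have 3: "bas (proj ?y, w, b) - (\<Sum>t\<in>T. scale (c t) (bas (pj t, w, b))) \<in> P_null n" using insert by simp
    show ?case using P_null.intros(2)[OF 1 P_null.intros(2)[OF 2 3]] insert(1,2) by (simp add: e algebra_simps)
  qed
  from this[of "supp x" "Poly_Mapping.lookup x"]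
  show ?thesis using assms(3) by (simp add: lin_bas_id[of x, unfolded lin_def] lin_def CQ_iff)
qed

lemma P_null_expand_right:
  assumes "w \<in> amb n" "a \<in> carrier A" "x \<in> CQ"
  shows "bas (a, w, proj x) - lin (\<lambda>q. bas (a, w, pj q)) x \<in> P_null n"
proof -
  have "bas (a, w, proj (\<Sum>t\<in>T. scale (c t) (bas t))) - (\<Sum>t\<in>T. scale (c t) (bas (a, w, pj t))) \<in> P_null n"
    if "finite T" "T \<subseteq> QP" for T and c :: "_ \<Rightarrow> 'k"
    using that
  proof (induction T)
    case empty
    have "proj 0 = Ascale 0 \<one>\<^bsub>A\<^esub>" by (simp add: A_one Ascale_proj eQ_CQ)
    then show ?case using P_null.intros(7)[of a w n "\<one>\<^bsub>A\<^esub>" 0] assms by simp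
  next
    case (insert p T)
    let ?y = "\<Sum>t\<in>T. scale (c t) (bas t) :: ('v, 'e, 'k) pa"
    have y: "?y \<in> CQ" by (intro CQ_sum CQ_scale CQ_bas) (use insert in auto)
    have p: "p \<in> QP" using insert by simp
    have e: "proj (scale (c p) (bas p) + ?y) = Ascale (c p) (pj p) \<oplus>\<^bsub>A\<^esub> proj ?y"
      by (simp add: Ascale_proj CQ_bas p proj_add CQ_scale y)
    have 1: "bas (a, w, Ascale (c p) (pj p) \<oplus>\<^bsub>A\<^esub> proj ?y) - bas (a, w, Ascale (c p) (pj p)) - bas (a, w, proj ?y) \<in> P_null n"
      by (rule P_null.intros(5)) (use p y assms in simp_all)
    have 2: "bas (a, w, Ascale (c p) (pj p)) - scale (c p) (bas (a, w, pj p)) \<in> P_null n"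
      by (rule P_null.intros(7)) (use p y assms in simp_all)
    have 3: "bas (a, w, proj ?y) - (\<Sum>t\<in>T. scale (c t) (bas (a, w, pj t))) \<in> P_null n" using insert by simp
    show ?case using P_null.intros(2)[OF 1 P_null.intros(2)[OF 2 3]] insert(1,2) by (simp add: e algebra_simps)
  qed
  from this[of "supp x" "Poly_Mapping.lookup x"]
  show ?thesis using assms(3) by (simp add: lin_bas_id[of x, unfolded lin_def] lin_def CQ_iff)
qed

lemma P_null_noncomposable:
  assumes "w \<in> amb n" "q \<in> QP" "r \<in> QP" "\<not> (tgt q = src w \<and> tgt w = src r)"
  shows "bas (pj q, w, pj r) \<in> P_null n"
proof (cases "tgt q = src w")
  case False
  have "pj q \<otimes>\<^bsub>A\<^esub> pj (triv (tgt q)) = pj q"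
    using assms(2) QP_verts by (simp add: proj_mult CQ_bas triv_QP bas_triv_tgt)
  then show ?thesis
    using P_null.intros(8)[of "pj q" w n "pj r" "tgt q"] assms False QP_verts(2)[OF assms(2)] by simp
next
  case True
  have "pj (triv (src r)) \<otimes>\<^bsub>A\<^esub> pj r = pj r"
    using assms(3) QP_verts by (simp add: proj_mult CQ_bas triv_QP bas_triv_src)
  then show ?thesis
    using P_null.intros(9)[of "pj q" w n "pj r" "src r"] assms True QP_verts(1)[OF assms(3)] by simp
qed

text \<open>Expand the representatives of both outer factors into paths; triples that are not composable
  vanish over \<open>\<k>Q\<^sub>0\<close>.\<close>
lemma P_null_normal_form:
  assumes "valid n x" shows "x - lin (\<lambda>(q, w, r). bas (pj q, w, pj r)) (tnf x) \<in> P_null n"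
proof -
  let ?l = "lin (\<lambda>(q, w, r). bas (pj q, w, pj r))"
  have 1: "bas (a, w, b) - ?l (tnf (bas (a, w, b))) \<in> P_null n"
    if a: "a \<in> carrier A" and w: "w \<in> amb n" and b: "b \<in> carrier A" for a w b
  proof -
    have s1: "bas (a, w, b) - lin (\<lambda>q. bas (pj q, w, b)) (sigma a) \<in> P_null n"
      using P_null_expand_left[OF w b sigma_CQ[OF a]] a by simp
    have "lin (\<lambda>q. bas (pj q, w, b) - lin (\<lambda>r. bas (pj q, w, pj r)) (sigma b)) (sigma a) \<in> P_null n"
    proof (rule P_null_lin)
      fix q assume "q \<in> supp (sigma a)"
      then have "q \<in> QP" using sigma_CQ[OF a] by (auto simp: CQ_iff)
      then show "bas (pj q, w, b) - lin (\<lambda>r. bas (pj q, w, pj r)) (sigma b) \<in> P_null n"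
        using P_null_expand_right[OF w _ sigma_CQ[OF b], of "pj q"] b by simp
    qed
    then have s2: "lin (\<lambda>q. bas (pj q, w, b)) (sigma a) - lin (\<lambda>q. lin (\<lambda>r. bas (pj q, w, pj r)) (sigma b)) (sigma a) \<in> P_null n"
      by (simp add: lin_diff_fun)
    have "lin (\<lambda>q. lin (\<lambda>r. bas (pj q, w, pj r) - (if tgt q = src w \<and> tgt w = src r then bas (pj q, w, pj r) else 0)) (sigma b)) (sigma a) \<in> P_null n"
    proof (intro P_null_lin)
      fix q r assume "q \<in> supp (sigma a)" "r \<in> supp (sigma b)"
      then have "q \<in> QP" "r \<in> QP" using sigma_CQ[OF a] sigma_CQ[OF b] by (auto simp: CQ_iff)
      then show "bas (pj q, w, pj r) - (if tgt q = src w \<and> tgt w = src r then bas (pj q, w, pj r) else 0) \<in> P_null n"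
        using P_null_noncomposable[OF w] by (auto intro: P_null.intros(1))
    qed
    moreover have "?l (tnf (bas (a, w, b))) = lin (\<lambda>q. lin (\<lambda>r. if tgt q = src w \<and> tgt w = src r then bas (pj q, w, pj r) else 0) (sigma b)) (sigma a)"
      unfolding tnf_bas tri_def lin_lin by (intro lin_cong) simp
    ultimately have s3: "lin (\<lambda>q. lin (\<lambda>r. bas (pj q, w, pj r)) (sigma b)) (sigma a) - ?l (tnf (bas (a, w, b))) \<in> P_null n"
      by (simp add: lin_diff_fun)
    show ?thesis by (rule P_null_trans[OF P_null_trans[OF s1 s2] s3])
  qed
  have "lin (\<lambda>t. bas t - ?l (tnf (bas t))) x \<in> P_null n"
  proof (rule P_null_lin)
    fix t assume t: "t \<in> supp x"
    obtain a w b where "t = (a, w, b)" by (cases t)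
    then show "bas t - ?l (tnf (bas t)) \<in> P_null n" using 1 valid_keys[OF assms] t by blast
  qed
  moreover have "lin (\<lambda>t. ?l (tnf (bas t))) x = ?l (tnf x)"
  proof -
    have "islin (\<lambda>x. ?l (tnf x))" by (rule islin_compose[OF islin_lin islin_tnf])
    from islin_expand[OF this, of x] show ?thesis by simp
  qed
  ultimately show ?thesis by (simp add: lin_diff_fun)
qed

text \<open>Normal forms decide equality in \<open>P\<^sub>n\<close>.  This is needed because the perturbation series sums over the terms that
  are nonzero in the tensor product.\<close>
lemma P_null_iff: "valid n x \<Longrightarrow> x \<in> P_null n \<longleftrightarrow> tnf x = 0"
  using P_null_tnf P_null_normal_form[of n x] by auto

subsection \<open>The operators in normal form\<close>

text \<open>The bimodule structure on normal forms.\<close>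
definition actN :: "('v, 'e, 'k) pa \<Rightarrow> ('v, 'e, 'k) pa \<Rightarrow>
   ('v, 'e, 'k) triples \<Rightarrow> ('v, 'e, 'k) triples" where
  "actN \<alpha> \<beta> = lin (\<lambda>(q, w, r). tri (nf (\<alpha> \<odot> bas q)) w (nf (bas r \<odot> \<beta>)))"

lemma islin_actN [simp]: "islin (actN \<alpha> \<beta>)" by (simp add: actN_def)

lemma keys_nf_left:
  assumes "x \<in> CQ" "q \<in> QP" "u \<in> supp (nf (x \<odot> bas q))" shows "tgt u = tgt q"
proof -
  have "nf (x \<odot> bas q) = lin (\<lambda>t. nf (bas t \<odot> bas q)) x"
    using islin_expand[OF islin_compose[OF islin_nf pa_mult_islin1], of x] by simp
  then obtain t where t: "t \<in> supp x" "u \<in> supp (nf (bas t \<odot> bas q))"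
    using assms(3) keys_lin[of "\<lambda>t. nf (bas t \<odot> bas q)" x] by auto
  then have "tgt t = src q" by (metis islin_nf islin_zero keys_zero empty_iff pa_mult_bas)
  moreover have "t \<in> QP" using t(1) assms(1) by (auto simp: CQ_iff)
  ultimately show ?thesis using nf_parallel(3)[of "pcomp t q" u] t(2) assms(2) by (simp add: pa_mult_bas pcomp_QP)
qed

lemma keys_nf_right:
  assumes "x \<in> CQ" "q \<in> QP" "u \<in> supp (nf (bas q \<odot> x))" shows "src u = src q"
proof -
  have "nf (bas q \<odot> x) = lin (\<lambda>t. nf (bas q \<odot> bas t)) x"
    using islin_expand[OF islin_compose[OF islin_nf pa_mult_islin2[of "bas q"]], of x] by simp
  then obtain t where t: "t \<in> supp x" "u \<in> supp (nf (bas q \<odot> bas t))"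
    using assms(3) keys_lin[of "\<lambda>t. nf (bas q \<odot> bas t)" x] by auto
  then have "tgt q = src t" by (metis islin_nf islin_zero keys_zero empty_iff pa_mult_bas)
  moreover have "t \<in> QP" using t(1) assms(1) by (auto simp: CQ_iff)
  ultimately show ?thesis using nf_parallel(2)[of "pcomp q t" u] t(2) assms(2) by (simp add: pa_mult_bas pcomp_QP)
qed

lemma actN_tri:
  assumes "\<alpha> \<in> CQ" "\<beta> \<in> CQ" "x \<in> CQ" "y \<in> CQ"
  shows "actN \<alpha> \<beta> (tri x w y) = tri (nf (\<alpha> \<odot> x)) w (nf (y \<odot> \<beta>))"
proof -
  have "actN \<alpha> \<beta> (tri x w y) = lin (\<lambda>q. lin (\<lambda>r. tri (nf (\<alpha> \<odot> bas q)) w (nf (bas r \<odot> \<beta>))) y) x"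
    unfolding tri_def[of x] islin_comp_lin[OF islin_actN]
  proof (intro lin_cong)
    fix q r assume "q \<in> supp x" "r \<in> supp y"
    then have qr: "q \<in> QP" "r \<in> QP" using assms by (auto simp: CQ_iff)
    show "actN \<alpha> \<beta> (if tgt q = src w \<and> tgt w = src r then bas (q, w, r) else 0) = tri (nf (\<alpha> \<odot> bas q)) w (nf (bas r \<odot> \<beta>))"
    proof (cases "tgt q = src w \<and> tgt w = src r")
      case False
      have "tri (nf (\<alpha> \<odot> bas q)) w (nf (bas r \<odot> \<beta>)) = 0"
        using False tri_zero_left[of "nf (\<alpha> \<odot> bas q)" w] keys_nf_left[OF assms(1) qr(1)]
          tri_zero_right[of "nf (bas r \<odot> \<beta>)" w] keys_nf_right[OF assms(2) qr(2)] by (metis (no_types))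
      then show ?thesis using False by (simp only: if_False islin_zero[OF islin_actN])
    qed (simp add: actN_def)
  qed
  also have "\<dots> = lin (\<lambda>q. tri (nf (\<alpha> \<odot> bas q)) w (nf (y \<odot> \<beta>))) x"
  proof (rule lin_cong)
    fix q
    have "islin (\<lambda>y. tri (nf (\<alpha> \<odot> bas q)) w (nf (y \<odot> \<beta>)))"
      by (intro islin_compose[OF islin_tri2] islin_compose[OF islin_nf] pa_mult_islin1)
    from islin_expand[OF this, of y] show "lin (\<lambda>r. tri (nf (\<alpha> \<odot> bas q)) w (nf (bas r \<odot> \<beta>))) y = tri (nf (\<alpha> \<odot> bas q)) w (nf (y \<odot> \<beta>))" by simp
  qed
  also have "\<dots> = tri (nf (\<alpha> \<odot> x)) w (nf (y \<odot> \<beta>))"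
  proof -
    have "islin (\<lambda>x. tri (nf (\<alpha> \<odot> x)) w (nf (y \<odot> \<beta>)))"
      by (intro islin_compose[OF islin_tri1] islin_compose[OF islin_nf] pa_mult_islin2)
    from islin_expand[OF this, of x] show ?thesis by simp
  qed
  finally show ?thesis .
qed

lemma act_bas: "act a (bas (a', w, b')) b = bas (a \<otimes>\<^bsub>A\<^esub> a', w, b' \<otimes>\<^bsub>A\<^esub> b)"
  by (simp add: act_def)

lemma islin_act [simp]: "islin (\<lambda>x. act a x b)" by (simp add: act_def)

lemma valid_act: "\<lbrakk>valid n x; a \<in> carrier A; b \<in> carrier A\<rbrakk> \<Longrightarrow> valid n (act a x b)"
  unfolding act_def by (rule valid_lin) (auto simp: valid_bas dest!: valid_keys)

lemma tnf_act: assumes "valid n x" "a \<in> carrier A" "b \<in> carrier A"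
  shows "tnf (act a x b) = actN (sigma a) (sigma b) (tnf x)"
  by (rule tnf_valid_eqI[OF islin_compose[OF islin_tnf islin_act] islin_compose[OF islin_actN islin_tnf] assms(1)])
    (use assms in \<open>simp add: act_bas sigma_mult actN_tri sigma_CQ\<close>)

text \<open>The normal form of \<open>\<alpha> split\<^sub>1(p) \<beta>\<close>.\<close>
definition asplit_in :: "('v, 'e, 'k) pa \<Rightarrow> ('v, 'e, 'k) pa \<Rightarrow> ('v, 'e) qpath \<Rightarrow> ('v, 'e, 'k) triples" where
  "asplit_in \<alpha> \<beta> p = asum (\<lambda>q y r. tri (nf (\<alpha> \<odot> bas q)) y (nf (bas r \<odot> \<beta>))) p"

lemma asplit_asplit_in: "asplit p = asplit_in eQ eQ p"
  unfolding asplit_def asplit_in_def by (rule asum_cong) (simp add: eQ_left eQ_right CQ_bas)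

lemma actN_asplit_in:
  assumes "\<alpha> \<in> CQ" "\<beta> \<in> CQ" "\<alpha>' \<in> CQ" "\<beta>' \<in> CQ"
  shows "actN \<alpha>' \<beta>' (asplit_in \<alpha> \<beta> p) = asplit_in (\<alpha>' \<odot> \<alpha>) (\<beta> \<odot> \<beta>') p"
  unfolding asplit_in_def asum_islin[OF islin_actN]
proof (rule asum_cong)
  fix q y r assume o: "q \<in> QP" "r \<in> QP"
  have c: "\<alpha> \<odot> bas q \<in> CQ" "bas r \<odot> \<beta> \<in> CQ" using assms o by (auto intro!: CQ_mult CQ_bas)
  show "actN \<alpha>' \<beta>' (tri (nf (\<alpha> \<odot> bas q)) y (nf (bas r \<odot> \<beta>))) = tri (nf (\<alpha>' \<odot> \<alpha> \<odot> bas q)) y (nf (bas r \<odot> (\<beta> \<odot> \<beta>')))"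
    using assms c by (simp add: actN_tri nf_CQ nf_mult_left nf_mult_right pa_mult_assoc)
qed

lemma actN_asplit: "\<alpha> \<in> CQ \<Longrightarrow> \<beta> \<in> CQ \<Longrightarrow> actN \<alpha> \<beta> (asplit p) = asplit_in \<alpha> \<beta> p"
  using actN_asplit_in[OF eQ_CQ eQ_CQ] by (simp add: asplit_asplit_in eQ_left eQ_right)

lemma split_valid: "amb n \<subseteq> QP \<Longrightarrow> valid n (split n p)"
  unfolding split_def by (rule valid_sum) (auto simp: valid_bas occs_iff)

lemma tnf_split1: "tnf (split (Suc 0) p) = asplit p"
  unfolding split_def asplit_def asum_def amb_simps islin_sum[OF islin_tnf]
  by (rule sum.cong) (auto simp: occs_iff sigma_pj)

text \<open>All occurrences of elements of \<open>S\<close> in \<open>y u\<close> start at \<open>y\<close>, so by independence there is at most one,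
  and \<open>split\<close> agrees with the rightmost splitting.\<close>
lemma occs_arrow_Irr:
  assumes "y \<in> arw" "u \<in> Irr" "tgt y = src u"
  shows "occs S (pcomp y u) = (if pcomp y u \<in> Irr then {} else {rm (pcomp y u)})"
proof (cases "pcomp y u \<in> Irr")
  case True
  then show ?thesis by (auto simp: Irr_def)
next
  case False
  obtain s r where t: "(triv (src y), s, r) \<in> rightmost S (pcomp y u)" "pcomp s r = pcomp y u"
    using rightmost_arrow[OF assms False] by metis
  note d = rightmostD[OF t(1)]
  have s: "s \<in> QP" using d S_QP by blast
  have yQ: "y \<in> QP" "plen y = 1" "u \<in> QP" using assms arw_QP arw_plen Irr_QP by auto
  have "T = (triv (src y), s, r)" if T: "T \<in> occs S (pcomp y u)" for T
  proof -
    obtain q1 s1 r1 where T1: "T = (q1, s1, r1)" "(q1, s1, r1) \<in> occs S (pcomp y u)" using T by (cases T) simp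
    note o = occs_S_D[OF T1(2)]
    have s1: "s1 \<in> QP" using o S_QP by blast
    have "plen q1 = 0"
    proof (rule ccontr)
      assume q1: "plen q1 \<noteq> 0"
      obtain m where "m \<in> QP" "q1 = pcomp y m" "u = pcomp m (pcomp s1 r1)" "tgt m = src (pcomp s1 r1)"
      proof (rule pcomp_levi[of y u q1 "pcomp s1 r1"])
        show "pcomp s1 r1 \<in> QP" by (rule pcomp_QP) (use o s1 in simp_all)
        show "plen y \<le> plen q1" using q1 yQ by linarith
      qed (use o yQ assms(3) in \<open>simp_all add: pcomp_assoc\<close>)
      then have "(m, s1, r1) \<in> occs S u" using o by (simp add: occs_iff pcomp_assoc)
      then show False using IrrD[OF assms(2)] by blast
    qed
    then have q1: "q1 = triv (src q1)" "tgt q1 = src q1" using plen0[OF o(1)] by auto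
    have "src q1 = src y" using arg_cong[OF o(6), of src] by simp
    then have q1': "q1 = triv (src y)" "src s1 = src y" using q1 o(4) by auto
    have e: "pcomp s r = pcomp s1 r1" using o(6) t(2) q1' by simp
    have "s = s1"
    proof (cases "plen s \<le> plen s1")
      case True
      obtain m where m: "m \<in> QP" "s1 = pcomp s m" "tgt s = src m"
        using pcomp_levi[OF e s d(3) s1 o(3) d(5) o(5) True] by metis
      have "(triv (src s), s, m) \<in> occs {s} s1" using m s QP_verts[OF s] by (simp add: occs_iff triv_QP)
      then show ?thesis using S_indep[of s s1] d o by auto
    next
      case False
      then have le: "plen s1 \<le> plen s" by simp
      obtain m where m: "m \<in> QP" "s = pcomp s1 m" "tgt s1 = src m"
        using pcomp_levi[OF e[symmetric] s1 o(3) s d(3) o(5) d(5) le] by metis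
      have "(triv (src s1), s1, m) \<in> occs {s1} s" using m s1 QP_verts[OF s1] by (simp add: occs_iff triv_QP)
      then show ?thesis using S_indep[of s1 s] d o by auto
    qed
    have SQ: "S \<subseteq> QP" using S_QP by blast
    show ?thesis using occs_determined[OF T1(2) rightmost_occs[OF t(1)] SQ] q1' T1 \<open>s = s1\<close> by simp
  qed
  then have "occs S (pcomp y u) = {(triv (src y), s, r)}" using rightmost_occs[OF t(1)] by blast
  then show ?thesis using False rm_eq[OF t(1)] by simp
qed

lemma amb_QP: "amb 0 \<subseteq> QP" "amb (Suc 0) \<subseteq> QP" "amb 2 \<subseteq> QP" "amb (Suc (Suc 0)) \<subseteq> QP"
  using triv_QP arw_QP S_QP by (auto simp: amb_simps)

lemma gamma_bas: "gamma n (bas (a, w, b)) = act a (lin (\<lambda>u. if tgt w = src u then scale ((-1) ^ Suc n) (split (Suc n) (pcomp w u)) else 0)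
               (sigma b)) \<one>\<^bsub>A\<^esub>"
  by (simp add: gamma_def)

lemma islin_gamma [simp]: "islin (gamma n)" by (simp add: gamma_def)

lemma valid_gamma: assumes "valid n x" "amb (Suc n) \<subseteq> QP" shows "valid (Suc n) (gamma n x)"
  unfolding gamma_def
proof (rule valid_lin)
  fix t assume t: "t \<in> supp x"
  obtain a w b where tt: "t = (a, w, b)" by (cases t)
  then have "a \<in> carrier A" using valid_keys[OF assms(1)] t by blast
  then show "valid (Suc n) (case t of (a, w, b) \<Rightarrow> act a (lin (\<lambda>u. if tgt w = src u then scale ((-1) ^ Suc n) (split (Suc n) (pcomp w u)) else 0) (sigma b)) \<one>\<^bsub>A\<^esub>)"
    unfolding tt prod.case
    by (intro valid_act valid_lin) (simp_all add: valid_scale[OF split_valid[OF assms(2)]] del: power_Suc)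
qed

lemma tnf_gamma1: assumes "valid (Suc 0) x" shows "tnf (gamma (Suc 0) x) = gamma1 (tnf x)"
proof (rule tnf_valid_eqI[OF islin_compose[OF islin_tnf islin_gamma] islin_compose[OF islin_gamma1 islin_tnf] assms])
  fix a y b assume o: "a \<in> carrier A" "y \<in> amb (Suc 0)" "b \<in> carrier A"
  then have y: "y \<in> arw" by (simp add: amb_simps)
  let ?x = "lin (\<lambda>u. if tgt y = src u then scale ((-1) ^ Suc (Suc 0)) (split (Suc (Suc 0)) (pcomp y u)) else 0) (sigma b)"
  have v: "valid (Suc (Suc 0)) ?x"
    by (rule valid_lin) (simp add: split_valid amb_QP)
  have "tnf (gamma (Suc 0) (bas (a, y, b))) = actN (sigma a) eQ (tnf ?x)"
    unfolding gamma_bas using tnf_act[OF v o(1)] by simp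
  also have "\<dots> = lin (\<lambda>u. actN (sigma a) eQ (tnf (if tgt y = src u then scale ((-1) ^ Suc (Suc 0)) (split (Suc (Suc 0)) (pcomp y u)) else 0))) (sigma b)"
    by (rule islin_comp_lin[OF islin_compose[OF islin_actN islin_tnf]])
  also have "\<dots> = lin (\<lambda>u. gamma1 (tri (sigma a) y (bas u))) (sigma b)"
  proof (rule lin_cong)
    fix u assume "u \<in> supp (sigma b)"
    then have u: "u \<in> Irr" using sigma_kIrr[OF o(3)] by (auto simp: kIrr_iff)
    show "actN (sigma a) eQ (tnf (if tgt y = src u then scale ((-1) ^ Suc (Suc 0)) (split (Suc (Suc 0)) (pcomp y u)) else 0)) = gamma1 (tri (sigma a) y (bas u))"
    proof (cases "tgt y = src u")
      case False
      then have "tri (sigma a) y (bas u) = 0" by (intro tri_zero_right) auto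
      then show ?thesis using False by (simp add: islin_zero)
    next
      case True
      show ?thesis
      proof (cases "pcomp y u \<in> Irr")
        case T: True
        have "gamma1 (tri (sigma a) y (bas u)) = 0"
        proof (rule tau_killed(2))
          fix q z v assume "(q, z, v) \<in> supp (tri (sigma a) y (bas u))"
          then have "z = y \<and> v \<in> supp (bas u :: ('v, 'e, 'k) pa)" using keys_tri by blast
          then show "pcomp z v \<in> Irr" using T by simp
        qed
        then show ?thesis using T True by (simp add: split_def amb_simps occs_arrow_Irr[OF y u True] islin_zero)
      next
        case F: False
        obtain s r where t: "(triv (src y), s, r) \<in> rightmost S (pcomp y u)"
          using rightmost_arrow[OF y u True F] by metis
        note d = rightmostD[OF t]
        have rI: "r \<in> Irr" by (rule rightmost_Irr[OF t])
        have yv: "src y \<in> verts Q" using QP_verts(1)[OF arw_QP[OF y]] .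
        have oc: "occs S (pcomp y u) = {(triv (src y), s, r)}"
          using occs_arrow_Irr[OF y u True] F by (simp add: rm_eq[OF t])
        have "tnf (split (Suc (Suc 0)) (pcomp y u)) = tri (bas (triv (src y))) s (bas r)"
          using yv d(3) by (simp add: split_def amb_simps oc sigma_pj triv_QP nf_Irr triv_Irr rI)
        then have L: "actN (sigma a) eQ (tnf (split (Suc (Suc 0)) (pcomp y u))) = tri (sigma a \<odot> bas (triv (src y))) s (bas r)"
          using d yv o by (simp add: actN_tri sigma_CQ eQ_CQ CQ_bas triv_QP eQ_right nf_Irr rI nf_id mult_triv_kIrr sigma_kIrr)
        have ss: "src s = src y" using d by simp
        have "gamma1 (tri (sigma a) y (bas u)) = lin (\<lambda>q. gamma1 (tri (bas q) y (bas u))) (sigma a)"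
          by (rule islin_expand[OF islin_compose[OF islin_gamma1 islin_tri1]])
        also have "\<dots> = lin (\<lambda>q. tri (bas q) s (bas r)) (sigma a)"
          by (rule lin_cong) (use True tau_bas(2)[OF t] ss d in \<open>simp add: tri_bas islin_zero[OF islin_gamma1]\<close>)
        also have "\<dots> = tri (sigma a) s (bas r)" by (rule islin_expand[OF islin_tri1, symmetric])
        finally show ?thesis using L True ss by (simp add: tri_triv_left)
      qed
    qed
  qed
  also have "\<dots> = gamma1 (tnf (bas (a, y, b)))"
    using islin_expand[OF islin_compose[OF islin_gamma1 islin_tri2], of "sigma a" y "sigma b"] by simp
  finally show "tnf (gamma (Suc 0) (bas (a, y, b))) = gamma1 (tnf (bas (a, y, b)))" .
qed

text \<open>\<open>\<gamma>\<^sub>0\<close> on normal forms\<close>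
definition gamma0 :: "('v, 'e, 'k) triples \<Rightarrow> ('v, 'e, 'k) triples" where
  "gamma0 = lin (\<lambda>(q, w, u). - asplit_in (bas q) eQ u)"

lemma islin_gamma0 [simp]: "islin gamma0" by (simp add: gamma0_def)

lemma islin_bsp1: "islin (\<lambda>\<alpha>. asplit_in \<alpha> \<beta> p)"
  unfolding asplit_in_def asum_def case_prod_unfold
  by (intro islin_sum_fun islin_compose[OF islin_tri1] islin_compose[OF islin_nf] pa_mult_islin1)

lemma islin_bsp2: "islin (\<lambda>\<beta>. asplit_in \<alpha> \<beta> p)"
  unfolding asplit_in_def asum_def case_prod_unfold
  by (intro islin_sum_fun islin_compose[OF islin_tri2] islin_compose[OF islin_nf] pa_mult_islin2)

lemma asplit_in_zero_left: assumes "tgt q \<noteq> src p" shows "asplit_in (bas q) \<beta> p = 0"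
proof -
  have "asplit_in (bas q) \<beta> p = asum (\<lambda>q y r. 0) p" unfolding asplit_in_def
    by (rule asum_cong) (use assms in \<open>simp add: pa_mult_bas islin_zero[OF islin_nf] islin_zero[OF islin_tri1]\<close>)
  then show ?thesis by (simp add: asum_zero)
qed

lemma asplit_in_zero_right: assumes "src r \<noteq> tgt p" shows "asplit_in \<alpha> (bas r) p = 0"
proof -
  have "asplit_in \<alpha> (bas r) p = asum (\<lambda>q y r. 0) p" unfolding asplit_in_def
    by (rule asum_cong) (use assms in \<open>auto simp add: pa_mult_bas islin_zero[OF islin_nf] islin_zero[OF islin_tri2]\<close>)
  then show ?thesis by (simp add: asum_zero)
qed

lemma asplit_in_triv: "asplit_in (x \<odot> bas (triv (src u))) \<beta> u = asplit_in x \<beta> u"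
proof -
  have b: "asplit_in (bas q \<odot> bas (triv (src u))) \<beta> u = asplit_in (bas q) \<beta> u" for q
    by (cases "tgt q = src u") (simp_all add: pa_mult_bas asplit_in_zero_left islin_zero[OF islin_bsp1])
  have i: "islin (\<lambda>x. asplit_in (x \<odot> bas (triv (src u))) \<beta> u)"
    by (rule islin_compose[OF islin_bsp1 pa_mult_islin1])
  show ?thesis by (rule islin_eqI[OF i islin_bsp1]) (rule b)
qed

lemma gamma0_tri:
  assumes "v \<in> verts Q"
  shows "gamma0 (tri x (triv v) y) = - lin (\<lambda>u. asplit_in (x \<odot> bas (triv v)) eQ u) (bas (triv v) \<odot> y)"
proof -
  have b: "gamma0 (tri (bas q) (triv v) (bas u)) = - lin (\<lambda>u. asplit_in (bas q \<odot> bas (triv v)) eQ u) (bas (triv v) \<odot> bas u)" for q u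
    by (auto simp: tri_bas gamma0_def pa_mult_bas asplit_in_zero_left islin_zero[OF islin_bsp1])
  have i1: "islin (\<lambda>x. - lin (\<lambda>u. asplit_in (x \<odot> bas (triv v)) eQ u) z)" for z
    by (intro islin_neg islin_lin_arg islin_compose[OF islin_bsp1] pa_mult_islin1)
  have i2: "islin (\<lambda>y. - lin (\<lambda>u. asplit_in \<alpha> eQ u) (bas (triv v) \<odot> y))" for \<alpha>
    by (intro islin_neg islin_compose[OF islin_lin] pa_mult_islin2)
  have c: "gamma0 (tri (bas q) (triv v) y) = - lin (\<lambda>u. asplit_in (bas q \<odot> bas (triv v)) eQ u) (bas (triv v) \<odot> y)" for q
    using islin_eqI[OF islin_compose[OF islin_gamma0 islin_tri2[of "bas q" "triv v"]] i2[of "bas q \<odot> bas (triv v)"], of y] b by blast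
  show ?thesis
    using islin_eqI[OF islin_compose[OF islin_gamma0 islin_tri1[of "triv v" y]] i1[of "bas (triv v) \<odot> y"], of x] c by blast
qed

lemma tnf_gamma0: assumes "valid 0 x" shows "tnf (gamma 0 x) = gamma0 (tnf x)"
proof (rule tnf_valid_eqI[OF islin_compose[OF islin_tnf islin_gamma] islin_compose[OF islin_gamma0 islin_tnf] assms])
  fix a w b assume o: "a \<in> carrier A" "w \<in> amb 0" "b \<in> carrier A"
  then obtain v where v: "w = triv v" "v \<in> verts Q" by (auto simp: amb_simps)
  let ?x = "lin (\<lambda>u. if tgt w = src u then scale ((-1) ^ Suc 0) (split (Suc 0) (pcomp w u)) else 0) (sigma b)"
  have vx: "valid (Suc 0) ?x"
    by (rule valid_lin) (simp add: valid_scale[of _ _ "- 1", simplified] split_valid amb_QP)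
  have "tnf (gamma 0 (bas (a, w, b))) = actN (sigma a) eQ (tnf ?x)"
    unfolding gamma_bas using tnf_act[OF vx o(1)] by simp
  also have "\<dots> = lin (\<lambda>u. actN (sigma a) eQ (tnf (if tgt w = src u then scale ((-1) ^ Suc 0) (split (Suc 0) (pcomp w u)) else 0))) (sigma b)"
    by (rule islin_comp_lin[OF islin_compose[OF islin_actN islin_tnf]])
  also have "\<dots> = lin (\<lambda>u. gamma0 (tri (sigma a) w (bas u))) (sigma b)"
  proof (rule lin_cong)
    fix u
    have "asplit_in (sigma a \<odot> bas (triv (src u))) eQ u = asplit_in (sigma a) eQ u"
      by (rule asplit_in_triv)
    then show "actN (sigma a) eQ (tnf (if tgt w = src u then scale ((-1) ^ Suc 0) (split (Suc 0) (pcomp w u)) else 0)) = gamma0 (tri (sigma a) w (bas u))"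
      using v o by (auto simp: gamma0_tri tnf_split1 islin_uminus[OF islin_tnf] islin_uminus[OF islin_actN] actN_asplit sigma_CQ eQ_CQ
          pa_mult_bas islin_zero[OF islin_tnf] islin_zero[OF islin_actN])
  qed
  also have "\<dots> = gamma0 (tnf (bas (a, w, b)))"
    using islin_expand[OF islin_compose[OF islin_gamma0 islin_tri2], of "sigma a" w "sigma b"] by simp
  finally show "tnf (gamma 0 (bas (a, w, b))) = gamma0 (tnf (bas (a, w, b)))" .
qed

text \<open>The normal form of \<open>x \<otimes> y\<close> in \<open>P\<^sub>0 = A \<otimes> A\<close>.\<close>
definition pure_tensor :: "('v, 'e, 'k) pa \<Rightarrow> ('v, 'e, 'k) pa \<Rightarrow> ('v, 'e, 'k) triples" where
  "pure_tensor x y = (\<Sum>v\<in>verts Q. tri x (triv v) y)"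

lemma gamma0_pure_tensor: assumes "y \<in> CQ" shows "gamma0 (pure_tensor x y) = - lin (asplit_in x eQ) y"
proof (rule islin_eqI[of "\<lambda>y. gamma0 (pure_tensor x y)" "\<lambda>y. - lin (asplit_in x eQ) y"])
  show "islin (\<lambda>y. gamma0 (pure_tensor x y))" unfolding pure_tensor_def
    by (intro islin_compose[OF islin_gamma0] islin_sum_fun islin_tri2)
  show "islin (\<lambda>y. - lin (asplit_in x eQ) y)" by (intro islin_neg islin_lin)
  fix u assume "u \<in> supp y"
  then have u: "u \<in> QP" using assms by (auto simp: CQ_iff)
  have "gamma0 (pure_tensor x (bas u)) = (\<Sum>v\<in>verts Q. if v = src u then - asplit_in x eQ u else 0)"
    unfolding pure_tensor_def islin_sum[OF islin_gamma0]
    by (rule sum.cong) (auto simp: gamma0_tri pa_mult_bas asplit_in_triv)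
  also have "\<dots> = - asplit_in x eQ u" using QP_verts(1)[OF u] by simp
  finally show "gamma0 (pure_tensor x (bas u)) = - lin (asplit_in x eQ) (bas u)" by simp
qed

lemma coaug_valid: "a \<in> carrier A \<Longrightarrow> valid 0 (coaug a)"
  unfolding coaug_def by (rule valid_sum) (simp add: valid_bas amb_simps)

lemma tnf_coaug: "tnf (coaug a) = pure_tensor (sigma a) eQ"
  by (simp add: coaug_def pure_tensor_def islin_sum[OF islin_tnf])

lemma aug_A: assumes "valid 0 z"
  shows "aug z \<in> carrier A" "sigma (aug z) = lin (\<lambda>(a, w, b). nf (nf (sigma a \<odot> bas w) \<odot> sigma b)) z"
proof -
  have 1: "(case t of (a, w, b) \<Rightarrow> a \<otimes>\<^bsub>A\<^esub> pj w \<otimes>\<^bsub>A\<^esub> b) \<in> carrier A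
      \<and> sigma (case t of (a, w, b) \<Rightarrow> a \<otimes>\<^bsub>A\<^esub> pj w \<otimes>\<^bsub>A\<^esub> b) = (case t of (a, w, b) \<Rightarrow> nf (nf (sigma a \<odot> bas w) \<odot> sigma b))"
    if t: "t \<in> supp z" for t
  proof -
    obtain a w b where tt: "t = (a, w, b)" by (cases t)
    have o: "a \<in> carrier A" "w \<in> amb 0" "b \<in> carrier A" using valid_keys[OF assms] t tt by blast+
    then obtain v where v: "w = triv v" "v \<in> verts Q" by (auto simp: amb_simps)
    then show ?thesis using o tt by (simp add: sigma_mult sigma_pj triv_QP nf_Irr triv_Irr)
  qed
  show "aug z \<in> carrier A" unfolding aug_def by (rule Alin_A(1)) (use 1 in blast)
  have "sigma (aug z) = lin (\<lambda>t. sigma (case t of (a, w, b) \<Rightarrow> a \<otimes>\<^bsub>A\<^esub> pj w \<otimes>\<^bsub>A\<^esub> b)) z"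
    unfolding aug_def by (rule Alin_A(2)) (use 1 in blast)
  also have "\<dots> = lin (\<lambda>(a, w, b). nf (nf (sigma a \<odot> bas w) \<odot> sigma b)) z"
    by (rule lin_cong) (use 1 in blast)
  finally show "sigma (aug z) = \<dots>" .
qed

lemma delta1_1: "delta1 (Suc 0) w = bas (pj w, triv (tgt w), \<one>\<^bsub>A\<^esub>) - bas (\<one>\<^bsub>A\<^esub>, triv (src w), pj w)"
  and delta1_2: "delta1 (Suc (Suc 0)) w = split (Suc 0) w"
  by (simp_all add: delta1_def)

lemma delta1_1_valid: "w \<in> arw \<Longrightarrow> valid 0 (delta1 (Suc 0) w)"
  unfolding delta1_1 using arw_QP[of w] QP_verts[of w]
  by (intro valid_diff) (simp_all add: valid_bas amb_simps)

lemma aug_delta1: assumes "w \<in> arw" shows "aug (delta1 (Suc 0) w) = \<zero>\<^bsub>A\<^esub>"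
proof (rule sigma_inj)
  have w: "w \<in> QP" "src w \<in> verts Q" "tgt w \<in> verts Q" "w \<in> Irr"
    using assms arw_QP QP_verts arw_Irr by auto
  show "sigma (aug (delta1 (Suc 0) w)) = sigma \<zero>\<^bsub>A\<^esub>"
    unfolding aug_A(2)[OF delta1_1_valid[OF assms]] unfolding delta1_1
    using w by (simp add: lin_diff sigma_pj nf_Irr bas_triv_tgt eQ_left eQ_right
        CQ_bas triv_QP bas_triv_src triv_Irr)
qed (simp_all add: aug_A[OF delta1_1_valid[OF assms]])

text \<open>The value \<open>\<partial>\<^sub>1(1 \<otimes> w \<otimes> 1)\<close>.  The correction term represents zero, but not by the zero combination.\<close>
definition bd1 :: "('v, 'e) qpath \<Rightarrow> ('v, 'e, 'k) Pten" where
  "bd1 w = delta1 (Suc 0) w - coaug (aug (delta1 (Suc 0) w))"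

lemma bdry_1: "bdry (Suc 0) = bimod_ext bd1" by (simp add: bd1_def[abs_def])

lemma bd1_valid: "w \<in> arw \<Longrightarrow> valid 0 (bd1 w)"
  unfolding bd1_def by (intro valid_diff delta1_1_valid coaug_valid) (simp_all add: aug_A delta1_1_valid)

lemma tnf_bd1: assumes "w \<in> arw"
  shows "tnf (bd1 w) = tri (bas w) (triv (tgt w)) eQ - tri eQ (triv (src w)) (bas w)" "tnf (bd1 w) = tnf (delta1 (Suc 0) w)"
proof -
  have "tnf (coaug \<zero>\<^bsub>A\<^esub>) = 0" by (simp add: tnf_coaug pure_tensor_def islin_zero[OF islin_tri1])
  then show "tnf (bd1 w) = tnf (delta1 (Suc 0) w)" by (simp add: bd1_def islin_diff[OF islin_tnf] aug_delta1[OF assms])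
  then show "tnf (bd1 w) = tri (bas w) (triv (tgt w)) eQ - tri eQ (triv (src w)) (bas w)"
    using arw_QP[OF assms] arw_Irr[OF assms] by (simp add: delta1_1 islin_diff[OF islin_tnf] sigma_pj nf_Irr)
qed

lemma bimod_ext_bas: "bimod_ext g (bas (a, w, b)) = act a (g w) b"
  by (simp add: bimod_ext_def)

lemma islin_bimod_ext [simp]: "islin (bimod_ext g)" by (simp add: bimod_ext_def)

lemma valid_bimod_ext:
  assumes "\<And>w. w \<in> amb n \<Longrightarrow> valid m (g w)" "valid n x" shows "valid m (bimod_ext g x)"
  unfolding bimod_ext_def
proof (rule valid_lin)
  fix t assume t: "t \<in> supp x"
  obtain a w b where tt: "t = (a, w, b)" by (cases t)
  then have o: "a \<in> carrier A" "w \<in> amb n" "b \<in> carrier A" using valid_keys[OF assms(2)] t by blast+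
  show "valid m (case t of (a, w, b) \<Rightarrow> act a (g w) b)"
    unfolding tt prod.case by (intro valid_act assms(1) o)
qed

lemma tnf_bimod_ext_bas:
  "\<lbrakk>valid m (g w); a \<in> carrier A; b \<in> carrier A\<rbrakk> \<Longrightarrow> tnf (bimod_ext g (bas (a, w, b))) = actN (sigma a) (sigma b) (tnf (g w))"
  by (simp add: bimod_ext_bas tnf_act)

lemma valid_bdry1: "valid (Suc 0) x \<Longrightarrow> valid 0 (bdry (Suc 0) x)"
  unfolding bdry_1 by (rule valid_bimod_ext[of "Suc 0"]) (simp_all add: bd1_valid amb_simps)

lemma valid_delta1: "valid (Suc 0) x \<Longrightarrow> valid 0 (delta (Suc 0) x)"
  unfolding delta_def by (rule valid_bimod_ext[of "Suc 0"]) (simp_all add: delta1_1_valid amb_simps)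

lemma tnf_delta1_bdry1: assumes "valid (Suc 0) x" shows "tnf (delta (Suc 0) x) = tnf (bdry (Suc 0) x)"
  unfolding delta_def bdry_1
  by (rule tnf_valid_eqI[OF islin_compose[OF islin_tnf islin_bimod_ext] islin_compose[OF islin_tnf islin_bimod_ext] assms])
    (simp add: tnf_bimod_ext_bas[of 0] delta1_1_valid bd1_valid amb_simps tnf_bd1(2))

text \<open>The series stops as soon as its terms vanish in normal form; terms that vanish earlier do no harm.\<close>
lemma tnf_perturb:
  assumes x: "valid n x" and amb: "amb (Suc n) \<subseteq> QP" and D: "\<And>y. valid (Suc n) y \<Longrightarrow> valid n (D y)"
    and del: "\<And>y. valid (Suc n) y \<Longrightarrow> valid n (delta (Suc n) y)"
    and zero: "\<And>i. i \<ge> n0 \<Longrightarrow> tnf (gamma n (((\<lambda>y. delta (Suc n) (gamma n y) - D (gamma n y)) ^^ i) x)) = 0" and n0: "1 \<le> n0"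
  shows "valid (Suc n) (perturb n D x)"
    and "tnf (perturb n D x) = (\<Sum>i<n0. tnf (gamma n (((\<lambda>y. delta (Suc n) (gamma n y) - D (gamma n y)) ^^ i) x)))"
proof -
  let ?T = "\<lambda>y. delta (Suc n) (gamma n y) - D (gamma n y)"
  have vT: "valid n ((?T ^^ i) x)" for i
    by (induction i) (simp_all add: x valid_diff D del valid_gamma amb)
  have vg: "valid (Suc n) (gamma n ((?T ^^ i) x))" for i by (rule valid_gamma[OF vT amb])
  let ?J = "{i. 1 \<le> i \<and> gamma n ((?T ^^ i) x) \<notin> P_null (Suc n)}"
  have J: "?J = {i. 1 \<le> i \<and> tnf (gamma n ((?T ^^ i) x)) \<noteq> 0}" using P_null_iff[OF vg] by simp
  have "\<not> (i \<ge> n0)" if "i \<in> ?J" for i using zero[of i] that unfolding J by blast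
  then have sub: "?J \<subseteq> {1..<n0}" unfolding J by fastforce
  have p: "perturb n D x = gamma n x + (\<Sum>i\<in>?J. gamma n ((?T ^^ i) x))" by (simp add: perturb_def Let_def)
  show "valid (Suc n) (perturb n D x)" unfolding p
    by (intro valid_add valid_sum vg) (use vg[of 0] in simp)
  have "tnf (perturb n D x) = tnf (gamma n x) + (\<Sum>i\<in>?J. tnf (gamma n ((?T ^^ i) x)))"
    unfolding p by (simp add: islin_add[OF islin_tnf] islin_sum[OF islin_tnf])
  also have "(\<Sum>i\<in>?J. tnf (gamma n ((?T ^^ i) x))) = (\<Sum>i\<in>{1..<n0}. tnf (gamma n ((?T ^^ i) x)))"
    by (rule sum.mono_neutral_left[OF _ sub]) (unfold J, auto)
  also have "tnf (gamma n x) + \<dots> = (\<Sum>i<n0. tnf (gamma n ((?T ^^ i) x)))"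
  proof -
    have "{..<n0} = insert 0 {1..<n0}" using n0 by auto
    then show ?thesis by simp
  qed
  finally show "tnf (perturb n D x) = (\<Sum>i<n0. tnf (gamma n ((?T ^^ i) x)))" .
qed

text \<open>\<open>\<rho>\<^sub>0\<close> agrees with \<open>\<gamma>\<^sub>0\<close>, as \<open>\<partial>\<^sub>1\<close> agrees with \<open>\<delta>\<^sub>1\<close>.\<close>
lemma rho0: assumes "valid 0 x" shows "valid (Suc 0) (rho 0 x)" "tnf (rho 0 x) = gamma0 (tnf x)"
proof -
  let ?T = "\<lambda>y. delta (Suc 0) (gamma 0 y) - bdry (Suc 0) (gamma 0 y)"
  have vT: "valid 0 ((?T ^^ i) x)" for i
    by (induction i) (simp_all only: funpow.simps o_apply id_apply assms valid_diff valid_delta1 valid_bdry1 valid_gamma[OF _ amb_QP(2)])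
  have NT: "tnf (?T y) = 0" if "valid 0 y" for y
    using tnf_delta1_bdry1[OF valid_gamma[OF that amb_QP(2)]] by (simp only: islin_diff[OF islin_tnf] diff_self)
  have z: "tnf (gamma 0 ((?T ^^ i) x)) = 0" if i1: "i \<ge> 1" for i
  proof -
    obtain j where j: "i = Suc j" using i1 by (cases i) auto
    have "tnf ((?T ^^ i) x) = 0" unfolding j funpow.simps o_apply by (rule NT[OF vT])
    then show ?thesis using tnf_gamma0[OF vT[of i]] by (simp only: islin_zero[OF islin_gamma0])
  qed
  have r: "rho 0 x = perturb 0 (bdry (Suc 0)) x" by (simp only: rho.simps)
  show "valid (Suc 0) (rho 0 x)" unfolding r
    by (rule tnf_perturb(1)[OF assms amb_QP(2) valid_bdry1 valid_delta1 z order_refl])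
  show "tnf (rho 0 x) = gamma0 (tnf x)" unfolding r
    using tnf_perturb(2)[OF assms amb_QP(2) valid_bdry1 valid_delta1 z order_refl] by (simp add: tnf_gamma0[OF assms])
qed

text \<open>Moving the arrow from the left to the right factor, consecutive terms of \<open>\<partial>\<^sub>1 split\<^sub>1(p)\<close> cancel.\<close>
lemma telescope:
  assumes "p \<in> QP"
  shows "\<lbrakk>c \<in> QP; tgt c = src p\<rbrakk> \<Longrightarrow>
     asum (\<lambda>q y r. tri (nf (bas c \<odot> (bas q \<odot> bas y))) (triv (tgt y)) (nf (bas r)) - tri (nf (bas c \<odot> bas q)) (triv (src y)) (nf (bas y \<odot> bas r))) p
     = tri (nf (bas c \<odot> bas p)) (triv (tgt p)) eQ - tri (nf (bas c)) (triv (src p)) (nf (bas p))"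
  using assms
proof (induction p arbitrary: c rule: path_induct)
  case (triv v)
  have "eQ = (\<Sum>v\<in>verts Q. bas (triv v))" by (rule eQ_def)
  have "tri (nf (bas c)) (triv v) eQ = tri (nf (bas c)) (triv v) (bas (triv v) \<odot> eQ)" by (simp add: tri_triv_right)
  then have "tri (nf (bas c)) (triv v) eQ = tri (nf (bas c)) (triv v) (bas (triv v))"
    using triv(1) by (simp add: eQ_right CQ_bas triv_QP)
  then show ?case using triv by (simp add: pa_mult_bas nf_Irr triv_Irr)
next
  case (arrow y p')
  have y: "y \<in> QP" by (rule arw_QP[OF arrow(1)])
  have cy: "pcomp c y \<in> QP" using arrow y by (auto intro!: pcomp_QP)
  let ?g = "\<lambda>c q y r. tri (nf (bas c \<odot> (bas q \<odot> bas y))) (triv (tgt y)) (nf (bas r)) - tri (nf (bas c \<odot> bas q)) (triv (src y)) (nf (bas y \<odot> bas r))"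
  have "asum (?g c) (pcomp y p') = ?g c (triv (src y)) y p' + asum (\<lambda>q. ?g c (pcomp y q)) p'"
    by (rule asum_arw_pcomp[OF arrow(1-3)])
  also have "asum (\<lambda>q. ?g c (pcomp y q)) p' = asum (?g (pcomp c y)) p'"
    by (rule asum_cong) (use arrow in \<open>simp add: pa_mult_bas pcomp_assoc\<close>)
  also have "\<dots> = tri (nf (bas (pcomp c y) \<odot> bas p')) (triv (tgt p')) eQ - tri (nf (bas (pcomp c y))) (triv (src p')) (nf (bas p'))"
    by (rule arrow(4)[OF cy]) (use arrow in simp)
  also have "?g c (triv (src y)) y p' = tri (nf (bas (pcomp c y))) (triv (src p')) (nf (bas p')) - tri (nf (bas c)) (triv (src y)) (nf (bas (pcomp y p')))"
    using arrow by (simp add: pa_mult_bas)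
  finally show ?case using arrow by (simp add: pa_mult_bas pcomp_assoc)
qed

lemma tnf_bdry1_split:
  assumes "p \<in> QP"
  shows "tnf (bdry (Suc 0) (split (Suc 0) p)) = tri (nf (bas p)) (triv (tgt p)) eQ - tri eQ (triv (src p)) (nf (bas p))"
proof -
  have "tnf (bdry (Suc 0) (split (Suc 0) p)) = asum (\<lambda>q y r. tnf (bdry (Suc 0) (bas (pj q, y, pj r)))) p"
    unfolding split_def asum_def amb_simps bdry_1
    by (simp add: islin_sum[OF islin_compose[OF islin_tnf islin_bimod_ext]] case_prod_unfold)
  also have "\<dots> = asum (\<lambda>q y r. tri (nf (bas (triv (src p)) \<odot> (bas q \<odot> bas y))) (triv (tgt y)) (nf (bas r)) - tri (nf (bas (triv (src p)) \<odot> bas q)) (triv (src y)) (nf (bas y \<odot> bas r))) p"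
  proof (rule asum_cong)
    fix q y r assume o: "q \<in> QP" "y \<in> arw" "r \<in> QP" "tgt q = src y" "tgt y = src r" "p = pcomp (pcomp q y) r"
    have yQ: "y \<in> QP" using o arw_QP by blast
    have yC: "bas y \<in> CQ" "bas q \<in> CQ" "bas r \<in> CQ" using o yQ by (simp_all add: CQ_bas)
    have "tnf (bdry (Suc 0) (bas (pj q, y, pj r))) = actN (nf (bas q)) (nf (bas r)) (tri (bas y) (triv (tgt y)) eQ - tri eQ (triv (src y)) (bas y))"
      unfolding bdry_1 using tnf_bimod_ext_bas[of 0 bd1 y "pj q" "pj r", OF bd1_valid[OF o(2)]] o by (simp add: tnf_bd1 sigma_pj)
    also have "\<dots> = tri (nf (bas q \<odot> bas y)) (triv (tgt y)) (nf (bas r)) - tri (nf (bas q)) (triv (src y)) (nf (bas y \<odot> bas r))"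
      using yC by (simp add: islin_diff[OF islin_actN] actN_tri nf_CQ eQ_CQ eQ_left eQ_right nf_mult_left nf_mult_right nf_nf)
    finally show "tnf (bdry (Suc 0) (bas (pj q, y, pj r))) = tri (nf (bas (triv (src p)) \<odot> (bas q \<odot> bas y))) (triv (tgt y)) (nf (bas r)) - tri (nf (bas (triv (src p)) \<odot> bas q)) (triv (src y)) (nf (bas y \<odot> bas r))"
      using o by (simp add: pa_mult_bas)
  qed
  also have "\<dots> = tri (nf (bas (triv (src p)) \<odot> bas p)) (triv (tgt p)) eQ - tri (nf (bas (triv (src p)))) (triv (src p)) (nf (bas p))"
    by (rule telescope[OF assms]) (use QP_verts[OF assms] in \<open>simp_all add: triv_QP\<close>)
  also have "tri (nf (bas (triv (src p)))) (triv (src p)) (nf (bas p)) = tri eQ (triv (src p)) (nf (bas p))"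
    using QP_verts[OF assms] tri_triv_left[of eQ "src p" "triv (src p)" "nf (bas p)"]
    by (simp add: nf_Irr triv_Irr eQ_left CQ_bas triv_QP)
  finally show ?thesis by (simp add: bas_triv_src)
qed

lemma nf_S: "s \<in> S \<Longrightarrow> nf (bas s) = \<phi> s"
  by (rule nf_unique[OF phi_kIrr rel_I])

text \<open>The value \<open>\<partial>\<^sub>2(1 \<otimes> s \<otimes> 1)\<close>.\<close>
definition bd2 :: "('v, 'e) qpath \<Rightarrow> ('v, 'e, 'k) Pten" where
  "bd2 s = delta1 (Suc (Suc 0)) s - rho 0 (bdry (Suc 0) (delta1 (Suc (Suc 0)) s))"

lemma bdry_2: "bdry (Suc (Suc 0)) = bimod_ext bd2" by (simp only: bdry.simps bd2_def[abs_def])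

lemma bd2_valid: "valid (Suc 0) (bd2 s)"
  unfolding bd2_def delta1_2 by (intro valid_diff rho0 valid_bdry1 split_valid amb_QP)

lemma gamma0_tri_one: "v \<in> verts Q \<Longrightarrow> gamma0 (tri x (triv v) eQ) = 0"
  by (simp add: gamma0_tri eQ_right CQ_bas triv_QP asplit_in_def)

text \<open>By \<open>tnf_bdry1_split\<close> the correction term is \<open>\<gamma>\<^sub>0\<close> of \<open>s \<otimes> 1 - 1 \<otimes> s\<close> with \<open>\<sigma>\<pi>(s) = \<phi> s\<close>, hence a splitting of
  \<open>\<phi> s\<close>.\<close>
lemma tnf_bd2: assumes s: "s \<in> S" shows "tnf (bd2 s) = asplit s - lin asplit (\<phi> s)"
proof -
  have sQ: "s \<in> QP" using s by (rule S_QP)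
  have v: "src s \<in> verts Q" "tgt s \<in> verts Q" using QP_verts[OF sQ] .
  have "tnf (rho 0 (bdry (Suc 0) (split (Suc 0) s))) = gamma0 (tri (nf (bas s)) (triv (tgt s)) eQ - tri eQ (triv (src s)) (nf (bas s)))"
    using rho0(2)[OF valid_bdry1[OF split_valid[OF amb_QP(2)]]] by (simp only: tnf_bdry1_split[OF sQ])
  also have "\<dots> = lin (\<lambda>u. asplit_in (eQ \<odot> bas (triv (src s))) eQ u) (bas (triv (src s)) \<odot> \<phi> s)"
    unfolding islin_diff[OF islin_gamma0] gamma0_tri_one[OF v(2)] gamma0_tri[OF v(1)] nf_S[OF s] by simp
  also have "bas (triv (src s)) \<odot> \<phi> s = \<phi> s" by (rule triv_sandwich(1)[OF phi_keys[OF s]])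
  also have "lin (\<lambda>u. asplit_in (eQ \<odot> bas (triv (src s))) eQ u) (\<phi> s) = lin asplit (\<phi> s)"
  proof (rule lin_cong)
    fix u assume "u \<in> supp (\<phi> s)"
    then have "src u = src s" by (rule phi_path(2)[OF s])
    then show "asplit_in (eQ \<odot> bas (triv (src s))) eQ u = asplit u" using asplit_in_triv[of eQ u eQ] by (simp add: asplit_asplit_in)
  qed
  finally show ?thesis unfolding bd2_def delta1_2 islin_diff[OF islin_tnf] tnf_split1 by simp
qed

text \<open>The difference of \<open>\<delta>\<^sub>2\<close> and \<open>\<partial>\<^sub>2\<close> on normal forms.\<close>
definition subst_phi :: "('v, 'e, 'k) triples \<Rightarrow> ('v, 'e, 'k) triples" where
  "subst_phi = lin (\<lambda>(q, s, r). lin (asplit_in (bas q) (bas r)) (\<phi> s))"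

lemma islin_subst_phi [simp]: "islin subst_phi" by (simp add: subst_phi_def)

lemma subst_phi_tri: assumes "s \<in> S" shows "subst_phi (tri x s y) = lin (asplit_in x y) (\<phi> s)"
proof -
  have i1: "islin (\<lambda>x. lin (asplit_in x z) (\<phi> s))" for z by (intro islin_lin_arg islin_bsp1)
  have i2: "islin (\<lambda>y. lin (asplit_in z y) (\<phi> s))" for z by (intro islin_lin_arg islin_bsp2)
  have b: "subst_phi (tri (bas q) s (bas r)) = lin (asplit_in (bas q) (bas r)) (\<phi> s)" for q r
  proof (cases "tgt q = src s \<and> tgt s = src r")
    case False
    have "lin (asplit_in (bas q) (bas r)) (\<phi> s) = lin (\<lambda>u. 0) (\<phi> s)"
    proof (rule lin_cong)
      fix u assume "u \<in> supp (\<phi> s)"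
      then show "asplit_in (bas q) (bas r) u = 0"
        using phi_path(2,3)[OF assms] False asplit_in_zero_left[of q u "bas r"] asplit_in_zero_right[of r u "bas q"] by metis
    qed
    then show ?thesis using False by (auto simp add: tri_bas islin_zero[OF islin_subst_phi])
  qed (simp add: tri_bas subst_phi_def)
  have c: "subst_phi (tri (bas q) s y) = lin (asplit_in (bas q) y) (\<phi> s)" for q
    using islin_eqI[OF islin_compose[OF islin_subst_phi islin_tri2[of "bas q" s]] i2[of "bas q"], of y] b by blast
  show ?thesis
    using islin_eqI[OF islin_compose[OF islin_subst_phi islin_tri1[of s y]] i1[of y], of x] c by blast
qed

lemma valid_delta2: "valid (Suc (Suc 0)) x \<Longrightarrow> valid (Suc 0) (delta (Suc (Suc 0)) x)"
  unfolding delta_def by (rule valid_bimod_ext[of "Suc (Suc 0)"]) (simp_all add: delta1_2 split_valid amb_QP)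

lemma valid_bdry2: "valid (Suc (Suc 0)) x \<Longrightarrow> valid (Suc 0) (bdry (Suc (Suc 0)) x)"
  unfolding bdry_2 by (rule valid_bimod_ext[of "Suc (Suc 0)"]) (simp_all add: bd2_valid)

lemma islin_asplit_lin: "actN \<alpha> \<beta> (lin asplit x) = lin (asplit_in \<alpha> \<beta>) x" if "\<alpha> \<in> CQ" "\<beta> \<in> CQ"
  using that by (simp add: islin_comp_lin[OF islin_actN] actN_asplit)

lemma tnf_delta2_bdry2:
  assumes "valid (Suc (Suc 0)) x"
  shows "tnf (delta (Suc (Suc 0)) x - bdry (Suc (Suc 0)) x) = subst_phi (tnf x)"
proof (rule tnf_valid_eqI[of "\<lambda>x. tnf (delta (Suc (Suc 0)) x - bdry (Suc (Suc 0)) x)", OF _ islin_compose[OF islin_subst_phi islin_tnf] assms])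
  show "islin (\<lambda>x. tnf (delta (Suc (Suc 0)) x - bdry (Suc (Suc 0)) x))"
    unfolding bdry_2 delta_def by (intro islin_compose[OF islin_tnf] islin_minus islin_bimod_ext)
  fix a s b assume o: "a \<in> carrier A" "s \<in> amb (Suc (Suc 0))" "b \<in> carrier A"
  then have s: "s \<in> S" by (simp add: amb_simps)
  have "tnf (delta (Suc (Suc 0)) (bas (a, s, b))) = actN (sigma a) (sigma b) (asplit s)"
    unfolding delta_def using tnf_bimod_ext_bas[of "Suc 0" "delta1 (Suc (Suc 0))" s a b] o
    by (simp add: delta1_2 split_valid amb_QP tnf_split1)
  moreover have "tnf (bdry (Suc (Suc 0)) (bas (a, s, b))) = actN (sigma a) (sigma b) (asplit s - lin asplit (\<phi> s))"
    unfolding bdry_2 using tnf_bimod_ext_bas[of "Suc 0" bd2 s a b, OF bd2_valid o(1,3)] by (simp add: tnf_bd2[OF s])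
  ultimately show "tnf (delta (Suc (Suc 0)) (bas (a, s, b)) - bdry (Suc (Suc 0)) (bas (a, s, b))) = subst_phi (tnf (bas (a, s, b)))"
    unfolding islin_diff[OF islin_tnf] using o by (simp add: islin_diff[OF islin_actN] islin_asplit_lin sigma_CQ subst_phi_tri[OF s])
qed

lemma tnf_irr_triples: assumes "valid n x" shows "supp (tnf x) \<subseteq> irr_triples (amb n)"
  unfolding tnf_def
proof (rule keys_lin_subset)
  fix t assume t: "t \<in> supp x"
  obtain a w b where tt: "t = (a, w, b)" by (cases t)
  then have o: "a \<in> carrier A" "w \<in> amb n" "b \<in> carrier A" using valid_keys[OF assms] t by blast+
  show "supp (case t of (a, w, b) \<Rightarrow> tri (sigma a) w (sigma b)) \<subseteq> irr_triples (amb n)"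
    unfolding tt prod.case by (intro tri_irr_triples sigma_kIrr o)
qed

lemma tau_subst_phi: assumes "supp z \<subseteq> irr_triples arw" shows "tau z = subst_phi (gamma1 z)"
proof (rule islin_eqI[OF islin_tau islin_compose[OF islin_subst_phi islin_gamma1]])
  fix t assume "t \<in> supp z"
  then obtain q y u where t: "t = (q, y, u)" "q \<in> Irr" "y \<in> arw" "u \<in> Irr" "tgt q = src y" "tgt y = src u"
    using assms unfolding irr_triples_def by blast
  show "tau (bas t) = subst_phi (gamma1 (bas t))"
  proof (cases "pcomp y u \<in> Irr")
    case True
    then have "tau (bas t) = 0" "gamma1 (bas t) = 0" by (intro tau_killed; use t in simp)+
    then show ?thesis by (simp add: islin_zero[OF islin_subst_phi])
  next
    case False
    obtain s r where tt: "(triv (src y), s, r) \<in> rightmost S (pcomp y u)" using rightmost_arrow[OF t(3,4,6) False] by metis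
    show ?thesis unfolding t(1) tau_bas[OF tt] by (simp add: subst_phi_def asplit_in_def[abs_def])
  qed
qed

text \<open>On normal forms \<open>\<gamma>\<^sub>1\<close> and \<open>\<delta>\<^sub>2\<gamma>\<^sub>1 - \<partial>\<^sub>2\<gamma>\<^sub>1\<close> are \<open>gamma1\<close> and \<open>tau\<close>, and \<open>\<tau>\<close> is nilpotent.\<close>
lemma rho1: assumes "valid (Suc 0) x"
  shows "valid (Suc (Suc 0)) (rho (Suc 0) x)" "tnf (rho (Suc 0) x) = Theta (tnf x)"
proof -
  let ?D = "bdry (Suc (Suc 0))"
  let ?T = "\<lambda>y. delta (Suc (Suc 0)) (gamma (Suc 0) y) - ?D (gamma (Suc 0) y)"
  note vgam = valid_gamma[OF _ amb_QP(4)]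
  have vT: "valid (Suc 0) ((?T ^^ i) x)" for i
    by (induction i) (simp_all only: funpow.simps o_apply id_apply assms valid_diff valid_delta2 valid_bdry2 vgam)
  have NT: "tnf (?T y) = tau (tnf y)" if "valid (Suc 0) y" for y
    using tnf_delta2_bdry2[OF vgam[OF that]] tau_subst_phi[of "tnf y"] tnf_irr_triples[OF that] by (simp only: tnf_gamma1[OF that] amb_simps)
  have NTi: "tnf ((?T ^^ i) x) = (tau ^^ i) (tnf x)" for i
    by (induction i) (simp_all only: funpow.simps o_apply id_apply NT[OF vT])
  have TRx: "supp (tnf x) \<subseteq> irr_triples arw" using tnf_irr_triples[OF assms] by (simp only: amb_simps)
  obtain m where m: "(tau ^^ m) (tnf x) = 0" using nilp_irr_triples[OF TRx] unfolding nilp_def by blast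
  obtain n0 where n0: "\<And>n. n \<ge> n0 \<Longrightarrow> (\<Sum>i<n. gamma1 ((tau ^^ i) (tnf x))) = Theta (tnf x)"
    using Theta_eventually[OF TRx] by blast
  let ?n = "Suc (max m n0)"
  have z: "tnf (gamma (Suc 0) ((?T ^^ i) x)) = 0" if "i \<ge> ?n" for i
    using tau_pow_mono[OF m, of i] that by (simp only: tnf_gamma1[OF vT] NTi) (simp add: islin_zero[OF islin_gamma1])
  have r: "rho (Suc 0) x = perturb (Suc 0) ?D x" by (simp only: rho.simps)
  have n1: "1 \<le> ?n" by simp
  show "valid (Suc (Suc 0)) (rho (Suc 0) x)" unfolding r
    by (rule tnf_perturb(1)[OF assms amb_QP(4) valid_bdry2 valid_delta2 z n1])
  have "tnf (perturb (Suc 0) ?D x) = (\<Sum>i<?n. tnf (gamma (Suc 0) ((?T ^^ i) x)))"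
    by (rule tnf_perturb(2)[OF assms amb_QP(4) valid_bdry2 valid_delta2 z n1])
  also have "\<dots> = (\<Sum>i<?n. gamma1 ((tau ^^ i) (tnf x)))" by (simp only: tnf_gamma1[OF vT] NTi)
  also have "\<dots> = Theta (tnf x)" by (rule n0) simp
  finally show "tnf (rho (Suc 0) x) = Theta (tnf x)" unfolding r .
qed

subsection \<open>The comparison maps\<close>

lemma A_one_simps [simp]: "a \<in> carrier A \<Longrightarrow> a \<otimes>\<^bsub>A\<^esub> \<one>\<^bsub>A\<^esub> = a" "a \<in> carrier A \<Longrightarrow> \<one>\<^bsub>A\<^esub> \<otimes>\<^bsub>A\<^esub> a = a"
proof -
  interpret RA: ring A by (rule ring_A)
  show "a \<in> carrier A \<Longrightarrow> a \<otimes>\<^bsub>A\<^esub> \<one>\<^bsub>A\<^esub> = a" "a \<in> carrier A \<Longrightarrow> \<one>\<^bsub>A\<^esub> \<otimes>\<^bsub>A\<^esub> a = a" by auto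
qed

lemma A_minus: assumes "a \<in> carrier A" "b \<in> carrier A"
  shows "a \<ominus>\<^bsub>A\<^esub> b \<in> carrier A" "sigma (a \<ominus>\<^bsub>A\<^esub> b) = sigma a - sigma b"
proof -
  interpret RA: ring A by (rule ring_A)
  show c: "a \<ominus>\<^bsub>A\<^esub> b \<in> carrier A" using assms by simp
  have "(a \<ominus>\<^bsub>A\<^esub> b) \<oplus>\<^bsub>A\<^esub> b = a" using assms by (simp add: a_minus_def RA.a_assoc RA.l_neg)
  then have "sigma (a \<ominus>\<^bsub>A\<^esub> b) + sigma b = sigma a" using sigma_add[OF c assms(2)] by simp
  then show "sigma (a \<ominus>\<^bsub>A\<^esub> b) = sigma a - sigma b" by (simp add: algebra_simps)
qed

lemma islin_G [simp]: "islin (G n)" by (cases n) simp_all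

lemma islin_bar_diff [simp]: "islin (bar_diff n)" by (simp add: bar_diff_def)

lemma actN_pure_tensor: "\<lbrakk>\<alpha> \<in> CQ; \<beta> \<in> CQ; x \<in> CQ; y \<in> CQ\<rbrakk> \<Longrightarrow> actN \<alpha> \<beta> (pure_tensor x y) = pure_tensor (nf (\<alpha> \<odot> x)) (nf (y \<odot> \<beta>))"
  by (simp add: pure_tensor_def islin_sum[OF islin_actN] actN_tri)

lemma G0:
  assumes "x \<in> carrier A" "y \<in> carrier A"
  shows "valid 0 (G 0 (bas [x, y]))" "tnf (G 0 (bas [x, y])) = pure_tensor (sigma x) (sigma y)"
proof -
  have g: "G 0 (bas [x, y]) = act \<one>\<^bsub>A\<^esub> (coaug x) y" using assms by simp
  show "valid 0 (G 0 (bas [x, y]))" unfolding g by (intro valid_act coaug_valid assms A_one_closed)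
  show "tnf (G 0 (bas [x, y])) = pure_tensor (sigma x) (sigma y)" unfolding g
    using tnf_act[OF coaug_valid[OF assms(1)] A_one_closed assms(2)] assms
    by (simp add: tnf_coaug actN_pure_tensor eQ_CQ sigma_CQ eQ_left eQ_right nf_id sigma_kIrr)
qed

lemma lin_asplit_in_eQ: "lin (asplit_in x y) eQ = 0"
  by (simp add: eQ_def lin_sum asplit_in_def)

text \<open>\<open>G\<^sub>1\<close> splits the middle factor at its arrows, as \<open>\<rho>\<^sub>0\<close> does.\<close>
lemma G1:
  assumes "x \<in> carrier A" "y \<in> carrier A" "z \<in> carrier A"
  shows "valid (Suc 0) (G (Suc 0) (bas [x, y, z]))" "tnf (G (Suc 0) (bas [x, y, z])) = lin (asplit_in (sigma x) (sigma z)) (sigma y)"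
proof -
  have b: "bar_diff (Suc 0) (bas [x, y, \<one>\<^bsub>A\<^esub>]) = bas [x \<otimes>\<^bsub>A\<^esub> y, \<one>\<^bsub>A\<^esub>] - bas [x, y]"
    using assms by (simp add: bar_diff_def)
  let ?g = "G 0 (bas [x \<otimes>\<^bsub>A\<^esub> y, \<one>\<^bsub>A\<^esub>]) - G 0 (bas [x, y])"
  have g: "G (Suc 0) (bas [x, y, z]) = act \<one>\<^bsub>A\<^esub> (rho 0 ?g) z"
    unfolding G.simps(2) lin_bas using b by (simp add: islin_diff[OF islin_G] del: G.simps rho.simps)
  have v: "valid 0 ?g" by (intro valid_diff G0) (simp_all add: assms)
  show "valid (Suc 0) (G (Suc 0) (bas [x, y, z]))" unfolding g by (intro valid_act rho0 v assms A_one_closed)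
  have "tnf ?g = pure_tensor (sigma (x \<otimes>\<^bsub>A\<^esub> y)) eQ - pure_tensor (sigma x) (sigma y)"
    using assms by (simp add: islin_diff[OF islin_tnf] G0(2) del: G.simps)
  then have "tnf (rho 0 ?g) = lin (asplit_in (sigma x) eQ) (sigma y)"
    using rho0(2)[OF v] assms by (simp add: islin_diff[OF islin_gamma0] gamma0_pure_tensor eQ_CQ sigma_CQ lin_asplit_in_eQ del: G.simps rho.simps)
  then show "tnf (G (Suc 0) (bas [x, y, z])) = lin (asplit_in (sigma x) (sigma z)) (sigma y)" unfolding g
    using tnf_act[OF rho0(1)[OF v] A_one_closed assms(3)] assms
    by (simp add: islin_comp_lin[OF islin_actN] actN_asplit_in eQ_CQ sigma_CQ eQ_left del: G.simps rho.simps)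
qed

lemma Theta_asplit_in_killed: assumes "p \<in> Irr" "\<alpha> \<in> CQ" shows "Theta (asplit_in \<alpha> eQ p) = 0"
proof -
  have "Theta (asplit_in \<alpha> eQ p) = asum (\<lambda>q y r. 0) p"
    unfolding asplit_in_def asum_islin[OF islin_Theta]
  proof (rule asum_cong)
    fix q y r assume o: "q \<in> QP" "y \<in> arw" "r \<in> QP" "tgt q = src y" "tgt y = src r" "p = pcomp (pcomp q y) r"
    have yQ: "y \<in> QP" using o arw_QP by blast
    have "pcomp q (pcomp y r) \<in> Irr" using assms o by (simp add: pcomp_assoc)
    then have yr: "pcomp y r \<in> Irr" by (rule Irr_subpath) (use o yQ in \<open>simp_all add: pcomp_QP\<close>)
    then have "r \<in> Irr" using Irr_subpath(2)[OF _ yQ o(3,5)] by blast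
    then show "Theta (tri (nf (\<alpha> \<odot> bas q)) y (nf (bas r \<odot> eQ))) = 0"
      using Theta_tri_killed[OF nf_kIrr[OF CQ_mult[OF assms(2) CQ_bas[OF o(1)]]] o(2) _ yr]
      by (simp add: eQ_right CQ_bas o nf_Irr)
  qed
  then show ?thesis by (simp add: asum_zero)
qed

lemma Theta_lin_asplit_in_killed: "x \<in> kIrr \<Longrightarrow> \<alpha> \<in> CQ \<Longrightarrow> Theta (lin (asplit_in \<alpha> eQ) x) = 0"
  unfolding islin_comp_lin[OF islin_Theta] by (rule lin_eq_0) (use Theta_asplit_in_killed in \<open>auto simp: kIrr_iff\<close>)

text \<open>Of the splitting of \<open>a b\<close> at all arrows, \<open>Theta\<close> kills the part at the arrows of \<open>b\<close>, which is irreducible.\<close>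
lemma Theta_product:
  assumes "a \<in> kIrr" "b \<in> kIrr"
  shows "Theta (lin (asplit_in eQ b) a) = Theta (lin asplit (a \<odot> b))"
proof -
  have P: "Theta (lin (asplit_in eQ (bas r)) (bas p)) = Theta (lin asplit (bas p \<odot> bas r))" if p: "p \<in> Irr" and r: "r \<in> Irr" for p r
  proof (cases "tgt p = src r")
    case False
    then show ?thesis by (simp add: asplit_in_zero_right pa_mult_bas)
  next
    case True
    have pQ: "p \<in> QP" and rQ: "r \<in> QP" using p r Irr_QP by auto
    have "asplit (pcomp p r) = asum (\<lambda>q y t. tri (nf (bas q)) y (nf (bas (pcomp t r)))) p + asum (\<lambda>q y t. tri (nf (bas (pcomp p q))) y (nf (bas t))) r"
      unfolding asplit_def by (rule asum_pcomp[OF pQ rQ True])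
    also have "asum (\<lambda>q y t. tri (nf (bas q)) y (nf (bas (pcomp t r)))) p = asplit_in eQ (bas r) p"
      unfolding asplit_in_def by (rule asum_cong) (use True in \<open>simp add: eQ_left CQ_bas pa_mult_bas\<close>)
    also have "asum (\<lambda>q y t. tri (nf (bas (pcomp p q))) y (nf (bas t))) r = asplit_in (bas p) eQ r"
      unfolding asplit_in_def by (rule asum_cong) (use True in \<open>simp add: eQ_right CQ_bas pa_mult_bas\<close>)
    finally show ?thesis using True Theta_asplit_in_killed[OF r CQ_bas[OF pQ]]
      by (simp add: pa_mult_bas islin_add[OF islin_Theta])
  qed
  have i1: "islin (\<lambda>b. Theta (lin (asplit_in eQ b) a))" for a by (intro islin_compose[OF islin_Theta] islin_lin_arg islin_bsp2)
  have i2: "islin (\<lambda>b. Theta (lin asplit (a \<odot> b)))" for a by (intro islin_compose[OF islin_Theta] islin_compose[OF islin_lin] pa_mult_islin2)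
  have i3: "islin (\<lambda>a. Theta (lin (asplit_in eQ b) a))" by (intro islin_compose[OF islin_Theta] islin_lin)
  have i4: "islin (\<lambda>a. Theta (lin asplit (a \<odot> b)))" by (intro islin_compose[OF islin_Theta] islin_compose[OF islin_lin] pa_mult_islin1)
  have Q: "Theta (lin (asplit_in eQ b) (bas p)) = Theta (lin asplit (bas p \<odot> b))" if p: "p \<in> Irr" for p
    by (rule islin_eqI[OF i1[of "bas p"] i2[of "bas p"], of b]) (use P[OF p] assms(2) in \<open>auto simp: kIrr_iff\<close>)
  show ?thesis by (rule islin_eqI[OF i3 i4, of a]) (use Q assms(1) in \<open>auto simp: kIrr_iff\<close>)
qed

lemma tnf_act_one: assumes "valid n x" shows "tnf (act \<one>\<^bsub>A\<^esub> x \<one>\<^bsub>A\<^esub>) = tnf x"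
  by (rule tnf_valid_eqI[OF islin_compose[OF islin_tnf islin_act] islin_tnf assms]) (simp add: act_bas)

text \<open>\<open>G\<^sub>2(1 \<otimes> a \<otimes> b \<otimes> 1)\<close> records the reductions used for \<open>\<sigma>(a)\<sigma>(b)\<close>.\<close>
lemma G2:
  assumes a: "a \<in> carrier A" and b: "b \<in> carrier A"
  shows "valid (Suc (Suc 0)) (G (Suc (Suc 0)) (bas [\<one>\<^bsub>A\<^esub>, a, b, \<one>\<^bsub>A\<^esub>]))"
    "tnf (G (Suc (Suc 0)) (bas [\<one>\<^bsub>A\<^esub>, a, b, \<one>\<^bsub>A\<^esub>])) = Theta (lin asplit (sigma a \<odot> sigma b))"
proof -
  let ?o = "\<one>\<^bsub>A\<^esub>"
  have bd: "bar_diff (Suc (Suc 0)) (bas [?o, a, b, ?o]) = bas [a, b, ?o] - bas [?o, a \<otimes>\<^bsub>A\<^esub> b, ?o] + bas [?o, a, b]"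
    using assms by (simp add: bar_diff_def)
  let ?g = "G (Suc 0) (bas [a, b, ?o]) - G (Suc 0) (bas [?o, a \<otimes>\<^bsub>A\<^esub> b, ?o]) + G (Suc 0) (bas [?o, a, b])"
  have g: "G (Suc (Suc 0)) (bas [?o, a, b, ?o]) = act ?o (rho (Suc 0) ?g) ?o"
    unfolding G.simps(2)[of "Suc 0"] lin_bas using bd
    by (simp add: islin_diff[OF islin_G] islin_add[OF islin_G] del: G.simps rho.simps)
  have v: "valid (Suc 0) ?g" by (intro valid_diff valid_add G1) (simp_all add: assms)
  show "valid (Suc (Suc 0)) (G (Suc (Suc 0)) (bas [?o, a, b, ?o]))" unfolding g by (intro valid_act rho1 v A_one_closed)
  have "tnf ?g = lin (asplit_in (sigma a) eQ) (sigma b) - lin (asplit_in eQ eQ) (sigma (a \<otimes>\<^bsub>A\<^esub> b)) + lin (asplit_in eQ (sigma b)) (sigma a)"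
    using assms by (simp add: islin_diff[OF islin_tnf] islin_add[OF islin_tnf] G1(2) del: G.simps)
  then have "Theta (tnf ?g) = Theta (lin asplit (sigma a \<odot> sigma b))"
    using assms by (simp add: islin_diff[OF islin_Theta] islin_add[OF islin_Theta] Theta_lin_asplit_in_killed sigma_kIrr sigma_CQ eQ_CQ Theta_product del: G.simps)
  then show "tnf (G (Suc (Suc 0)) (bas [?o, a, b, ?o])) = Theta (lin asplit (sigma a \<odot> sigma b))"
    unfolding g using tnf_act_one[OF rho1(1)[OF v]] rho1(2)[OF v] by simp
qed

lemma eval_gen_tri_compat:
  assumes "islin (e w)" "x \<in> CQ" "y \<in> CQ"
    "\<And>r. \<lbrakk>r \<in> QP; src r \<noteq> tgt w\<rbrakk> \<Longrightarrow> e w (bas r) = 0"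
    "\<And>q r. \<lbrakk>q \<in> QP; r \<in> QP; tgt q \<noteq> src w\<rbrakk> \<Longrightarrow> bas q \<odot> e w (bas r) = 0"
  shows "eval_gen e (tri x w y) = nf (x \<odot> e w y)"
proof -
  have b: "eval_gen e (tri (bas q) w (bas r)) = nf (bas q \<odot> e w (bas r))" if "q \<in> QP" "r \<in> QP" for q r
    using assms(4)[of r] assms(5)[of q r] that by (auto simp: tri_bas eval_gen_def islin_zero[OF islin_nf])
  have i2: "islin (\<lambda>y. nf (bas q \<odot> e w y))" for q
    by (intro islin_compose[OF islin_nf] islin_compose[OF pa_mult_islin2] assms(1))
  have c: "eval_gen e (tri (bas q) w y) = nf (bas q \<odot> e w y)" if "q \<in> QP" for q
    by (rule islin_eqI[OF islin_compose[OF islin_eval_gen islin_tri2[of "bas q" w]] i2, of y])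
      (use b[OF that] assms(3) in \<open>auto simp: CQ_iff\<close>)
  have i1: "islin (\<lambda>x. nf (x \<odot> e w y))" by (intro islin_compose[OF islin_nf] pa_mult_islin1)
  show ?thesis
    by (rule islin_eqI[OF islin_compose[OF islin_eval_gen islin_tri1[of w y]] i1, of x]) (use c assms(2) in \<open>auto simp: CQ_iff\<close>)
qed

lemma eval_gen_tnf:
  assumes "valid n x" "\<And>w. w \<in> amb n \<Longrightarrow> islin (e w)"
    "\<And>w r. \<lbrakk>w \<in> amb n; r \<in> QP; src r \<noteq> tgt w\<rbrakk> \<Longrightarrow> e w (bas r) = 0"
    "\<And>w q r. \<lbrakk>w \<in> amb n; q \<in> QP; r \<in> QP; tgt q \<noteq> src w\<rbrakk> \<Longrightarrow> bas q \<odot> e w (bas r) = 0"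
  shows "eval_gen e (tnf x) = lin (\<lambda>(a, w, b). nf (sigma a \<odot> e w (sigma b))) x"
  by (rule tnf_valid_eqI[OF islin_compose[OF islin_eval_gen islin_tnf] islin_lin assms(1)])
    (use eval_gen_tri_compat[OF assms(2) sigma_CQ sigma_CQ assms(3,4)] in simp)

text \<open>Each reduction \<open>(q, s, r)\<close> listed by \<open>Theta\<close> contributes the normal form of \<open>q (f s) r\<close>, which is what
  using \<open>f\<close> at this very step contributes to \<open>polred [f]\<close>.\<close>
lemma eval_gen_Theta_first_order:
  assumes f: "adm f" and p: "p \<in> QP"
  shows "eval_gen (\<lambda>s z. f s \<odot> z) (Theta (asplit p)) = polred [f] (bas p)"
  using p
proof (induction p rule: wf_induct_rule[OF wf_rrel])
  case (1 p)
  show ?case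
  proof (cases "p \<in> Irr")
    case True
    then show ?thesis using polred_on_kIrr[OF kIrr_bas[OF True], of "[f]"] by (simp add: Theta_Irr islin_zero[OF islin_eval_gen])
  next
    case False
    obtain q s r where t: "(q, s, r) \<in> rightmost S p" using rightmost_ex[OF 1(2) False] by metis
    note d = rightmostD[OF t]
    let ?x0 = "bas q \<odot> \<phi> s \<odot> bas r"
    let ?e = "\<lambda>s z. f s \<odot> z"
    have fs: "f s \<in> CQ" by (rule adm_CQ[OF f d(2)])
    have IH: "eval_gen ?e (Theta (lin asplit ?x0)) = polred [f] ?x0"
    proof (rule islin_eqI[of "\<lambda>x. eval_gen ?e (Theta (lin asplit x))" "polred [f]"])
      show "islin (\<lambda>x. eval_gen ?e (Theta (lin asplit x)))" by (intro islin_compose[OF islin_eval_gen] islin_compose[OF islin_Theta] islin_lin)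
      fix u assume u: "u \<in> supp ?x0"
      then have "(u, p) \<in> rrel" using False 1(2) r0_rightmost[OF t] by (simp add: rrel_def)
      then show "eval_gen ?e (Theta (lin asplit (bas u))) = polred [f] (bas u)" using 1(1) rrel_QP by simp
    qed simp
    have "eval_gen ?e (tri (nf (bas q)) s (bas r)) = nf (nf (bas q) \<odot> (f s \<odot> bas r))"
      using nf_parallel(3)[OF d(1)] d by (intro eval_gen_tri) simp_all
    also have "\<dots> = polred [] (bas q \<odot> f s \<odot> bas r)"
      using d fs by (simp add: nf_mult_left CQ_bas CQ_mult polred_nil pa_mult_assoc)
    finally have E: "eval_gen ?e (tri (nf (bas q)) s (bas r)) = polred [] (bas q \<odot> f s \<odot> bas r)" .
    show ?thesis unfolding Theta_step[OF t] islin_add[OF islin_eval_gen] E IH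
      using polred_step[OF _ t, of f "[]"] f by (simp add: add.commute)
  qed
qed

lemma HomSA_adm: assumes "f \<in> HomSA" shows "adm (\<lambda>s. sigma (f s))"
  unfolding adm_def
proof
  fix s assume s: "s \<in> S"
  have v: "src s \<in> verts Q" "tgt s \<in> verts Q" using QP_verts[OF S_QP[OF s]] .
  have fs: "f s \<in> carrier A" "pj (triv (src s)) \<otimes>\<^bsub>A\<^esub> f s \<otimes>\<^bsub>A\<^esub> pj (triv (tgt s)) = f s"
    using assms s unfolding HomSA_def by auto
  have "sigma (f s) = bas (triv (src s)) \<odot> sigma (f s) \<odot> bas (triv (tgt s))"
    using arg_cong[OF fs(2), of sigma] fs(1) v by (simp add: sigma_mult_triv triv_QP)
  then have "supp (sigma (f s)) \<subseteq> {u. src u = src s \<and> tgt u = tgt s}"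
    using sandwich_keys[of _ "triv (src s)" "sigma (f s)" "triv (tgt s)"] by fastforce
  then show "supp (sigma (f s)) \<subseteq> irr_par s"
    using sigma_kIrr[OF fs(1)] unfolding kIrr_iff by blast
qed

text \<open>The case \<open>k = 1\<close> of the theorem, in polarized form.\<close>
lemma G_up_polred:
  assumes f: "f \<in> HomSA" and a: "a \<in> carrier A" and b: "b \<in> carrier A"
  shows "G_up 2 f [a, b] \<in> carrier A" "sigma (G_up 2 f [a, b]) = polred [\<lambda>s. sigma (f s)] (sigma a \<odot> sigma b)"
proof -
  let ?x = "G (Suc (Suc 0)) (bas [\<one>\<^bsub>A\<^esub>, a, b, \<one>\<^bsub>A\<^esub>])"
  have g: "G_up 2 f [a, b] = check_P f ?x" by (simp add: G_up_def numeral_2_eq_2 del: G.simps)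
  have fA: "f s \<in> carrier A" if "s \<in> S" for s using f that unfolding HomSA_def by blast
  have adm: "adm (\<lambda>s. sigma (f s))" by (rule HomSA_adm[OF f])
  have k: "supp (sigma (f s)) \<subseteq> irr_par s" if "s \<in> S" for s
    using adm that by (simp add: adm_def)
  have 1: "(case t of (a, w, b) \<Rightarrow> a \<otimes>\<^bsub>A\<^esub> f w \<otimes>\<^bsub>A\<^esub> b) \<in> carrier A
      \<and> sigma (case t of (a, w, b) \<Rightarrow> a \<otimes>\<^bsub>A\<^esub> f w \<otimes>\<^bsub>A\<^esub> b) = (case t of (a, w, b) \<Rightarrow> nf (sigma a \<odot> (sigma (f w) \<odot> sigma b)))"
    if t: "t \<in> supp ?x" for t
  proof -
    obtain a' w b' where tt: "t = (a', w, b')" by (cases t)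
    have o: "a' \<in> carrier A" "w \<in> amb (Suc (Suc 0))" "b' \<in> carrier A" using valid_keys[OF G2(1)[OF a b]] t tt by blast+
    then have w: "w \<in> S" by (simp add: amb_simps)
    show ?thesis using o fA[OF w] tt by (simp add: sigma_mult nf_mult_left CQ_mult sigma_CQ pa_mult_assoc)
  qed
  show "G_up 2 f [a, b] \<in> carrier A" unfolding g check_P_def by (rule Alin_A(1)) (use 1 in blast)
  have "sigma (G_up 2 f [a, b]) = lin (\<lambda>t. sigma (case t of (a, w, b) \<Rightarrow> a \<otimes>\<^bsub>A\<^esub> f w \<otimes>\<^bsub>A\<^esub> b)) ?x"
    unfolding g check_P_def by (rule Alin_A(2)) (use 1 in blast)
  also have "\<dots> = lin (\<lambda>(a, w, b). nf (sigma a \<odot> (sigma (f w) \<odot> sigma b))) ?x"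
    by (rule lin_cong) (use 1 in blast)
  also have "\<dots> = eval_gen (\<lambda>s z. sigma (f s) \<odot> z) (tnf ?x)"
  proof (rule eval_gen_tnf[OF G2(1)[OF a b], symmetric])
    fix w r assume "w \<in> amb (Suc (Suc 0))" "r \<in> QP" "src r \<noteq> tgt w"
    then show "sigma (f w) \<odot> bas r = 0" using k[of w] by (intro pa_mult_eq_0') (auto simp: amb_simps)
  next
    fix w and q r :: "('v, 'e) qpath" assume o: "w \<in> amb (Suc (Suc 0))" "tgt q \<noteq> src w"
    have "bas q \<odot> sigma (f w) = 0" using k[of w] o by (intro pa_mult_eq_0) (auto simp: amb_simps)
    then show "bas q \<odot> (sigma (f w) \<odot> bas r) = 0" by (simp add: pa_mult_assoc[symmetric])
  qed simp
  also have "\<dots> = eval_gen (\<lambda>s z. sigma (f s) \<odot> z) (Theta (lin asplit (sigma a \<odot> sigma b)))" by (simp only: G2(2)[OF a b])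
  also have "\<dots> = polred [\<lambda>s. sigma (f s)] (sigma a \<odot> sigma b)"
  proof (rule islin_eqI[of "\<lambda>x. eval_gen (\<lambda>s z. sigma (f s) \<odot> z) (Theta (lin asplit x))"])
    show "islin (\<lambda>x. eval_gen (\<lambda>s z. sigma (f s) \<odot> z) (Theta (lin asplit x)))"
      by (intro islin_compose[OF islin_eval_gen] islin_compose[OF islin_Theta] islin_lin)
    fix t assume "t \<in> supp (sigma a \<odot> sigma b)"
    then have "t \<in> QP" using CQ_mult[OF sigma_CQ[OF a] sigma_CQ[OF b]] by (auto simp: CQ_iff)
    then show "eval_gen (\<lambda>s z. sigma (f s) \<odot> z) (Theta (lin asplit (bas t))) = polred [\<lambda>s. sigma (f s)] (bas t)"
      using eval_gen_Theta_first_order[OF adm] by simp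
  qed simp
  finally show "sigma (G_up 2 f [a, b]) = polred [\<lambda>s. sigma (f s)] (sigma a \<odot> sigma b)" .
qed

subsection \<open>The homotopy on cochains\<close>

definition alg_lists :: "nat \<Rightarrow> ('v, 'e, 'k) alg list set" where
  "alg_lists n = {l. length l = n \<and> set l \<subseteq> carrier A}"

definition validB :: "nat \<Rightarrow> ('v, 'e, 'k) Barten \<Rightarrow> bool" where
  "validB n x \<longleftrightarrow> supp x \<subseteq> alg_lists n"

lemma validB_bas: "validB n (bas l) \<longleftrightarrow> l \<in> alg_lists n" by (simp add: validB_def)
lemma validB_add: "validB n x \<Longrightarrow> validB n y \<Longrightarrow> validB n (x + y)"
  unfolding validB_def using Poly_Mapping.keys_add[of x y] by blast
lemma validB_scale: "validB n x \<Longrightarrow> validB n (scale c x)"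
  unfolding validB_def using keys_scale[of c x] by blast
lemma validB_lin: "(\<And>t. t \<in> supp x \<Longrightarrow> validB n (g t)) \<Longrightarrow> validB n (lin g x)"
  unfolding validB_def using keys_lin[of g x] by blast

lemma validB_append: assumes "validB n x" "bs \<in> alg_lists m" shows "validB (n + m) (bar_append x bs)"
  unfolding bar_append_def
  by (rule validB_lin) (use assms in \<open>auto simp: validB_def alg_lists_def\<close>)

lemma islin_bar_append [simp]: "islin (\<lambda>x. bar_append x bs)" by (simp add: bar_append_def)
lemma islin_F [simp]: "islin (F n)" by (cases n) simp_all

lemma bar_append_bas [simp]: "bar_append (bas l) bs = bas (l @ bs)" by (simp add: bar_append_def)

lemma bar_append_append: "bar_append (bar_append x as) bs = bar_append x (as @ bs)"
  by (simp add: bar_append_def lin_lin)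

lemma validB_F:
  "valid 0 x \<Longrightarrow> validB 2 (F 0 x)"
  "valid (Suc 0) y \<Longrightarrow> validB 3 (F (Suc 0) y)"
  "valid (Suc (Suc 0)) z \<Longrightarrow> validB 4 (F (Suc (Suc 0)) z)"
proof -
  have F0: "validB 2 (F 0 x)" if "valid 0 x" for x
    unfolding F.simps
  proof (rule validB_lin)
    fix t assume t: "t \<in> supp x"
    obtain a w b where tt: "t = (a, w, b)" by (cases t)
    have o: "a \<in> carrier A" "w \<in> amb 0" "b \<in> carrier A" using valid_keys[OF that] t tt by blast+
    then have "valid 0 (bas (a, w, \<one>\<^bsub>A\<^esub>))" by (simp add: valid_bas)
    then show "validB 2 (case t of (a, w, b) \<Rightarrow> bas [aug (bas (a, w, \<one>\<^bsub>A\<^esub>)), b])"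
      using aug_A(1) o tt by (simp add: validB_bas alg_lists_def)
  qed
  then show "valid 0 x \<Longrightarrow> validB 2 (F 0 x)" .
  have F1: "validB 3 (F (Suc 0) x)" if "valid (Suc 0) x" for x
    unfolding F.simps(2)
  proof (rule validB_lin)
    fix t assume t: "t \<in> supp x"
    obtain a w b where tt: "t = (a, w, b)" by (cases t)
    have o: "a \<in> carrier A" "w \<in> amb (Suc 0)" "b \<in> carrier A" using valid_keys[OF that] t tt by blast+
    then have "valid (Suc 0) (bas (a, w, \<one>\<^bsub>A\<^esub>))" by (simp add: valid_bas)
    then have "validB (2 + 1) (bar_append (F 0 (bdry (Suc 0) (bas (a, w, \<one>\<^bsub>A\<^esub>)))) [b])"
      using o by (intro validB_append F0 valid_bdry1) (simp_all add: alg_lists_def)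
    then show "validB 3 (case t of (a, w, b) \<Rightarrow> scale ((- 1) ^ Suc 0) (bar_append (F 0 (bdry (Suc 0) (bas (a, w, \<one>\<^bsub>A\<^esub>)))) [b]))"
      unfolding tt prod.case by (intro validB_scale) (simp del: bdry.simps F.simps)
  qed
  then show "valid (Suc 0) y \<Longrightarrow> validB 3 (F (Suc 0) y)" .
  assume z: "valid (Suc (Suc 0)) z"
  show "validB 4 (F (Suc (Suc 0)) z)"
    unfolding F.simps(2)[of "Suc 0"]
  proof (rule validB_lin)
    fix t assume t: "t \<in> supp z"
    obtain a w b where tt: "t = (a, w, b)" by (cases t)
    have o: "a \<in> carrier A" "w \<in> amb (Suc (Suc 0))" "b \<in> carrier A" using valid_keys[OF z] t tt by blast+
    then have "valid (Suc (Suc 0)) (bas (a, w, \<one>\<^bsub>A\<^esub>))" by (simp add: valid_bas)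
    then have "validB (3 + 1) (bar_append (F (Suc 0) (bdry (Suc (Suc 0)) (bas (a, w, \<one>\<^bsub>A\<^esub>)))) [b])"
      using o by (intro validB_append F1 valid_bdry2) (simp_all add: alg_lists_def)
    then show "validB 4 (case t of (a, w, b) \<Rightarrow> scale ((- 1) ^ Suc (Suc 0)) (bar_append (F (Suc 0) (bdry (Suc (Suc 0)) (bas (a, w, \<one>\<^bsub>A\<^esub>)))) [b]))"
      unfolding tt prod.case by (intro validB_scale) (simp del: bdry.simps F.simps)
  qed
qed

text \<open>A normalized 3-cochain over \<open>\<k>Q\<^sub>0\<close>, as a trilinear map on representatives.\<close>
definition tri_ok :: "(('v, 'e, 'k) pa \<Rightarrow> ('v, 'e, 'k) pa \<Rightarrow> ('v, 'e, 'k) pa \<Rightarrow> ('v, 'e, 'k) pa) \<Rightarrow> bool" where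
  "tri_ok AA \<longleftrightarrow>
     (\<forall>x y. islin (AA x y)) \<and> (\<forall>x z. islin (\<lambda>y. AA x y z)) \<and>
     (\<forall>x\<in>CQ. \<forall>y\<in>CQ. \<forall>z\<in>CQ. AA x y z \<in> kIrr \<and> (\<forall>v. AA (bas (triv v) \<odot> x) y z = bas (triv v) \<odot> AA x y z)) \<and>
     (\<forall>y\<in>kIrr. \<forall>z\<in>CQ. AA eQ y z = 0) \<and>
     (\<forall>p\<in>QP. \<forall>r\<in>QP. tgt p \<noteq> src r \<longrightarrow> (\<forall>z\<in>CQ. AA (bas p) (bas r) z = 0) \<and> (\<forall>x\<in>CQ. AA x (bas p) (bas r) = 0))"

text \<open>\<open>arrow_assoc\<close> for an arbitrary 3-cochain \<open>AA\<close> on irreducible representatives.\<close>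
definition arrow_eval :: "(('v, 'e, 'k) pa \<Rightarrow> ('v, 'e, 'k) pa \<Rightarrow> ('v, 'e, 'k) pa \<Rightarrow> ('v, 'e, 'k) pa) \<Rightarrow> ('v, 'e) qpath \<Rightarrow> ('v, 'e, 'k) pa \<Rightarrow> ('v, 'e, 'k) pa" where
  "arrow_eval AA p b = asum (\<lambda>q y r. nf (bas q \<odot> AA (bas y) (nf (bas r)) b)) p"

text \<open>\<open>rel_assoc\<close> for an arbitrary 3-cochain \<open>AA\<close> on irreducible representatives.\<close>
definition rel_eval :: "(('v, 'e, 'k) pa \<Rightarrow> ('v, 'e, 'k) pa \<Rightarrow> ('v, 'e, 'k) pa \<Rightarrow> ('v, 'e, 'k) pa) \<Rightarrow> ('v, 'e) qpath \<Rightarrow> ('v, 'e, 'k) pa \<Rightarrow> ('v, 'e, 'k) pa" where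
  "rel_eval AA s b = arrow_eval AA s b - lin (\<lambda>p. arrow_eval AA p b) (\<phi> s)"

lemma tri_ok_D:
  assumes "tri_ok AA"
  shows "islin (AA x y)" "islin (\<lambda>y. AA x y z)"
    "\<lbrakk>x \<in> CQ; y \<in> CQ; z \<in> CQ\<rbrakk> \<Longrightarrow> AA x y z \<in> kIrr"
    "\<lbrakk>x \<in> CQ; y \<in> CQ; z \<in> CQ\<rbrakk> \<Longrightarrow> AA x y z \<in> CQ"
    "\<lbrakk>x \<in> CQ; y \<in> CQ; z \<in> CQ\<rbrakk> \<Longrightarrow> AA (bas (triv v) \<odot> x) y z = bas (triv v) \<odot> AA x y z"
    "\<lbrakk>y \<in> kIrr; z \<in> CQ\<rbrakk> \<Longrightarrow> AA eQ y z = 0"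
    "\<lbrakk>p \<in> QP; r \<in> QP; tgt p \<noteq> src r; z \<in> CQ\<rbrakk> \<Longrightarrow> AA (bas p) (bas r) z = 0"
    "\<lbrakk>p \<in> QP; r \<in> QP; tgt p \<noteq> src r; x \<in> CQ\<rbrakk> \<Longrightarrow> AA x (bas p) (bas r) = 0"
  using assms kIrr_CQ unfolding tri_ok_def by (simp_all only:) blast+

lemma arrow_eval_CQ: assumes "tri_ok AA" "b \<in> CQ" shows "arrow_eval AA p b \<in> kIrr"
  unfolding arrow_eval_def asum_def
proof (rule kIrr_sum)
  fix t assume t: "t \<in> occs arw p"
  obtain q y r where tt: "t = (q, y, r)" by (cases t)
  have "nf (bas q \<odot> AA (bas y) (nf (bas r)) b) \<in> kIrr"
    by (intro nf_kIrr CQ_mult tri_ok_D(4)[OF assms(1)] nf_CQ) (use t tt assms(2) arw_QP in \<open>simp_all add: occs_iff CQ_bas\<close>)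
  then show "(case t of (q, y, r) \<Rightarrow> nf (bas q \<odot> AA (bas y) (nf (bas r)) b)) \<in> kIrr" using tt by simp
qed

lemma islin_arrow_eval: "tri_ok AA \<Longrightarrow> islin (arrow_eval AA p)"
  unfolding arrow_eval_def[abs_def] asum_def case_prod_unfold
  by (intro islin_sum_fun islin_compose[OF islin_nf] islin_compose[OF pa_mult_islin2] tri_ok_D(1))

lemma islin_rel_eval: "tri_ok AA \<Longrightarrow> islin (rel_eval AA s)"
  unfolding rel_eval_def[abs_def] by (intro islin_minus islin_lin_arg islin_arrow_eval)

lemma arrow_eval_left: assumes "tri_ok AA" "b \<in> CQ" shows "bas (triv (src p)) \<odot> arrow_eval AA p b = arrow_eval AA p b"
  unfolding arrow_eval_def asum_islin[OF pa_mult_islin2]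
proof (rule asum_cong)
  fix q y r assume o: "q \<in> QP" "y \<in> arw" "r \<in> QP" "p = pcomp (pcomp q y) r"
  let ?z = "bas q \<odot> AA (bas y) (nf (bas r)) b"
  have z: "?z \<in> CQ"
    by (intro CQ_mult tri_ok_D(4)[OF assms(1)] nf_CQ) (use o assms(2) arw_QP in \<open>simp_all add: CQ_bas\<close>)
  have "bas (triv (src p)) \<odot> nf ?z = nf (bas (triv (src p)) \<odot> ?z)"
    using polred_triv_left[of "[]" ?z "src p"] z CQ_mult[OF _ z, of "bas (triv (src p))"] o
      QP_verts(1)[OF o(1)] by (simp add: polred_nil CQ_bas triv_QP)
  also have "bas (triv (src p)) \<odot> ?z = ?z" using o by (simp add: pa_mult_assoc[symmetric] bas_triv_src)
  finally show "bas (triv (src p)) \<odot> nf ?z = nf ?z" .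
qed

lemma arrow_eval_right:
  assumes "tri_ok AA" "r \<in> QP" "src r \<noteq> tgt p" shows "arrow_eval AA p (bas r) = 0"
proof -
  have "arrow_eval AA p (bas r) = asum (\<lambda>q y t. 0) p"
    unfolding arrow_eval_def
  proof (rule asum_cong)
    fix q y t assume o: "q \<in> QP" "y \<in> arw" "t \<in> QP" "p = pcomp (pcomp q y) t"
    have "AA (bas y) (nf (bas t)) (bas r) = lin (\<lambda>u. AA (bas y) (bas u) (bas r)) (nf (bas t))"
      by (rule islin_expand[OF tri_ok_D(2)[OF assms(1)]])
    also have "\<dots> = 0"
    proof (rule lin_eq_0)
      fix u assume "u \<in> supp (nf (bas t))"
      then have "u \<in> QP" "tgt u = tgt t" using nf_parallel[OF o(3)] Irr_QP by auto
      then show "AA (bas y) (bas u) (bas r) = 0"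
        using tri_ok_D(8)[OF assms(1), of u r "bas y"] assms o arw_QP by (simp add: CQ_bas)
    qed
    finally show "nf (bas q \<odot> AA (bas y) (nf (bas t)) (bas r)) = 0" by (simp add: islin_zero[OF islin_nf])
  qed
  then show ?thesis by (simp add: asum_zero)
qed

lemma rel_eval_compat:
  assumes "tri_ok AA" "s \<in> S" "r \<in> QP"
  shows "src r \<noteq> tgt s \<Longrightarrow> rel_eval AA s (bas r) = 0" "tgt q \<noteq> src s \<Longrightarrow> bas q \<odot> rel_eval AA s (bas r) = 0"
proof -
  assume "src r \<noteq> tgt s"
  then show "rel_eval AA s (bas r) = 0"
    unfolding rel_eval_def using arrow_eval_right[OF assms(1,3)] phi_path(3)[OF assms(2)]
    by (simp add: lin_eq_0)
next
  assume q: "tgt q \<noteq> src s"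
  have "rel_eval AA s (bas r) = bas (triv (src s)) \<odot> rel_eval AA s (bas r)"
  proof -
    have L: "lin (\<lambda>p. arrow_eval AA p (bas r)) (\<phi> s) = lin (\<lambda>p. bas (triv (src s)) \<odot> arrow_eval AA p (bas r)) (\<phi> s)"
    proof (rule lin_cong)
      fix u assume "u \<in> supp (\<phi> s)"
      then show "arrow_eval AA u (bas r) = bas (triv (src s)) \<odot> arrow_eval AA u (bas r)"
        using arrow_eval_left[OF assms(1) CQ_bas[OF assms(3)], of u] phi_path(2)[OF assms(2)] by simp
    qed
    show ?thesis
      unfolding rel_eval_def pa_mult_diff_right arrow_eval_left[OF assms(1) CQ_bas[OF assms(3)]] islin_comp_lin[OF pa_mult_islin2] L[symmetric] ..
  qed
  then have "bas q \<odot> rel_eval AA s (bas r) = (bas q \<odot> bas (triv (src s))) \<odot> rel_eval AA s (bas r)"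
    by (metis pa_mult_assoc)
  then show "bas q \<odot> rel_eval AA s (bas r) = 0" using q by (simp add: pa_mult_bas)
qed

text \<open>The map \<open>Bar\<^sub>3 \<rightarrow> A\<close> corresponding to the 3-cochain \<open>c\<close>, followed by \<open>\<sigma>\<close>.\<close>
definition chi :: "('v, 'e, 'k) cochain \<Rightarrow> ('v, 'e, 'k) alg list \<Rightarrow> ('v, 'e, 'k) pa" where
  "chi c l = nf (nf (sigma (hd l) \<odot> sigma (c (butlast (tl l)))) \<odot> sigma (last l))"

definition coch3 :: "('v, 'e, 'k) cochain \<Rightarrow> (('v, 'e, 'k) pa \<Rightarrow> ('v, 'e, 'k) pa \<Rightarrow> ('v, 'e, 'k) pa \<Rightarrow> ('v, 'e, 'k) pa) \<Rightarrow> bool" where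
  "coch3 c AA \<longleftrightarrow> tri_ok AA \<and> (\<forall>x\<in>carrier A. \<forall>y\<in>carrier A. \<forall>z\<in>carrier A.
      c [x, y, z] \<in> carrier A \<and> sigma (c [x, y, z]) = AA (sigma x) (sigma y) (sigma z))"

lemma check_Bar_A:
  assumes "coch3 c AA" "validB 5 x"
  shows "check_Bar c x \<in> carrier A" "sigma (check_Bar c x) = lin (chi c) x"
proof -
  have 1: "hd l \<otimes>\<^bsub>A\<^esub> c (butlast (tl l)) \<otimes>\<^bsub>A\<^esub> last l \<in> carrier A \<and>
      sigma (hd l \<otimes>\<^bsub>A\<^esub> c (butlast (tl l)) \<otimes>\<^bsub>A\<^esub> last l) = chi c l" if "l \<in> supp x" for l
  proof -
    have "l \<in> alg_lists 5" using that assms(2) unfolding validB_def by blast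
    then obtain a0 a1 a2 a3 a4 where l: "l = [a0, a1, a2, a3, a4]" "a0 \<in> carrier A" "a1 \<in> carrier A" "a2 \<in> carrier A" "a3 \<in> carrier A" "a4 \<in> carrier A"
      by (auto simp: alg_lists_def length_Suc_conv eval_nat_numeral)
    then have "c [a1, a2, a3] \<in> carrier A" using assms(1) unfolding coch3_def by blast
    then show ?thesis using l by (simp add: chi_def sigma_mult)
  qed
  show "check_Bar c x \<in> carrier A" unfolding check_Bar_def by (rule Alin_A(1)) (use 1 in blast)
  have "sigma (check_Bar c x) = lin (\<lambda>l. sigma (hd l \<otimes>\<^bsub>A\<^esub> c (butlast (tl l)) \<otimes>\<^bsub>A\<^esub> last l)) x"
    unfolding check_Bar_def by (rule Alin_A(2)) (use 1 in blast)
  also have "\<dots> = lin (chi c) x" by (rule lin_cong) (use 1 in blast)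
  finally show "sigma (check_Bar c x) = lin (chi c) x" .
qed

lemma chi_list:
  assumes "coch3 c AA" "x \<in> carrier A" "y \<in> carrier A" "z \<in> carrier A" "w \<in> carrier A"
  shows "chi c [w, x, y, z, \<one>\<^bsub>A\<^esub>] = nf (sigma w \<odot> AA (sigma x) (sigma y) (sigma z))"
proof -
  have "AA (sigma x) (sigma y) (sigma z) \<in> CQ"
    using assms tri_ok_D(4) sigma_CQ unfolding coch3_def by blast
  then show ?thesis using assms unfolding coch3_def
    by (simp add: chi_def nf_mult_left[OF _ eQ_CQ] CQ_mult sigma_CQ eQ_right nf_CQ)
      (simp add: nf_nf CQ_mult sigma_CQ)
qed

lemma sigma_aug_bas:
  assumes "a \<in> carrier A" "v \<in> verts Q"
  shows "aug (bas (a, triv v, \<one>\<^bsub>A\<^esub>)) \<in> carrier A" "sigma (aug (bas (a, triv v, \<one>\<^bsub>A\<^esub>))) = sigma a \<odot> bas (triv v)"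
proof -
  have v: "valid 0 (bas (a, triv v, \<one>\<^bsub>A\<^esub>))" using assms by (simp add: valid_bas amb_simps)
  have k: "sigma a \<odot> bas (triv v) \<in> kIrr" by (rule mult_triv_kIrr[OF sigma_kIrr[OF assms(1)]])
  show "aug (bas (a, triv v, \<one>\<^bsub>A\<^esub>)) \<in> carrier A" by (rule aug_A(1)[OF v])
  show "sigma (aug (bas (a, triv v, \<one>\<^bsub>A\<^esub>))) = sigma a \<odot> bas (triv v)"
    unfolding aug_A(2)[OF v] using k by (simp add: nf_id eQ_right kIrr_CQ)
qed

text \<open>Of the two terms of \<open>\<partial>\<^sub>1(1 \<otimes> y \<otimes> 1)\<close> the one with \<open>1\<close> as its last factor is degenerate, so the
  normalized cochain \<open>c\<close> only sees the arrow in the first entry.\<close>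
lemma F1_eval:
  assumes c: "coch3 c AA" and b: "b \<in> carrier A" and z: "valid (Suc 0) z"
  shows "lin (chi c) (bar_append (F (Suc 0) z) [b, \<one>\<^bsub>A\<^esub>]) = eval_gen (\<lambda>y u. AA (bas y) u (sigma b)) (tnf z)"
proof -
  have T: "tri_ok AA" using c by (simp add: coch3_def)
  note D = tri_ok_D[OF T]
  have sb: "sigma b \<in> CQ" by (rule sigma_CQ[OF b])
  have e: "eval_gen (\<lambda>y u. AA (bas y) u (sigma b)) (tnf z) = lin (\<lambda>(a, w, b'). nf (sigma a \<odot> AA (bas w) (sigma b') (sigma b))) z"
  proof (rule eval_gen_tnf[OF z])
    fix w assume w: "w \<in> amb (Suc 0)"
    then have wQ: "w \<in> QP" using arw_QP by (simp add: amb_simps)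
    show "islin (\<lambda>u. AA (bas w) u (sigma b))" by (rule D(2))
    fix r assume r: "r \<in> QP"
    show "src r \<noteq> tgt w \<Longrightarrow> AA (bas w) (bas r) (sigma b) = 0" using D(7)[OF wQ r _ sb] by simp
    fix q :: "('v, 'e) qpath" assume q: "tgt q \<noteq> src w"
    have "AA (bas w) (bas r) (sigma b) = bas (triv (src w)) \<odot> AA (bas w) (bas r) (sigma b)"
      using D(5)[of "bas w" "bas r" "sigma b" "src w"] wQ r sb by (simp add: CQ_bas bas_triv_src)
    then have "bas q \<odot> AA (bas w) (bas r) (sigma b) = (bas q \<odot> bas (triv (src w))) \<odot> AA (bas w) (bas r) (sigma b)"
      by (metis pa_mult_assoc)
    then show "bas q \<odot> AA (bas w) (bas r) (sigma b) = 0" using q by (simp add: pa_mult_bas)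
  qed
  have i: "islin (\<lambda>z. lin (chi c) (bar_append (F (Suc 0) z) [b, \<one>\<^bsub>A\<^esub>]))"
    by (rule islin_compose[OF islin_lin islin_compose[OF islin_bar_append islin_F]])
  show ?thesis unfolding e
  proof (rule tnf_valid_eqI[OF i islin_lin z])
    fix a y b' assume o: "a \<in> carrier A" "y \<in> amb (Suc 0)" "b' \<in> carrier A"
    then have y: "y \<in> arw" by (simp add: amb_simps)
    have yQ: "y \<in> QP" "src y \<in> verts Q" "tgt y \<in> verts Q" "y \<in> Irr" using arw_QP[OF y] QP_verts[of y] arw_Irr[OF y] by auto
    define om where "om w = lin (chi c) (bar_append (F 0 w) [b', b, \<one>\<^bsub>A\<^esub>])" for w
    have om: "islin om" unfolding om_def[abs_def] by (rule islin_compose[OF islin_lin islin_compose[OF islin_bar_append islin_F]])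
    have omb: "om (bas (a0, triv v, b0)) = nf (sigma a0 \<odot> bas (triv v) \<odot> AA (sigma b0) (sigma b') (sigma b))"
      if "a0 \<in> carrier A" "v \<in> verts Q" "b0 \<in> carrier A" for a0 v b0
      using that o b by (simp add: om_def chi_list[OF c] sigma_aug_bas)
    have bd: "bdry (Suc 0) (bas (a, y, \<one>\<^bsub>A\<^esub>)) = bas (a \<otimes>\<^bsub>A\<^esub> pj y, triv (tgt y), \<one>\<^bsub>A\<^esub>) - bas (a, triv (src y), pj y)
        - (\<Sum>v\<in>verts Q. bas (a \<otimes>\<^bsub>A\<^esub> \<zero>\<^bsub>A\<^esub>, triv v, \<one>\<^bsub>A\<^esub>))"
      unfolding bdry_1 bimod_ext_bas bd1_def aug_delta1[OF y]
      unfolding delta1_1 coaug_def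
      using o yQ by (simp add: islin_diff[OF islin_act] islin_sum[OF islin_act] act_bas)
    have "om (bas (a \<otimes>\<^bsub>A\<^esub> pj y, triv (tgt y), \<one>\<^bsub>A\<^esub>)) = 0"
      using o yQ D(6)[OF sigma_kIrr[OF o(3)] sb] by (simp add: omb islin_zero[OF islin_nf])
    moreover have "om (bas (a, triv (src y), pj y)) = nf (sigma a \<odot> AA (bas y) (sigma b') (sigma b))"
    proof -
      have "bas (triv (src y)) \<odot> AA (bas y) (sigma b') (sigma b) = AA (bas y) (sigma b') (sigma b)"
        using D(5)[of "bas y" "sigma b'" "sigma b" "src y"] yQ o sb by (simp add: CQ_bas bas_triv_src sigma_CQ)
      then show ?thesis using o yQ by (simp add: omb sigma_pj nf_Irr pa_mult_assoc)
    qed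
    moreover have "om (\<Sum>v\<in>verts Q. bas (a \<otimes>\<^bsub>A\<^esub> \<zero>\<^bsub>A\<^esub>, triv v, \<one>\<^bsub>A\<^esub>)) = 0"
      unfolding islin_sum[OF om]
      by (rule sum.neutral) (use o in \<open>simp add: omb sigma_mult islin_zero[OF islin_nf]\<close>)
    ultimately have "om (bdry (Suc 0) (bas (a, y, \<one>\<^bsub>A\<^esub>))) = - nf (sigma a \<odot> AA (bas y) (sigma b') (sigma b))"
      unfolding bd islin_diff[OF om] by simp
    then show "lin (chi c) (bar_append (F (Suc 0) (bas (a, y, b'))) [b, \<one>\<^bsub>A\<^esub>])
      = lin (\<lambda>(a, w, b'). nf (sigma a \<odot> AA (bas w) (sigma b') (sigma b))) (bas (a, y, b'))"
      unfolding F.simps(2)[of 0] lin_bas prod.case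
      by (simp add: om_def islin_uminus[OF islin_bar_append] bar_append_append lin_uminus del: F.simps bdry.simps)
  qed
qed

lemma eval_gen_asplit_in:
  assumes T: "tri_ok AA" and \<alpha>: "\<alpha> \<in> CQ" and b: "b \<in> CQ"
  shows "eval_gen (\<lambda>y u. AA (bas y) u b) (asplit_in \<alpha> eQ p) = nf (\<alpha> \<odot> arrow_eval AA p b)"
proof -
  note D = tri_ok_D[OF T]
  have l: "islin (\<lambda>z. nf (\<alpha> \<odot> z))" by (rule islin_compose[OF islin_nf pa_mult_islin2])
  show ?thesis
    unfolding asplit_in_def arrow_eval_def asum_islin[OF islin_eval_gen] asum_islin[OF l]
  proof (rule asum_cong)
    fix q y r assume o: "q \<in> QP" "y \<in> arw" "r \<in> QP" "tgt q = src y" "tgt y = src r"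
    have C: "AA (bas y) (nf (bas r)) b \<in> CQ"
      by (rule D(4)) (use o b arw_QP in \<open>simp_all add: CQ_bas nf_CQ\<close>)
    have "eval_gen (\<lambda>y u. AA (bas y) u b) (tri (nf (\<alpha> \<odot> bas q)) y (nf (bas r \<odot> eQ))) = nf (nf (\<alpha> \<odot> bas q) \<odot> AA (bas y) (nf (bas r)) b)"
      by (subst eval_gen_tri) (use o keys_nf_left[OF \<alpha> o(1)] nf_parallel(2)[OF o(3)] in \<open>simp_all add: D(2) eQ_right CQ_bas\<close>)
    also have "\<dots> = nf (\<alpha> \<odot> nf (bas q \<odot> AA (bas y) (nf (bas r)) b))"
      using \<alpha> o C by (simp add: nf_mult_left nf_mult_right CQ_mult CQ_bas pa_mult_assoc)
    finally show "eval_gen (\<lambda>y u. AA (bas y) u b) (tri (nf (\<alpha> \<odot> bas q)) y (nf (bas r \<odot> eQ))) = \<dots>" .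
  qed
qed

lemma eval_gen_lin_asplit_in:
  assumes T: "tri_ok AA" and \<alpha>: "\<alpha> \<in> CQ" and b: "b \<in> CQ"
  shows "eval_gen (\<lambda>y u. AA (bas y) u b) (lin (asplit_in \<alpha> eQ) x) = nf (\<alpha> \<odot> lin (\<lambda>p. arrow_eval AA p b) x)"
proof -
  have l: "islin (\<lambda>z. nf (\<alpha> \<odot> z))" by (rule islin_compose[OF islin_nf pa_mult_islin2])
  show ?thesis by (simp add: islin_comp_lin[OF islin_eval_gen] islin_comp_lin[OF l] eval_gen_asplit_in[OF assms])
qed

text \<open>\<open>F\<^sub>2\<close> is built from \<open>F\<^sub>1\<partial>\<^sub>2\<close>, and \<open>\<partial>\<^sub>2\<close> takes the arrow splitting of \<open>s\<close> to that of \<open>s - \<phi> s\<close>.\<close>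
lemma F2_eval:
  assumes c: "coch3 c AA" and z: "valid (Suc (Suc 0)) z"
  shows "lin (chi c) (bar_append (F (Suc (Suc 0)) z) [\<one>\<^bsub>A\<^esub>]) = eval_gen (rel_eval AA) (tnf z)"
proof -
  have T: "tri_ok AA" using c by (simp add: coch3_def)
  have e: "eval_gen (rel_eval AA) (tnf z) = lin (\<lambda>(a, w, b'). nf (sigma a \<odot> rel_eval AA w (sigma b'))) z"
    by (rule eval_gen_tnf[OF z]) (simp_all add: amb_simps islin_rel_eval[OF T] rel_eval_compat[OF T])
  have i: "islin (\<lambda>z. lin (chi c) (bar_append (F (Suc (Suc 0)) z) [\<one>\<^bsub>A\<^esub>]))"
    by (rule islin_compose[OF islin_lin islin_compose[OF islin_bar_append islin_F]])
  show ?thesis unfolding e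
  proof (rule tnf_valid_eqI[OF i islin_lin z])
    fix a s b' assume o: "a \<in> carrier A" "s \<in> amb (Suc (Suc 0))" "b' \<in> carrier A"
    then have s: "s \<in> S" by (simp add: amb_simps)
    have v: "valid (Suc (Suc 0)) (bas (a, s, \<one>\<^bsub>A\<^esub>))" using o by (simp add: valid_bas)
    have sa: "sigma a \<in> CQ" "sigma b' \<in> CQ" using o by (simp_all add: sigma_CQ)
    have "tnf (bdry (Suc (Suc 0)) (bas (a, s, \<one>\<^bsub>A\<^esub>))) = actN (sigma a) eQ (asplit s - lin asplit (\<phi> s))"
      unfolding bdry_2 using tnf_bimod_ext_bas[of "Suc 0" bd2 s a "\<one>\<^bsub>A\<^esub>", OF bd2_valid o(1)] by (simp add: tnf_bd2[OF s])
    also have "\<dots> = asplit_in (sigma a) eQ s - lin (asplit_in (sigma a) eQ) (\<phi> s)"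
      using sa by (simp add: islin_diff[OF islin_actN] islin_asplit_lin actN_asplit eQ_CQ)
    finally have "eval_gen (\<lambda>y u. AA (bas y) u (sigma b')) (tnf (bdry (Suc (Suc 0)) (bas (a, s, \<one>\<^bsub>A\<^esub>)))) = nf (sigma a \<odot> rel_eval AA s (sigma b'))"
      using sa by (simp only: islin_diff[OF islin_eval_gen] eval_gen_asplit_in[OF T] eval_gen_lin_asplit_in[OF T] rel_eval_def pa_mult_diff_right islin_diff[OF islin_nf])
    then have "lin (chi c) (bar_append (F (Suc 0) (bdry (Suc (Suc 0)) (bas (a, s, \<one>\<^bsub>A\<^esub>)))) [b', \<one>\<^bsub>A\<^esub>]) = nf (sigma a \<odot> rel_eval AA s (sigma b'))"
      using F1_eval[OF c o(3) valid_bdry2[OF v]] by (simp only:)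
    then show "lin (chi c) (bar_append (F (Suc (Suc 0)) (bas (a, s, b'))) [\<one>\<^bsub>A\<^esub>])
        = lin (\<lambda>(a, w, b'). nf (sigma a \<odot> rel_eval AA w (sigma b'))) (bas (a, s, b'))"
      unfolding F.simps(2)[of "Suc 0"] lin_bas prod.case
      by (simp add: bar_append_append del: F.simps bdry.simps)
  qed
qed

text \<open>The homotopy in arity 2 for an arbitrary normalized cochain: only \<open>F\<^sub>1G\<^sub>1\<close> and \<open>F\<^sub>2G\<^sub>2\<close> enter.\<close>
lemma h_up_eval:
  assumes c: "coch3 c AA" and a: "a \<in> carrier A" and b: "b \<in> carrier A"
  shows "h_up 2 c [a, b] \<in> carrier A"
    "sigma (h_up 2 c [a, b]) = lin (\<lambda>p. arrow_eval AA p (sigma b)) (sigma a) - eval_gen (rel_eval AA) (Theta (lin asplit (sigma a \<odot> sigma b)))"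
proof -
  let ?o = "\<one>\<^bsub>A\<^esub>"
  have T: "tri_ok AA" using c by (simp add: coch3_def)
  have sb: "sigma b \<in> CQ" by (rule sigma_CQ[OF b])
  let ?g1 = "G (Suc 0) (bas [?o, a, ?o])" and ?g2 = "G (Suc (Suc 0)) (bas [?o, a, b, ?o])"
  let ?h = "bar_append (F (Suc 0) ?g1) [b, ?o] + scale (- 1) (bar_append (F (Suc (Suc 0)) ?g2) [?o])"
  have J: "{1..2::nat} = {Suc 0, Suc (Suc 0)}" by auto
  have h: "h 2 (bas [?o, a, b, ?o]) = ?h"
    unfolding h_def lin_bas J by (simp add: numeral_2_eq_2 del: F.simps G.simps)
  note v1 = G1(1)[OF A_one_closed a A_one_closed] and v2 = G2(1)[OF a b]
  have "validB (3 + 2) (bar_append (F (Suc 0) ?g1) [b, ?o])"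
    by (rule validB_append[OF validB_F(2)[OF v1]]) (use b in \<open>simp add: alg_lists_def\<close>)
  moreover have "validB (4 + 1) (bar_append (F (Suc (Suc 0)) ?g2) [?o])"
    by (rule validB_append[OF validB_F(3)[OF v2]]) (simp add: alg_lists_def)
  ultimately have vh: "validB 5 ?h" by (intro validB_add validB_scale) (simp_all del: F.simps G.simps)
  have e: "[?o] @ [a, b] @ [?o] = [?o, a, b, ?o]" and e1: "(- 1 :: 'k) ^ 2 = 1" by simp_all
  have u: "h_up 2 c [a, b] = Ascale 1 (check_Bar c ?h)"
    by (simp only: h_up_def e e1 h)
  show "h_up 2 c [a, b] \<in> carrier A" unfolding u by (intro Ascale_carrier check_Bar_A(1)[OF c vh])
  have "sigma (h_up 2 c [a, b]) = lin (chi c) ?h"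
    unfolding u sigma_Ascale[OF check_Bar_A(1)[OF c vh]] check_Bar_A(2)[OF c vh] by simp
  also have "\<dots> = eval_gen (\<lambda>y u. AA (bas y) u (sigma b)) (tnf ?g1) - eval_gen (rel_eval AA) (tnf ?g2)"
    unfolding lin_add lin_scale F1_eval[OF c b v1] F2_eval[OF c v2] by simp
  also have "tnf ?g1 = lin (asplit_in eQ eQ) (sigma a)" using G1(2)[OF A_one_closed a A_one_closed] by (simp del: G.simps)
  also have "eval_gen (\<lambda>y u. AA (bas y) u (sigma b)) \<dots> = nf (eQ \<odot> lin (\<lambda>p. arrow_eval AA p (sigma b)) (sigma a))"
    by (rule eval_gen_lin_asplit_in[OF T eQ_CQ sb])
  also have "\<dots> = lin (\<lambda>p. arrow_eval AA p (sigma b)) (sigma a)"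
  proof -
    have "lin (\<lambda>p. arrow_eval AA p (sigma b)) (sigma a) \<in> kIrr" by (intro kIrr_lin arrow_eval_CQ[OF T sb])
    then show ?thesis by (simp add: eQ_left kIrr_CQ nf_id)
  qed
  also have "tnf ?g2 = Theta (lin asplit (sigma a \<odot> sigma b))" by (rule G2(2)[OF a b])
  finally show "sigma (h_up 2 c [a, b]) = lin (\<lambda>p. arrow_eval AA p (sigma b)) (sigma a) - eval_gen (rel_eval AA) (Theta (lin asplit (sigma a \<odot> sigma b)))" .
qed

text \<open>The values of the cochains considered here depend only on the product of the representatives.\<close>
definition coch2 :: "('v, 'e, 'k) cochain \<Rightarrow> (('v, 'e, 'k) pa \<Rightarrow> ('v, 'e, 'k) pa) \<Rightarrow> bool" where
  "coch2 f M \<longleftrightarrow> goodM M \<and> (\<forall>x\<in>kIrr. M x = 0) \<and>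
     (\<forall>x\<in>carrier A. \<forall>y\<in>carrier A. f [x, y] \<in> carrier A \<and> sigma (f [x, y]) = M (sigma x \<odot> sigma y))"

lemma assoc_op_islin2: assumes "islin M1" "islin M2" shows "islin (\<lambda>y. assoc_op M1 M2 x y z)"
  unfolding assoc_op_def
  by (rule islin_minus[OF
        islin_compose[OF assms(1) islin_compose[OF pa_mult_islin2[of x] islin_compose[OF assms(2) pa_mult_islin1[of z]]]]
        islin_compose[OF assms(1) islin_compose[OF pa_mult_islin1[of z] islin_compose[OF assms(2) pa_mult_islin2[of x]]]]])

text \<open>The associator is normalized and respects the tensor product over \<open>\<k>Q\<^sub>0\<close>.\<close>
lemma assoc_op_vanish:
  assumes g: "goodM M1" "goodM M2" and v: "\<forall>x\<in>kIrr. M1 x = 0" "\<forall>x\<in>kIrr. M2 x = 0"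
  shows "\<lbrakk>y \<in> kIrr; z \<in> CQ\<rbrakk> \<Longrightarrow> assoc_op M1 M2 eQ y z = 0"
    "\<lbrakk>p \<in> QP; r \<in> QP; tgt p \<noteq> src r; z \<in> CQ\<rbrakk> \<Longrightarrow> assoc_op M1 M2 (bas p) (bas r) z = 0"
    "\<lbrakk>p \<in> QP; r \<in> QP; tgt p \<noteq> src r; x \<in> CQ\<rbrakk> \<Longrightarrow> assoc_op M1 M2 x (bas p) (bas r) = 0"
proof -
  note D1 = goodM_D[OF g(1)] and D2 = goodM_D[OF g(2)]
  show "assoc_op M1 M2 eQ y z = 0" if y: "y \<in> kIrr" "z \<in> CQ"
  proof -
    have "y \<odot> z \<in> CQ" by (rule CQ_mult[OF kIrr_CQ[OF y(1)] y(2)])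
    then have "M1 (eQ \<odot> M2 (y \<odot> z)) = 0" using D2(2,3) v(1) by (simp add: eQ_left)
    moreover have "M2 (eQ \<odot> y) = 0" using y v(2) by (simp add: eQ_left kIrr_CQ)
    ultimately show ?thesis by (simp add: assoc_op_def islin_zero[OF D1(1)])
  qed
  show "assoc_op M1 M2 (bas p) (bas r) z = 0" if o: "p \<in> QP" "r \<in> QP" "tgt p \<noteq> src r" "z \<in> CQ"
  proof -
    have "bas r \<odot> z \<in> CQ" using o by (intro CQ_mult CQ_bas)
    then have "M2 (bas r \<odot> z) = bas (triv (src r)) \<odot> M2 (bas r \<odot> z)"
      using D2(4)[of "bas r \<odot> z" "src r"] by (simp add: pa_mult_assoc[symmetric] bas_triv_src)
    then have "bas p \<odot> M2 (bas r \<odot> z) = (bas p \<odot> bas (triv (src r))) \<odot> M2 (bas r \<odot> z)" by (metis pa_mult_assoc)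
    then show ?thesis using o by (simp add: assoc_op_def pa_mult_bas islin_zero[OF D1(1)] islin_zero[OF D2(1)])
  qed
  show "assoc_op M1 M2 x (bas p) (bas r) = 0" if o: "p \<in> QP" "r \<in> QP" "tgt p \<noteq> src r" "x \<in> CQ"
  proof -
    have "x \<odot> bas p \<in> CQ" using o by (intro CQ_mult CQ_bas)
    then have "M2 (x \<odot> bas p) = M2 (x \<odot> bas p) \<odot> bas (triv (tgt p))"
      using D2(5)[of "x \<odot> bas p" "tgt p"] by (simp add: pa_mult_assoc bas_triv_tgt)
    then have "M2 (x \<odot> bas p) \<odot> bas r = M2 (x \<odot> bas p) \<odot> (bas (triv (tgt p)) \<odot> bas r)" by (metis pa_mult_assoc)
    then show ?thesis using o by (simp add: assoc_op_def pa_mult_bas islin_zero[OF D1(1)] islin_zero[OF D2(1)])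
  qed
qed

lemma bracket_coch3:
  assumes f: "coch2 f M1" and g: "coch2 g M2"
  shows "coch3 (bracket 0 0 f g) (\<lambda>x y z. assoc_op M1 M2 x y z + assoc_op M2 M1 x y z)"
  unfolding coch3_def
proof (intro conjI ballI)
  have G: "goodM M1" "goodM M2" and v: "\<forall>x\<in>kIrr. M1 x = 0" "\<forall>x\<in>kIrr. M2 x = 0"
    using f g by (auto simp: coch2_def)
  note l = goodM_D(1)[OF G(1)] goodM_D(1)[OF G(2)]
  show "tri_ok (\<lambda>x y z. assoc_op M1 M2 x y z + assoc_op M2 M1 x y z)"
    unfolding tri_ok_def
    by (intro conjI allI ballI impI islin_plus islin_Aop3 assoc_op_islin2 l kIrr_add assoc_op_props(1)[OF G] assoc_op_props(1)[OF G(2,1)])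
      (simp_all add: assoc_op_props(2)[OF G] assoc_op_props(2)[OF G(2,1)] pa_mult_add_right assoc_op_vanish[OF G v] assoc_op_vanish[OF G(2,1) v(2,1)])
  fix x y z assume o: "x \<in> carrier A" "y \<in> carrier A" "z \<in> carrier A"
  have fA: "f [a, b] \<in> carrier A" "sigma (f [a, b]) = M1 (sigma a \<odot> sigma b)" if "a \<in> carrier A" "b \<in> carrier A" for a b
    using f that unfolding coch2_def by blast+
  have gA: "g [a, b] \<in> carrier A" "sigma (g [a, b]) = M2 (sigma a \<odot> sigma b)" if "a \<in> carrier A" "b \<in> carrier A" for a b
    using g that unfolding coch2_def by blast+
  have B: "bullet (Suc 0) (Suc 0) f' g' [x, y, z] \<in> carrier A \<and>
      sigma (bullet (Suc 0) (Suc 0) f' g' [x, y, z]) = sigma (f' [g' [x, y], z]) - sigma (f' [x, g' [y, z]])"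
    if "f' [g' [x, y], z] \<in> carrier A" "f' [x, g' [y, z]] \<in> carrier A" for f' g'
  proof -
    let ?t = "\<lambda>i. Ascale ((- 1) ^ (Suc 0 * i)) (f' (take i [x, y, z] @ [g' (take (Suc (Suc 0)) (drop i [x, y, z]))] @ drop (i + Suc (Suc 0)) [x, y, z]))"
    have "?t i \<in> carrier A" if "i \<in> {0..Suc 0}" for i
      using that \<open>f' [g' [x, y], z] \<in> carrier A\<close> \<open>f' [x, g' [y, z]] \<in> carrier A\<close> by (cases i) auto
    from finsum_A[where f = ?t and J = "{0..Suc 0}", OF this] show ?thesis
      using that unfolding bullet_def by (simp add: sigma_Ascale)
  qed
  note b1 = B[of f g] and b2 = B[of g f]
  have c: "f [g [x, y], z] \<in> carrier A" "f [x, g [y, z]] \<in> carrier A" "g [f [x, y], z] \<in> carrier A" "g [x, f [y, z]] \<in> carrier A"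
    using o by (simp_all add: fA gA)
  have br: "bracket 0 0 f g [x, y, z] = Ascale (- 1) (bullet (Suc 0) (Suc 0) f g [x, y, z] \<ominus>\<^bsub>A\<^esub> Ascale (- 1) (bullet (Suc 0) (Suc 0) g f [x, y, z]))"
    by (simp add: bracket_def gerstenhaber_def)
  show "bracket 0 0 f g [x, y, z] \<in> carrier A" unfolding br using b1 b2 c by (simp add: A_minus)
  show "sigma (bracket 0 0 f g [x, y, z]) = assoc_op M1 M2 (sigma x) (sigma y) (sigma z) + assoc_op M2 M1 (sigma x) (sigma y) (sigma z)"
    unfolding br using b1 b2 c o by (simp add: A_minus sigma_Ascale fA gA assoc_op_def)
qed

lemma arrow_eval_sum: "arrow_eval (\<lambda>x y z. assoc_op M1 M2 x y z + assoc_op M2 M1 x y z) p b = arrow_assoc M1 M2 p b + arrow_assoc M2 M1 p b"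
  by (simp add: arrow_eval_def arrow_assoc_def pa_mult_add_right islin_add[OF islin_nf] asum_add)

lemma eval_gen_add: "eval_gen (\<lambda>s z. e s z + e' s z) x = eval_gen e x + eval_gen e' x"
  unfolding eval_gen_def lin_add_fun[symmetric]
  by (rule lin_cong) (simp add: pa_mult_add_right islin_add[OF islin_nf] split: prod.split)

text \<open>With the sign convention for the bracket, the bracket is the sum of the two associators.\<close>
theorem h_up_bracket:
  assumes f: "coch2 f M1" and g: "coch2 g M2" and a: "a \<in> carrier A" and b: "b \<in> carrier A"
  shows "h_up 2 (bracket 0 0 f g) [a, b] \<in> carrier A"
    "sigma (h_up 2 (bracket 0 0 f g) [a, b]) = homotopy_assoc M1 M2 (sigma a) (sigma b) + homotopy_assoc M2 M1 (sigma a) (sigma b)"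
proof -
  let ?AA = "\<lambda>x y z. assoc_op M1 M2 x y z + assoc_op M2 M1 x y z"
  have K: "rel_eval ?AA = (\<lambda>s z. rel_assoc M1 M2 s z + rel_assoc M2 M1 s z)"
    by (intro ext) (simp add: rel_eval_def rel_assoc_def arrow_eval_sum lin_add_fun)
  show "h_up 2 (bracket 0 0 f g) [a, b] \<in> carrier A" by (rule h_up_eval(1)[OF bracket_coch3[OF f g] a b])
  show "sigma (h_up 2 (bracket 0 0 f g) [a, b]) = homotopy_assoc M1 M2 (sigma a) (sigma b) + homotopy_assoc M2 M1 (sigma a) (sigma b)"
    unfolding h_up_eval(2)[OF bracket_coch3[OF f g] a b] K eval_gen_add arrow_eval_sum lin_add_fun homotopy_assoc_def by simp
qed

end

section \<open>Shuffles and permutations\<close>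

text \<open>Both functions enumerate the same finite set in increasing order.\<close>
lemma strict_mono_on_determined:
  fixes f g :: "nat \<Rightarrow> nat"
  assumes "strict_mono_on {a..<b} f" "strict_mono_on {a..<b} g" "f ` {a..<b} = g ` {a..<b}" "j \<in> {a..<b}"
  shows "f j = g j"
proof -
  have s: "sorted (map h [a..<b]) \<and> distinct (map h [a..<b])" if "strict_mono_on {a..<b} h" for h :: "nat \<Rightarrow> nat"
    using that strict_mono_on_imp_inj_on[OF that]
    by (auto simp: sorted_iff_nth_mono distinct_map intro!: strict_mono_on_leD[OF that])
  have "map f [a..<b] = sorted_list_of_set (f ` {a..<b})"
    using sorted_list_of_set.idem_if_sorted_distinct[of "map f [a..<b]"] s[OF assms(1)] by simp
  moreover have "map g [a..<b] = sorted_list_of_set (g ` {a..<b})"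
    using sorted_list_of_set.idem_if_sorted_distinct[of "map g [a..<b]"] s[OF assms(2)] by simp
  ultimately have "map f [a..<b] = map g [a..<b]" using assms(3) by simp
  then show ?thesis using assms(4) by auto
qed

text \<open>The condition \<open>\<tau> 0 < \<tau> i\<close> says that \<open>0\<close> lies in the first block, as the minimum of each block is its
  first value.\<close>
lemma pointed_shufflesD:
  assumes "(i, \<tau>) \<in> pointed_shuffles k"
  shows "1 \<le> i" "i < k" "\<tau> permutes {..<k}" "strict_mono_on {0..<i} \<tau>" "strict_mono_on {i..<k} \<tau>" "\<tau> 0 < \<tau> i"
    "\<tau> ` {0..<i} \<union> \<tau> ` {i..<k} = {..<k}" "\<tau> ` {0..<i} \<inter> \<tau> ` {i..<k} = {}" "0 \<in> \<tau> ` {0..<i}"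
proof -
  show d: "1 \<le> i" "i < k" "\<tau> permutes {..<k}" "strict_mono_on {0..<i} \<tau>" "strict_mono_on {i..<k} \<tau>" "\<tau> 0 < \<tau> i"
    using assms by (simp_all add: pointed_shuffles_def atLeast0LessThan)
  have k: "{..<k} = {0..<i} \<union> {i..<k}" using d by auto
  have im: "\<tau> ` {..<k} = {..<k}" by (rule permutes_image[OF d(3)])
  show u: "\<tau> ` {0..<i} \<union> \<tau> ` {i..<k} = {..<k}" using im unfolding k by (simp add: image_Un)
  show "\<tau> ` {0..<i} \<inter> \<tau> ` {i..<k} = {}" by (subst image_Int[OF permutes_inj[OF d(3)], symmetric]) (simp add: disjoint_iff)
  have "0 \<in> {..<k}" using d by auto
  then consider "0 \<in> \<tau> ` {0..<i}" | "0 \<in> \<tau> ` {i..<k}" using u by blast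
  then show "0 \<in> \<tau> ` {0..<i}"
  proof cases
    case 2
    then obtain j where "j \<in> {i..<k}" "\<tau> j = 0" by auto
    then have "\<tau> i \<le> 0" using strict_mono_on_leD[OF d(5), of i j] d(2) by auto
    then show ?thesis using d(6) by simp
  qed
qed

text \<open>A shuffle is determined by the set of values of its first block.\<close>
lemma pointed_shuffles_bij:
  "bij_betw (\<lambda>(i, \<tau>). \<tau> ` {0..<i}) (pointed_shuffles k) {U. U \<subseteq> {..<k} \<and> 0 \<in> U \<and> U \<noteq> {..<k}}"
proof (rule bij_betwI')
  fix x y assume "x \<in> pointed_shuffles k" "y \<in> pointed_shuffles k"
  obtain i \<tau> j \<rho> where xy: "x = (i, \<tau>)" "y = (j, \<rho>)" by (metis surj_pair)
  then have dx: "(i, \<tau>) \<in> pointed_shuffles k" and dy: "(j, \<rho>) \<in> pointed_shuffles k"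
    using \<open>x \<in> _\<close> \<open>y \<in> _\<close> by auto
  note d = pointed_shufflesD[OF dx] and e = pointed_shufflesD[OF dy]
  have "x = y" if eq: "\<tau> ` {0..<i} = \<rho> ` {0..<j}"
  proof -
    have "card (\<tau> ` {0..<i}) = i" "card (\<rho> ` {0..<j}) = j"
      by (simp_all add: card_image permutes_inj_on[OF d(3)] permutes_inj_on[OF e(3)])
    then have ij: "i = j" using eq by simp
    have c1: "\<tau> ` {i..<k} = {..<k} - \<tau> ` {0..<i}" using d(7,8) by blast
    moreover have "\<rho> ` {j..<k} = {..<k} - \<rho> ` {0..<j}" using e(7,8) by blast
    ultimately have im2: "\<tau> ` {i..<k} = \<rho> ` {i..<k}" using eq ij by simp
    then have "\<tau> m = \<rho> m" for m
    proof (cases "m < i")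
      case True
      then show ?thesis using strict_mono_on_determined[OF d(4), of \<rho> m] e(4) eq ij by simp
    next
      case False
      show ?thesis
      proof (cases "m < k")
        case True
        then show ?thesis using strict_mono_on_determined[OF d(5), of \<rho> m] e(5) im2 ij False by simp
      next
        case F: False
        then show ?thesis using permutes_not_in[OF d(3), of m] permutes_not_in[OF e(3), of m] by simp
      qed
    qed
    then show ?thesis using xy ij by auto
  qed
  then show "((case x of (i, \<tau>) \<Rightarrow> \<tau> ` {0..<i}) = (case y of (i, \<tau>) \<Rightarrow> \<tau> ` {0..<i})) = (x = y)"
    using xy by auto
next
  fix x assume x: "x \<in> pointed_shuffles k"
  obtain i \<tau> where xx: "x = (i, \<tau>)" by (cases x)
  note d = pointed_shufflesD[OF x[unfolded xx]]
  have "\<tau> i \<in> \<tau> ` {i..<k}" using d(2) by auto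
  then have "\<tau> ` {0..<i} \<noteq> {..<k}" using d(7,8) by blast
  then show "(case x of (i, \<tau>) \<Rightarrow> \<tau> ` {0..<i}) \<in> {U. U \<subseteq> {..<k} \<and> 0 \<in> U \<and> U \<noteq> {..<k}}" using d xx by auto
next
  fix U assume "U \<in> {U. U \<subseteq> {..<k} \<and> 0 \<in> U \<and> U \<noteq> {..<k}}"
  then have U: "U \<subseteq> {..<k}" "0 \<in> U" "U \<noteq> {..<k}" by auto
  have fU: "finite U" using U finite_subset by blast
  let ?V = "{..<k} - U"
  let ?l1 = "sorted_list_of_set U" and ?l2 = "sorted_list_of_set ?V"
  let ?i = "card U"
  have len: "length ?l1 = ?i" "length ?l2 = k - ?i" "?i \<le> k"
    using U fU card_mono[OF _ U(1)] by (simp_all add: card_Diff_subset)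
  have Vne: "?V \<noteq> {}" using U by blast
  have iU: "1 \<le> ?i" using U fU by (auto simp: Suc_le_eq card_gt_0_iff)
  have ik: "?i < k" using psubset_card_mono[of "{..<k}" U] U by auto
  define \<tau> where "\<tau> j = (if j < k then (?l1 @ ?l2) ! j else j)" for j
  have t1: "\<tau> j = ?l1 ! j" if "j < ?i" for j using that len ik by (simp add: \<tau>_def nth_append)
  have t2: "\<tau> j = ?l2 ! (j - ?i)" if "?i \<le> j" "j < k" for j using that len by (simp add: \<tau>_def nth_append)
  have dis: "distinct (?l1 @ ?l2)" using fU by auto
  have setl: "set (?l1 @ ?l2) = {..<k}" using fU U by auto
  have "bij_betw (\<lambda>j. (?l1 @ ?l2) ! j) {..<k} {..<k}"
    using bij_betw_nth[OF dis, of "{..<k}" "{..<k}"] len setl by simp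
  then have "bij_betw \<tau> {..<k} {..<k}" by (rule bij_betw_cong[THEN iffD1, rotated]) (simp add: \<tau>_def)
  then have p: "\<tau> permutes {..<k}" by (rule bij_imp_permutes) (simp add: \<tau>_def)
  have m1: "strict_mono_on {..<?i} \<tau>"
    using strict_sorted_list_of_set[of U] len by (auto intro!: strict_mono_onI simp: t1 sorted_wrt_iff_nth_less)
  have m2: "strict_mono_on {?i..<k} \<tau>"
    using strict_sorted_list_of_set[of ?V] len by (auto intro!: strict_mono_onI simp: t2 sorted_wrt_iff_nth_less)
  have im: "\<tau> ` {0..<?i} = U"
  proof -
    have "\<tau> ` {0..<?i} = (\<lambda>j. ?l1 ! j) ` {0..<length ?l1}" using len t1 by (auto intro!: image_cong)
    also have "\<dots> = set ?l1" using set_conv_nth[of ?l1] by auto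
    finally show ?thesis using fU by simp
  qed
  have "\<tau> 0 = 0"
  proof -
    have "0 \<in> \<tau> ` {0..<?i}" using U(2) im by simp
    then obtain j where j: "j < ?i" "\<tau> j = 0" by auto
    then show ?thesis using strict_mono_on_leD[OF m1, of 0 j] by auto
  qed
  moreover have "\<tau> ?i \<noteq> 0"
  proof -
    have "\<tau> ?i \<in> set ?l2" using t2[of ?i] ik len nth_mem[of 0 ?l2] by simp
    then have "\<tau> ?i \<notin> U" by simp
    then show ?thesis using U(2) by metis
  qed
  ultimately have "(?i, \<tau>) \<in> pointed_shuffles k" using iU ik p m1 m2 by (simp add: pointed_shuffles_def)
  then show "\<exists>x\<in>pointed_shuffles k. U = (case x of (i, \<tau>) \<Rightarrow> \<tau> ` {0..<i})"
    using im by (intro bexI[of _ "(?i, \<tau>)"]) auto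
qed

context confluent_system begin

lemma assoc_op_sum1: "assoc_op (\<lambda>x. \<Sum>j\<in>J. M1 j x) M2 x y z = (\<Sum>j\<in>J. assoc_op (M1 j) M2 x y z)"
  by (simp add: assoc_op_def sum_subtractf)

lemma assoc_op_sum2: "islin M1 \<Longrightarrow> assoc_op M1 (\<lambda>x. \<Sum>j\<in>J. M2 j x) x y z = (\<Sum>j\<in>J. assoc_op M1 (M2 j) x y z)"
  by (simp add: assoc_op_def sum_subtractf pa_mult_sum_left pa_mult_sum_right islin_sum)

lemma arrow_assoc_sum1: "arrow_assoc (\<lambda>x. \<Sum>j\<in>J. M1 j x) M2 p b = (\<Sum>j\<in>J. arrow_assoc (M1 j) M2 p b)"
  by (simp add: arrow_assoc_def assoc_op_sum1 pa_mult_sum_right islin_sum[OF islin_nf] asum_sum)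

lemma arrow_assoc_sum2: "islin M1 \<Longrightarrow> arrow_assoc M1 (\<lambda>x. \<Sum>j\<in>J. M2 j x) p b = (\<Sum>j\<in>J. arrow_assoc M1 (M2 j) p b)"
  by (simp add: arrow_assoc_def assoc_op_sum2 pa_mult_sum_right islin_sum[OF islin_nf] asum_sum)

lemma homotopy_assoc_sum1: "homotopy_assoc (\<lambda>x. \<Sum>j\<in>J. M1 j x) M2 a b = (\<Sum>j\<in>J. homotopy_assoc (M1 j) M2 a b)"
proof -
  have "rel_assoc (\<lambda>x. \<Sum>j\<in>J. M1 j x) M2 = (\<lambda>s z. \<Sum>j\<in>J. rel_assoc (M1 j) M2 s z)"
    by (intro ext) (simp add: rel_assoc_def arrow_assoc_sum1 lin_sum_fun sum_subtractf)
  then show ?thesis by (simp add: homotopy_assoc_def arrow_assoc_sum1 lin_sum_fun eval_gen_sum sum_subtractf)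
qed

lemma homotopy_assoc_sum2: assumes "islin M1" shows "homotopy_assoc M1 (\<lambda>x. \<Sum>j\<in>J. M2 j x) a b = (\<Sum>j\<in>J. homotopy_assoc M1 (M2 j) a b)"
proof -
  have "rel_assoc M1 (\<lambda>x. \<Sum>j\<in>J. M2 j x) = (\<lambda>s z. \<Sum>j\<in>J. rel_assoc M1 (M2 j) s z)"
    by (intro ext) (simp add: rel_assoc_def arrow_assoc_sum2[OF assms] lin_sum_fun sum_subtractf)
  then show ?thesis by (simp add: homotopy_assoc_def arrow_assoc_sum2[OF assms] lin_sum_fun eval_gen_sum sum_subtractf)
qed

lemma goodM_sum: assumes "\<And>j. j \<in> J \<Longrightarrow> goodM (M j)" shows "goodM (\<lambda>x. \<Sum>j\<in>J. M j x)"
  unfolding goodM_def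
  by (intro conjI ballI allI islin_sum_fun kIrr_sum)
    (use assms in \<open>auto simp: goodM_D pa_mult_sum_left pa_mult_sum_right intro!: sum.cong\<close>)

text \<open>The right-hand side of the polarized theorem.\<close>
definition Sym :: "('i \<Rightarrow> ('v, 'e) qpath \<Rightarrow> ('v, 'e, 'k) alg) \<Rightarrow> 'i set \<Rightarrow> ('v, 'e, 'k) pa \<Rightarrow> ('v, 'e, 'k) pa" where
  "Sym g U x = (\<Sum>l\<in>permutations_of_set U. polred (map (\<lambda>i s. sigma (g i s)) l) x)"

lemma Sym_good:
  assumes "\<And>i. i \<in> U \<Longrightarrow> g i \<in> HomSA" "finite U" "U \<noteq> {}"
  shows "goodM (Sym g U)" "\<forall>x\<in>kIrr. Sym g U x = 0"
proof -
  have ad: "adms (map (\<lambda>i s. sigma (g i s)) l)" if "l \<in> permutations_of_set U" for l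
    using that assms HomSA_adm by (auto dest: permutations_of_setD)
  show "goodM (Sym g U)" unfolding Sym_def[abs_def] by (intro goodM_sum goodM_polred ad)
  have "l \<noteq> []" if "l \<in> permutations_of_set U" for l using that assms(3) by (auto dest: permutations_of_setD)
  then show "\<forall>x\<in>kIrr. Sym g U x = 0" unfolding Sym_def by (auto simp: polred_on_kIrr intro!: sum.neutral)
qed

lemma homotopy_assoc_Sym:
  "homotopy_assoc (Sym g U) (Sym g W) a b = (\<Sum>l1\<in>permutations_of_set U. \<Sum>l2\<in>permutations_of_set W.
     homotopy_assoc (polred (map (\<lambda>i s. sigma (g i s)) l1)) (polred (map (\<lambda>i s. sigma (g i s)) l2)) a b)"
  unfolding Sym_def[abs_def] homotopy_assoc_sum1 by (intro sum.cong refl homotopy_assoc_sum2 islin_polred)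

text \<open>Cutting a permutation of \<open>Y\<close> into two nonempty lists amounts to choosing the set \<open>U\<close> of entries of the
  second list and permutations of \<open>U\<close> and of \<open>Y - U\<close>.\<close>
lemma Sym_recursion:
  assumes Y: "finite Y" "card Y \<ge> 2" and g: "\<And>i. i \<in> Y \<Longrightarrow> g i \<in> HomSA" and a: "a \<in> kIrr" and b: "b \<in> kIrr"
  shows "Sym g Y (a \<odot> b) = (\<Sum>U | U \<subseteq> Y \<and> U \<noteq> {} \<and> U \<noteq> Y. homotopy_assoc (Sym g U) (Sym g (Y - U)) a b)"
proof -
  let ?R = "\<lambda>l. polred (map (\<lambda>i s. sigma (g i s)) l)"
  have 1: "?R l (a \<odot> b) = (\<Sum>i\<in>{1..<card Y}. homotopy_assoc (?R (drop i l)) (?R (take i l)) a b)" if l: "l \<in> permutations_of_set Y" for l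
  proof -
    have ll: "length l = card Y" "set l = Y" using l by (auto simp: permutations_of_setD distinct_card[symmetric])
    have ad: "adms (map (\<lambda>i s. sigma (g i s)) l)" using ll g HomSA_adm by auto
    obtain x y l' where "l = x # y # l'" using ll(1) Y(2) by (cases l; cases "tl l") auto
    then have "?R l (a \<odot> b) = (\<Sum>i\<in>{1..<length (map (\<lambda>i s. sigma (g i s)) l)}. homotopy_assoc (polred (drop i (map (\<lambda>i s. sigma (g i s)) l))) (polred (take i (map (\<lambda>i s. sigma (g i s)) l))) a b)"
      by (intro polred_product_recursion[of _ "\<lambda>s. sigma (g x s)" "map (\<lambda>i s. sigma (g i s)) (y # l')", OF _ _ ad a b]) (simp_all only: list.map list.distinct not_False_eq_True)
    then show ?thesis by (simp only: drop_map take_map length_map ll(1))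
  qed
  have "Sym g Y (a \<odot> b) = (\<Sum>l\<in>permutations_of_set Y. \<Sum>i\<in>{1..<card Y}. homotopy_assoc (?R (drop i l)) (?R (take i l)) a b)"
    unfolding Sym_def by (rule sum.cong[OF refl 1])
  also have "\<dots> = (\<Sum>(l, i)\<in>permutations_of_set Y \<times> {1..<card Y}. homotopy_assoc (?R (drop i l)) (?R (take i l)) a b)"
    by (simp add: sum.cartesian_product)
  also have "\<dots> = (\<Sum>(U, l1, l2)\<in>(SIGMA U:{U. U \<subseteq> Y \<and> U \<noteq> {} \<and> U \<noteq> Y}. permutations_of_set U \<times> permutations_of_set (Y - U)). homotopy_assoc (?R l1) (?R l2) a b)"
  proof (rule sum.reindex_bij_witness[where i = "\<lambda>(U, l1, l2). (l2 @ l1, length l2)" and j = "\<lambda>(l, i). (set (drop i l), drop i l, take i l)"])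
    fix t assume "t \<in> permutations_of_set Y \<times> {1..<card Y}"
    then obtain l i where t: "t = (l, i)" "l \<in> permutations_of_set Y" "1 \<le> i" "i < card Y" by auto
    have l: "set l = Y" "distinct l" using t by (auto dest: permutations_of_setD)
    have len: "length l = card Y" using distinct_card[OF l(2)] l(1) by simp
    show "(case (case t of (l, i) \<Rightarrow> (set (drop i l), drop i l, take i l)) of (U, l1, l2) \<Rightarrow> (l2 @ l1, length l2)) = t"
      using t len by simp
    have ld: "l = take i l @ drop i l" by simp
    have dj: "set (take i l) \<inter> set (drop i l) = {}" using l(2) by (metis ld distinct_append)
    have un: "set (take i l) \<union> set (drop i l) = Y" using l(1) by (metis ld set_append)
    have dd: "distinct (take i l)" "distinct (drop i l)" using l(2) by simp_all
    have ne: "take i l \<noteq> []" "drop i l \<noteq> []" using t len by auto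
    have "set (drop i l) \<subseteq> Y" "set (drop i l) \<noteq> {}" "set (take i l) = Y - set (drop i l)" using un dj ne by auto
    moreover have "set (drop i l) \<noteq> Y"
    proof
      assume "set (drop i l) = Y"
      then have "set (take i l) = {}" using dj Un_upper1[of "set (take i l)" "set (drop i l)", unfolded un] by (metis Int_absorb2)
      then show False using ne by simp
    qed
    ultimately show "(case t of (l, i) \<Rightarrow> (set (drop i l), drop i l, take i l)) \<in> (SIGMA U:{U. U \<subseteq> Y \<and> U \<noteq> {} \<and> U \<noteq> Y}. permutations_of_set U \<times> permutations_of_set (Y - U))"
      using t dd by (auto intro!: permutations_of_setI)
    show "(case (case t of (l, i) \<Rightarrow> (set (drop i l), drop i l, take i l)) of (U, l1, l2) \<Rightarrow> homotopy_assoc (?R l1) (?R l2) a b) = (case t of (l, i) \<Rightarrow> homotopy_assoc (?R (drop i l)) (?R (take i l)) a b)"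
      using t by simp
  next
    fix t assume "t \<in> (SIGMA U:{U. U \<subseteq> Y \<and> U \<noteq> {} \<and> U \<noteq> Y}. permutations_of_set U \<times> permutations_of_set (Y - U))"
    then obtain U l1 l2 where t: "t = (U, l1, l2)" "U \<subseteq> Y" "U \<noteq> {}" "U \<noteq> Y" "l1 \<in> permutations_of_set U" "l2 \<in> permutations_of_set (Y - U)" by auto
    have l: "set l1 = U" "distinct l1" "set l2 = Y - U" "distinct l2" using t by (auto dest: permutations_of_setD)
    show "(case (case t of (U, l1, l2) \<Rightarrow> (l2 @ l1, length l2)) of (l, i) \<Rightarrow> (set (drop i l), drop i l, take i l)) = t"
      using t l by simp
    have fU: "finite U" using Y t finite_subset by blast
    have "length l2 = card Y - card U" using distinct_card[OF l(4)] l(3) t fU by (simp add: card_Diff_subset)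
    moreover have "card U < card Y" "0 < card U" using t Y fU psubset_card_mono[of Y U] by (auto simp: card_gt_0_iff)
    ultimately show "(case t of (U, l1, l2) \<Rightarrow> (l2 @ l1, length l2)) \<in> permutations_of_set Y \<times> {1..<card Y}"
      using t l by (auto intro!: permutations_of_setI)
  qed
  also have "\<dots> = (\<Sum>U | U \<subseteq> Y \<and> U \<noteq> {} \<and> U \<noteq> Y. \<Sum>(l1, l2)\<in>permutations_of_set U \<times> permutations_of_set (Y - U). homotopy_assoc (?R l1) (?R l2) a b)"
    by (rule sum.Sigma[symmetric]) (use Y in auto)
  also have "\<dots> = (\<Sum>U | U \<subseteq> Y \<and> U \<noteq> {} \<and> U \<noteq> Y. homotopy_assoc (Sym g U) (Sym g (Y - U)) a b)"
    by (rule sum.cong[OF refl]) (simp add: homotopy_assoc_Sym sum.cartesian_product)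
  finally show ?thesis .
qed

text \<open>An unordered division of \<open>Y\<close> is counted once on the left, with both orders of its parts.\<close>
lemma pointed_sum:
  assumes "finite Y" "x0 \<in> Y"
  shows "(\<Sum>U | U \<subseteq> Y \<and> x0 \<in> U \<and> U \<noteq> Y. f U (Y - U) + f (Y - U) U) = (\<Sum>U | U \<subseteq> Y \<and> U \<noteq> {} \<and> U \<noteq> Y. (f U (Y - U) :: 'm::comm_monoid_add))"
proof -
  let ?P = "{U. U \<subseteq> Y \<and> x0 \<in> U \<and> U \<noteq> Y}" and ?N = "{U. U \<subseteq> Y \<and> x0 \<notin> U \<and> U \<noteq> {}}"
  have fin: "finite ?P" "finite ?N" using assms by (auto intro: finite_subset[of _ "Pow Y"])
  have e: "{U. U \<subseteq> Y \<and> U \<noteq> {} \<and> U \<noteq> Y} = ?P \<union> ?N" using assms by auto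
  have "(\<Sum>U\<in>?P. f (Y - U) U) = (\<Sum>U\<in>?N. f U (Y - U))"
    by (rule sum.reindex_bij_witness[where i = "\<lambda>U. Y - U" and j = "\<lambda>U. Y - U"]) (use assms in \<open>auto simp: double_diff\<close>)
  then show ?thesis unfolding e using fin by (simp add: sum.union_disjoint sum.distrib disjoint_iff)
qed

declare G_hi.simps [simp del]

text \<open>Induction on the number of arguments: the defining recursion of \<open>G\<^sub>k\<close>, rewritten with \<open>h_up_bracket\<close> and
  \<open>pointed_shuffles_bij\<close>, is the recursion \<open>Sym_recursion\<close>.  The arguments are indexed by distinct \<open>xs\<close> since
  the same map may occur several times among them.\<close>
theorem G_hi_coch2:
  assumes "xs \<noteq> []" "distinct xs" "\<And>i. i \<in> set xs \<Longrightarrow> g i \<in> HomSA"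
  shows "coch2 (G_hi (map g xs)) (Sym g (set xs))"
  using assms
proof (induction "length xs" arbitrary: xs rule: less_induct)
  case less
  let ?k = "length xs"
  have good: "goodM (Sym g (set xs))" "\<forall>x\<in>kIrr. Sym g (set xs) x = 0"
    using Sym_good[of "set xs" g] less by auto
  show ?case
  proof (cases "?k = 1")
    case True
    then obtain x where x: "xs = [x]" by (cases xs) auto
    have "G_hi (map g xs) = G_up 2 (g x)" by (subst G_hi.simps) (simp add: x)
    then show ?thesis using good G_up_polred[of "g x"] less(4)[of x]
      by (simp add: coch2_def x Sym_def)
  next
    case False
    then have k: "?k \<ge> 2" using less(2) by (cases xs) (auto simp: Suc_le_eq)
    have card: "card (set xs) = ?k" using less(3) by (rule distinct_card)
    have inj: "inj_on ((!) xs) {..<?k}" using less(3) by (simp add: inj_on_nth)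
    let ?us = "\<lambda>\<tau> i. map (\<lambda>j. xs ! \<tau> j) [0..<i]" and ?vs = "\<lambda>\<tau> i. map (\<lambda>j. xs ! \<tau> j) [i..<?k]"
    let ?t = "\<lambda>(i, \<tau>). h_up 2 (bracket 0 0 (G_hi (map g (?us \<tau> i))) (G_hi (map g (?vs \<tau> i))))"
    have P: "coch2 (G_hi (map g (?us \<tau> i))) (Sym g ((!) xs ` \<tau> ` {0..<i})) \<and>
        coch2 (G_hi (map g (?vs \<tau> i))) (Sym g (set xs - (!) xs ` \<tau> ` {0..<i}))"
      if t: "(i, \<tau>) \<in> pointed_shuffles ?k" for i \<tau>
    proof -
      note d = pointed_shufflesD[OF t]
      have injt: "inj_on (\<lambda>j. xs ! \<tau> j) {..<?k}"
        using comp_inj_on[of \<tau> "{..<?k}" "(!) xs"] permutes_inj_on[OF d(3)] permutes_image[OF d(3)] inj by (simp add: o_def)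
      have im: "(\<lambda>j. xs ! \<tau> j) ` {..<?k} = set xs"
      proof -
        have "(\<lambda>j. xs ! \<tau> j) ` {..<?k} = (!) xs ` (\<tau> ` {..<?k})" by (simp add: image_image)
        also have "\<dots> = set xs" unfolding permutes_image[OF d(3)] using set_conv_nth[of xs] by auto
        finally show ?thesis .
      qed
      have su: "set (?us \<tau> i) = (!) xs ` \<tau> ` {0..<i}" by (simp add: image_image)
      have sv: "set (?vs \<tau> i) = set xs - (!) xs ` \<tau> ` {0..<i}"
      proof -
        have "{..<?k} = {0..<i} \<union> {i..<?k}" using d by auto
        then have "set xs = (\<lambda>j. xs ! \<tau> j) ` {0..<i} \<union> (\<lambda>j. xs ! \<tau> j) ` {i..<?k}" using im by (metis image_Un)
        moreover have "(\<lambda>j. xs ! \<tau> j) ` {0..<i} \<inter> (\<lambda>j. xs ! \<tau> j) ` {i..<?k} = {}"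
          using inj_on_image_Int[OF injt, of "{0..<i}" "{i..<?k}"] d by (auto simp: subset_iff)
        ultimately show ?thesis by (auto simp: image_image)
      qed
      have "inj_on (\<lambda>j. xs ! \<tau> j) {0..<i}" "inj_on (\<lambda>j. xs ! \<tau> j) {i..<?k}"
        using d by (auto intro: inj_on_subset[OF injt])
      then have dist: "distinct (?us \<tau> i)" "distinct (?vs \<tau> i)" by (simp_all add: distinct_map)
      have sub: "set (?us \<tau> i) \<subseteq> set xs" using im d unfolding su by (auto simp: image_image)
      have U: "coch2 (G_hi (map g (?us \<tau> i))) (Sym g (set (?us \<tau> i)))"
        by (rule less(1)) (use d dist(1) sub less(4) in auto)
      have W: "coch2 (G_hi (map g (?vs \<tau> i))) (Sym g (set (?vs \<tau> i)))"
        by (rule less(1)) (use d dist(2) sv less(4) in auto)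
      show ?thesis using U W unfolding su sv by blast
    qed
    have G: "G_hi (map g xs) ys = finsum A (\<lambda>p. ?t p ys) (pointed_shuffles ?k)" for ys
    proof -
      have "G_hi (map g xs) ys = finsum A (\<lambda>(i, \<tau>). h_up 2 (bracket 0 0 (G_hi (map (\<lambda>j. map g xs ! \<tau> j) [0..<i]))
          (G_hi (map (\<lambda>j. map g xs ! \<tau> j) [i..<?k]))) ys) (pointed_shuffles ?k)"
        by (subst G_hi.simps) (use k in simp)
      also have "\<dots> = finsum A (\<lambda>p. ?t p ys) (pointed_shuffles ?k)"
      proof (rule finsum_fundef_cong[OF refl])
        fix p assume p: "p \<in> pointed_shuffles ?k"
        obtain i \<tau> where pp: "p = (i, \<tau>)" by (cases p)
        note d = pointed_shufflesD[OF p[unfolded pp]]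
        have "\<tau> j < ?k" if "j < ?k" for j using permutes_in_image[OF d(3), of j] that by simp
        then have "map (\<lambda>j. map g xs ! \<tau> j) [0..<i] = map g (?us \<tau> i)" "map (\<lambda>j. map g xs ! \<tau> j) [i..<?k] = map g (?vs \<tau> i)"
          using d(2) by simp_all
        then show "(case p of (i, \<tau>) \<Rightarrow> h_up 2 (bracket 0 0 (G_hi (map (\<lambda>j. map g xs ! \<tau> j) [0..<i]))
          (G_hi (map (\<lambda>j. map g xs ! \<tau> j) [i..<?k]))) ys) = ?t p ys" unfolding pp prod.case by (simp only:)
      qed
      finally show ?thesis .
    qed
    let ?S = "\<lambda>U. Sym g ((!) xs ` U)"
    show ?thesis unfolding coch2_def
    proof (intro conjI good ballI)
      fix x y assume xy: "x \<in> carrier A" "y \<in> carrier A"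
      let ?f = "\<lambda>U W. homotopy_assoc (Sym g U) (Sym g W) (sigma x) (sigma y)"
      have t: "?t p [x, y] \<in> carrier A \<and> sigma (?t p [x, y]) =
          ?f ((!) xs ` (case p of (i, \<tau>) \<Rightarrow> \<tau> ` {0..<i})) (set xs - (!) xs ` (case p of (i, \<tau>) \<Rightarrow> \<tau> ` {0..<i}))
        + ?f (set xs - (!) xs ` (case p of (i, \<tau>) \<Rightarrow> \<tau> ` {0..<i})) ((!) xs ` (case p of (i, \<tau>) \<Rightarrow> \<tau> ` {0..<i}))"
        if p: "p \<in> pointed_shuffles ?k" for p
      proof -
        obtain i \<tau> where pp: "p = (i, \<tau>)" by (cases p)
        note c = P[OF p[unfolded pp]]
        show ?thesis unfolding pp prod.case
          using h_up_bracket[OF conjunct1[OF c] conjunct2[OF c] xy] by blast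
      qed
      have f: "finsum A (\<lambda>p. ?t p [x, y]) (pointed_shuffles ?k) \<in> carrier A \<and>
          sigma (finsum A (\<lambda>p. ?t p [x, y]) (pointed_shuffles ?k)) = (\<Sum>p\<in>pointed_shuffles ?k. sigma (?t p [x, y]))"
        by (rule finsum_A) (use t in blast)
      show "G_hi (map g xs) [x, y] \<in> carrier A" unfolding G using f by blast
      have "sigma (G_hi (map g xs) [x, y]) = (\<Sum>p\<in>pointed_shuffles ?k. sigma (?t p [x, y]))" unfolding G using f by blast
      also have "\<dots> = (\<Sum>p\<in>pointed_shuffles ?k. (\<lambda>U. ?f ((!) xs ` U) (set xs - (!) xs ` U) + ?f (set xs - (!) xs ` U) ((!) xs ` U)) (case p of (i, \<tau>) \<Rightarrow> \<tau> ` {0..<i}))"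
        by (rule sum.cong[OF refl]) (use t in blast)
      also have "\<dots> = (\<Sum>U | U \<subseteq> {..<?k} \<and> 0 \<in> U \<and> U \<noteq> {..<?k}. ?f ((!) xs ` U) (set xs - (!) xs ` U) + ?f (set xs - (!) xs ` U) ((!) xs ` U))"
        by (rule sum.reindex_bij_betw[OF pointed_shuffles_bij])
      also have "\<dots> = (\<Sum>U | U \<subseteq> set xs \<and> xs ! 0 \<in> U \<and> U \<noteq> set xs. ?f U (set xs - U) + ?f (set xs - U) U)"
      proof (rule sum.reindex_bij_betw)
        have img: "(!) xs ` {..<?k} = set xs" using set_conv_nth[of xs] by auto
        have b0: "bij_betw ((`) ((!) xs)) (Pow {..<?k}) (Pow (set xs))"
          using bij_betw_Pow[of "(!) xs" "{..<?k}" "set xs"] inj img by (simp add: bij_betw_def)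
        show "bij_betw ((`) ((!) xs)) {U. U \<subseteq> {..<?k} \<and> 0 \<in> U \<and> U \<noteq> {..<?k}} {U. U \<subseteq> set xs \<and> xs ! 0 \<in> U \<and> U \<noteq> set xs}"
        proof (rule bij_betw_imageI)
          show "inj_on ((`) ((!) xs)) {U. U \<subseteq> {..<?k} \<and> 0 \<in> U \<and> U \<noteq> {..<?k}}"
            using b0 by (auto simp: bij_betw_def intro: inj_on_subset)
          show "(`) ((!) xs) ` {U. U \<subseteq> {..<?k} \<and> 0 \<in> U \<and> U \<noteq> {..<?k}} = {U. U \<subseteq> set xs \<and> xs ! 0 \<in> U \<and> U \<noteq> set xs}"
          proof (intro equalityI subsetI)
            fix W assume "W \<in> (`) ((!) xs) ` {U. U \<subseteq> {..<?k} \<and> 0 \<in> U \<and> U \<noteq> {..<?k}}"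
            then obtain U where U: "W = (!) xs ` U" "U \<subseteq> {..<?k}" "0 \<in> U" "U \<noteq> {..<?k}" by auto
            have "W \<noteq> set xs" using U inj img by (metis inj_on_image_eq_iff order_refl)
            then show "W \<in> {U. U \<subseteq> set xs \<and> xs ! 0 \<in> U \<and> U \<noteq> set xs}" using U img by auto
          next
            fix W assume W: "W \<in> {U. U \<subseteq> set xs \<and> xs ! 0 \<in> U \<and> U \<noteq> set xs}"
            let ?U = "{j. j < ?k \<and> xs ! j \<in> W}"
            have e: "(!) xs ` ?U = W" using W img by auto
            moreover have "?U \<noteq> {..<?k}" using e W img by auto
            moreover have "0 \<in> ?U" using W k by auto
            moreover have "?U \<subseteq> {..<?k}" by auto
            ultimately show "W \<in> (`) ((!) xs) ` {U. U \<subseteq> {..<?k} \<and> 0 \<in> U \<and> U \<noteq> {..<?k}}" by (intro image_eqI[of _ _ ?U]) auto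
          qed
        qed
      qed
      also have "\<dots> = (\<Sum>U | U \<subseteq> set xs \<and> U \<noteq> {} \<and> U \<noteq> set xs. ?f U (set xs - U))"
        by (rule pointed_sum) (use less(2) in auto)
      also have "\<dots> = Sym g (set xs) (sigma x \<odot> sigma y)"
        by (rule Sym_recursion[symmetric]) (use k card less(4) xy sigma_kIrr in auto)
      finally show "sigma (G_hi (map g xs) [x, y]) = Sym g (set xs) (sigma x \<odot> sigma y)" .
    qed
  qed
qed

end

section \<open>Convergence in a complete local ring\<close>

lemma type_algebra_sel [simp]:
  "carrier (ring_of_type_algebra :: 'b::comm_ring_1 ring) = UNIV"
  "monoid.mult (ring_of_type_algebra :: 'b::comm_ring_1 ring) = (*)"
  "monoid.one (ring_of_type_algebra :: 'b::comm_ring_1 ring) = 1"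
  "ring.zero (ring_of_type_algebra :: 'b::comm_ring_1 ring) = 0"
  "ring.add (ring_of_type_algebra :: 'b::comm_ring_1 ring) = (+)"
  by (simp_all add: ring_of_type_algebra_def)

locale adic =
  fixes \<mm> :: "'b::comm_ring_1 set"
  assumes cln: "complete_local_noetherian \<mm>"
begin

definition pw :: "nat \<Rightarrow> 'b set" where "pw n = mpow \<mm> n"

lemma mm_ideal: "ideal \<mm> ring_of_type_algebra"
  using cln by (simp add: complete_local_noetherian_def maximalideal_def)

lemma pw_0 [simp]: "pw 0 = UNIV"
  by (simp add: pw_def nat_pow_def ideals_set_def)

lemma pw_Suc: "pw (Suc n) = ideal_prod ring_of_type_algebra (pw n) \<mm>"
  by (simp add: pw_def nat_pow_def ideals_set_def)

lemma pw_ideal: "ideal (pw n) ring_of_type_algebra"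
proof (induction n)
  case 0
  show ?case using ring.oneideal[OF ring_from_type_algebra] by simp
next
  case (Suc n)
  show ?case unfolding pw_Suc by (rule ring.ideal_prod_is_ideal[OF ring_from_type_algebra Suc mm_ideal])
qed

lemma pw_zero [simp]: "0 \<in> pw n"
  using additive_subgroup.zero_closed[OF ideal.axioms(1)[OF pw_ideal], of n] by simp

lemma pw_add: "x \<in> pw n \<Longrightarrow> y \<in> pw n \<Longrightarrow> x + y \<in> pw n"
  using additive_subgroup.a_closed[OF ideal.axioms(1)[OF pw_ideal], of x n y] by simp

lemma pw_multl: "y \<in> pw n \<Longrightarrow> x * y \<in> pw n"
  using ideal.I_l_closed[OF pw_ideal, of y n x] by simp

lemma pw_multr: "x \<in> pw n \<Longrightarrow> x * y \<in> pw n"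
  using pw_multl[of x n y] by (simp add: mult.commute)

lemma pw_uminus: "x \<in> pw n \<Longrightarrow> - x \<in> pw n"
  using pw_multl[of x n "- 1"] by simp

lemma pw_sum: "(\<And>j. j \<in> J \<Longrightarrow> x j \<in> pw n) \<Longrightarrow> sum x J \<in> pw n"
  by (induction J rule: infinite_finite_induct) (auto intro: pw_add)

lemma pw_Suc_subset: "pw (Suc n) \<subseteq> pw n"
  using ring.ideal_prod_inter[OF ring_from_type_algebra pw_ideal mm_ideal, of n] by (simp add: pw_Suc)

lemma pw_antimono: "m \<le> n \<Longrightarrow> x \<in> pw n \<Longrightarrow> x \<in> pw m"
  using lift_Suc_antimono_le[of pw m n, OF pw_Suc_subset] by blast

lemma pw_Suc_mult: "x \<in> pw n \<Longrightarrow> y \<in> \<mm> \<Longrightarrow> x * y \<in> pw (Suc n)"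
  using ideal_prod.prod[of x "pw n" y \<mm> ring_of_type_algebra] by (simp add: pw_Suc)

definition cong :: "nat \<Rightarrow> 'b \<Rightarrow> 'b \<Rightarrow> bool" where "cong n x y \<longleftrightarrow> x - y \<in> pw n"

lemma cong_refl [simp]: "cong n x x" by (simp add: cong_def)
lemma cong_sym: "cong n x y \<Longrightarrow> cong n y x" using pw_uminus[of "x - y" n] by (simp add: cong_def)
lemma cong_trans [trans]: "cong n x y \<Longrightarrow> cong n y z \<Longrightarrow> cong n x z"
  using pw_add[of "x - y" n "y - z"] by (simp add: cong_def)
lemma cong_add: "cong n x y \<Longrightarrow> cong n x' y' \<Longrightarrow> cong n (x + x') (y + y')"
  using pw_add[of "x - y" n "x' - y'"] by (simp add: cong_def algebra_simps)
lemma cong_mult: assumes "cong n x y" "cong n x' y'" shows "cong n (x * x') (y * y')"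
proof -
  have "x * x' - y * y' = (x - y) * x' + y * (x' - y')" by (simp add: algebra_simps)
  then show ?thesis using assms by (simp add: cong_def pw_add pw_multl pw_multr)
qed
lemma cong_sum: "(\<And>j. j \<in> J \<Longrightarrow> cong n (x j) (y j)) \<Longrightarrow> cong n (sum x J) (sum y J)"
  using pw_sum[of J "\<lambda>j. x j - y j" n] by (simp add: cong_def sum_subtractf)
lemma cong_0: "cong n x 0 \<longleftrightarrow> x \<in> pw n" by (simp add: cong_def)
lemma cong_pw: "cong n x y \<Longrightarrow> y \<in> pw n \<Longrightarrow> x \<in> pw n"
  using pw_add[of "x - y" n y] by (simp add: cong_def)

lemma cong_superset:
  assumes "finite E'" "E \<subseteq> E'" "\<And>j. j \<in> E' - E \<Longrightarrow> x j \<in> pw n"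
  shows "cong n (sum x E') (sum x E)"
proof -
  have "sum x E' - sum x E = sum x (E' - E)" using assms by (simp add: sum_diff)
  then show ?thesis using pw_sum[of "E' - E" x n] assms(3) by (simp add: cong_def)
qed

lemma complete: assumes "\<And>n. x (Suc n) - x n \<in> pw n" shows "\<exists>!y. \<forall>n. y - x n \<in> pw n"
proof -
  have "\<forall>x. (\<forall>n. x (Suc n) - x n \<in> pw n) \<longrightarrow> (\<exists>!y. \<forall>n. y - x n \<in> pw n)"
    using cln unfolding complete_local_noetherian_def pw_def by (elim conjE)
  from mp[OF spec[OF this, of x] allI[OF assms]] show ?thesis .
qed

lemma separated: assumes "\<And>n. cong n x y" shows "x = y"
proof -
  have "\<exists>!u. \<forall>n. u - x \<in> pw n" using complete[of "\<lambda>_. x"] by simp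
  moreover have "\<forall>n. x - x \<in> pw n" "\<forall>n. y - x \<in> pw n" using assms cong_sym by (auto simp: cong_def)
  ultimately show ?thesis by blast
qed

definition null_family :: "('i \<Rightarrow> 'b) \<Rightarrow> 'i set \<Rightarrow> bool" where
  "null_family x J \<longleftrightarrow> (\<forall>n. finite {j \<in> J. x j \<notin> pw n})"

text \<open>Since \<open>pw\<close> consists of additive subgroups, a sum is already controlled modulo \<open>pw n\<close> by one
  finite set of indices off which all terms lie in \<open>pw n\<close>.\<close>
lemma adic_infsum_eq:
  assumes "\<And>n. \<exists>E\<subseteq>J. finite E \<and> (\<forall>j\<in>J - E. x j \<in> pw n) \<and> cong n y (sum x E)"
  shows "adic_infsum \<mm> x J = y"
  unfolding adic_infsum_def pw_def[symmetric]
proof (rule the_equality)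
  show t: "\<forall>n. \<exists>E\<subseteq>J. finite E \<and> (\<forall>E'\<subseteq>J. finite E' \<and> E \<subseteq> E' \<longrightarrow> y - sum x E' \<in> pw n)"
  proof
    fix n
    obtain E where E: "E \<subseteq> J" "finite E" "\<And>j. j \<in> J - E \<Longrightarrow> x j \<in> pw n" "cong n y (sum x E)" using assms by metis
    have "cong n y (sum x E')" if "E' \<subseteq> J" "finite E'" "E \<subseteq> E'" for E'
      using cong_trans[OF E(4) cong_sym[OF cong_superset[of E' E x n]]] that E(3) by blast
    then show "\<exists>E\<subseteq>J. finite E \<and> (\<forall>E'\<subseteq>J. finite E' \<and> E \<subseteq> E' \<longrightarrow> y - sum x E' \<in> pw n)"
      using E(1,2) unfolding cong_def by blast
  qed
  fix z assume z: "\<forall>n. \<exists>E\<subseteq>J. finite E \<and> (\<forall>E'\<subseteq>J. finite E' \<and> E \<subseteq> E' \<longrightarrow> z - sum x E' \<in> pw n)"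
  show "z = y"
  proof (rule separated)
    fix n
    obtain E1 where 1: "E1 \<subseteq> J" "finite E1" "\<And>E'. E' \<subseteq> J \<Longrightarrow> finite E' \<Longrightarrow> E1 \<subseteq> E' \<Longrightarrow> z - sum x E' \<in> pw n"
      using z by meson
    obtain E2 where 2: "E2 \<subseteq> J" "finite E2" "\<And>E'. E' \<subseteq> J \<Longrightarrow> finite E' \<Longrightarrow> E2 \<subseteq> E' \<Longrightarrow> y - sum x E' \<in> pw n"
      using t by meson
    have "cong n z (sum x (E1 \<union> E2))" "cong n y (sum x (E1 \<union> E2))" unfolding cong_def by (rule 1 2; use 1 2 in simp)+
    then show "cong n z y" using cong_sym cong_trans by blast
  qed
qed

text \<open>By completeness the partial sums over the terms outside of \<open>pw n\<close>, for \<open>n = 0, 1, \<dots>\<close>, converge.\<close>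
lemma adic_infsum_cong:
  assumes x: "null_family x J" and E: "E \<subseteq> J" "finite E" "\<And>j. j \<in> J - E \<Longrightarrow> x j \<in> pw n"
  shows "cong n (adic_infsum \<mm> x J) (sum x E)"
proof -
  let ?E = "\<lambda>n. {j \<in> J. x j \<notin> pw n}"
  have fin: "finite (?E n)" for n using x by (simp add: null_family_def)
  have "sum x (?E (Suc n)) - sum x (?E n) \<in> pw n" for n
    by (rule cong_superset[of "?E (Suc n)" "?E n" x n, unfolded cong_def]) (use fin pw_Suc_subset[of n] in auto)
  then have "\<exists>!y. \<forall>n. y - sum x (?E n) \<in> pw n" by (rule complete)
  then obtain y where y: "\<And>n. cong n y (sum x (?E n))" unfolding cong_def by blast
  have "adic_infsum \<mm> x J = y"
  proof (rule adic_infsum_eq)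
    fix n show "\<exists>E\<subseteq>J. finite E \<and> (\<forall>j\<in>J - E. x j \<in> pw n) \<and> cong n y (sum x E)"
      using y[of n] fin[of n] by (intro exI[of _ "?E n"]) auto
  qed
  moreover have "cong n (sum x E) (sum x (?E n))"
    by (rule cong_superset) (use E in auto)
  ultimately show ?thesis using y[of n] cong_sym cong_trans by blast
qed

lemma adic_lim_eq:
  assumes "\<And>n. \<exists>m0. \<forall>m\<ge>m0. cong n y (x m)" shows "adic_lim \<mm> x = y"
  unfolding adic_lim_def pw_def[symmetric]
proof (rule the_equality)
  show "\<forall>n. \<exists>m0. \<forall>m\<ge>m0. y - x m \<in> pw n" using assms by (simp add: cong_def)
  fix z assume z: "\<forall>n. \<exists>m0. \<forall>m\<ge>m0. z - x m \<in> pw n"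
  show "z = y"
  proof (rule separated)
    fix n
    obtain m1 m2 where "\<And>m. m \<ge> m1 \<Longrightarrow> z - x m \<in> pw n" "\<And>m. m \<ge> m2 \<Longrightarrow> y - x m \<in> pw n"
      using z assms by (metis cong_def)
    then have "cong n z (x (max m1 m2))" "cong n y (x (max m1 m2))" by (simp_all add: cong_def)
    then show "cong n z y" using cong_sym cong_trans by blast
  qed
qed

end

section \<open>The completed tensor products\<close>

lemma I_coset: "x \<in> reduction_datum.proj Q I y \<longleftrightarrow> (\<exists>z\<in>I. x = z + y)"
  by (auto simp: reduction_datum.proj_def a_r_coset_def r_coset_def path_algebra_def)

locale complete_coefficients = confluent_system Q I S \<phi> + deformation_datum Q I S \<phi> \<iota> \<mm> + adic \<mm>
  for Q :: "('v, 'e) pre_digraph"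
    and I :: "(('v, 'e) qpath \<Rightarrow>\<^sub>0 'k::field_char_0) set"
    and S :: "('v, 'e) qpath set"
    and \<phi> :: "('v, 'e) qpath \<Rightarrow> (('v, 'e) qpath \<Rightarrow>\<^sub>0 'k)"
    and \<iota> :: "'k \<Rightarrow> 'b::comm_ring_1"
    and \<mm> :: "'b set" +
  assumes iota: "\<iota> \<in> ring_hom ring_of_type_algebra ring_of_type_algebra"
begin

lemma iota_add: "\<iota> (x + y) = \<iota> x + \<iota> y" and iota_mult: "\<iota> (x * y) = \<iota> x * \<iota> y" and iota_1 [simp]: "\<iota> 1 = 1"
  using ring_hom_add[OF iota, of x y] ring_hom_mult[OF iota, of x y] ring_hom_one[OF iota] by simp_all

lemma iota_0 [simp]: "\<iota> 0 = 0" using iota_add[of 0 0] by simp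

lemma iota_sum: "\<iota> (sum g J) = (\<Sum>j\<in>J. \<iota> (g j))"
  by (induction J rule: infinite_finite_induct) (simp_all add: iota_add)

lemma iota_of_nat: "\<iota> (of_nat n) = of_nat n"
  by (induction n) (simp_all add: iota_add)

lemma iota_fact: "\<iota> (1 / fact k) * of_nat (fact k) = 1"
proof -
  have "\<iota> (1 / fact k) * of_nat (fact k) = \<iota> (1 / fact k * of_nat (fact k))" by (simp only: iota_mult iota_of_nat)
  then show ?thesis by simp
qed

lemma emb_add: "emb (x + y) p = emb x p + emb y p" by (simp add: emb_def lookup_add iota_add)
lemma emb_zero [simp]: "emb 0 p = 0" by (simp add: emb_def)
lemma emb_scale: "emb (scale c x) p = \<iota> c * emb x p" by (simp add: emb_def iota_mult)
lemma emb_sum: "emb (sum g J) p = (\<Sum>j\<in>J. emb (g j) p)" by (simp add: emb_def lookup_sum iota_sum)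
lemma emb_nonkey: "p \<notin> supp x \<Longrightarrow> emb x p = 0" by (simp add: emb_def in_keys_iff)

lemma emb_expand:
  assumes "islin g" "finite E" "supp x \<subseteq> E"
  shows "emb (g x) p = (\<Sum>t\<in>E. emb x t * emb (g (bas t)) p)"
proof -
  have "g x = (\<Sum>t\<in>E. scale (Poly_Mapping.lookup x t) (g (bas t)))"
    by (subst islin_expand[OF assms(1)]) (rule lin_superset[OF assms(2,3)])
  then show ?thesis by (simp add: emb_sum emb_scale) (simp add: emb_def)
qed

lemma KQhat_iff: "x \<in> KQhat \<longleftrightarrow> (\<forall>p. p \<notin> QP \<longrightarrow> x p = 0) \<and> (\<forall>n. finite {p. x p \<notin> pw n})"
  by (simp add: KQhat_def pw_def)

lemma nbhd_iff: "x \<in> nbhd n \<longleftrightarrow> x \<in> KQhat \<and> (\<exists>y\<in>IB. \<forall>p. cong n (x p) (y p))"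
  by (simp add: nbhd_def pw_def cong_def)

lemma KQhat_add: assumes "x \<in> KQhat" "y \<in> KQhat" shows "(\<lambda>p. x p + y p) \<in> KQhat"
proof -
  have "{p. x p + y p \<notin> pw n} \<subseteq> {p. x p \<notin> pw n} \<union> {p. y p \<notin> pw n}" for n using pw_add by blast
  moreover have "finite ({p. x p \<notin> pw n} \<union> {p. y p \<notin> pw n})" for n using assms by (simp add: KQhat_iff)
  ultimately have "finite {p. x p + y p \<notin> pw n}" for n by (rule finite_subset)
  then show ?thesis using assms by (simp add: KQhat_iff)
qed

lemma KQhat_smult: assumes "x \<in> KQhat" shows "(\<lambda>p. c * x p) \<in> KQhat"
proof -
  have "{p. c * x p \<notin> pw n} \<subseteq> {p. x p \<notin> pw n}" for n using pw_multl by blast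
  moreover have "finite {p. x p \<notin> pw n}" for n using assms by (simp add: KQhat_iff)
  ultimately have "finite {p. c * x p \<notin> pw n}" for n by (rule finite_subset)
  then show ?thesis using assms by (simp add: KQhat_iff)
qed

lemma KQhat_zero: "(\<lambda>p. 0) \<in> KQhat" by (simp add: KQhat_iff)

lemma KQhat_diff: "x \<in> KQhat \<Longrightarrow> y \<in> KQhat \<Longrightarrow> (\<lambda>p. x p - y p) \<in> KQhat"
  using KQhat_add[OF _ KQhat_smult[of y "- 1"], of x] by simp

lemma KQhat_sum: "(\<And>j. j \<in> J \<Longrightarrow> x j \<in> KQhat) \<Longrightarrow> (\<lambda>p. \<Sum>j\<in>J. x j p) \<in> KQhat"
  by (induction J rule: infinite_finite_induct) (simp_all add: KQhat_zero KQhat_add)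

lemma KQhat_emb: assumes "x \<in> CQ" shows "emb x \<in> KQhat"
proof -
  have "{p. emb x p \<notin> pw n} \<subseteq> supp x" for n using emb_nonkey by fastforce
  moreover have "emb x p = 0" if "p \<notin> QP" for p using that assms emb_nonkey unfolding CQ_iff by blast
  moreover from calculation(1) have "finite {p. emb x p \<notin> pw n}" for n by (rule finite_subset) simp
  ultimately show ?thesis by (simp add: KQhat_iff)
qed

lemma IB_I: "\<forall>i<(m::nat). u i \<in> I \<Longrightarrow> (\<lambda>p. \<Sum>i<m. c i * emb (u i) p) \<in> IB"
  unfolding IB_def by (intro CollectI exI[of _ m] exI[of _ c] exI[of _ u] conjI refl)

lemma IB_add: assumes "x \<in> IB" "y \<in> IB" shows "(\<lambda>p. x p + y p) \<in> IB"
proof -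
  obtain m c u where x: "\<And>i. i < m \<Longrightarrow> u i \<in> I" "x = (\<lambda>p. \<Sum>i<(m::nat). c i * emb (u i) p)"
    using assms(1) unfolding IB_def by blast
  obtain n d v where y: "\<And>i. i < n \<Longrightarrow> v i \<in> I" "y = (\<lambda>p. \<Sum>i<(n::nat). d i * emb (v i) p)"
    using assms(2) unfolding IB_def by blast
  let ?e = "\<lambda>i. if i < m then c i else d (i - m)" and ?w = "\<lambda>i. if i < m then u i else v (i - m)"
  have "(\<lambda>p. x p + y p) = (\<lambda>p. \<Sum>i<m + n. ?e i * emb (?w i) p)"
  proof
    fix p
    have "(\<Sum>i<m + n. ?e i * emb (?w i) p) = (\<Sum>i<m. ?e i * emb (?w i) p) + (\<Sum>i\<in>{m..<m + n}. ?e i * emb (?w i) p)"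
      using sum.atLeastLessThan_concat[of 0 m "m + n" "\<lambda>i. ?e i * emb (?w i) p"] by (simp only: atLeast0LessThan le_add1 zero_le)
    also have "(\<Sum>i\<in>{m..<m + n}. ?e i * emb (?w i) p) = (\<Sum>i<n. d i * emb (v i) p)"
      by (rule sum.reindex_bij_witness[of _ "\<lambda>i. i + m" "\<lambda>i. i - m"]) auto
    finally show "x p + y p = (\<Sum>i<m + n. ?e i * emb (?w i) p)" by (simp add: x y)
  qed
  moreover have "\<forall>i<m + n. ?w i \<in> I" using x(1) y(1) by auto
  ultimately show ?thesis using IB_I[of "m + n" ?w ?e] by simp
qed

lemma IB_emb: "x \<in> I \<Longrightarrow> (\<lambda>p. c * emb x p) \<in> IB"
  unfolding IB_def by (intro CollectI exI[of _ "Suc 0"] exI[of _ "\<lambda>_. c"] exI[of _ "\<lambda>_. x"]) simp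

lemma IB_smult: assumes "x \<in> IB" shows "(\<lambda>p. c * x p) \<in> IB"
proof -
  obtain m d u where x: "\<forall>i<m. u i \<in> I" "x = (\<lambda>p. \<Sum>i<(m::nat). d i * emb (u i) p)"
    using assms unfolding IB_def by blast
  have "(\<lambda>p. c * x p) = (\<lambda>p. \<Sum>i<m. (c * d i) * emb (u i) p)" by (simp add: x sum_distrib_left mult.assoc)
  then show ?thesis using IB_I[OF x(1), of "\<lambda>i. c * d i"] by simp
qed

lemma nbhd_small: assumes "x \<in> KQhat" "\<And>p. x p \<in> pw n" shows "x \<in> nbhd n"
  using assms IB_emb[OF I_zero, of 0] unfolding nbhd_iff by (intro conjI bexI[of _ "\<lambda>p. 0"]) (simp_all add: cong_0)

lemma nbhd_add: assumes "x \<in> nbhd n" "y \<in> nbhd n" shows "(\<lambda>p. x p + y p) \<in> nbhd n"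
proof -
  obtain u v where u: "u \<in> IB" "\<And>p. cong n (x p) (u p)" and v: "v \<in> IB" "\<And>p. cong n (y p) (v p)"
    using assms unfolding nbhd_iff by blast
  have "cong n (x p + y p) (u p + v p)" for p by (rule cong_add[OF u(2) v(2)])
  then show ?thesis using assms unfolding nbhd_iff by (intro conjI bexI[OF _ IB_add[OF u(1) v(1)]] allI KQhat_add) simp_all
qed

lemma nbhd_smult: assumes "x \<in> nbhd n" shows "(\<lambda>p. c * x p) \<in> nbhd n"
proof -
  obtain u where u: "u \<in> IB" "\<And>p. cong n (x p) (u p)" using assms unfolding nbhd_iff by blast
  have "cong n (c * x p) (c * u p)" for p by (rule cong_mult[OF cong_refl u(2)])
  then show ?thesis using assms unfolding nbhd_iff by (intro conjI bexI[OF _ IB_smult[OF u(1)]] allI KQhat_smult) simp_all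
qed

lemma nbhd_diff: "x \<in> nbhd n \<Longrightarrow> y \<in> nbhd n \<Longrightarrow> (\<lambda>p. x p - y p) \<in> nbhd n"
  using nbhd_add[OF _ nbhd_smult[of y n "- 1"], of x] by simp

lemma nbhd_zero: "(\<lambda>p. 0) \<in> nbhd n" by (rule nbhd_small[OF KQhat_zero]) simp

lemma nbhd_sum: "(\<And>j. j \<in> J \<Longrightarrow> x j \<in> nbhd n) \<Longrightarrow> (\<lambda>p. \<Sum>j\<in>J. x j p) \<in> nbhd n"
  by (induction J rule: infinite_finite_induct) (simp_all add: nbhd_zero nbhd_add)

lemma nbhd_emb: "x \<in> I \<Longrightarrow> (\<lambda>p. c * emb x p) \<in> nbhd n"
  using IB_emb[of x c] KQhat_smult[OF KQhat_emb[OF I_CQ]] unfolding nbhd_iff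
  by (intro conjI bexI[of _ "\<lambda>p. c * emb x p"]) simp_all

lemma projhat_eqI:
  assumes "\<And>n. (\<lambda>p. x p - y p) \<in> nbhd n" shows "projhat x = projhat y"
proof -
  have "(\<lambda>p. z p - x p) \<in> nbhd n \<longleftrightarrow> (\<lambda>p. z p - y p) \<in> nbhd n" for z n
    using nbhd_add[of "\<lambda>p. z p - x p" n "\<lambda>p. x p - y p"] nbhd_diff[of "\<lambda>p. z p - y p" n "\<lambda>p. x p - y p"] assms[of n] by auto
  then show ?thesis unfolding projhat_def by simp
qed

lemma projhat_self: "x \<in> KQhat \<Longrightarrow> x \<in> projhat x" by (simp add: projhat_def nbhd_zero)

lemma projhat_D: "y \<in> projhat x \<Longrightarrow> (\<lambda>p. y p - x p) \<in> nbhd n" by (simp add: projhat_def)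

lemma Ahat_add_projhat: assumes "x \<in> KQhat" "y \<in> KQhat"
  shows "Ahat_add (projhat x) (projhat y) = projhat (\<lambda>p. x p + y p)"
proof -
  have "projhat (\<lambda>p. u p + v p) = projhat (\<lambda>p. x p + y p)" if "u \<in> projhat x" "v \<in> projhat y" for u v
  proof (rule projhat_eqI)
    fix n show "(\<lambda>p. u p + v p - (x p + y p)) \<in> nbhd n"
      using nbhd_add[OF projhat_D[OF that(1), of n] projhat_D[OF that(2), of n]] by (simp add: algebra_simps)
  qed
  then show ?thesis unfolding Ahat_add_def using projhat_self[OF assms(1)] projhat_self[OF assms(2)] by blast
qed

lemma Ahat_smult_projhat: assumes "x \<in> KQhat" shows "Ahat_smult c (projhat x) = projhat (\<lambda>p. c * x p)"
proof -
  have "projhat (\<lambda>p. c * u p) = projhat (\<lambda>p. c * x p)" if "u \<in> projhat x" for u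
  proof (rule projhat_eqI)
    fix n show "(\<lambda>p. c * u p - c * x p) \<in> nbhd n"
      using nbhd_smult[OF projhat_D[OF that, of n], of c] by (simp add: algebra_simps)
  qed
  then show ?thesis unfolding Ahat_smult_def using projhat_self[OF assms] by blast
qed

text \<open>Representatives of an element of \<open>A\<close> differ by elements of \<open>I\<close>, so \<open>\<sigma>(a)\<close> can be used.\<close>
lemma tens_projhat: assumes "a \<in> carrier A" shows "tens a c = projhat (\<lambda>p. c * emb (sigma a) p)"
proof -
  have a: "a = proj (sigma a)" using assms by simp
  have "projhat (\<lambda>p. c * emb x p) = projhat (\<lambda>p. c * emb (sigma a) p)" if x: "x \<in> a" for x
  proof (rule projhat_eqI)
    fix n
    obtain z where z: "z \<in> I" "x = z + sigma a" using x a I_coset[of x Q I "sigma a"] by auto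
    show "(\<lambda>p. c * emb x p - c * emb (sigma a) p) \<in> nbhd n"
      using nbhd_emb[OF z(1), of c n] by (simp add: z(2) emb_add algebra_simps)
  qed
  moreover have "sigma a \<in> a" using a I_coset[of "sigma a" Q I "sigma a"] I_zero by (metis add_0)
  ultimately show ?thesis unfolding tens_def by blast
qed

lemma Ahat_infsum_eq:
  assumes w: "w \<in> KQhat" and Z: "\<And>j. j \<in> J \<Longrightarrow> Z j = projhat (z j) \<and> z j \<in> KQhat"
    and tail: "\<And>n. \<exists>E\<subseteq>J. finite E \<and> (\<forall>E'\<subseteq>J. finite E' \<and> E \<subseteq> E' \<longrightarrow> (\<lambda>p. w p - (\<Sum>j\<in>E'. z j p)) \<in> nbhd n)"
  shows "Ahat_infsum Z J = projhat w"
  unfolding Ahat_infsum_def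
proof (rule the_equality)
  define T where "T Y n E' \<longleftrightarrow> (\<forall>y\<in>Y. \<forall>x. (\<forall>j\<in>E'. x j \<in> Z j) \<longrightarrow> (\<lambda>p. y p - (\<Sum>j\<in>E'. x j p)) \<in> nbhd n)" for Y n E'
  have 1: "T (projhat w) n E'" if "E' \<subseteq> J" and d: "(\<lambda>p. w p - (\<Sum>j\<in>E'. z j p)) \<in> nbhd n" for n E'
    unfolding T_def
  proof (intro ballI allI impI)
    fix y x assume y: "y \<in> projhat w" and x: "\<forall>j\<in>E'. x j \<in> Z j"
    have "(\<lambda>p. \<Sum>j\<in>E'. x j p - z j p) \<in> nbhd n"
      by (rule nbhd_sum) (use x Z that(1) in \<open>blast intro: projhat_D\<close>)
    from nbhd_diff[OF nbhd_add[OF projhat_D[OF y] d] this]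
    show "(\<lambda>p. y p - (\<Sum>j\<in>E'. x j p)) \<in> nbhd n" by (simp add: sum_subtractf algebra_simps)
  qed
  have 2: "\<exists>E\<subseteq>J. finite E \<and> (\<forall>E'\<subseteq>J. finite E' \<and> E \<subseteq> E' \<longrightarrow> T (projhat w) n E')" for n
    using tail[of n] 1 by meson
  then show "projhat w \<in> Ahat \<and> (\<forall>n. \<exists>E\<subseteq>J. finite E \<and> (\<forall>E'\<subseteq>J. finite E' \<and> E \<subseteq> E' \<longrightarrow>
      (\<forall>y\<in>projhat w. \<forall>x. (\<forall>j\<in>E'. x j \<in> Z j) \<longrightarrow> (\<lambda>p. y p - (\<Sum>j\<in>E'. x j p)) \<in> nbhd n)))"
    unfolding T_def Ahat_def by (intro conjI imageI w allI)
  fix Y assume "Y \<in> Ahat \<and> (\<forall>n. \<exists>E\<subseteq>J. finite E \<and> (\<forall>E'\<subseteq>J. finite E' \<and> E \<subseteq> E' \<longrightarrow>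
      (\<forall>y\<in>Y. \<forall>x. (\<forall>j\<in>E'. x j \<in> Z j) \<longrightarrow> (\<lambda>p. y p - (\<Sum>j\<in>E'. x j p)) \<in> nbhd n)))"
  note YY = this
  have YA: "Y \<in> Ahat" by (rule conjunct1[OF YY])
  have Y: "\<exists>E\<subseteq>J. finite E \<and> (\<forall>E'\<subseteq>J. finite E' \<and> E \<subseteq> E' \<longrightarrow> T Y n E')" for n
    unfolding T_def by (rule spec[OF conjunct2[OF YY]])
  obtain v where v: "v \<in> KQhat" "Y = projhat v" using YA unfolding Ahat_def by blast
  show "Y = projhat w" unfolding v(2)
  proof (rule projhat_eqI)
    fix n
    obtain E1 where E1: "E1 \<subseteq> J" "finite E1" "\<And>E'. E' \<subseteq> J \<Longrightarrow> finite E' \<Longrightarrow> E1 \<subseteq> E' \<Longrightarrow> T Y n E'" using Y[of n] by meson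
    obtain E2 where E2: "E2 \<subseteq> J" "finite E2" "\<And>E'. E' \<subseteq> J \<Longrightarrow> finite E' \<Longrightarrow> E2 \<subseteq> E' \<Longrightarrow> T (projhat w) n E'" using 2[of n] by meson
    let ?E = "E1 \<union> E2"
    have zz: "\<forall>j\<in>?E. z j \<in> Z j" using Z projhat_self E1(1) E2(1) by blast
    have "(\<lambda>p. v p - (\<Sum>j\<in>?E. z j p)) \<in> nbhd n"
      using E1(3)[of ?E] E1(1,2) E2(1,2) zz projhat_self[OF v(1)] v(2) unfolding T_def by simp
    moreover have "(\<lambda>p. w p - (\<Sum>j\<in>?E. z j p)) \<in> nbhd n"
      using E2(3)[of ?E] E1(1,2) E2(1,2) zz projhat_self[OF w] unfolding T_def by simp
    ultimately have "(\<lambda>p. (v p - (\<Sum>j\<in>?E. z j p)) - (w p - (\<Sum>j\<in>?E. z j p))) \<in> nbhd n" by (rule nbhd_diff)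
    then show "(\<lambda>p. v p - w p) \<in> nbhd n" by simp
  qed
qed

end

section \<open>The combinatorial star product as an adic sum\<close>

lemma permuted_lists_bij:
  assumes l: "l \<in> permutations_of_set {..<k}" and B: "finite B"
  shows "bij_betw (\<lambda>js. map ((!) js) l) {js. length js = k \<and> set js \<subseteq> B} {js. length js = k \<and> set js \<subseteq> B}"
proof -
  let ?E = "{js. length js = k \<and> set js \<subseteq> B}"
  have sl: "set l = {..<k}" "distinct l" using l by (auto dest: permutations_of_setD)
  have ll: "length l = k" using distinct_card[OF sl(2)] sl(1) by simp
  have fin: "finite ?E" using finite_lists_length_eq[OF B, of k] by (simp add: conj_commute)
  have inj: "inj_on (\<lambda>js. map ((!) js) l) ?E"
  proof (rule inj_onI)
    fix js js' assume o: "js \<in> ?E" "js' \<in> ?E" "map ((!) js) l = map ((!) js') l"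
    then have "\<forall>i<k. js ! i = js' ! i" using sl(1) by auto
    then show "js = js'" using o by (auto intro: nth_equalityI)
  qed
  have sub: "(\<lambda>js. map ((!) js) l) ` ?E \<subseteq> ?E"
  proof
    fix ys assume "ys \<in> (\<lambda>js. map ((!) js) l) ` ?E"
    then obtain js where js: "ys = map ((!) js) l" "length js = k" "set js \<subseteq> B" by blast
    have "set ys = (!) js ` {..<k}" by (simp add: js(1) sl(1))
    then have "set ys \<subseteq> set js" using js(2) by auto
    then show "ys \<in> ?E" using js ll by auto
  qed
  show ?thesis unfolding bij_betw_def using inj endo_inj_surj[OF fin sub inj] by blast
qed

lemma mset_permuted_list:
  assumes "l \<in> permutations_of_set {..<length js}" shows "mset (map ((!) js) l) = mset js"
proof -
  have sl: "set l = {..<length js}" "distinct l" using assms by (auto dest: permutations_of_setD)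
  have "mset l = mset [0..<length js]" using sl by (intro set_eq_iff_mset_eq_distinct[THEN iffD1]) (auto simp: atLeast0LessThan)
  then have "mset (map ((!) js) l) = mset (map ((!) js) [0..<length js])" by simp
  then show ?thesis by (simp add: map_nth)
qed

context confluent_system begin

lemma polred_iter_CQ: "adms fs \<Longrightarrow> x \<in> CQ \<Longrightarrow> polred_iter n fs x \<in> CQ"
proof (induction n arbitrary: fs x)
  case 0
  then show ?case by (simp add: CQ_zero)
next
  case (Suc n)
  show ?case
  proof (cases fs)
    case (Cons f fs')
    have "polred_iter n fs (r0 x) \<in> CQ" by (rule Suc.IH[OF Suc.prems(1) r0_CQ[OF Suc.prems(2)]])
    moreover have "polred_iter n fs' (r1 f x) \<in> CQ" using Suc.prems Cons by (intro Suc.IH r1_CQ) auto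
    ultimately show ?thesis using Cons by (simp add: CQ_add)
  qed (use Suc in \<open>simp add: r0_CQ\<close>)
qed

end

locale formal_deformation = complete_coefficients Q I S \<phi> \<iota> \<mm>
  for Q :: "('v, 'e) pre_digraph"
    and I :: "(('v, 'e) qpath \<Rightarrow>\<^sub>0 'k::field_char_0) set"
    and S :: "('v, 'e) qpath set"
    and \<phi> :: "('v, 'e) qpath \<Rightarrow> (('v, 'e) qpath \<Rightarrow>\<^sub>0 'k)"
    and \<iota> :: "'k \<Rightarrow> 'b::comm_ring_1"
    and \<mm> :: "'b set" +
  fixes \<psi> :: "(nat \<Rightarrow> ('v, 'e) qpath \<Rightarrow> ('v, 'e, 'k) alg) \<times> (nat \<Rightarrow> 'b)"
  assumes psi: "\<psi> \<in> completed_HomSA"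
begin

definition summand :: "nat \<Rightarrow> ('v, 'e) qpath \<Rightarrow> ('v, 'e, 'k) pa" where "summand j = (\<lambda>s. sigma (fst \<psi> j s))"
definition coeff_prod :: "nat list \<Rightarrow> 'b" where "coeff_prod js = prod_list (map (snd \<psi>) js)"

lemma psi_HomSA: "fst \<psi> j \<in> HomSA" and psi_mm: "snd \<psi> j \<in> \<mm>"
  and psi_null: "\<exists>j0. \<forall>j\<ge>j0. snd \<psi> j \<in> pw n"
  using psi by (auto simp: completed_HomSA_def pw_def)

lemma adm_summand: "adm (summand j)" unfolding summand_def by (rule HomSA_adm[OF psi_HomSA])
lemma adms_summand: "adms (map summand js)" using adm_summand by auto

definition cutoff :: "nat \<Rightarrow> nat" where "cutoff n = (SOME j0. \<forall>j\<ge>j0. snd \<psi> j \<in> pw n)"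

lemma cutoff: "j \<ge> cutoff n \<Longrightarrow> snd \<psi> j \<in> pw n"
  using someI_ex[OF psi_null[of n]] by (simp add: cutoff_def)

text \<open>The index lists of length \<open>k\<close> whose terms matter modulo \<open>pw n\<close>.\<close>
definition idxs :: "nat \<Rightarrow> nat \<Rightarrow> nat list set" where
  "idxs k n = {js. length js = k \<and> set js \<subseteq> {..<cutoff n}}"

lemma idxs_finite: "finite (idxs k n)"
  using finite_lists_length_eq[of "{..<cutoff n}" k] by (simp add: idxs_def conj_commute)

lemma idxs_length: "js \<in> idxs k n \<Longrightarrow> length js = k" by (simp add: idxs_def)

lemma coeff_prod_small: assumes "j \<in> set js" "snd \<psi> j \<in> pw n" shows "coeff_prod js \<in> pw n"
  using assms(1) by (induction js) (auto simp: coeff_prod_def pw_multl pw_multr assms(2))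

lemma coeff_prod_off: assumes "length js = k" "js \<notin> idxs k n" shows "coeff_prod js \<in> pw n"
proof -
  obtain j where "j \<in> set js" "\<not> j < cutoff n" using assms by (auto simp: idxs_def)
  then show ?thesis using coeff_prod_small cutoff by simp
qed

lemma coeff_prod_length: "coeff_prod js \<in> pw (length js)"
proof (induction js)
  case (Cons j js)
  then show ?case using pw_Suc_mult[OF Cons psi_mm[of j]] by (simp add: coeff_prod_def mult.commute)
qed (simp add: coeff_prod_def)

definition Wsum :: "nat \<Rightarrow> (nat list \<Rightarrow> ('v, 'e, 'k) pa) \<Rightarrow> ('v, 'e) qpath \<Rightarrow> 'b" where
  "Wsum k x p = adic_infsum \<mm> (\<lambda>js. coeff_prod js * emb (x js) p) {js. length js = k}"

lemma Wsum_null: "null_family (\<lambda>js. coeff_prod js * emb (x js) p) {js. length js = k}"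
proof -
  have "{js \<in> {js. length js = k}. coeff_prod js * emb (x js) p \<notin> pw n} \<subseteq> idxs k n" for n
    using coeff_prod_off pw_multr by blast
  from finite_subset[OF this idxs_finite] show ?thesis unfolding null_family_def by blast
qed

lemma Wsum_cong: "cong n (Wsum k x p) (\<Sum>js\<in>idxs k n. coeff_prod js * emb (x js) p)"
  unfolding Wsum_def
proof (rule adic_infsum_cong[OF Wsum_null _ idxs_finite])
  show "idxs k n \<subseteq> {js. length js = k}" by (auto simp: idxs_def)
  show "coeff_prod j * emb (x j) p \<in> pw n" if "j \<in> {js. length js = k} - idxs k n" for j
    using that coeff_prod_off[of j k n] pw_multr by simp
qed

lemma Wsum_pw: "Wsum k x p \<in> pw k"
proof (rule cong_pw[OF Wsum_cong], rule pw_sum)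
  fix js assume "js \<in> idxs k k"
  then have "coeff_prod js \<in> pw k" using coeff_prod_length[of js] by (simp add: idxs_length)
  then show "coeff_prod js * emb (x js) p \<in> pw k" by (rule pw_multr)
qed

lemma Wsum_0: "Wsum 0 x p = emb (x []) p"
proof -
  have e: "idxs 0 n = {[]}" for n by (auto simp: idxs_def)
  show ?thesis by (rule separated) (use Wsum_cong[of _ 0 x p] in \<open>simp add: e coeff_prod_def\<close>)
qed

lemma Wsum_zero: assumes "\<And>js. length js = k \<Longrightarrow> x js = 0" shows "Wsum k x p = 0"
proof (rule separated)
  fix n
  have "(\<Sum>js\<in>idxs k n. coeff_prod js * emb (x js) p) = 0"
    by (rule sum.neutral) (use assms idxs_length in simp)
  then show "cong n (Wsum k x p) 0" using Wsum_cong[of n k x p] by simp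
qed

lemma Wsum_off: assumes "p \<notin> (\<Union>js\<in>idxs k n. supp (x js))" shows "Wsum k x p \<in> pw n"
proof -
  have "(\<Sum>js\<in>idxs k n. coeff_prod js * emb (x js) p) = 0"
    by (rule sum.neutral) (use assms emb_nonkey in auto)
  then show ?thesis using Wsum_cong[of n k x p] by (simp add: cong_0)
qed

lemma Wsum_KQhat: assumes "\<And>js. x js \<in> CQ" shows "Wsum k x \<in> KQhat"
proof -
  have "{p. Wsum k x p \<notin> pw n} \<subseteq> (\<Union>js\<in>idxs k n. supp (x js))" for n using Wsum_off by blast
  moreover have "finite (\<Union>js\<in>idxs k n. supp (x js))" for n using idxs_finite by simp
  ultimately have "finite {p. Wsum k x p \<notin> pw n}" for n by (rule finite_subset)
  moreover have "Wsum k x p = 0" if "p \<notin> QP" for p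
  proof (rule separated)
    fix n
    have "p \<notin> (\<Union>js\<in>idxs k n. supp (x js))" using assms that unfolding CQ_iff by blast
    then show "cong n (Wsum k x p) 0" by (simp add: cong_0 Wsum_off)
  qed
  ultimately show ?thesis by (simp add: KQhat_iff)
qed

lemma finite_middle:
  "finite {u. u \<in> QP \<and> tgt q = src u \<and> tgt u = src r \<and> p = pcomp (pcomp q u) r}"
proof (rule finite_subset)
  let ?u = "(tgt q, take (plen p - plen q - plen r) (drop (plen q) (arrows p)), src r)"
  show "{u. u \<in> QP \<and> tgt q = src u \<and> tgt u = src r \<and> p = pcomp (pcomp q u) r} \<subseteq> {?u}"
  proof
    fix u assume u: "u \<in> {u. u \<in> QP \<and> tgt q = src u \<and> tgt u = src r \<and> p = pcomp (pcomp q u) r}"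
    have "u = ?u" by (rule path_eqI) (use u in \<open>simp_all add: src_def tgt_def arrows_def pcomp_def\<close>)
    then show "u \<in> {?u}" by simp
  qed
qed simp

lemma sandwich_emb: assumes "y \<in> CQ" shows "sandwich q (emb y) r p = emb (bas q \<odot> y \<odot> bas r) p"
proof -
  let ?U = "{u. u \<in> QP \<and> tgt q = src u \<and> tgt u = src r \<and> p = pcomp (pcomp q u) r}"
  have i: "islin (\<lambda>y. bas q \<odot> y \<odot> bas r)" by (rule islin_compose[OF pa_mult_islin1 pa_mult_islin2])
  have b: "emb (bas q \<odot> bas u \<odot> bas r) p = (if tgt q = src u \<and> tgt u = src r \<and> p = pcomp (pcomp q u) r then 1 else 0)" for u
    by (auto simp: pa_mult_bas emb_def lookup_single when_def)
  have "emb (bas q \<odot> y \<odot> bas r) p = (\<Sum>u\<in>supp y. emb y u * emb (bas q \<odot> bas u \<odot> bas r) p)"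
    using emb_expand[OF i finite_keys order_refl] .
  also have "\<dots> = (\<Sum>u\<in>supp y \<inter> ?U. emb y u)"
  proof (rule sum.mono_neutral_cong_right[OF finite_keys])
    show "\<forall>u\<in>supp y - supp y \<inter> ?U. emb y u * emb (bas q \<odot> bas u \<odot> bas r) p = 0"
    proof
      fix u assume "u \<in> supp y - supp y \<inter> ?U"
      then have nu: "\<not> (tgt q = src u \<and> tgt u = src r \<and> p = pcomp (pcomp q u) r)" using assms unfolding CQ_iff by blast
      then show "emb y u * emb (bas q \<odot> bas u \<odot> bas r) p = 0" unfolding b if_not_P[OF nu] by simp
    qed
    show "emb y u * emb (bas q \<odot> bas u \<odot> bas r) p = emb y u" if "u \<in> supp y \<inter> ?U" for u
      using that unfolding b by simp
  qed blast
  also have "\<dots> = (\<Sum>u\<in>?U. emb y u)"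
  proof (rule sum.mono_neutral_left[OF finite_middle])
    show "\<forall>u\<in>?U - supp y \<inter> ?U. emb y u = 0" using emb_nonkey by blast
  qed blast
  finally show ?thesis by (simp add: sandwich_def)
qed

lemma phi_tilde_cong: "cong n (phi_tilde \<psi> s u) (\<Sum>j<cutoff n. snd \<psi> j * emb (summand j s) u)"
proof -
  let ?x = "\<lambda>j. snd \<psi> j * emb (summand j s) u"
  have "{j \<in> UNIV. ?x j \<notin> pw m} \<subseteq> {..<cutoff m}" for m using cutoff[of m] pw_multr by (auto simp: not_le[symmetric])
  then have "null_family ?x UNIV" unfolding null_family_def using finite_subset by blast
  from adic_infsum_cong[OF this, of "{..<cutoff n}" n] show ?thesis
    using cutoff pw_multr by (simp add: phi_tilde_def summand_def)
qed

lemma red0_emb: assumes "p \<in> QP" shows "red0 p p' = emb (r0 (bas p)) p'"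
proof (cases "p \<in> Irr")
  case False
  obtain q s r where t: "(q, s, r) \<in> rightmost S p" using rightmost_ex[OF assms False] by metis
  have "the_elem (rightmost S p) = (q, s, r)" using rm_eq[OF t] by (simp add: rm_def)
  then show ?thesis using False sandwich_emb[OF phi_CQ[OF rightmostD(2)[OF t]]] by (simp add: red0_def r0_rightmost[OF t])
qed (simp add: red0_def r0_Irr)

lemma red1_cong: assumes "p \<in> QP" shows "cong n (red1 \<psi> p p') (\<Sum>j<cutoff n. snd \<psi> j * emb (r1 (summand j) (bas p)) p')"
proof (cases "p \<in> Irr")
  case False
  obtain q s r where t: "(q, s, r) \<in> rightmost S p" using rightmost_ex[OF assms False] by metis
  let ?U = "{u. u \<in> QP \<and> tgt q = src u \<and> tgt u = src r \<and> p' = pcomp (pcomp q u) r}"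
  have "the_elem (rightmost S p) = (q, s, r)" using rm_eq[OF t] by (simp add: rm_def)
  then have e1: "red1 \<psi> p p' = (\<Sum>u\<in>?U. phi_tilde \<psi> s u)" using False by (simp add: red1_def sandwich_def)
  have c: "cong n (\<Sum>u\<in>?U. phi_tilde \<psi> s u) (\<Sum>u\<in>?U. \<Sum>j<cutoff n. snd \<psi> j * emb (summand j s) u)" by (rule cong_sum[OF phi_tilde_cong])
  have "(\<Sum>u\<in>?U. \<Sum>j<cutoff n. snd \<psi> j * emb (summand j s) u) = (\<Sum>j<cutoff n. snd \<psi> j * sandwich q (emb (summand j s)) r p')"
    unfolding sandwich_def sum_distrib_left by (rule sum.swap)
  also have "\<dots> = (\<Sum>j<cutoff n. snd \<psi> j * emb (r1 (summand j) (bas p)) p')"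
    by (simp add: sandwich_emb[OF adm_CQ[OF adm_summand rightmostD(2)[OF t]]] r1_rightmost[OF t])
  finally have e2: "(\<Sum>u\<in>?U. \<Sum>j<cutoff n. snd \<psi> j * emb (summand j s) u) = (\<Sum>j<cutoff n. snd \<psi> j * emb (r1 (summand j) (bas p)) p')" .
  show ?thesis using c unfolding e1 e2 .
qed (simp add: red1_def r1_Irr)

lemma idxs_Suc: "bij_betw (\<lambda>(js, j). js @ [j]) (idxs k n \<times> {..<cutoff n}) (idxs (Suc k) n)"
proof (rule bij_betw_byWitness[where f' = "\<lambda>js. (butlast js, last js)"])
  show "(\<lambda>js. (butlast js, last js)) ` idxs (Suc k) n \<subseteq> idxs k n \<times> {..<cutoff n}"
  proof
    fix t assume "t \<in> (\<lambda>js. (butlast js, last js)) ` idxs (Suc k) n"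
    then obtain js where t: "t = (butlast js, last js)" "length js = Suc k" "set js \<subseteq> {..<cutoff n}" by (auto simp: idxs_def)
    then have "js \<noteq> []" by auto
    then have "last js \<in> set js" "set (butlast js) \<subseteq> set js" by (auto dest: in_set_butlastD)
    then show "t \<in> idxs k n \<times> {..<cutoff n}" using t by (auto simp: idxs_def)
  qed
  show "\<forall>a\<in>idxs (Suc k) n. (\<lambda>(js, j). js @ [j]) (butlast a, last a) = a" by (auto simp: idxs_def intro: append_butlast_last_id)
qed (auto simp: idxs_def)

text \<open>Modulo \<open>\<mm>\<^sup>n\<close> only finitely many index lists and paths matter, so a map given by its values on
  paths can be applied term by term.\<close>
lemma Wsum_apply:
  assumes CQ: "\<And>js. x js \<in> CQ" and E: "finite E" "(\<Union>js\<in>idxs k n. supp (x js)) \<subseteq> E"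
    and g: "\<And>j. islin (g j)" and c: "\<And>p. p \<in> E \<Longrightarrow> cong n (c p) (\<Sum>j\<in>L. t j * emb (g j (bas p)) p')"
  shows "cong n (\<Sum>p\<in>E. Wsum k x p * c p) (\<Sum>js\<in>idxs k n. \<Sum>j\<in>L. coeff_prod js * t j * emb (g j (x js)) p')"
proof -
  have c1: "cong n (\<Sum>p\<in>E. Wsum k x p * c p) (\<Sum>p\<in>E. (\<Sum>js\<in>idxs k n. coeff_prod js * emb (x js) p) * (\<Sum>j\<in>L. t j * emb (g j (bas p)) p'))"
    by (intro cong_sum cong_mult Wsum_cong c)
  have "(\<Sum>p\<in>E. (\<Sum>js\<in>idxs k n. coeff_prod js * emb (x js) p) * (\<Sum>j\<in>L. t j * emb (g j (bas p)) p'))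
      = (\<Sum>p\<in>E. \<Sum>js\<in>idxs k n. \<Sum>j\<in>L. coeff_prod js * t j * (emb (x js) p * emb (g j (bas p)) p'))"
    unfolding sum_product by (intro sum.cong refl) (simp only: mult_ac)
  also have "\<dots> = (\<Sum>js\<in>idxs k n. \<Sum>p\<in>E. \<Sum>j\<in>L. coeff_prod js * t j * (emb (x js) p * emb (g j (bas p)) p'))"
    by (rule sum.swap)
  also have "\<dots> = (\<Sum>js\<in>idxs k n. \<Sum>j\<in>L. \<Sum>p\<in>E. coeff_prod js * t j * (emb (x js) p * emb (g j (bas p)) p'))"
    by (intro sum.cong refl sum.swap)
  also have "\<dots> = (\<Sum>js\<in>idxs k n. \<Sum>j\<in>L. coeff_prod js * t j * emb (g j (x js)) p')"
  proof (intro sum.cong refl)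
    fix js j assume "js \<in> idxs k n"
    then have "supp (x js) \<subseteq> E" using E(2) by blast
    from emb_expand[OF g E(1) this, of j p']
    show "(\<Sum>p\<in>E. coeff_prod js * t j * (emb (x js) p * emb (g j (bas p)) p')) = coeff_prod js * t j * emb (g j (x js)) p'"
      by (simp add: sum_distrib_left)
  qed
  finally show ?thesis using c1 by (simp only:)
qed

text \<open>In one reduction step a term either keeps its index list or gets the index of the summand of
  \<open>\<psi>\<close> used in this step appended.\<close>
lemma red_Wsum:
  assumes CQ: "\<And>js. x js \<in> CQ"
    and x': "x' [] = r0 (x [])" "\<And>js j. x' (js @ [j]) = r0 (x (js @ [j])) + r1 (summand j) (x js)"
  shows "red \<psi> (\<lambda>k. Wsum k x) = (\<lambda>k. Wsum k x')"
proof (intro ext)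
  fix k p'
  show "red \<psi> (\<lambda>k. Wsum k x) k p' = Wsum k x' p'"
    unfolding red_def
  proof (rule adic_infsum_eq)
    fix n
    let ?K = "\<lambda>k. \<Union>js\<in>idxs k n. supp (x js)"
    let ?E = "?K k \<union> ?K (k - 1)"
    let ?f = "\<lambda>p. Wsum k x p * red0 p p' + (if k = 0 then 0 else Wsum (k - 1) x p * red1 \<psi> p p')"
    have fin: "finite ?E" using idxs_finite by simp
    have QP: "?E \<subseteq> QP" using CQ unfolding CQ_iff by blast
    have off: "?f p \<in> pw n" if "p \<in> QP - ?E" for p
      using that Wsum_off[where p = p and k = k and n = n and x = x] Wsum_off[where p = p and k = "k - 1" and n = n and x = x] by (simp add: pw_add pw_multr)
    have s0: "cong n (\<Sum>p\<in>?E. Wsum k x p * red0 p p') (\<Sum>js\<in>idxs k n. coeff_prod js * emb (r0 (x js)) p')"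
    proof -
      have "cong n (\<Sum>p\<in>?E. Wsum k x p * red0 p p') (\<Sum>js\<in>idxs k n. \<Sum>j\<in>{()}. coeff_prod js * 1 * emb (r0 (x js)) p')"
      proof (rule Wsum_apply[OF CQ fin])
        fix p assume "p \<in> ?E"
        then have "p \<in> QP" using QP by blast
        then show "cong n (red0 p p') (\<Sum>j\<in>{()}. 1 * emb (r0 (bas p)) p')" by (simp add: red0_emb)
      qed simp_all
      then show ?thesis by simp
    qed
    have "cong n (sum ?f ?E) (Wsum k x' p')"
    proof (cases k)
      case 0
      have "idxs 0 n = {[]}" by (auto simp: idxs_def)
      then show ?thesis using s0 by (simp add: 0 Wsum_0 x' coeff_prod_def)
    next
      case (Suc m)
      have s1: "cong n (\<Sum>p\<in>?E. Wsum m x p * red1 \<psi> p p') (\<Sum>js\<in>idxs m n. \<Sum>j<cutoff n. coeff_prod js * snd \<psi> j * emb (r1 (summand j) (x js)) p')"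
        by (rule Wsum_apply[OF CQ fin _ islin_r1 red1_cong]) (use QP Suc in auto)
      have "(\<Sum>js\<in>idxs k n. coeff_prod js * emb (x' js) p') = (\<Sum>(js, j)\<in>idxs m n \<times> {..<cutoff n}. coeff_prod (js @ [j]) * emb (x' (js @ [j])) p')"
        unfolding Suc by (subst sum.reindex_bij_betw[OF idxs_Suc, symmetric]) (simp add: case_prod_unfold)
      also have "\<dots> = (\<Sum>(js, j)\<in>idxs m n \<times> {..<cutoff n}. coeff_prod (js @ [j]) * emb (r0 (x (js @ [j]))) p')
          + (\<Sum>(js, j)\<in>idxs m n \<times> {..<cutoff n}. coeff_prod js * snd \<psi> j * emb (r1 (summand j) (x js)) p')"
        by (simp add: x' emb_add distrib_left sum.distrib case_prod_unfold coeff_prod_def)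
      also have "(\<Sum>(js, j)\<in>idxs m n \<times> {..<cutoff n}. coeff_prod (js @ [j]) * emb (r0 (x (js @ [j]))) p') = (\<Sum>js\<in>idxs k n. coeff_prod js * emb (r0 (x js)) p')"
        unfolding Suc by (subst sum.reindex_bij_betw[OF idxs_Suc, symmetric]) (simp add: case_prod_unfold)
      finally have e: "(\<Sum>js\<in>idxs k n. coeff_prod js * emb (x' js) p') = (\<Sum>js\<in>idxs k n. coeff_prod js * emb (r0 (x js)) p')
          + (\<Sum>js\<in>idxs m n. \<Sum>j<cutoff n. coeff_prod js * snd \<psi> j * emb (r1 (summand j) (x js)) p')"
        by (simp add: sum.cartesian_product)
      have "sum ?f ?E = (\<Sum>p\<in>?E. Wsum k x p * red0 p p') + (\<Sum>p\<in>?E. Wsum m x p * red1 \<psi> p p')"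
        by (simp add: Suc sum.distrib)
      then have "cong n (sum ?f ?E) (\<Sum>js\<in>idxs k n. coeff_prod js * emb (x' js) p')" unfolding e using cong_add[OF s0 s1] by simp
      then show ?thesis using cong_sym[OF Wsum_cong] cong_trans by blast
    qed
    then show "\<exists>E\<subseteq>QP. finite E \<and> (\<forall>j\<in>QP - E. ?f j \<in> pw n) \<and> cong n (Wsum k x' p') (sum ?f E)"
      using fin QP off cong_sym by (intro exI[of _ ?E] conjI ballI) blast+
  qed
qed

text \<open>Both sides satisfy the same recursion, by \<open>red_Wsum\<close> and \<open>polred_iter_snoc\<close>.\<close>
lemma red_iterate:
  assumes x0: "x0 \<in> CQ"
  shows "(red \<psi> ^^ m) (\<lambda>i. if i = 0 then emb x0 else (\<lambda>p. 0)) = (\<lambda>k. Wsum k (\<lambda>js. polred_iter m (map summand js) x0))"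
proof (induction m)
  case 0
  have "Wsum k (\<lambda>js. polred_iter 0 (map summand js) x0) = (if k = 0 then emb x0 else (\<lambda>p. 0))" for k
  proof (cases "k = 0")
    case False
    then have "Wsum k (\<lambda>js. polred_iter 0 (map summand js) x0) p = 0" for p by (intro Wsum_zero) auto
    then show ?thesis using False by auto
  qed (auto simp: Wsum_0)
  then show ?case by auto
next
  case (Suc m)
  have "red \<psi> (\<lambda>k. Wsum k (\<lambda>js. polred_iter m (map summand js) x0)) = (\<lambda>k. Wsum k (\<lambda>js. polred_iter (Suc m) (map summand js) x0))"
  proof (rule red_Wsum)
    show "polred_iter m (map summand js) x0 \<in> CQ" for js by (rule polred_iter_CQ[OF adms_summand x0])
    show "polred_iter (Suc m) (map summand []) x0 = r0 (polred_iter m (map summand []) x0)" using polred_iter_nil[of m x0] by simp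
    show "polred_iter (Suc m) (map summand (js @ [j])) x0 = r0 (polred_iter m (map summand (js @ [j])) x0) + r1 (summand j) (polred_iter m (map summand js) x0)" for js j
      using polred_iter_snoc[of m "map summand js" "summand j" x0] by simp
  qed
  then show ?case using Suc by simp
qed

text \<open>Modulo \<open>\<mm>\<^sup>n\<close> finitely many sequences of iterates have to become constant.\<close>
lemma red_inf_polred:
  assumes x0: "x0 \<in> CQ"
  shows "red_inf \<psi> (\<lambda>i. if i = 0 then emb x0 else (\<lambda>p. 0)) k = Wsum k (\<lambda>js. polred (map summand js) x0)"
proof
  fix p
  show "red_inf \<psi> (\<lambda>i. if i = 0 then emb x0 else (\<lambda>p. 0)) k p = Wsum k (\<lambda>js. polred (map summand js) x0) p"
    unfolding red_inf_def red_iterate[OF x0]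
  proof (rule adic_lim_eq)
    fix n
    have "\<forall>js. \<exists>n0. \<forall>m\<ge>n0. polred_iter m (map summand js) x0 = polred (map summand js) x0" using polred_iter_eventually_polred[OF adms_summand x0] by blast
    then obtain n0 where n0: "\<And>js m. m \<ge> n0 js \<Longrightarrow> polred_iter m (map summand js) x0 = polred (map summand js) x0" by metis
    have "cong n (Wsum k (\<lambda>js. polred (map summand js) x0) p) (Wsum k (\<lambda>js. polred_iter m (map summand js) x0) p)"
      if m: "m \<ge> Max (insert 0 (n0 ` idxs k n))" for m
    proof -
      have "polred_iter m (map summand js) x0 = polred (map summand js) x0" if "js \<in> idxs k n" for js
        by (rule n0, rule order_trans[OF Max_ge m]) (use that idxs_finite in auto)
      then have "(\<Sum>js\<in>idxs k n. coeff_prod js * emb (polred_iter m (map summand js) x0) p) = (\<Sum>js\<in>idxs k n. coeff_prod js * emb (polred (map summand js) x0) p)"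
        by (intro sum.cong) auto
      then show ?thesis
        using cong_trans[OF Wsum_cong[of n k "\<lambda>js. polred (map summand js) x0" p]] cong_sym[OF Wsum_cong[of n k "\<lambda>js. polred_iter m (map summand js) x0" p]] by simp
    qed
    then show "\<exists>m0. \<forall>m\<ge>m0. cong n (Wsum k (\<lambda>js. polred (map summand js) x0) p) (Wsum k (\<lambda>js. polred_iter m (map summand js) x0) p)" by blast
  qed
qed

section \<open>The homotopical star product as an adic sum\<close>

context
  fixes a b
  assumes a: "a \<in> carrier A" and b: "b \<in> carrier A"
begin

text \<open>The \<open>k\<close>-th term of both star products, as a combination of irreducible paths.\<close>
definition star_term :: "nat \<Rightarrow> ('v, 'e) qpath \<Rightarrow> 'b" where
  "star_term k = Wsum k (\<lambda>js. polred (map summand js) (sigma a \<odot> sigma b))"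

lemma ab_CQ: "sigma a \<odot> sigma b \<in> CQ" by (intro CQ_mult sigma_CQ a b)

lemma star_term_KQhat: "star_term k \<in> KQhat" unfolding star_term_def by (intro Wsum_KQhat polred_CQ adms_summand ab_CQ)

lemma star_C_coeff_star_term: "star_C_coeff \<psi> k a b = projhat (star_term k)"
  by (simp add: star_C_coeff_def red_inf_polred[OF ab_CQ] star_term_def)

lemma tens_mult_star_term: "tens (a \<otimes>\<^bsub>A\<^esub> b) 1 = projhat (star_term 0)"
proof -
  have "star_term 0 = emb (sigma (a \<otimes>\<^bsub>A\<^esub> b))"
    by (rule ext) (simp add: star_term_def Wsum_0 polred_nil[OF ab_CQ] sigma_mult a b)
  then show ?thesis using tens_projhat[of "a \<otimes>\<^bsub>A\<^esub> b" 1] a b by simp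
qed

text \<open>By \<open>G_hi_coch2\<close> the summand at \<open>js\<close> is a sum over permutations of the positions.  Each permutation permutes
  the index lists and does not change the product of the \<open>t\<^sub>j\<close>, so it contributes \<open>star_term k\<close>; there are
  \<open>k!\<close> of them.\<close>
lemma G_ext_star_term: "G_ext \<psi> k a b = projhat (\<lambda>p. of_nat (fact k) * star_term k p)"
proof (cases "k = 0")
  case True
  then show ?thesis by (simp add: G_ext_def tens_mult_star_term)
next
  case False
  let ?x0 = "sigma a \<odot> sigma b"
  let ?P = "permutations_of_set {..<k}"
  let ?y = "\<lambda>js. \<Sum>l\<in>?P. polred (map summand (map ((!) js) l)) ?x0"
  have G: "G_hi (map (fst \<psi>) js) [a, b] \<in> carrier A \<and> sigma (G_hi (map (fst \<psi>) js) [a, b]) = ?y js"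
    if k: "length js = k" for js
  proof -
    have m: "map (fst \<psi>) js = map (\<lambda>i. fst \<psi> (js ! i)) [0..<k]"
      unfolding k[symmetric] by (rule nth_equalityI) simp_all
    have "coch2 (G_hi (map (fst \<psi>) js)) (Sym (\<lambda>i. fst \<psi> (js ! i)) (set [0..<k]))"
      unfolding m by (rule G_hi_coch2) (use False psi_HomSA in auto)
    moreover have "Sym (\<lambda>i. fst \<psi> (js ! i)) (set [0..<k]) = (\<lambda>x. \<Sum>l\<in>?P. polred (map summand (map ((!) js) l)) x)"
      by (rule ext) (simp add: Sym_def summand_def atLeast0LessThan o_def)
    ultimately show ?thesis using a b unfolding coch2_def by simp
  qed
  have perm: "(\<Sum>js\<in>idxs k n. coeff_prod js * emb (?y js) p) = of_nat (fact k) * (\<Sum>js\<in>idxs k n. coeff_prod js * emb (polred (map summand js) ?x0) p)" for n p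
  proof -
    let ?t = "\<lambda>js. coeff_prod js * emb (polred (map summand js) ?x0) p"
    have coeff_prod: "coeff_prod (map ((!) js) l) = coeff_prod js" if "l \<in> ?P" "js \<in> idxs k n" for l js
    proof -
      have "mset (map ((!) js) l) = mset js" using that idxs_length[of js k n] by (intro mset_permuted_list) simp
      then show ?thesis by (metis mset_map prod_mset_prod_list coeff_prod_def)
    qed
    have "(\<Sum>js\<in>idxs k n. coeff_prod js * emb (?y js) p) = (\<Sum>js\<in>idxs k n. \<Sum>l\<in>?P. ?t (map ((!) js) l))"
      by (intro sum.cong refl) (simp add: emb_sum sum_distrib_left coeff_prod)
    also have "\<dots> = (\<Sum>l\<in>?P. \<Sum>js\<in>idxs k n. ?t (map ((!) js) l))" by (rule sum.swap)
    also have "\<dots> = (\<Sum>l\<in>?P. \<Sum>js\<in>idxs k n. ?t js)"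
    proof (rule sum.cong[OF refl])
      fix l assume "l \<in> ?P"
      from permuted_lists_bij[OF this, of "{..<cutoff n}"]
      have "bij_betw (\<lambda>js. map ((!) js) l) (idxs k n) (idxs k n)" by (simp add: idxs_def)
      then show "(\<Sum>js\<in>idxs k n. ?t (map ((!) js) l)) = (\<Sum>js\<in>idxs k n. ?t js)"
        by (rule sum.reindex_bij_betw)
    qed
    also have "\<dots> = of_nat (card ?P) * (\<Sum>js\<in>idxs k n. ?t js)" by simp
    also have "card ?P = fact k" by simp
    finally show ?thesis .
  qed
  have y_CQ: "?y js \<in> CQ" for js by (intro CQ_sum polred_CQ adms_summand ab_CQ)
  have "G_ext \<psi> k a b = Ahat_infsum (\<lambda>js. tens (G_hi (map (fst \<psi>) js) [a, b]) (coeff_prod js)) {js. length js = k}"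
    using False by (simp add: G_ext_def coeff_prod_def)
  also have "\<dots> = projhat (\<lambda>p. of_nat (fact k) * star_term k p)"
  proof (rule Ahat_infsum_eq[where z = "\<lambda>js p. coeff_prod js * emb (?y js) p"])
    show w: "(\<lambda>p. of_nat (fact k) * star_term k p) \<in> KQhat" by (rule KQhat_smult[OF star_term_KQhat])
    have zK: "(\<lambda>p. coeff_prod js * emb (?y js) p) \<in> KQhat" for js by (intro KQhat_smult KQhat_emb y_CQ)
    show "tens (G_hi (map (fst \<psi>) js) [a, b]) (coeff_prod js) = projhat (\<lambda>p. coeff_prod js * emb (?y js) p) \<and>
        (\<lambda>p. coeff_prod js * emb (?y js) p) \<in> KQhat" if "js \<in> {js. length js = k}" for js
      using G[of js] that tens_projhat[of "G_hi (map (fst \<psi>) js) [a, b]" "coeff_prod js"] zK[of js] by simp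
    fix n
    show "\<exists>E\<subseteq>{js. length js = k}. finite E \<and> (\<forall>E'\<subseteq>{js. length js = k}. finite E' \<and> E \<subseteq> E' \<longrightarrow>
        (\<lambda>p. of_nat (fact k) * star_term k p - (\<Sum>js\<in>E'. coeff_prod js * emb (?y js) p)) \<in> nbhd n)"
    proof (intro exI[of _ "idxs k n"] conjI idxs_finite allI impI)
      show "idxs k n \<subseteq> {js. length js = k}" by (auto simp: idxs_def)
      fix E' assume E': "E' \<subseteq> {js. length js = k}" "finite E' \<and> idxs k n \<subseteq> E'"
      show "(\<lambda>p. of_nat (fact k) * star_term k p - (\<Sum>js\<in>E'. coeff_prod js * emb (?y js) p)) \<in> nbhd n"
      proof (rule nbhd_small)
        show "(\<lambda>p. of_nat (fact k) * star_term k p - (\<Sum>js\<in>E'. coeff_prod js * emb (?y js) p)) \<in> KQhat"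
          by (intro KQhat_diff w KQhat_sum zK)
        fix p
        have c1: "cong n (of_nat (fact k) * star_term k p) (\<Sum>js\<in>idxs k n. coeff_prod js * emb (?y js) p)"
          unfolding perm star_term_def by (rule cong_mult[OF cong_refl Wsum_cong])
        have c2: "cong n (\<Sum>js\<in>idxs k n. coeff_prod js * emb (?y js) p) (\<Sum>js\<in>E'. coeff_prod js * emb (?y js) p)"
        proof (rule cong_sym, rule cong_superset)
          fix js assume "js \<in> E' - idxs k n"
          then have "coeff_prod js \<in> pw n" using E'(1) by (intro coeff_prod_off[of _ k]) auto
          then show "coeff_prod js * emb (?y js) p \<in> pw n" by (rule pw_multr)
        qed (use E' in auto)
        show "of_nat (fact k) * star_term k p - (\<Sum>js\<in>E'. coeff_prod js * emb (?y js) p) \<in> pw n"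
          using cong_trans[OF c1 c2] by (simp only: cong_def)
      qed
    qed
  qed
  finally show ?thesis .
qed

lemma smult_G_ext_star_term: "Ahat_smult (\<iota> (1 / fact k)) (G_ext \<psi> k a b) = projhat (star_term k)"
  unfolding G_ext_star_term Ahat_smult_projhat[OF KQhat_smult[OF star_term_KQhat]]
  by (simp only: mult.assoc[symmetric] iota_fact mult_1)

lemma star_term_pw: "star_term k p \<in> pw k" unfolding star_term_def by (rule Wsum_pw)

definition star_total :: "('v, 'e) qpath \<Rightarrow> 'b" where "star_total p = adic_infsum \<mm> (\<lambda>k. star_term k p) UNIV"

lemma star_total_cong: "cong n (star_total p) (\<Sum>k<n. star_term k p)"
  unfolding star_total_def
proof (rule adic_infsum_cong)
  have "{j \<in> UNIV. star_term j p \<notin> pw m} \<subseteq> {..<m}" for m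
  proof
    fix j assume "j \<in> {j \<in> UNIV. star_term j p \<notin> pw m}"
    then have "\<not> m \<le> j" using pw_antimono[OF _ star_term_pw[of j p], of m] by blast
    then show "j \<in> {..<m}" by simp
  qed
  then show "null_family (\<lambda>k. star_term k p) UNIV" unfolding null_family_def using finite_subset by blast
  show "star_term j p \<in> pw n" if "j \<in> UNIV - {..<n}" for j using pw_antimono[OF _ star_term_pw, of n j] that by simp
qed simp_all

lemma star_total_KQhat: "star_total \<in> KQhat"
proof -
  have "{p. star_total p \<notin> pw n} \<subseteq> (\<Union>k<n. {p. star_term k p \<notin> pw n})" for n
  proof
    fix p assume p: "p \<in> {p. star_total p \<notin> pw n}"
    show "p \<in> (\<Union>k<n. {p. star_term k p \<notin> pw n})"
    proof (rule ccontr)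
      assume "p \<notin> (\<Union>k<n. {p. star_term k p \<notin> pw n})"
      then have "(\<Sum>k<n. star_term k p) \<in> pw n" by (intro pw_sum) auto
      then show False using cong_pw[OF star_total_cong] p by simp
    qed
  qed
  moreover have "finite (\<Union>k<n. {p. star_term k p \<notin> pw n})" for n using star_term_KQhat by (simp add: KQhat_iff)
  ultimately have "finite {p. star_total p \<notin> pw n}" for n by (rule finite_subset)
  moreover have "star_total p = 0" if "p \<notin> QP" for p
  proof (rule separated)
    have "star_term k p = 0" for k using star_term_KQhat[of k] that unfolding KQhat_iff by blast
    then show "cong n (star_total p) 0" for n using star_total_cong[of n p] by simp
  qed
  ultimately show ?thesis by (simp add: KQhat_iff)
qed

text \<open>The terms of index at least \<open>n\<close> vanish modulo \<open>pw n\<close>.\<close>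
lemma infsum_star_term:
  assumes J: "\<And>k. k \<in> J \<Longrightarrow> Z k = projhat (star_term k)" and v: "v \<in> KQhat"
    and vs: "\<And>n p. cong n (v p) (\<Sum>k\<in>J \<inter> {..<n}. star_term k p)"
  shows "Ahat_infsum Z J = projhat v"
proof (rule Ahat_infsum_eq[OF v, where z = star_term])
  show "Z k = projhat (star_term k) \<and> star_term k \<in> KQhat" if "k \<in> J" for k using J that star_term_KQhat by simp
  fix n
  show "\<exists>E\<subseteq>J. finite E \<and> (\<forall>E'\<subseteq>J. finite E' \<and> E \<subseteq> E' \<longrightarrow> (\<lambda>p. v p - (\<Sum>k\<in>E'. star_term k p)) \<in> nbhd n)"
  proof (intro exI[of _ "J \<inter> {..<n}"] conjI allI impI)
    fix E' assume E': "E' \<subseteq> J" "finite E' \<and> J \<inter> {..<n} \<subseteq> E'"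
    show "(\<lambda>p. v p - (\<Sum>k\<in>E'. star_term k p)) \<in> nbhd n"
    proof (rule nbhd_small)
      show "(\<lambda>p. v p - (\<Sum>k\<in>E'. star_term k p)) \<in> KQhat" by (intro KQhat_diff v KQhat_sum star_term_KQhat)
      fix p
      have "cong n (v p) (\<Sum>k\<in>E'. star_term k p)"
      proof (rule cong_trans[OF vs cong_sym[OF cong_superset]])
        show "star_term k p \<in> pw n" if "k \<in> E' - J \<inter> {..<n}" for k
          by (rule pw_antimono[OF _ star_term_pw]) (use that E'(1) in auto)
      qed (use E' in auto)
      then show "v p - (\<Sum>k\<in>E'. star_term k p) \<in> pw n" by (simp only: cong_def)
    qed
  qed auto
qed

lemma star_C_star_total: "star_C \<psi> a b = projhat star_total"
  unfolding star_C_def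
  by (rule infsum_star_term) (use star_total_cong in \<open>simp_all add: star_C_coeff_star_term star_total_KQhat\<close>)

lemma star_H_star_total: "star_H \<psi> a b = projhat star_total"
proof -
  let ?v = "\<lambda>p. star_total p - star_term 0 p"
  have v: "?v \<in> KQhat" by (intro KQhat_diff star_total_KQhat star_term_KQhat)
  have "Ahat_infsum (\<lambda>k. Ahat_smult (\<iota> (1 / fact k)) (G_ext \<psi> k a b)) {1..} = projhat ?v"
  proof (rule infsum_star_term[OF smult_G_ext_star_term v])
    fix n p
    show "cong n (?v p) (\<Sum>k\<in>{1..} \<inter> {..<n}. star_term k p)"
    proof (cases "n = 0")
      case False
      then have "{..<n} = insert 0 ({1..} \<inter> {..<n})" by auto
      then have "(\<Sum>k<n. star_term k p) = (\<Sum>k\<in>insert 0 ({1..} \<inter> {..<n}). star_term k p)" by (rule arg_cong)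
      also have "\<dots> = star_term 0 p + (\<Sum>k\<in>{1..} \<inter> {..<n}. star_term k p)" by (rule sum.insert) auto
      finally show ?thesis using star_total_cong[of n p] by (simp add: cong_def algebra_simps)
    qed (simp add: cong_def)
  qed
  then show ?thesis by (simp add: star_H_def tens_mult_star_term Ahat_add_projhat[OF star_term_KQhat v])
qed

end

end

theorem theorem7p23:
  fixes Q :: "('v, 'e) pre_digraph"
    and I :: "(('v, 'e) qpath \<Rightarrow>\<^sub>0 'k::field_char_0) set"
    and S :: "('v, 'e) qpath set"
    and \<phi> :: "('v, 'e) qpath \<Rightarrow> (('v, 'e) qpath \<Rightarrow>\<^sub>0 'k)"
    and \<iota> :: "'k \<Rightarrow> 'b::comm_ring_1"
    and \<mm> :: "'b set"
    and \<psi> :: "(nat \<Rightarrow> ('v, 'e) qpath \<Rightarrow> ('v, 'e, 'k) alg) \<times> (nat \<Rightarrow> 'b)"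
    and a b :: "('v, 'e, 'k) alg"
  assumes "fin_digraph Q"
    and "ideal I (path_algebra Q)"
    and "reduction_datum.reduction_system Q S \<phi>"
    and "reduction_datum.diamond Q I S \<phi>"
    and "\<iota> \<in> ring_hom ring_of_type_algebra ring_of_type_algebra"
    and "complete_local_noetherian \<mm>"
    and "\<psi> \<in> deformation_datum.completed_HomSA Q I S \<mm>"
    and "a \<in> carrier (path_algebra Q Quot I)"
    and "b \<in> carrier (path_algebra Q Quot I)"
  shows "(\<forall>k. deformation_datum.Ahat_smult Q I \<iota> \<mm> (\<iota> (1 / fact k))
                (deformation_datum.G_ext Q I S \<iota> \<mm> \<psi> k a b)
              = deformation_datum.star_C_coeff Q I S \<phi> \<iota> \<mm> \<psi> k a b)
       \<and> deformation_datum.star_C Q I S \<phi> \<iota> \<mm> \<psi> a b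
         = deformation_datum.star_H Q I S \<iota> \<mm> \<psi> a b"
proof -
  interpret formal_deformation Q I S \<phi> \<iota> \<mm> \<psi>
    by (intro formal_deformation.intro formal_deformation_axioms.intro complete_coefficients.intro complete_coefficients_axioms.intro confluent_system.intro adic.intro assms)
  have ab: "a \<in> carrier A" "b \<in> carrier A" using assms(8,9) by (simp_all add: A_def)
  show ?thesis
    by (simp add: smult_G_ext_star_term[OF ab] star_C_coeff_star_term[OF ab] star_C_star_total[OF ab] star_H_star_total[OF ab])
qed

end
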